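(* Consider the function-on-function polynomial regression model of degree $p$ with i.i.d. data $(X_1,Y_1),\dots,(X_n,Y_n)$, the operators $\mathbb{A}$, $[\mathbb{A}^*\mathbb{A}]_n$, $\Gamma$ and the estimator $\hat\beta_\lambda = g_\lambda([\mathbb{A}^*\mathbb{A}]_n)[\mathbb{A}^*Y]_n$, all as defined in the context. Suppose that: (1) $\beta^*\in\Omega_{\varphi,R}=\{f\in\mathbb{L}^2 : f=\varphi(\mathbb{A}^*\mathbb{A})v,\ \|v\|_{\mathbb{L}^2}\le R\}$, where $R>0$ and $\varphi:[0,\eta]\to\mathbb{R}$ is an index function (continuous, non-decreasing, $\varphi(0)=0$); (2) $\sup_{\omega\in\Omega}\|X(\omega,\cdot)\|_{L^2(S_1)}^2\le\kappa<\infty$; (3) for some $b>1$ the eigenvalues $(\mu_i)_{i\in\mathbb{N}}$ of $\Gamma$ satisfy $i^{-b}\lesssim\mu_i\lesssim i^{-b}$ for all $i\in\mathbb{N}$. Let $\psi(x)=\varphi(x)x^{\frac12+\frac1{2b}}$, let $\nu\ge1$ be the qualification of the regularization family, let $0\le s\le\frac12$, and suppose $\nu-s$ covers $\varphi$, i.e. there is $c>0$ such that $c\,\frac{\lambda^{\nu-s}}{\varphi(\lambda)}\le\inf_{\lambda\le\sigma\le\eta}\frac{\sigma^{\nu-s}}{\varphi(\sigma)}$ for all $0<\lambda\le\eta$. Then, for $\lambda=\psi^{-1}(n^{-\frac12})$, for every $\delta\in(0,1)$ there is a constant $C_\delta>0$ not depending on $n$ such that, with probability at least $1-\delta$, $$\|(\mathbb{A}^*\mathbb{A})^s(\hat\beta_\lambda-\beta^*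 )\|_{\mathbb{L}^2}\le C_\delta\,\varphi\big(\psi^{-1}(n^{-\frac12})\big)\,\big(\psi^{-1}(n^{-\frac12})\big)^{s}.$$
   Context: Let $S_1,S_2\subset\mathbb{R}$ be compact, $\mu$ the (Lebesgue) measure on them, and $p\ge1$ an integer. Put $L^2_0=\mathbb{R}$ and $L^2_l=L^2(S_1)^{\otimes l}$ ($l$-fold tensor product) for $1\le l\le p$. Put $\mathbb{L}^2=L^2(S_2)\oplus\bigoplus_{l=1}^p (L^2(S_2)\otimes L^2_l)$, with $\|u\|_{\mathbb{L}^2}^2=\sum_{l=0}^p\|u_l\|^2$ for $u=(u_0,\dots,u_p)$; it is isometrically isomorphic to $L^2(S_2)\otimes(\bigoplus_{l=0}^pL^2_l)$. Model: $X(\omega,\cdot)\in L^2(S_1)$, $Y(\omega,\cdot)\in L^2(S_2)$ are random processes on $(\Omega,\mathbb{P})$ with $Y=\mathbb{A}\beta^*+\epsilon$, where $\beta^*=(\beta_0^*,\dots,\beta_p^* )\in\mathbb{L}^2$ is unknown, $\epsilon\in L^2(\Omega,\mathbb{P})\otimes L^2(S_2)$ has zero mean, $\mathbb{E}\|\epsilon\|_{L^2(S_2)}^2=\sigma^2<\infty$, and $\epsilon$ is independent of $X$. Here $\mathbb{A}:\mathbb{L}^2\to L^2(\Omega,\mathbb{P})\otimes L^2(S_2)$ is $$(\mathbb{A}u)(\omega,t)=u_0(t)+\sum_{l=1}^p\int_{S_1}\cdots\int_{S_1}u_l(t,s_1,\dots,s_l)\prod_{i=1}^lX(\omega,s_i)\,d\mu(s_1)\cdots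 d\mu(s_l),$$ and $\mathbb{A}^*$ is its adjoint. The data $(X_i,Y_i)$, $1\le i\le n$, are i.i.d. copies of $(X,Y)$, with errors $\epsilon_i$. For each $i$, $\mathbb{B}_i:\mathbb{L}^2\to L^2(S_2)$ is $(\mathbb{B}_iu)(t)=u_0(t)+\sum_{l=1}^p\int_{S_1}\cdots\int_{S_1}u_l(t,s_1,\dots,s_l)\prod_{j=1}^lX_i(s_j)\,d\mu(s_1)\cdots d\mu(s_l)$, with adjoint $\mathbb{B}_i^*g=(g,\ g(t)X_i(s_1),\dots,\ g(t)\prod_{j=1}^pX_i(s_j))$. Put $[\mathbb{A}^*\mathbb{A}]_n=\frac1n\sum_{i=1}^n\mathbb{B}_i^*\mathbb{B}_i$ and $[\mathbb{A}^*Y]_n=\frac1n\sum_{i=1}^n\mathbb{B}_i^*Y_i$. Let $\chi=(\chi_0,\dots,\chi_p)\in\bigoplus_{l=0}^pL^2_l$ with $\chi_0=1$, $\chi_k=\prod_{i=1}^kX(\omega,s_i)$, and $\Gamma=\mathbb{E}[\chi\otimes\chi]$ on $\bigoplus_{l=0}^pL^2_l$, where $(\chi\otimes\chi)f=\langle\chi,f\rangle\chi$. Its eigenvalues $\mu_1\ge\mu_2\ge\dots$ are listed in non-increasing order with multiplicity. $a_i\lesssim b_i$ means $a_i\le Cb_i$ for a positive constant $C$ not depending on $i$. Regularization family: functions $g_\lambda:[0,\eta]\to\mathbb{R}$, $0<\lambda\le\eta$, where $[0,\eta]$ contains the spectra of $\mathbb{A}^*\mathbb{A}$ and $[\mathbb{A}^*\mathbb{A}]_n$,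 such that for some constants $A,B>0$ (independent of $\lambda$) $\sup_{0<\sigma\le\eta}|\sigma g_\lambda(\sigma)|\le A$ and $\sup_{0<\sigma\le\eta}|g_\lambda(\sigma)|\le B/\lambda$. With $r_\lambda(\sigma)=1-\sigma g_\lambda(\sigma)$, the qualification $\nu$ is the largest value for which there is a constant $\omega_\nu>0$ with $\sup_{0<\sigma\le\eta}|r_\lambda(\sigma)|\sigma^\nu\le\omega_\nu\lambda^\nu$ for all $\lambda$. Functions of self-adjoint operators are defined by the functional calculus. $\psi^{-1}$ is the inverse function of $\psi$ (its existence is presupposed, and $n$ is such that $n^{-1/2}$ lies in the range of $\psi$). *)

theory Defs
  imports "HOL-Probability.Probability"
begin

section \<open>Square-integrable functions and finite direct sums\<close>

text \<open>Elements of \<open>L\<^sup>2\<close> are represented by functions; two representatives are the same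
  element iff their difference has norm \<open>0\<close>.\<close>

definition L2 :: "'a measure \<Rightarrow> ('a \<Rightarrow> real) set" where
  "L2 N = {f \<in> borel_measurable N. integrable N (\<lambda>x. (f x)\<^sup>2)}"

definition L2_inner :: "'a measure \<Rightarrow> ('a \<Rightarrow> real) \<Rightarrow> ('a \<Rightarrow> real) \<Rightarrow> real" where
  "L2_inner N f h = (LINT x|N. f x * h x)"

definition L2_norm :: "'a measure \<Rightarrow> ('a \<Rightarrow> real) \<Rightarrow> real" where
  "L2_norm N f = sqrt (L2_inner N f f)"

text \<open>The measurable structure on \<open>L2 N\<close> generated by the continuous linear functionals; if
  \<open>L\<^sup>2\<close> is separable, this is the Borel structure of the norm topology.\<close>

definition L2_sigma :: "'a measure \<Rightarrow> ('a \<Rightarrow> real) measure" where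
  "L2_sigma N = sigma (L2 N)
     {{f \<in> L2 N. L2_inner N f h \<in> B} | h B. h \<in> L2 N \<and> B \<in> sets borel}"

text \<open>The Hilbert space \<open>\<Oplus>l\<le>p. L\<^sup>2(N l)\<close>; components with index above \<open>p\<close> are
  irrelevant.\<close>

definition dsum :: "nat \<Rightarrow> (nat \<Rightarrow> 'a measure) \<Rightarrow> (nat \<Rightarrow> 'a \<Rightarrow> real) set" where
  "dsum p N = {u. \<forall>l\<le>p. u l \<in> L2 (N l)}"

definition dinner ::
  "nat \<Rightarrow> (nat \<Rightarrow> 'a measure) \<Rightarrow> (nat \<Rightarrow> 'a \<Rightarrow> real) \<Rightarrow> (nat \<Rightarrow> 'a \<Rightarrow> real) \<Rightarrow> real" where
  "dinner p N u v = (\<Sum>l\<le>p. L2_inner (N l) (u l) (v l))"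

definition dnorm :: "nat \<Rightarrow> (nat \<Rightarrow> 'a measure) \<Rightarrow> (nat \<Rightarrow> 'a \<Rightarrow> real) \<Rightarrow> real" where
  "dnorm p N u = sqrt (dinner p N u u)"

definition ddiff :: "(nat \<Rightarrow> 'a \<Rightarrow> real) \<Rightarrow> (nat \<Rightarrow> 'a \<Rightarrow> real) \<Rightarrow> nat \<Rightarrow> 'a \<Rightarrow> real" where
  "ddiff u v = (\<lambda>l z. u l z - v l z)"

definition dscale :: "real \<Rightarrow> (nat \<Rightarrow> 'a \<Rightarrow> real) \<Rightarrow> nat \<Rightarrow> 'a \<Rightarrow> real" where
  "dscale x u = (\<lambda>l z. x * u l z)"


section \<open>Operators on direct sums\<close>

definition dadjoint :: "nat \<Rightarrow> (nat \<Rightarrow> 'a measure) \<Rightarrow> 'b measure \<Rightarrow>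
    ((nat \<Rightarrow> 'a \<Rightarrow> real) \<Rightarrow> 'b \<Rightarrow> real) \<Rightarrow> ('b \<Rightarrow> real) \<Rightarrow> nat \<Rightarrow> 'a \<Rightarrow> real" where
  "dadjoint p N N' T = (SOME T'. \<forall>h\<in>L2 N'. T' h \<in> dsum p N \<and>
     (\<forall>u\<in>dsum p N. L2_inner N' (T u) h = dinner p N u (T' h)))"

text \<open>The (real) spectrum: those \<open>x\<close> for which \<open>T - x\<close> has no bounded inverse.  All operators
  considered are self-adjoint, so no complex spectrum is lost.\<close>

definition spectrum_on :: "nat \<Rightarrow> (nat \<Rightarrow> 'a measure) \<Rightarrow>
    ((nat \<Rightarrow> 'a \<Rightarrow> real) \<Rightarrow> nat \<Rightarrow> 'a \<Rightarrow> real) \<Rightarrow> real set" where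
  "spectrum_on p N T = {x. \<not> (\<exists>R C. \<forall>u\<in>dsum p N. R u \<in> dsum p N \<and>
     dnorm p N (R u) \<le> C * dnorm p N u \<and>
     dnorm p N (ddiff (R (ddiff (T u) (dscale x u))) u) = 0 \<and>
     dnorm p N (ddiff (ddiff (T (R u)) (dscale x (R u))) u) = 0)}"

definition eigenspace :: "nat \<Rightarrow> (nat \<Rightarrow> 'a measure) \<Rightarrow>
    ((nat \<Rightarrow> 'a \<Rightarrow> real) \<Rightarrow> nat \<Rightarrow> 'a \<Rightarrow> real) \<Rightarrow> real \<Rightarrow> (nat \<Rightarrow> 'a \<Rightarrow> real) set" where
  "eigenspace p N T x = {u \<in> dsum p N. dnorm p N (ddiff (T u) (dscale x u)) = 0}"

text \<open>The Hilbert space dimension of a subspace (modulo elements of norm \<open>0\<close>), with all infinite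
  cardinals identified.\<close>

definition ddim :: "nat \<Rightarrow> (nat \<Rightarrow> 'a measure) \<Rightarrow> (nat \<Rightarrow> 'a \<Rightarrow> real) set \<Rightarrow> enat" where
  "ddim p N V = Sup {enat k | k. \<exists>e. (\<forall>i<k. e i \<in> V) \<and>
     (\<forall>i<k. \<forall>j<k. dinner p N (e i) (e j) = (if i = j then 1 else 0))}"

text \<open>\<open>\<mu> 1 \<ge> \<mu> 2 \<ge> \<dots>\<close> is the list of the eigenvalues of the compact positive operator \<open>T\<close>, repeated
  according to multiplicity (\<open>\<mu> 0\<close> is unused).  As usual for compact operators the condition only
  concerns the nonzero eigenvalues: if there are infinitely many of them, an eigenvalue \<open>0\<close> has no
  place in a non-increasing sequence.\<close>

definition eigenvalue_list :: "nat \<Rightarrow> (nat \<Rightarrow> 'a measure) \<Rightarrow>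
    ((nat \<Rightarrow> 'a \<Rightarrow> real) \<Rightarrow> nat \<Rightarrow> 'a \<Rightarrow> real) \<Rightarrow> (nat \<Rightarrow> real) \<Rightarrow> bool" where
  "eigenvalue_list p N T \<mu> \<longleftrightarrow>
     (\<forall>i j. 1 \<le> i \<longrightarrow> i \<le> j \<longrightarrow> \<mu> j \<le> \<mu> i) \<and>
     (\<forall>x. x \<noteq> 0 \<longrightarrow> finite {i. 1 \<le> i \<and> \<mu> i = x} \<and>
        enat (card {i. 1 \<le> i \<and> \<mu> i = x}) = ddim p N (eigenspace p N T x))"


section \<open>Functional calculus\<close>

text \<open>For a bounded self-adjoint \<open>T\<close>, the scalar spectral measure of \<open>T\<close> at \<open>u\<close> is the compactly
  supported Borel measure \<open>m\<close> with \<open>\<langle>u, q(T) u\<rangle> = \<integral>q dm\<close> for all polynomials \<open>q\<close>, and \<open>f(T)\<close> is the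
  symmetric operator with \<open>\<langle>f(T) u, u\<rangle> = \<integral>f dm\<close> for all \<open>u\<close> (it is determined by polarization).
  Integrating against the completion of \<open>m\<close> makes the values of \<open>f\<close> off the spectrum irrelevant,
  even for measurability; if \<open>T\<close> has pure point spectrum, every function bounded on the spectrum
  is admissible.\<close>

definition spectral_measure :: "nat \<Rightarrow> (nat \<Rightarrow> 'a measure) \<Rightarrow>
    ((nat \<Rightarrow> 'a \<Rightarrow> real) \<Rightarrow> nat \<Rightarrow> 'a \<Rightarrow> real) \<Rightarrow> (nat \<Rightarrow> 'a \<Rightarrow> real) \<Rightarrow> real measure" where
  "spectral_measure p N T u = (THE m. sets m = sets borel \<and> finite_measure m \<and>
     (\<exists>r. AE x in m. \<bar>x\<bar> \<le> r) \<and> (\<forall>k. (LINT x|m. x ^ k) = dinner p N u ((T ^^ k) u)))"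

definition fcalc :: "nat \<Rightarrow> (nat \<Rightarrow> 'a measure) \<Rightarrow> (real \<Rightarrow> real) \<Rightarrow>
    ((nat \<Rightarrow> 'a \<Rightarrow> real) \<Rightarrow> nat \<Rightarrow> 'a \<Rightarrow> real) \<Rightarrow> (nat \<Rightarrow> 'a \<Rightarrow> real) \<Rightarrow> nat \<Rightarrow> 'a \<Rightarrow> real" where
  "fcalc p N f T = (SOME F. (\<forall>u\<in>dsum p N. F u \<in> dsum p N) \<and>
     (\<forall>u\<in>dsum p N. \<forall>v\<in>dsum p N. dinner p N (F u) v = dinner p N u (F v)) \<and>
     (\<forall>u\<in>dsum p N. dinner p N (F u) u = (LINT x|completion (spectral_measure p N T u). f x)))"

text \<open>\<open>x\<^sup>s\<close> for \<open>x \<ge> 0\<close>, with \<open>0\<^sup>0 = 1\<close> (whereas \<open>0 powr 0 = 0\<close>), so that \<open>T\<^sup>0\<close> is the identity.\<close>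

definition rpow :: "real \<Rightarrow> real \<Rightarrow> real" where
  "rpow s x = (if s = 0 then 1 else x powr s)"


section \<open>The polynomial regression model\<close>

definition leb :: "real set \<Rightarrow> real measure" where
  "leb S = restrict_space lborel S"

text \<open>\<open>L\<^sup>2(S)\<^sup>\<otimes>\<^sup>l\<close> is \<open>L\<^sup>2(S\<^sup>l)\<close>, a point of \<open>S\<^sup>l\<close> being a function on \<open>{..<l}\<close>.  For \<open>l = 0\<close> this is a
  one-point space of mass \<open>1\<close>, so that its \<open>L\<^sup>2\<close> is \<open>\<real>\<close> and
  the integral over it is evaluation.\<close>

definition S_pow :: "real set \<Rightarrow> nat \<Rightarrow> (nat \<Rightarrow> real) measure" where
  "S_pow S l = PiM {..<l} (\<lambda>_. leb S)"

definition LL_meas :: "real set \<Rightarrow> real set \<Rightarrow> nat \<Rightarrow> (real \<times> (nat \<Rightarrow> real)) measure" where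
  "LL_meas S1 S2 l = leb S2 \<Otimes>\<^sub>M S_pow S1 l"

definition L2_process :: "'w measure \<Rightarrow> real set \<Rightarrow> ('w \<Rightarrow> real \<Rightarrow> real) \<Rightarrow> bool" where
  "L2_process M S Z \<longleftrightarrow> (\<lambda>(\<omega>, t). Z \<omega> t) \<in> borel_measurable (M \<Otimes>\<^sub>M leb S) \<and>
     (\<forall>\<omega>\<in>space M. Z \<omega> \<in> L2 (leb S))"

definition chi :: "(real \<Rightarrow> real) \<Rightarrow> nat \<Rightarrow> (nat \<Rightarrow> real) \<Rightarrow> real" where
  "chi x l s = (\<Prod>i<l. x (s i))"

definition B_op :: "nat \<Rightarrow> real set \<Rightarrow> (real \<Rightarrow> real) \<Rightarrow>
    (nat \<Rightarrow> real \<times> (nat \<Rightarrow> real) \<Rightarrow> real) \<Rightarrow> real \<Rightarrow> real" where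
  "B_op p S1 x u t = (\<Sum>l\<le>p. LINT s|S_pow S1 l. u l (t, s) * chi x l s)"

definition B_adj :: "(real \<Rightarrow> real) \<Rightarrow> (real \<Rightarrow> real) \<Rightarrow> nat \<Rightarrow> real \<times> (nat \<Rightarrow> real) \<Rightarrow> real" where
  "B_adj x h l = (\<lambda>(t, s). h t * chi x l s)"

definition A_op :: "nat \<Rightarrow> real set \<Rightarrow> ('w \<Rightarrow> real \<Rightarrow> real) \<Rightarrow>
    (nat \<Rightarrow> real \<times> (nat \<Rightarrow> real) \<Rightarrow> real) \<Rightarrow> 'w \<times> real \<Rightarrow> real" where
  "A_op p S1 X u = (\<lambda>(\<omega>, t). B_op p S1 (X \<omega>) u t)"

definition AA_op :: "'w measure \<Rightarrow> nat \<Rightarrow> real set \<Rightarrow> real set \<Rightarrow> ('w \<Rightarrow> real \<Rightarrow> real) \<Rightarrow>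
    (nat \<Rightarrow> real \<times> (nat \<Rightarrow> real) \<Rightarrow> real) \<Rightarrow> nat \<Rightarrow> real \<times> (nat \<Rightarrow> real) \<Rightarrow> real" where
  "AA_op M p S1 S2 X u =
     dadjoint p (LL_meas S1 S2) (M \<Otimes>\<^sub>M leb S2) (A_op p S1 X) (A_op p S1 X u)"

definition AA_emp :: "nat \<Rightarrow> real set \<Rightarrow> (nat \<Rightarrow> 'w \<Rightarrow> real \<Rightarrow> real) \<Rightarrow> nat \<Rightarrow> 'w \<Rightarrow>
    (nat \<Rightarrow> real \<times> (nat \<Rightarrow> real) \<Rightarrow> real) \<Rightarrow> nat \<Rightarrow> real \<times> (nat \<Rightarrow> real) \<Rightarrow> real" where
  "AA_emp p S1 Xs n \<omega> u =
     (\<lambda>l z. (\<Sum>i=1..n. B_adj (Xs i \<omega>) (B_op p S1 (Xs i \<omega>) u) l z) / real n)"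

definition AY_emp :: "(nat \<Rightarrow> 'w \<Rightarrow> real \<Rightarrow> real) \<Rightarrow> (nat \<Rightarrow> 'w \<Rightarrow> real \<Rightarrow> real) \<Rightarrow> nat \<Rightarrow> 'w \<Rightarrow>
    nat \<Rightarrow> real \<times> (nat \<Rightarrow> real) \<Rightarrow> real" where
  "AY_emp Xs Ys n \<omega> = (\<lambda>l z. (\<Sum>i=1..n. B_adj (Xs i \<omega>) (Ys i \<omega>) l z) / real n)"

definition estimator :: "nat \<Rightarrow> real set \<Rightarrow> real set \<Rightarrow> (real \<Rightarrow> real \<Rightarrow> real) \<Rightarrow>
    (nat \<Rightarrow> 'w \<Rightarrow> real \<Rightarrow> real) \<Rightarrow> (nat \<Rightarrow> 'w \<Rightarrow> real \<Rightarrow> real) \<Rightarrow> nat \<Rightarrow> real \<Rightarrow> 'w \<Rightarrow>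
    nat \<Rightarrow> real \<times> (nat \<Rightarrow> real) \<Rightarrow> real" where
  "estimator p S1 S2 g Xs Ys n lam \<omega> =
     fcalc p (LL_meas S1 S2) (g lam) (AA_emp p S1 Xs n \<omega>) (AY_emp Xs Ys n \<omega>)"

text \<open>\<open>\<Gamma> f = E[\<langle>\<chi>, f\<rangle> \<chi>]\<close>; for a jointly measurable process \<open>X\<close> the vector-valued expectation may be
  taken componentwise and pointwise.\<close>

definition Gamma_op :: "'w measure \<Rightarrow> nat \<Rightarrow> real set \<Rightarrow> ('w \<Rightarrow> real \<Rightarrow> real) \<Rightarrow>
    (nat \<Rightarrow> (nat \<Rightarrow> real) \<Rightarrow> real) \<Rightarrow> nat \<Rightarrow> (nat \<Rightarrow> real) \<Rightarrow> real" where
  "Gamma_op M p S1 X f =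
     (\<lambda>l s. LINT \<omega>|M. dinner p (S_pow S1) (chi (X \<omega>)) f * chi (X \<omega>) l s)"

text \<open>The mean of the jointly measurable process \<open>\<epsilon>\<close> is taken pointwise almost everywhere, which
  agrees with its mean as an \<open>L\<^sup>2\<close>-valued random element; independence is that of \<open>L\<^sup>2\<close>-valued
  random elements.\<close>

definition regression_model :: "'w measure \<Rightarrow> nat \<Rightarrow> real set \<Rightarrow> real set \<Rightarrow>
    ('w \<Rightarrow> real \<Rightarrow> real) \<Rightarrow> ('w \<Rightarrow> real \<Rightarrow> real) \<Rightarrow> ('w \<Rightarrow> real \<Rightarrow> real) \<Rightarrow> real \<Rightarrow>
    (nat \<Rightarrow> real \<times> (nat \<Rightarrow> real) \<Rightarrow> real) \<Rightarrow> bool" where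
  "regression_model M p S1 S2 X Y eps \<sigma> \<beta> \<longleftrightarrow>
     prob_space M \<and> 1 \<le> p \<and> compact S1 \<and> compact S2 \<and>
     L2_process M S1 X \<and> L2_process M S2 Y \<and> L2_process M S2 eps \<and>
     \<beta> \<in> dsum p (LL_meas S1 S2) \<and>
     (AE (\<omega>, t) in M \<Otimes>\<^sub>M leb S2. Y \<omega> t = A_op p S1 X \<beta> (\<omega>, t) + eps \<omega> t) \<and>
     (\<lambda>(\<omega>, t). eps \<omega> t) \<in> L2 (M \<Otimes>\<^sub>M leb S2) \<and>
     (AE t in leb S2. (LINT \<omega>|M. eps \<omega> t) = 0) \<and>
     (LINT \<omega>|M. (L2_norm (leb S2) (eps \<omega>))\<^sup>2) = \<sigma>\<^sup>2 \<and>
     prob_space.indep_var M (L2_sigma (leb S1)) X (L2_sigma (leb S2)) eps"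

definition iid_copies :: "'w measure \<Rightarrow> real set \<Rightarrow> real set \<Rightarrow>
    ('w \<Rightarrow> real \<Rightarrow> real) \<Rightarrow> ('w \<Rightarrow> real \<Rightarrow> real) \<Rightarrow>
    (nat \<Rightarrow> 'w \<Rightarrow> real \<Rightarrow> real) \<Rightarrow> (nat \<Rightarrow> 'w \<Rightarrow> real \<Rightarrow> real) \<Rightarrow> bool" where
  "iid_copies M S1 S2 X Y Xs Ys \<longleftrightarrow>
     (let P = L2_sigma (leb S1) \<Otimes>\<^sub>M L2_sigma (leb S2) in
      prob_space.indep_vars M (\<lambda>_. P) (\<lambda>i \<omega>. (Xs i \<omega>, Ys i \<omega>)) {1..} \<and>
      (\<forall>i\<ge>1. distr M P (\<lambda>\<omega>. (Xs i \<omega>, Ys i \<omega>)) = distr M P (\<lambda>\<omega>. (X \<omega>, Y \<omega>))))"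


section \<open>Regularization, qualification, source condition\<close>

definition regularization :: "real \<Rightarrow> real \<Rightarrow> real \<Rightarrow> (real \<Rightarrow> real \<Rightarrow> real) \<Rightarrow> bool" where
  "regularization \<eta> A B g \<longleftrightarrow> A > 0 \<and> B > 0 \<and>
     (\<forall>lam\<in>{0<..\<eta>}. \<forall>x\<in>{0<..\<eta>}. \<bar>x * g lam x\<bar> \<le> A \<and> \<bar>g lam x\<bar> \<le> B / lam)"

definition has_qualification :: "real \<Rightarrow> (real \<Rightarrow> real \<Rightarrow> real) \<Rightarrow> real \<Rightarrow> bool" where
  "has_qualification \<eta> g q \<longleftrightarrow> (\<exists>w>0. \<forall>lam\<in>{0<..\<eta>}. \<forall>x\<in>{0<..\<eta>}.
     \<bar>1 - x * g lam x\<bar> * x powr q \<le> w * lam powr q)"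

definition qualification :: "real \<Rightarrow> (real \<Rightarrow> real \<Rightarrow> real) \<Rightarrow> real \<Rightarrow> bool" where
  "qualification \<eta> g \<nu> \<longleftrightarrow> has_qualification \<eta> g \<nu> \<and> (\<forall>q. has_qualification \<eta> g q \<longrightarrow> q \<le> \<nu>)"

definition covers :: "real \<Rightarrow> real \<Rightarrow> (real \<Rightarrow> real) \<Rightarrow> bool" where
  "covers \<eta> q \<phi> \<longleftrightarrow> (\<exists>c>0. \<forall>lam\<in>{0<..\<eta>}.
     c * (lam powr q / \<phi> lam) \<le> (INF x\<in>{lam..\<eta>}. x powr q / \<phi> x))"

definition index_function :: "real \<Rightarrow> (real \<Rightarrow> real) \<Rightarrow> bool" where
  "index_function \<eta> \<phi> \<longleftrightarrow> continuous_on {0..\<eta>} \<phi> \<and> mono_on {0..\<eta>} \<phi> \<and> \<phi> 0 = 0"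

definition source_set :: "nat \<Rightarrow> (nat \<Rightarrow> 'a measure) \<Rightarrow> (real \<Rightarrow> real) \<Rightarrow>
    ((nat \<Rightarrow> 'a \<Rightarrow> real) \<Rightarrow> nat \<Rightarrow> 'a \<Rightarrow> real) \<Rightarrow> real \<Rightarrow> (nat \<Rightarrow> 'a \<Rightarrow> real) set" where
  "source_set p N \<phi> T R = {f \<in> dsum p N. \<exists>v\<in>dsum p N. dnorm p N v \<le> R \<and>
     dnorm p N (ddiff f (fcalc p N \<phi> T v)) = 0}"

end

theory Submission
  imports Defs "HOL-Library.Diagonal_Subsequence"
begin

text \<open>In an orthonormal basis of \<open>L\<^sup>2(S\<^sub>2)\<close> the operators \<open>A\<^sup>*A\<close> and \<open>[A\<^sup>*A]\<^sub>n\<close> act on each coordinate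
  \<open>u\<^sub>j\<close> of \<open>u\<close> as \<open>\<Gamma>\<close> and its empirical version \<open>\<Gamma>\<^sub>n\<close>. Both are positive Hilbert-Schmidt
  operators, so the functional calculus is diagonal in their eigenbases. The second moments of
  \<open>(\<Gamma> + \<lambda>)\<^sup>-\<^sup>1\<^sup>/\<^sup>2 (\<Gamma> - \<Gamma>\<^sub>n)\<close> in Hilbert-Schmidt norm and of the noise term weighted in the same way are at
  most a constant times the effective dimension \<open>tr (\<Gamma> (\<Gamma> + \<lambda>)\<^sup>-\<^sup>1) = O(\<lambda>\<^sup>-\<^sup>1\<^sup>/\<^sup>b)\<close> over \<open>n\<close>; for
  \<open>\<psi>(\<lambda>) = n\<^sup>-\<^sup>1\<^sup>/\<^sup>2\<close> this is \<open>O(\<phi>(\<lambda>)\<^sup>2 \<lambda>)\<close>, and Markov's inequality gives a bound with high probability.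
  On this event \<open>(\<Gamma> + \<lambda>)\<^sup>\<theta>\<close> and \<open>(\<Gamma>\<^sub>n + \<lambda>)\<^sup>\<theta>\<close>, \<open>0 \<le> \<theta> \<le> 1\<close>, are comparable by Heinz's inequality. The
  powers of order above 1 needed for the bias are peeled off one at a time; each exchange of \<open>\<Gamma> + \<lambda>\<close> for
  \<open>\<Gamma>\<^sub>n + \<lambda>\<close> costs an error governed by \<open>\<parallel>(\<Gamma> + \<lambda>)\<^sup>-\<^sup>1\<^sup>/\<^sup>2 (\<Gamma> - \<Gamma>\<^sub>n)\<parallel> = O(\<phi>(\<lambda>) \<lambda>\<^sup>1\<^sup>/\<^sup>2)\<close>, which is
  already of the order of the rate.\<close>

section \<open>Diagonal operators on a Hilbert space\<close>

text \<open>Two features of the hypotheses shape the argument. The index function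
  \<open>\<phi>\<close> is only continuous and monotone, so \<open>\<phi>\<close> of the population
  operator cannot be compared with \<open>\<phi>\<close> of the empirical one through operator
  monotonicity; all comparisons concern powers, and \<open>\<phi>\<close> stays tied to the
  population eigenbasis. The constant may grow like a power of 1/\<delta>, which is the price of
  working with second moments. Elements of the model spaces are functions whose equality means
  distance zero, and adjoint, spectral measure and functional calculus are given by descriptions
  that say nothing until existence, and for the last two uniqueness, is shown. Everything is
  therefore moved to a true Hilbert space of sequences, where one eigenbasis serves all coordinates
  \<open>hat u j\<close>. The bases are explicit Gram-Schmidt families, because the coordinates of
  the tensor powers of \<open>X\<close> must be measurable functions of \<open>X\<close>. If
  \<open>S2\<close> is a null set, every norm vanishes and the spectra carry no information on
  \<Gamma>, which forces a few case distinctions.\<close>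

text \<open>A complete orthonormal system padded by zero vectors, so that it can always be indexed by
  the natural numbers.\<close>

locale onb =
  fixes e :: "nat \<Rightarrow> 'h::{real_inner,banach}"
  assumes orth: "\<And>i j. i \<noteq> j \<Longrightarrow> e i \<bullet> e j = 0"
    and unit: "\<And>i. e i \<noteq> 0 \<Longrightarrow> e i \<bullet> e i = 1"
    and parseval: "\<And>u. (\<lambda>i. (u \<bullet> e i)\<^sup>2) sums (u \<bullet> u)"

text \<open>A function of an operator with eigenbasis \<open>e\<close>, given by its values on the
  spectrum. Convergence of the series comes from boundedness of \<open>a\<close>; at padding indices
  the term is zero whatever \<open>a i\<close> is.\<close>

definition diag :: "(nat \<Rightarrow> 'h::{real_inner,banach}) \<Rightarrow> (nat \<Rightarrow> real) \<Rightarrow> 'h \<Rightarrow> 'h" where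
  "diag e a u = (\<Sum>i. (a i * (u \<bullet> e i)) *\<^sub>R e i)"

lemma Bseq_plus:
  fixes a b :: "nat \<Rightarrow> real"
  assumes "Bseq a" "Bseq b" shows "Bseq (\<lambda>i. a i + b i)"
proof -
  obtain C D where C: "\<And>i. \<bar>a i\<bar> \<le> C" and D: "\<And>i. \<bar>b i\<bar> \<le> D"
    using assms unfolding Bseq_def by auto
  show ?thesis
    by (rule BseqI'[of _ "C + D"]) (use C D in \<open>force intro: order.trans[OF abs_triangle_ineq] add_mono\<close>)
qed

lemma orthogonal_series_summable:
  fixes e :: "nat \<Rightarrow> 'h::{real_inner,banach}"
  assumes orth: "\<And>i j. i \<noteq> j \<Longrightarrow> e i \<bullet> e j = 0"
    and unit: "\<And>i. e i \<bullet> e i \<le> 1"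
    and c: "summable (\<lambda>i. (c i)\<^sup>2)"
  shows "summable (\<lambda>i. c i *\<^sub>R e i)"
  unfolding summable_Cauchy
proof (intro allI impI)
  fix \<epsilon> :: real assume \<epsilon>: "\<epsilon> > 0"
  then have "\<epsilon>\<^sup>2 > 0" by simp
  with c obtain N where N: "\<And>m n. m \<ge> N \<Longrightarrow> norm (\<Sum>i=m..<n. (c i)\<^sup>2) < \<epsilon>\<^sup>2"
    unfolding summable_Cauchy by blast
  have "norm (\<Sum>i=m..<n. c i *\<^sub>R e i) < \<epsilon>" if "m \<ge> N" for m n
  proof -
    have "(norm (\<Sum>i=m..<n. c i *\<^sub>R e i))\<^sup>2 = (\<Sum>i=m..<n. (c i)\<^sup>2 * (e i \<bullet> e i))"
    proof -
      have "(\<Sum>j=m..<n. (c i *\<^sub>R e i) \<bullet> (c j *\<^sub>R e j)) = (c i)\<^sup>2 * (e i \<bullet> e i)"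
        if "i \<in> {m..<n}" for i
      proof -
        have "(\<Sum>j=m..<n. (c i *\<^sub>R e i) \<bullet> (c j *\<^sub>R e j)) =
            (\<Sum>j=m..<n. if j = i then (c i)\<^sup>2 * (e i \<bullet> e i) else 0)"
          by (intro sum.cong) (auto simp: orth power2_eq_square)
        with that show ?thesis by simp
      qed
      then show ?thesis
        unfolding power2_norm_eq_inner inner_sum_left inner_sum_right
        by (subst sum.swap) (simp del: inner_scaleR_left inner_scaleR_right)
    qed
    also have "\<dots> \<le> (\<Sum>i=m..<n. (c i)\<^sup>2)"
      by (intro sum_mono) (simp add: mult_left_le unit)
    also have "\<dots> < \<epsilon>\<^sup>2"
      using N[OF that, of n] by simp
    finally show ?thesis
      using \<epsilon> power_less_imp_less_base[of _ 2 \<epsilon>] by simp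
  qed
  then show "\<exists>N. \<forall>m\<ge>N. \<forall>n. norm (\<Sum>i=m..<n. c i *\<^sub>R e i) < \<epsilon>" by blast
qed

lemma orthogonal_series_inner:
  fixes e :: "nat \<Rightarrow> 'h::{real_inner,banach}"
  assumes orth: "\<And>i j. i \<noteq> j \<Longrightarrow> e i \<bullet> e j = 0"
    and unit: "\<And>i. e i \<bullet> e i \<le> 1"
    and c: "summable (\<lambda>i. (c i)\<^sup>2)"
  shows "(\<Sum>i. c i *\<^sub>R e i) \<bullet> e k = c k * (e k \<bullet> e k)"
proof -
  have "(\<lambda>i. c i *\<^sub>R e i) sums (\<Sum>i. c i *\<^sub>R e i)"
    using orthogonal_series_summable[OF assms] by (rule summable_sums)
  then have "(\<lambda>i. (c i *\<^sub>R e i) \<bullet> e k) sums ((\<Sum>i. c i *\<^sub>R e i) \<bullet> e k)"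
    by (rule bounded_linear.sums[OF bounded_linear_inner_left])
  moreover have "(\<lambda>i. (c i *\<^sub>R e i) \<bullet> e k) = (\<lambda>i. if i = k then c k * (e k \<bullet> e k) else 0)"
    by (auto simp: orth)
  ultimately show ?thesis
    using sums_If_finite_set[of "{k}" "\<lambda>i. c k * (e k \<bullet> e k)"] sums_unique2 by fastforce
qed

text \<open>By Bessel's inequality the Fourier series of \<open>u\<close> converges, and its sum has
  the same coefficients as \<open>u\<close>. The difference is orthogonal to every
  \<open>e i\<close>, so totality makes it vanish; pairing the series with \<open>u\<close> gives
  Parseval's identity.\<close>

lemma total_imp_onb:
  fixes e :: "nat \<Rightarrow> 'h::{real_inner,banach}"
  assumes orth: "\<And>i j. i \<noteq> j \<Longrightarrow> e i \<bullet> e j = 0"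
    and unit: "\<And>i. e i \<noteq> 0 \<Longrightarrow> e i \<bullet> e i = 1"
    and total: "\<And>u. (\<And>i. u \<bullet> e i = 0) \<Longrightarrow> u = 0"
  shows "onb e"
proof
  fix u
  have unit': "e i \<bullet> e i \<le> 1" for i
    using unit[of i] by (cases "e i = 0") auto
  \<comment> \<open>At padding indices the coefficient vanishes as well, so
    \<open>e i \<bullet> e i\<close> can be treated as 1.\<close>
  have eq: "(u \<bullet> e i) * (e i \<bullet> e i) = u \<bullet> e i" for i u
    using unit[of i] by (cases "e i = 0") auto
  define s where "s n = (\<Sum>i<n. (u \<bullet> e i) *\<^sub>R e i)" for n
  have us: "u \<bullet> s n = (\<Sum>i<n. (u \<bullet> e i)\<^sup>2)" for n
    by (simp add: s_def inner_sum_right power2_eq_square)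
  have ss: "s n \<bullet> s n = (\<Sum>i<n. (u \<bullet> e i)\<^sup>2)" for n
  proof -
    have "(\<Sum>j<n. ((u \<bullet> e i) *\<^sub>R e i) \<bullet> ((u \<bullet> e j) *\<^sub>R e j)) = (u \<bullet> e i)\<^sup>2" if "i < n" for i
    proof -
      have "(\<Sum>j<n. ((u \<bullet> e i) *\<^sub>R e i) \<bullet> ((u \<bullet> e j) *\<^sub>R e j)) =
          (\<Sum>j<n. if j = i then (u \<bullet> e i)\<^sup>2 else 0)"
        using eq[of u i] by (intro sum.cong) (auto simp: orth power2_eq_square)
      with that show ?thesis by simp
    qed
    then show ?thesis
      unfolding s_def inner_sum_left inner_sum_right
      by (subst sum.swap) (simp del: inner_scaleR_left inner_scaleR_right)
  qed
  have "(\<Sum>i<n. (u \<bullet> e i)\<^sup>2) \<le> u \<bullet> u" for n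
  proof -
    have "0 \<le> (u - s n) \<bullet> (u - s n)" by simp
    then show ?thesis
      by (simp add: inner_diff_left inner_diff_right us ss inner_commute[of "s n" u])
  qed
  then have sm: "summable (\<lambda>i. (u \<bullet> e i)\<^sup>2)"
    by (intro summableI_nonneg_bounded[where x="u \<bullet> u"]) auto
  have *: "(\<Sum>i. (u \<bullet> e i) *\<^sub>R e i) \<bullet> e k = u \<bullet> e k" for k
    using orthogonal_series_inner[OF orth unit' sm, where k=k] eq[of u k] by (rule trans)
  have "u - (\<Sum>i. (u \<bullet> e i) *\<^sub>R e i) = 0"
    by (rule total) (simp only: inner_diff_left * diff_self)
  then have "u = (\<Sum>i. (u \<bullet> e i) *\<^sub>R e i)" by simp
  moreover have "summable (\<lambda>i. (u \<bullet> e i) *\<^sub>R e i)"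
    using orth unit' sm by (rule orthogonal_series_summable)
  ultimately have "(\<lambda>i. (u \<bullet> e i) *\<^sub>R e i) sums u"
    using summable_sums by metis
  then have "(\<lambda>i. u \<bullet> ((u \<bullet> e i) *\<^sub>R e i)) sums (u \<bullet> u)"
    by (rule bounded_linear.sums[OF bounded_linear_inner_right])
  then show "(\<lambda>i. (u \<bullet> e i)\<^sup>2) sums (u \<bullet> u)"
    by (simp add: power2_eq_square)
qed (use assms in auto)

context onb
begin

lemma unit_le: "e i \<bullet> e i \<le> 1"
  using unit[of i] by (cases "e i = 0") auto

lemma inner_unit [simp]: "(u \<bullet> e i) * (e i \<bullet> e i) = u \<bullet> e i"
  using unit[of i] by (cases "e i = 0") auto

text \<open>Parseval's identity, polarized.\<close>

lemma inner_sums: "(\<lambda>i. (u \<bullet> e i) * (v \<bullet> e i)) sums (u \<bullet> v)"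
proof -
  have "(\<lambda>i. (((u + v) \<bullet> e i)\<^sup>2 - ((u - v) \<bullet> e i)\<^sup>2) / 4) sums
      (((u + v) \<bullet> (u + v) - (u - v) \<bullet> (u - v)) / 4)"
    by (intro sums_divide sums_diff parseval)
  then show ?thesis
    by (simp add: inner_simps power2_eq_square algebra_simps inner_commute)
qed

lemma eqI: assumes "\<And>i. u \<bullet> e i = v \<bullet> e i" shows "u = v"
proof -
  have "(\<lambda>i. 0) sums ((u - v) \<bullet> (u - v))"
    using parseval[of "u - v"] by (simp add: inner_diff_left assms)
  then show ?thesis using sums_unique2[OF sums_zero] by fastforce
qed

lemma bessel_summable: "summable (\<lambda>i. (u \<bullet> e i)\<^sup>2)"
  using parseval by (rule sums_summable)

lemma coeff_summable:
  assumes "Bseq a" shows "summable (\<lambda>i. (a i * (u \<bullet> e i))\<^sup>2)"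
proof -
  obtain C where C: "\<And>i. \<bar>a i\<bar> \<le> C" using assms unfolding Bseq_def by auto
  have "(a i * (u \<bullet> e i))\<^sup>2 \<le> C\<^sup>2 * (u \<bullet> e i)\<^sup>2" for i
    using C[of i] power_mono[of "\<bar>a i\<bar>" C 2] by (simp add: power_mult_distrib mult_right_mono)
  then show ?thesis
    by (intro summable_comparison_test'[OF summable_mult[OF bessel_summable, of "C\<^sup>2"], of 0]) auto
qed

lemma diag_coeff: "Bseq a \<Longrightarrow> diag e a u \<bullet> e i = a i * (u \<bullet> e i)"
  unfolding diag_def
  by (subst orthogonal_series_inner) (auto simp: orth unit_le coeff_summable mult.assoc)

lemma diag_inner_sums: "Bseq a \<Longrightarrow> (\<lambda>i. a i * (u \<bullet> e i) * (v \<bullet> e i)) sums (diag e a u \<bullet> v)"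
  using inner_sums[of "diag e a u" v] by (simp add: diag_coeff)

lemma norm_diag_sums: "Bseq a \<Longrightarrow> (\<lambda>i. (a i)\<^sup>2 * (u \<bullet> e i)\<^sup>2) sums (norm (diag e a u))\<^sup>2"
  using parseval[of "diag e a u"]
  by (simp add: diag_coeff power2_norm_eq_inner power_mult_distrib)

lemma diag_sym: "Bseq a \<Longrightarrow> diag e a u \<bullet> v = u \<bullet> diag e a v"
  using sums_unique2[OF diag_inner_sums[of a u v] diag_inner_sums[of a v u, THEN sums_cong[THEN iffD1, rotated]]]
  by (simp add: inner_commute mult_ac)

lemma diag_diag: "Bseq a \<Longrightarrow> Bseq b \<Longrightarrow> diag e a (diag e b u) = diag e (\<lambda>i. a i * b i) u"
  by (rule eqI) (simp add: diag_coeff Bseq_mult)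

lemma diag_cong: "(\<And>i. u \<bullet> e i \<noteq> 0 \<Longrightarrow> a i = b i) \<Longrightarrow> diag e a u = diag e b u"
  unfolding diag_def by (intro suminf_cong) (metis mult_zero_right)

lemma diag_plus: "Bseq a \<Longrightarrow> diag e a (u + v) = diag e a u + diag e a v"
  by (rule eqI) (simp add: diag_coeff inner_simps algebra_simps)

lemma diag_minus: "Bseq a \<Longrightarrow> diag e a (u - v) = diag e a u - diag e a v"
  by (rule eqI) (simp add: diag_coeff inner_simps algebra_simps)

lemma diag_sum: "Bseq a \<Longrightarrow> finite I \<Longrightarrow> diag e a (\<Sum>i\<in>I. f i) = (\<Sum>i\<in>I. diag e a (f i))"
  by (rule eqI) (simp add: diag_coeff inner_sum_left sum_distrib_left)

lemma diag_const: "diag e (\<lambda>i. c) u = c *\<^sub>R u"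
  by (rule eqI) (simp add: diag_coeff)

lemma diag_add_fun:
  "Bseq a \<Longrightarrow> Bseq b \<Longrightarrow> diag e (\<lambda>i. a i + b i) u = diag e a u + diag e b u"
  by (rule eqI) (simp add: diag_coeff Bseq_plus inner_add_left distrib_right)

text \<open>The comparison is demanded only where \<open>u\<close> has a component. This is what
  later allows estimates of filters that are uncontrolled on the kernel.\<close>

lemma norm_diag_mono:
  assumes "Bseq a" "Bseq b" "0 \<le> C" and le: "\<And>i. u \<bullet> e i \<noteq> 0 \<Longrightarrow> \<bar>a i\<bar> \<le> C * \<bar>b i\<bar>"
  shows "norm (diag e a u) \<le> C * norm (diag e b u)"
proof -
  have "(norm (diag e a u))\<^sup>2 \<le> C\<^sup>2 * (norm (diag e b u))\<^sup>2"
  proof (rule sums_le[OF _ norm_diag_sums sums_mult[OF norm_diag_sums]])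
    show "(a i)\<^sup>2 * (u \<bullet> e i)\<^sup>2 \<le> C\<^sup>2 * ((b i)\<^sup>2 * (u \<bullet> e i)\<^sup>2)" for i
    proof (cases "u \<bullet> e i = 0")
      case False
      have "(a i)\<^sup>2 \<le> (C * \<bar>b i\<bar>)\<^sup>2" using power_mono[OF le[OF False], of 2] by simp
      then show ?thesis
        using mult_right_mono[of "(a i)\<^sup>2" "(C * \<bar>b i\<bar>)\<^sup>2" "(u \<bullet> e i)\<^sup>2"]
        by (simp add: power_mult_distrib mult.assoc)
    qed simp
  qed fact+
  then have "(norm (diag e a u))\<^sup>2 \<le> (C * norm (diag e b u))\<^sup>2"
    by (simp add: power_mult_distrib)
  then show ?thesis
    by (rule power2_le_imp_le) (simp add: assms)
qed

lemma norm_diag_le: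
  assumes "0 \<le> C" "\<And>i. \<bar>a i\<bar> \<le> C"
  shows "norm (diag e a u) \<le> C * norm u"
proof -
  have "Bseq a" using assms by (intro BseqI'[of _ C]) auto
  then show ?thesis
    using norm_diag_mono[of a "\<lambda>_. 1" C u] assms by (simp add: diag_const)
qed

end


text \<open>The identity behind real interpolation: the left side is the infimum of
  \<open>\<parallel>a\<parallel>\<^sup>2 + x\<^sup>2 \<parallel>S b\<parallel>\<^sup>2\<close> over all decompositions \<open>u = a + b\<close>.\<close>

lemma K_functional_le:
  fixes x t :: real
  shows "x\<^sup>2 * t\<^sup>2 / (1 + x\<^sup>2 * t\<^sup>2) * (a + b)\<^sup>2 \<le> a\<^sup>2 + x\<^sup>2 * (t * b)\<^sup>2"
proof -
  define y where "y = x\<^sup>2 * t\<^sup>2"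
  have y: "y \<ge> 0" by (simp add: y_def)
  have "y * (a + b)\<^sup>2 \<le> (a\<^sup>2 + y * b\<^sup>2) * (1 + y)"
  proof -
    have "(a\<^sup>2 + y * b\<^sup>2) * (1 + y) - y * (a + b)\<^sup>2 = (a - y * b)\<^sup>2"
      by (simp add: power2_eq_square algebra_simps)
    then show ?thesis using zero_le_power2[of "a - y * b"] by linarith
  qed
  then have "y / (1 + y) * (a + b)\<^sup>2 \<le> a\<^sup>2 + y * b\<^sup>2"
    using y by (simp add: divide_simps mult_ac)
  then show ?thesis by (simp add: y_def power_mult_distrib mult.assoc)
qed

text \<open>The optimal decomposition \<open>u = v + w\<close> for the pair \<open>f\<close>,
  \<open>b\<close> is also admissible for \<open>e\<close>, \<open>a\<close>, where it yields an
  upper bound for the smaller functional. The part \<open>v\<close> is not touched by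
  \<open>le\<close>; its factor is absorbed through \<open>1 \<le> C\<close>.\<close>

lemma K_functional_mono:
  assumes e: "onb e" and f: "onb f" and a: "Bseq a" and b: "Bseq b" and C: "1 \<le> C"
    and le: "\<And>u. norm (diag e a u) \<le> C * norm (diag f b u)"
  shows "(\<Sum>i. x\<^sup>2 * (a i)\<^sup>2 / (1 + x\<^sup>2 * (a i)\<^sup>2) * (u \<bullet> e i)\<^sup>2) \<le>
    C\<^sup>2 * (\<Sum>i. x\<^sup>2 * (b i)\<^sup>2 / (1 + x\<^sup>2 * (b i)\<^sup>2) * (u \<bullet> f i)\<^sup>2)"
    and "summable (\<lambda>i. x\<^sup>2 * (a i)\<^sup>2 / (1 + x\<^sup>2 * (a i)\<^sup>2) * (u \<bullet> e i)\<^sup>2)"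
    and "summable (\<lambda>i. x\<^sup>2 * (b i)\<^sup>2 / (1 + x\<^sup>2 * (b i)\<^sup>2) * (u \<bullet> f i)\<^sup>2)"
proof -
  interpret e: onb e by fact
  interpret f: onb f by fact
  have le1: "x\<^sup>2 * t\<^sup>2 / (1 + x\<^sup>2 * t\<^sup>2) \<le> 1" for t :: real
    by (simp add: divide_simps add_pos_nonneg)
  have ge0: "0 \<le> x\<^sup>2 * t\<^sup>2 / (1 + x\<^sup>2 * t\<^sup>2)" for t :: real
    by (simp add: add_pos_nonneg)
  have le2: "norm (x\<^sup>2 * t\<^sup>2 / (1 + x\<^sup>2 * t\<^sup>2) * z\<^sup>2) \<le> z\<^sup>2" for t z :: real
    using mult_left_le_one_le[OF _ ge0[of t] le1[of t], of "z\<^sup>2"] ge0[of t]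
    by (simp only: real_norm_def abs_mult abs_of_nonneg zero_le_power2)
  show sa: "summable (\<lambda>i. x\<^sup>2 * (a i)\<^sup>2 / (1 + x\<^sup>2 * (a i)\<^sup>2) * (u \<bullet> e i)\<^sup>2)"
    by (rule summable_comparison_test'[OF e.bessel_summable[of u], of 0]) (rule le2)
  show sb: "summable (\<lambda>i. x\<^sup>2 * (b i)\<^sup>2 / (1 + x\<^sup>2 * (b i)\<^sup>2) * (u \<bullet> f i)\<^sup>2)"
    by (rule summable_comparison_test'[OF f.bessel_summable[of u], of 0]) (rule le2)
  \<comment> \<open>The minimizing decomposition: in the basis \<open>f\<close> each coefficient is
    split in the proportions \<open>d i\<close> and \<open>c i\<close>, for which
    \<open>K_functional_le\<close> becomes an equality.\<close>
  define c where "c i = 1 / (1 + x\<^sup>2 * (b i)\<^sup>2)" for i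
  define d where "d i = x\<^sup>2 * (b i)\<^sup>2 / (1 + x\<^sup>2 * (b i)\<^sup>2)" for i
  have Bc: "Bseq c"
    by (rule BseqI'[of _ 1]) (simp add: c_def divide_simps add_pos_nonneg)
  have Bd: "Bseq d"
    by (rule BseqI'[of _ 1]) (use le1 ge0 in \<open>simp add: d_def\<close>)
  define w where "w = diag f c u"
  define v where "v = diag f d u"
  have uvw: "u = v + w"
  proof -
    have "d i + c i = 1" for i
      unfolding d_def c_def by (simp add: divide_simps add_pos_nonneg)
         (metis add_pos_nonneg less_irrefl zero_le_mult_iff zero_le_power2 zero_less_one)
    then have "diag f (\<lambda>i. d i + c i) u = u"
      using f.diag_const[of 1 u] by simp
    then show ?thesis unfolding v_def w_def using f.diag_add_fun[OF Bd Bc] by simp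
  qed
  have A: "(norm v)\<^sup>2 \<le> C\<^sup>2 * (norm v)\<^sup>2"
    using mult_right_mono[OF one_le_power[OF C, of 2], of "(norm v)\<^sup>2"] by simp
  have B: "(norm (diag e a w))\<^sup>2 \<le> C\<^sup>2 * (norm (diag f b w))\<^sup>2"
    using power_mono[OF le[of w], of 2] by (simp add: power_mult_distrib)
  have "(\<Sum>i. x\<^sup>2 * (a i)\<^sup>2 / (1 + x\<^sup>2 * (a i)\<^sup>2) * (u \<bullet> e i)\<^sup>2) \<le>
      (norm v)\<^sup>2 + x\<^sup>2 * (norm (diag e a w))\<^sup>2"
  proof (rule sums_le[OF _ summable_sums[OF sa]])
    show "(\<lambda>i. (v \<bullet> e i)\<^sup>2 + x\<^sup>2 * (a i * (w \<bullet> e i))\<^sup>2) sums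
        ((norm v)\<^sup>2 + x\<^sup>2 * (norm (diag e a w))\<^sup>2)"
      using e.parseval[of v] e.norm_diag_sums[OF a, of w]
      by (intro sums_add sums_mult) (simp_all add: power2_norm_eq_inner power_mult_distrib)
    show "x\<^sup>2 * (a i)\<^sup>2 / (1 + x\<^sup>2 * (a i)\<^sup>2) * (u \<bullet> e i)\<^sup>2 \<le>
        (v \<bullet> e i)\<^sup>2 + x\<^sup>2 * (a i * (w \<bullet> e i))\<^sup>2" for i
      using K_functional_le[of x "a i" "v \<bullet> e i" "w \<bullet> e i"] by (simp add: uvw inner_add_left)
  qed
  also have "\<dots> \<le> C\<^sup>2 * (norm v)\<^sup>2 + x\<^sup>2 * (C\<^sup>2 * (norm (diag f b w))\<^sup>2)"
    by (rule add_mono[OF A mult_left_mono[OF B zero_le_power2]])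
  also have "\<dots> = C\<^sup>2 * ((norm v)\<^sup>2 + x\<^sup>2 * (norm (diag f b w))\<^sup>2)"
    by (simp add: algebra_simps)
  also have "(norm v)\<^sup>2 + x\<^sup>2 * (norm (diag f b w))\<^sup>2 =
      (\<Sum>i. x\<^sup>2 * (b i)\<^sup>2 / (1 + x\<^sup>2 * (b i)\<^sup>2) * (u \<bullet> f i)\<^sup>2)"
  proof -
    have "(\<lambda>i. (v \<bullet> f i)\<^sup>2 + x\<^sup>2 * (b i * (w \<bullet> f i))\<^sup>2) sums
        ((norm v)\<^sup>2 + x\<^sup>2 * (norm (diag f b w))\<^sup>2)"
      using f.parseval[of v] f.norm_diag_sums[OF b, of w]
      by (intro sums_add sums_mult) (simp_all add: power2_norm_eq_inner power_mult_distrib)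
    moreover have "(v \<bullet> f i)\<^sup>2 + x\<^sup>2 * (b i * (w \<bullet> f i))\<^sup>2 =
        x\<^sup>2 * (b i)\<^sup>2 / (1 + x\<^sup>2 * (b i)\<^sup>2) * (u \<bullet> f i)\<^sup>2" for i
    proof -
      define y where "y = x\<^sup>2 * (b i)\<^sup>2"
      have y: "y \<ge> 0" by (simp add: y_def)
      have "(y / (1 + y))\<^sup>2 + y * (1 / (1 + y))\<^sup>2 = y / (1 + y)"
      proof -
        have "(y / (1 + y))\<^sup>2 + y * (1 / (1 + y))\<^sup>2 = y * (1 + y) / (1 + y)\<^sup>2"
          by (simp add: power_divide power2_eq_square add_divide_distrib[symmetric] algebra_simps)
        also have "\<dots> = y / (1 + y)" using y by (simp add: power2_eq_square)
        finally show ?thesis .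
      qed
      moreover have "(v \<bullet> f i)\<^sup>2 = (y / (1 + y))\<^sup>2 * (u \<bullet> f i)\<^sup>2"
        unfolding v_def f.diag_coeff[OF Bd] d_def y_def by (rule power_mult_distrib)
      moreover have "x\<^sup>2 * (b i * (w \<bullet> f i))\<^sup>2 = y * (1 / (1 + y))\<^sup>2 * (u \<bullet> f i)\<^sup>2"
        unfolding w_def f.diag_coeff[OF Bc] c_def y_def by (simp only: power_mult_distrib mult_ac)
      ultimately show ?thesis
        unfolding y_def[symmetric] by (simp only: distrib_right[symmetric])
    qed
    ultimately show ?thesis using sums_unique by simp
  qed
  finally show "(\<Sum>i. x\<^sup>2 * (a i)\<^sup>2 / (1 + x\<^sup>2 * (a i)\<^sup>2) * (u \<bullet> e i)\<^sup>2) \<le>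
    C\<^sup>2 * (\<Sum>i. x\<^sup>2 * (b i)\<^sup>2 / (1 + x\<^sup>2 * (b i)\<^sup>2) * (u \<bullet> f i)\<^sup>2)" .
qed

section \<open>Heinz's inequality by real interpolation\<close>

text \<open>The constant in the representation of \<open>t powr (2 * \<theta>)\<close> as an
  integral of K-functionals over all scales. It equals \<pi> / (2 sin(\<pi> \<theta>)) for 0 <
  \<theta> < 1; the argument uses that it is neither 0 nor infinite.\<close>

definition heinz_const :: "real \<Rightarrow> ennreal" where
  "heinz_const \<theta> = (\<integral>\<^sup>+y. ennreal (indicator {0<..} y * (y powr (1 - 2 * \<theta>) / (1 + y\<^sup>2))) \<partial>lborel)"

text \<open>Near 0 the integrand is at most \<open>y powr (1 - 2 * \<theta>)\<close>, integrable
  because \<theta> < 1; beyond 1 it is at most \<open>y powr (- 1 - 2 * \<theta>)\<close>,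
  integrable because \<theta> > 0.\<close>

lemma heinz_const_finite:
  assumes "0 < \<theta>" "\<theta> < 1"
  shows "heinz_const \<theta> < \<infinity>"
proof -
  have "heinz_const \<theta> \<le> (\<integral>\<^sup>+y. ennreal (indicator {0..1} y * y powr (1 - 2 * \<theta>)) +
      ennreal (indicator {1..} y * y powr (- 1 - 2 * \<theta>)) \<partial>lborel)"
    unfolding heinz_const_def
  proof (rule nn_integral_mono)
    fix y :: real
    have "y powr (1 - 2 * \<theta>) / (1 + y\<^sup>2) \<le> y powr (1 - 2 * \<theta>)" if "0 < y"
      using that by (simp add: divide_simps add_pos_nonneg)
    moreover have "y powr (1 - 2 * \<theta>) / (1 + y\<^sup>2) \<le> y powr (- 1 - 2 * \<theta>)" if "0 < y"
    proof -
      have "y powr (1 - 2 * \<theta>) = y powr (- 1 - 2 * \<theta>) * y\<^sup>2"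
        using that by (simp add: powr_add[symmetric] flip: powr_numeral)
      then show ?thesis using that
        by (simp add: divide_simps add_pos_nonneg algebra_simps)
    qed
    ultimately show "ennreal (indicator {0<..} y * (y powr (1 - 2 * \<theta>) / (1 + y\<^sup>2))) \<le>
      ennreal (indicator {0..1} y * y powr (1 - 2 * \<theta>)) +
      ennreal (indicator {1..} y * y powr (- 1 - 2 * \<theta>))"
      by (cases "0 < y"; cases "y \<le> 1")
        (auto simp: indicator_def simp flip: ennreal_plus intro!: ennreal_leI add_increasing2)
  qed
  also have "\<dots> = ennreal (1 powr (1 - 2 * \<theta> + 1) / (1 - 2 * \<theta> + 1)) +
      ennreal (- (1 powr (- 1 - 2 * \<theta> + 1)) / (- 1 - 2 * \<theta> + 1))"
  proof (subst nn_integral_add)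
    have "(\<integral>\<^sup>+y. ennreal (indicator {0..1} y * y powr (1 - 2 * \<theta>)) \<partial>lborel) =
        ennreal (1 powr (1 - 2 * \<theta> + 1) / (1 - 2 * \<theta> + 1))"
      by (rule nn_integral_has_integral_lebesgue[OF _ has_integral_powr_from_0]) (use assms in auto)
    moreover have "(\<integral>\<^sup>+y. ennreal (indicator {1..} y * y powr (- 1 - 2 * \<theta>)) \<partial>lborel) =
        ennreal (- (1 powr (- 1 - 2 * \<theta> + 1)) / (- 1 - 2 * \<theta> + 1))"
      by (rule nn_integral_has_integral_lebesgue[OF _ has_integral_powr_to_inf]) (use assms in auto)
    ultimately show "(\<integral>\<^sup>+y. ennreal (indicator {0..1} y * y powr (1 - 2 * \<theta>)) \<partial>lborel) +
      (\<integral>\<^sup>+y. ennreal (indicator {1..} y * y powr (- 1 - 2 * \<theta>)) \<partial>lborel) =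
      ennreal (1 powr (1 - 2 * \<theta> + 1) / (1 - 2 * \<theta> + 1)) +
      ennreal (- (1 powr (- 1 - 2 * \<theta> + 1)) / (- 1 - 2 * \<theta> + 1))" by simp
  qed auto
  also have "\<dots> < \<infinity>" by (simp add: ennreal_add_less_top)
  finally show ?thesis .
qed

lemma heinz_const_pos:
  shows "0 < heinz_const \<theta>"
proof (rule ccontr)
  assume "\<not> 0 < heinz_const \<theta>"
  then have "heinz_const \<theta> = 0" by (simp add: not_less)
  then have "AE y in lborel. ennreal (indicator {0<..} y * (y powr (1 - 2 * \<theta>) / (1 + y\<^sup>2))) = 0"
    unfolding heinz_const_def by (subst (asm) nn_integral_0_iff_AE) auto
  then have "AE y in lborel. y \<notin> {0<..<1::real}"
    by eventually_elim (auto simp: ennreal_eq_0_iff divide_le_0_iff not_less[symmetric] add_pos_nonneg)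
  then have "{0<..<1::real} \<in> null_sets lborel"
    by (subst AE_iff_null_sets) auto
  then show False by (auto simp: null_sets_def)
qed

text \<open>Substituting \<open>y = x * t\<close> separates the dependence on \<open>t\<close> from
  an integral that is free of \<open>t\<close>.\<close>

lemma heinz_integral:
  assumes "0 < \<theta>" "0 \<le> t"
  shows "(\<integral>\<^sup>+x. ennreal (indicator {0<..} x * (x powr (- 1 - 2 * \<theta>) * (x\<^sup>2 * t\<^sup>2 / (1 + x\<^sup>2 * t\<^sup>2)))) \<partial>lborel) =
    ennreal (t powr (2 * \<theta>)) * heinz_const \<theta>"
proof (cases "t = 0")
  case False
  with assms have t: "t > 0" by simp
  have "(\<integral>\<^sup>+x. ennreal (indicator {0<..} x * (x powr (- 1 - 2 * \<theta>) * (x\<^sup>2 * t\<^sup>2 / (1 + x\<^sup>2 * t\<^sup>2)))) \<partial>lborel) =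
    ennreal \<bar>1 / t\<bar> * (\<integral>\<^sup>+y. ennreal (indicator {0<..} (0 + 1 / t * y) * ((0 + 1 / t * y) powr (- 1 - 2 * \<theta>) *
      ((0 + 1 / t * y)\<^sup>2 * t\<^sup>2 / (1 + (0 + 1 / t * y)\<^sup>2 * t\<^sup>2)))) \<partial>lborel)"
    by (rule nn_integral_real_affine) (use t in auto)
  also have "\<dots> = (\<integral>\<^sup>+y. ennreal (1 / t) * ennreal (indicator {0<..} (0 + 1 / t * y) * ((0 + 1 / t * y) powr (- 1 - 2 * \<theta>) *
      ((0 + 1 / t * y)\<^sup>2 * t\<^sup>2 / (1 + (0 + 1 / t * y)\<^sup>2 * t\<^sup>2)))) \<partial>lborel)"
    using t by (subst nn_integral_cmult) auto
  also have "\<dots> = (\<integral>\<^sup>+y. ennreal (t powr (2 * \<theta>)) *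
      ennreal (indicator {0<..} y * (y powr (1 - 2 * \<theta>) / (1 + y\<^sup>2))) \<partial>lborel)"
  proof (intro nn_integral_cong)
    fix y :: real
    have "1 / t * ((y / t) powr (- 1 - 2 * \<theta>) * (y\<^sup>2 / (1 + y\<^sup>2))) =
        t powr (2 * \<theta>) * (y powr (1 - 2 * \<theta>) / (1 + y\<^sup>2))" if y: "y > 0"
    proof -
      have 1: "(y / t) powr (- 1 - 2 * \<theta>) = y powr (- 1 - 2 * \<theta>) * (t powr (2 * \<theta>) * t)"
      proof -
        have "(y / t) powr (- 1 - 2 * \<theta>) = y powr (- 1 - 2 * \<theta>) / t powr (- 1 - 2 * \<theta>)"
          using y t by (simp add: powr_divide)
        also have "t powr (- 1 - 2 * \<theta>) = 1 / (t powr (2 * \<theta>) * t)"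
        proof -
          have "t powr (- 1 - 2 * \<theta>) = inverse (t powr (2 * \<theta> + 1))"
            by (subst powr_minus[symmetric]) (simp add: algebra_simps)
          then show ?thesis using t by (simp add: powr_add inverse_eq_divide)
        qed
        finally show ?thesis by simp
      qed
      have 2: "y powr (1 - 2 * \<theta>) = y powr (- 1 - 2 * \<theta>) * y\<^sup>2"
        using y by (simp add: powr_add[symmetric] flip: powr_numeral)
      show ?thesis unfolding 1 2 using t by simp
    qed
    moreover have "(y / t)\<^sup>2 * t\<^sup>2 = y\<^sup>2" using t by (simp add: power_divide)
    ultimately show "ennreal (1 / t) * ennreal (indicator {0<..} (0 + 1 / t * y) * ((0 + 1 / t * y) powr (- 1 - 2 * \<theta>) *
      ((0 + 1 / t * y)\<^sup>2 * t\<^sup>2 / (1 + (0 + 1 / t * y)\<^sup>2 * t\<^sup>2)))) =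
      ennreal (t powr (2 * \<theta>)) * ennreal (indicator {0<..} y * (y powr (1 - 2 * \<theta>) / (1 + y\<^sup>2)))"
      using t by (cases "y > 0")
        (auto simp: ennreal_mult'[symmetric] indicator_def zero_less_divide_iff)
  qed
  also have "\<dots> = ennreal (t powr (2 * \<theta>)) * heinz_const \<theta>"
    unfolding heinz_const_def by (subst nn_integral_cmult) auto
  finally show ?thesis .
qed (use assms in simp)

text \<open>Integrating the K-functional over all scales \<open>x\<close>, term by term by Tonelli,
  recovers the squared norm of the fractional power.\<close>

lemma heinz_sum:
  assumes "onb e" "0 < \<theta>" "Bseq a" "\<And>i. 0 \<le> a i"
  shows "(\<integral>\<^sup>+x. (\<Sum>i. ennreal (indicator {0<..} x * (x powr (- 1 - 2 * \<theta>) * (x\<^sup>2 * (a i)\<^sup>2 / (1 + x\<^sup>2 * (a i)\<^sup>2)))) *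
      ennreal ((u \<bullet> e i)\<^sup>2)) \<partial>lborel) =
    ennreal ((norm (diag e (\<lambda>i. a i powr \<theta>) u))\<^sup>2) * heinz_const \<theta>"
proof -
  interpret onb e by fact
  obtain C where C: "\<And>i. \<bar>a i\<bar> \<le> C" using assms(3) unfolding Bseq_def by auto
  have B: "Bseq (\<lambda>i. a i powr \<theta>)"
    by (rule BseqI'[of _ "C powr \<theta>"]) (use C assms in \<open>auto intro!: powr_mono2\<close>)
  have "(\<integral>\<^sup>+x. (\<Sum>i. ennreal (indicator {0<..} x * (x powr (- 1 - 2 * \<theta>) * (x\<^sup>2 * (a i)\<^sup>2 / (1 + x\<^sup>2 * (a i)\<^sup>2)))) *
      ennreal ((u \<bullet> e i)\<^sup>2)) \<partial>lborel) =
    (\<Sum>i. ennreal (a i powr (2 * \<theta>)) * heinz_const \<theta> * ennreal ((u \<bullet> e i)\<^sup>2))"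
    by (subst nn_integral_suminf, measurable, intro suminf_cong, subst nn_integral_multc, measurable)
      (simp only: heinz_integral[OF assms(2,4)])
  also have "\<dots> = (\<Sum>i. ennreal ((a i powr \<theta>)\<^sup>2 * (u \<bullet> e i)\<^sup>2) * heinz_const \<theta>)"
  proof -
    have "a i powr (2 * \<theta>) = (a i powr \<theta>)\<^sup>2" for i
      by (simp only: power2_eq_square mult_2 powr_add)
    then show ?thesis
      by (simp add: ennreal_mult mult_ac)
  qed
  also have "\<dots> = (\<Sum>i. ennreal ((a i powr \<theta>)\<^sup>2 * (u \<bullet> e i)\<^sup>2)) * heinz_const \<theta>"
    by simp
  also have "(\<Sum>i. ennreal ((a i powr \<theta>)\<^sup>2 * (u \<bullet> e i)\<^sup>2)) = ennreal ((norm (diag e (\<lambda>i. a i powr \<theta>) u))\<^sup>2)"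
    by (rule suminf_ennreal_eq[OF _ norm_diag_sums[OF B]]) simp
  finally show ?thesis .
qed

text \<open>The K-functionals of both operators compare at every scale, and integration multiplies
  both sides by the same finite positive constant. The factor obtained is \<open>C\<close>, not
  \<open>C powr \<theta>\<close>, which is convenient since it is uniform in \<theta>.\<close>

lemma heinz_inequality:
  assumes e: "onb e" and f: "onb f" and a: "Bseq a" "\<And>i. 0 \<le> a i" and b: "Bseq b" "\<And>i. 0 \<le> b i"
    and C: "1 \<le> C" and \<theta>: "0 < \<theta>" "\<theta> < 1"
    and le: "\<And>u. norm (diag e a u) \<le> C * norm (diag f b u)"
  shows "norm (diag e (\<lambda>i. a i powr \<theta>) u) \<le> C * norm (diag f (\<lambda>i. b i powr \<theta>) u)"
proof -
  have "ennreal ((norm (diag e (\<lambda>i. a i powr \<theta>) u))\<^sup>2) * heinz_const \<theta> \<le>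
      ennreal (C\<^sup>2) * (ennreal ((norm (diag f (\<lambda>i. b i powr \<theta>) u))\<^sup>2) * heinz_const \<theta>)"
    unfolding heinz_sum[OF e \<theta>(1) a, symmetric] heinz_sum[OF f \<theta>(1) b, symmetric]
  proof (subst nn_integral_cmult[symmetric], measurable, intro nn_integral_mono)
    fix x :: real
    note K = K_functional_mono[OF e f a(1) b(1) C le, of x u]
    define k where "k = indicator {0<..} x * x powr (- 1 - 2 * \<theta>)"
    have k: "k \<ge> 0" by (simp add: k_def)
    have eq: "(\<Sum>i. ennreal (indicator {0<..} x * (x powr (- 1 - 2 * \<theta>) * (x\<^sup>2 * (c i)\<^sup>2 / (1 + x\<^sup>2 * (c i)\<^sup>2)))) *
       ennreal ((u \<bullet> h i)\<^sup>2)) = ennreal (k * (\<Sum>i. x\<^sup>2 * (c i)\<^sup>2 / (1 + x\<^sup>2 * (c i)\<^sup>2) * (u \<bullet> h i)\<^sup>2))"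
      if s: "summable (\<lambda>i. x\<^sup>2 * (c i)\<^sup>2 / (1 + x\<^sup>2 * (c i)\<^sup>2) * (u \<bullet> h i)\<^sup>2)" for c and h :: "nat \<Rightarrow> 'a"
    proof -
      have "(\<lambda>i. k * (x\<^sup>2 * (c i)\<^sup>2 / (1 + x\<^sup>2 * (c i)\<^sup>2) * (u \<bullet> h i)\<^sup>2)) sums
         (k * (\<Sum>i. x\<^sup>2 * (c i)\<^sup>2 / (1 + x\<^sup>2 * (c i)\<^sup>2) * (u \<bullet> h i)\<^sup>2))"
        using s by (intro sums_mult summable_sums)
      then have "(\<Sum>i. ennreal (k * (x\<^sup>2 * (c i)\<^sup>2 / (1 + x\<^sup>2 * (c i)\<^sup>2) * (u \<bullet> h i)\<^sup>2))) =
         ennreal (k * (\<Sum>i. x\<^sup>2 * (c i)\<^sup>2 / (1 + x\<^sup>2 * (c i)\<^sup>2) * (u \<bullet> h i)\<^sup>2))"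
        by (intro suminf_ennreal_eq) (use k in \<open>auto simp: add_pos_nonneg\<close>)
      moreover have "ennreal (indicator {0<..} x * (x powr (- 1 - 2 * \<theta>) * (x\<^sup>2 * (c i)\<^sup>2 / (1 + x\<^sup>2 * (c i)\<^sup>2)))) *
         ennreal ((u \<bullet> h i)\<^sup>2) = ennreal (k * (x\<^sup>2 * (c i)\<^sup>2 / (1 + x\<^sup>2 * (c i)\<^sup>2) * (u \<bullet> h i)\<^sup>2))" for i
        by (subst ennreal_mult'[symmetric]) (auto simp: k_def add_pos_nonneg mult_ac)
      ultimately show ?thesis by simp
    qed
    show "(\<Sum>i. ennreal (indicator {0<..} x * (x powr (- 1 - 2 * \<theta>) * (x\<^sup>2 * (a i)\<^sup>2 / (1 + x\<^sup>2 * (a i)\<^sup>2)))) *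
       ennreal ((u \<bullet> e i)\<^sup>2)) \<le> ennreal (C\<^sup>2) *
       (\<Sum>i. ennreal (indicator {0<..} x * (x powr (- 1 - 2 * \<theta>) * (x\<^sup>2 * (b i)\<^sup>2 / (1 + x\<^sup>2 * (b i)\<^sup>2)))) *
       ennreal ((u \<bullet> f i)\<^sup>2))"
      unfolding eq[OF K(2)] eq[OF K(3)]
      using mult_left_mono[OF K(1) k]
      by (subst ennreal_mult'[symmetric]) (auto intro!: ennreal_leI simp: mult_ac)
  qed
  then have "heinz_const \<theta> * ennreal ((norm (diag e (\<lambda>i. a i powr \<theta>) u))\<^sup>2) \<le>
      heinz_const \<theta> * ennreal (C\<^sup>2 * (norm (diag f (\<lambda>i. b i powr \<theta>) u))\<^sup>2)"
    by (simp add: ennreal_mult mult_ac)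
  then have "ennreal ((norm (diag e (\<lambda>i. a i powr \<theta>) u))\<^sup>2) \<le>
      ennreal (C\<^sup>2 * (norm (diag f (\<lambda>i. b i powr \<theta>) u))\<^sup>2)"
    using heinz_const_finite[OF \<theta>] heinz_const_pos[of \<theta>]
    by (subst (asm) ennreal_mult_le_mult_iff) auto
  then have "(norm (diag e (\<lambda>i. a i powr \<theta>) u))\<^sup>2 \<le> (C * norm (diag f (\<lambda>i. b i powr \<theta>) u))\<^sup>2"
    by (subst (asm) ennreal_le_iff) (auto simp: power_mult_distrib)
  then show ?thesis
    by (rule power2_le_imp_le) (use C in simp)
qed

section \<open>Spectral regularization under a relative perturbation bound\<close>

lemma rpow_le:
  assumes "0 \<le> x" "0 < lam" "0 \<le> s"
  shows "0 \<le> rpow s x" "rpow s x \<le> (x + lam) powr s"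
  using assms by (auto simp: rpow_def intro: powr_mono2)

text \<open>The deterministic core: \<open>e\<close>, \<open>\<tau>\<close> belong to the population
  operator and \<open>f\<close>, \<open>\<rho>\<close> to the empirical one. The condition
  \<open>close\<close> bounds their difference composed with the inverse square root of the
  regularized population operator by \<open>\<epsilon> * sqrt lam\<close>; here
  \<open>\<epsilon>\<close> may be any nonnegative number.\<close>

locale perturbation =
  e: onb e + f: onb f for e f :: "nat \<Rightarrow> 'h::{real_inner,banach}" +
  fixes \<tau> \<rho> :: "nat \<Rightarrow> real" and \<eta> lam \<epsilon> :: real
  assumes \<tau>: "\<And>i. 0 \<le> \<tau> i" "\<And>i. \<tau> i \<le> \<eta>"
    and \<rho>: "\<And>i. 0 \<le> \<rho> i" "\<And>i. \<rho> i \<le> \<eta>"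
    and lam: "0 < lam" "lam \<le> \<eta>" and \<epsilon>: "0 \<le> \<epsilon>"
    and close: "\<And>a. norm (diag e \<tau> a - diag f \<rho> a) \<le>
      \<epsilon> * sqrt lam * norm (diag e (\<lambda>i. (\<tau> i + lam) powr (1/2)) a)"
begin

definition "C1 = 2 + \<epsilon>\<^sup>2"

abbreviation "P \<theta> \<equiv> diag e (\<lambda>i. (\<tau> i + lam) powr \<theta>)"
abbreviation "Q \<theta> \<equiv> diag f (\<lambda>i. (\<rho> i + lam) powr \<theta>)"

lemma C1: "1 \<le> C1" "0 \<le> C1"
  by (auto simp: C1_def add_increasing2)

lemma Bseq_fun:
  fixes h :: "real \<Rightarrow> real"
  assumes "\<And>x. x \<in> {0..\<eta>} \<Longrightarrow> \<bar>h x\<bar> \<le> C"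
  shows "Bseq (\<lambda>i. h (\<tau> i))" "Bseq (\<lambda>i. h (\<rho> i))"
  using assms \<tau> \<rho> by (auto intro!: BseqI'[of _ C])

lemma Bseq_id: "Bseq \<tau>" "Bseq \<rho>"
  using Bseq_fun[of "\<lambda>x. x" \<eta>] by simp_all

lemma Bseq_powr: "Bseq (\<lambda>i. (\<tau> i + lam) powr \<theta>)" "Bseq (\<lambda>i. (\<rho> i + lam) powr \<theta>)"
proof -
  have "\<bar>(x + lam) powr \<theta>\<bar> \<le> lam powr \<theta> + (\<eta> + lam) powr \<theta>" if "x \<in> {0..\<eta>}" for x
  proof (cases "\<theta> \<ge> 0")
    case True
    then have "(x + lam) powr \<theta> \<le> (\<eta> + lam) powr \<theta>" using that lam by (intro powr_mono2) auto
    then show ?thesis by (simp add: add_increasing)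
  next
    case False
    then have "(x + lam) powr \<theta> \<le> lam powr \<theta>" using that lam by (intro powr_mono2') auto
    then show ?thesis by (simp add: add_increasing2)
  qed
  then show "Bseq (\<lambda>i. (\<tau> i + lam) powr \<theta>)" "Bseq (\<lambda>i. (\<rho> i + lam) powr \<theta>)"
    using Bseq_fun[where h = "\<lambda>x. (x + lam) powr \<theta>"] by blast+
qed

lemma pos: "0 < \<tau> i + lam" "0 < \<rho> i + lam"
  using \<tau>(1)[of i] \<rho>(1)[of i] lam by auto

lemma P1: "P 1 a = diag e \<tau> a + lam *\<^sub>R a"
  using e.diag_add_fun[OF Bseq_id(1) Bfun_const, of lam a]
    pos(1) by (simp add: e.diag_const less_imp_le)

lemma Q1: "Q 1 a = diag f \<rho> a + lam *\<^sub>R a"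
  using f.diag_add_fun[OF Bseq_id(2) Bfun_const, of lam a]
    pos(2) by (simp add: f.diag_const less_imp_le)

lemma P_Q: "P 1 a = Q 1 a + (diag e \<tau> a - diag f \<rho> a)"
  unfolding P1 Q1 by simp

lemma P_half: "(norm (P (1/2) a))\<^sup>2 = P 1 a \<bullet> a"
proof -
  have "((\<tau> i + lam) powr (1/2))\<^sup>2 = (\<tau> i + lam) powr 1" for i
    using pos(1)[of i] by (simp add: power2_eq_square flip: powr_add)
  then have "(\<lambda>i. (\<tau> i + lam) powr 1 * (a \<bullet> e i) * (a \<bullet> e i)) sums (norm (P (1/2) a))\<^sup>2"
    using e.norm_diag_sums[OF Bseq_powr(1), of "1/2" a] by (simp add: power2_eq_square mult.assoc)
  then show ?thesis
    using e.diag_inner_sums[OF Bseq_powr(1), of 1 a a] by (rule sums_unique2)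
qed

text \<open>With \<open>x\<close> and \<open>r\<close> the two norms and \<open>y\<close> the size
  of the perturbation, \<open>x \<le> r + y\<close>. From \<open>lam * norm a \<le> r\<close> one
  gets \<open>y\<^sup>2 \<le> \<epsilon>\<^sup>2 * x * r\<close>, hence
  \<open>y \<le> (x + \<epsilon>\<^sup>2 * r) / 2\<close>. Solving for \<open>x\<close> gives the
  constant \<open>2 + \<epsilon>\<^sup>2\<close> of \<open>C1\<close>.\<close>

lemma resolvent: "norm (P 1 a) \<le> C1 * norm (Q 1 a)"
proof -
  define x where "x = norm (P 1 a)"
  define r where "r = norm (Q 1 a)"
  define y where "y = \<epsilon> * sqrt lam * norm (P (1/2) a)"
  have "norm a \<le> (1 / lam) * norm (Q 1 a)"
  proof -
    have "norm (diag f (\<lambda>_. 1) a) \<le> (1 / lam) * norm (Q 1 a)"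
    proof (rule f.norm_diag_mono[OF _ Bseq_powr(2)])
      show "\<bar>1\<bar> \<le> 1 / lam * \<bar>(\<rho> i + lam) powr 1\<bar>" for i
        using pos(2)[of i] lam \<rho>(1)[of i] by simp
    qed (use lam in auto)
    then show ?thesis by (simp add: f.diag_const)
  qed
  then have a: "lam * norm a \<le> r" using lam by (simp add: r_def field_simps)
  have "y\<^sup>2 = \<epsilon>\<^sup>2 * lam * (P 1 a \<bullet> a)"
    using lam by (simp add: y_def power_mult_distrib P_half[symmetric] del: powr_one' powr_one_gt_zero_iff)
  also have "\<dots> \<le> \<epsilon>\<^sup>2 * lam * (x * norm a)"
    using lam norm_cauchy_schwarz[of "P 1 a" a] by (intro mult_left_mono) (auto simp: x_def)
  also have "\<dots> = \<epsilon>\<^sup>2 * x * (lam * norm a)" by simp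
  also have "\<dots> \<le> \<epsilon>\<^sup>2 * x * r" using a by (intro mult_left_mono) (auto simp: x_def)
  also have "\<dots> \<le> ((x + \<epsilon>\<^sup>2 * r) / 2)\<^sup>2"
  proof -
    have "((x + \<epsilon>\<^sup>2 * r) / 2)\<^sup>2 - \<epsilon>\<^sup>2 * x * r = ((x - \<epsilon>\<^sup>2 * r) / 2)\<^sup>2"
      by (simp add: power2_eq_square field_simps)
    then show ?thesis using zero_le_power2[of "(x - \<epsilon>\<^sup>2 * r) / 2"] by linarith
  qed
  finally have "y \<le> (x + \<epsilon>\<^sup>2 * r) / 2"
    by (rule power2_le_imp_le) (simp add: x_def r_def)
  moreover have "x \<le> r + y"
    unfolding x_def P_Q r_def y_def using close[of a] by (intro order.trans[OF norm_triangle_ineq]) simp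
  ultimately show ?thesis unfolding x_def[symmetric] r_def[symmetric] C1_def by (simp add: distrib_right)
qed

text \<open>Interpolation between the trivial case \<theta> = 0 and \<open>resolvent\<close> at
  \<theta> = 1. The end points are treated apart because \<open>heinz_const\<close> is infinite
  there.\<close>

lemma heinz: "0 \<le> \<theta> \<Longrightarrow> \<theta> \<le> 1 \<Longrightarrow> norm (P \<theta> a) \<le> C1 * norm (Q \<theta> a)"
proof -
  assume \<theta>: "0 \<le> \<theta>" "\<theta> \<le> 1"
  have pw: "(\<lambda>i. (\<tau> i + lam) powr 1) = (\<lambda>i. \<tau> i + lam)" "(\<lambda>i. (\<rho> i + lam) powr 1) = (\<lambda>i. \<rho> i + lam)"
    using pos by (auto simp: less_imp_le)
  consider "\<theta> = 0" | "\<theta> = 1" | "0 < \<theta>" "\<theta> < 1" using \<theta> by linarith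
  then show "norm (P \<theta> a) \<le> C1 * norm (Q \<theta> a)"
  proof cases
    case 1
    have "\<tau> i + lam \<noteq> 0" "\<rho> i + lam \<noteq> 0" for i using pos[of i] by auto
    then show ?thesis using 1 C1(1) mult_right_mono[OF C1(1), of "norm a"]
      by (simp add: e.diag_const f.diag_const)
  next
    case 2
    then show ?thesis using resolvent by simp
  next
    case 3
    show ?thesis
      by (rule heinz_inequality[OF e.onb_axioms f.onb_axioms _ _ _ _ C1(1) 3])
        (use Bseq_powr[of 1, unfolded pw] pos resolvent[unfolded pw] in \<open>auto simp: less_imp_le\<close>)
  qed
qed

text \<open>Duality. The hypothesis on \<open>y\<close> says in effect that \<open>y\<close> is
  \<open>P \<theta>\<close> of a vector of norm at most \<open>d\<close>. Testing
  \<open>diag f h y\<close> against itself moves \<open>h\<close> to the other argument, where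
  \<open>heinz\<close> replaces \<open>P\<close> by \<open>Q\<close>, and \<open>Q \<theta>\<close>
  combines with \<open>h\<close> in the basis \<open>f\<close>.\<close>

lemma norm_diag_dual:
  assumes y: "\<And>a. y \<bullet> a \<le> d * norm (P \<theta> a)" and d: "0 \<le> d" and \<theta>: "0 \<le> \<theta>" "\<theta> \<le> 1"
    and h: "Bseq h" "\<And>i. y \<bullet> f i \<noteq> 0 \<Longrightarrow> \<bar>h i\<bar> * (\<rho> i + lam) powr \<theta> \<le> M" and M: "0 \<le> M"
  shows "norm (diag f h y) \<le> d * C1 * M"
proof -
  define z where "z = diag f h y"
  have "(norm z)\<^sup>2 = y \<bullet> diag f h z"
    using f.diag_sym[OF h(1), of y z] by (simp add: power2_norm_eq_inner z_def)
  also have "\<dots> \<le> d * norm (P \<theta> (diag f h z))" by (rule y)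
  also have "\<dots> \<le> d * (C1 * norm (Q \<theta> (diag f h z)))"
    using heinz[OF \<theta>] d by (intro mult_left_mono)
  also have "norm (Q \<theta> (diag f h z)) \<le> M * norm z"
  proof -
    have "norm (diag f (\<lambda>i. (\<rho> i + lam) powr \<theta> * h i) z) \<le> M * norm (diag f (\<lambda>_. 1) z)"
    proof (rule f.norm_diag_mono)
      fix i assume "z \<bullet> f i \<noteq> 0"
      then have "y \<bullet> f i \<noteq> 0" by (auto simp: z_def f.diag_coeff h)
      from h(2)[OF this] show "\<bar>(\<rho> i + lam) powr \<theta> * h i\<bar> \<le> M * \<bar>1\<bar>"
        by (simp add: abs_mult mult.commute)
    qed (use M h Bseq_powr in \<open>auto intro: Bseq_mult\<close>)
    then show ?thesis by (simp add: f.diag_diag Bseq_powr h f.diag_const)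
  qed
  finally have "norm z * norm z \<le> (d * C1 * M) * norm z"
    using d C1 by (simp add: power2_eq_square mult_left_mono mult.assoc)
  then show ?thesis unfolding z_def[symmetric]
    using d C1 M by (cases "z = 0") auto
qed

text \<open>By symmetry of both operators, \<open>close\<close> turns into a bound on the functional
  given by the difference applied to \<open>w\<close>, with weight exponent 1/2, as
  \<open>norm_diag_dual\<close> requires.\<close>

lemma error_dual:
  assumes "0 \<le> d" and h: "Bseq h" "\<And>i. \<bar>h i\<bar> * (\<rho> i + lam) powr (1/2) \<le> M" and M: "0 \<le> M"
  shows "norm (diag f h (diag e \<tau> w - diag f \<rho> w)) \<le> norm w * (\<epsilon> * sqrt lam) * C1 * M"
proof (rule norm_diag_dual[where \<theta>="1/2"])
  fix a
  have "(diag e \<tau> w - diag f \<rho> w) \<bullet> a = w \<bullet> (diag e \<tau> a - diag f \<rho> a)"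
    by (simp add: inner_diff_left inner_diff_right e.diag_sym f.diag_sym Bseq_id)
  also have "\<dots> \<le> norm w * norm (diag e \<tau> a - diag f \<rho> a)" by (rule norm_cauchy_schwarz)
  also have "\<dots> \<le> norm w * (\<epsilon> * sqrt lam * norm (P (1/2) a))"
    by (intro mult_left_mono close) simp
  finally show "(diag e \<tau> w - diag f \<rho> w) \<bullet> a \<le> norm w * (\<epsilon> * sqrt lam) * norm (P (1/2) a)"
    by (simp add: mult.assoc)
qed (use h M lam \<epsilon> in auto)

text \<open>Since \<open>s \<le> 1/2\<close>, raising the weight from exponent \<open>s\<close> to
  1/2 costs \<open>lam powr (s - 1/2)\<close>. One half power passes through \<open>heinz\<close>,
  the other through duality, and together they meet \<open>g\<close> in the bound \<open>Cg\<close>.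
  By \<open>ker\<close> the noise has no component where \<open>\<rho> i = 0\<close>, so the value
  of \<open>g\<close> at 0 does not enter.\<close>

lemma noise_bound:
  assumes y: "\<And>a. y \<bullet> a \<le> \<zeta> * norm (P (1/2) a)" and \<zeta>: "0 \<le> \<zeta>"
    and ker: "\<And>i. \<rho> i = 0 \<Longrightarrow> y \<bullet> f i = 0"
    and g: "Bseq (\<lambda>i. g (\<rho> i))" "\<And>x. 0 < x \<Longrightarrow> x \<le> \<eta> \<Longrightarrow> \<bar>g x\<bar> * (x + lam) \<le> Cg" and Cg: "0 \<le> Cg"
    and s: "0 \<le> s" "s \<le> 1/2"
  shows "norm (diag e (\<lambda>i. rpow s (\<tau> i)) (diag f (\<lambda>i. g (\<rho> i)) y)) \<le>
    lam powr (s - 1/2) * (C1 * (\<zeta> * C1 * Cg))"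
proof -
  define w where "w = diag f (\<lambda>i. g (\<rho> i)) y"
  have Bs: "Bseq (\<lambda>i. rpow s (\<tau> i))"
    by (rule Bseq_fun(1)[of "rpow s" "(\<eta> + lam) powr s"])
      (use rpow_le lam s in \<open>auto intro: order.trans[OF rpow_le(2)[of _ lam]] intro!: powr_mono2\<close>)
  have "norm (diag e (\<lambda>i. rpow s (\<tau> i)) w) \<le> lam powr (s - 1/2) * norm (P (1/2) w)"
  proof (rule e.norm_diag_mono[OF Bs Bseq_powr(1)])
    fix i
    have "rpow s (\<tau> i) \<le> (\<tau> i + lam) powr s" using \<tau> lam s by (intro rpow_le)
    also have "\<dots> = (\<tau> i + lam) powr (s - 1/2) * (\<tau> i + lam) powr (1/2)"
      by (simp flip: powr_add)
    also have "\<dots> \<le> lam powr (s - 1/2) * (\<tau> i + lam) powr (1/2)"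
      using \<tau>(1)[of i] lam s by (intro mult_right_mono powr_mono2') auto
    finally show "\<bar>rpow s (\<tau> i)\<bar> \<le> lam powr (s - 1/2) * \<bar>(\<tau> i + lam) powr (1/2)\<bar>"
      using rpow_le(1)[of "\<tau> i" lam s] \<tau> lam s by simp
  qed simp
  also have "\<dots> \<le> lam powr (s - 1/2) * (C1 * norm (Q (1/2) w))"
    by (intro mult_left_mono heinz) auto
  also have "norm (Q (1/2) w) = norm (diag f (\<lambda>i. (\<rho> i + lam) powr (1/2) * g (\<rho> i)) y)"
    unfolding w_def by (simp add: f.diag_diag Bseq_powr g)
  also have "\<dots> \<le> \<zeta> * C1 * Cg"
  proof (rule norm_diag_dual[where \<theta>="1/2", OF y \<zeta>])
    fix i assume "y \<bullet> f i \<noteq> 0"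
    then have "\<rho> i \<noteq> 0" using ker by auto
    then have "0 < \<rho> i" "\<rho> i \<le> \<eta>" using \<rho>[of i] by auto
    from g(2)[OF this] show "\<bar>(\<rho> i + lam) powr (1/2) * g (\<rho> i)\<bar> * (\<rho> i + lam) powr (1/2) \<le> Cg"
      using pos(2)[of i] by (simp add: abs_mult mult_ac flip: powr_add)
  qed (use Cg Bseq_mult[OF Bseq_powr(2) g(1)] in auto)
  finally show ?thesis using C1 by (simp add: w_def mult_left_mono)
qed

text \<open>\<open>V j\<close> carries \<open>j\<close> negative powers of the regularized
  population operator. Writing \<open>V J\<close> as \<open>P 1 (V (Suc J))\<close> and splitting
  \<open>P 1\<close> into \<open>Q 1\<close> and the perturbation trades one power per step.\<close>

lemma telescope:
  fixes v :: 'h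
  assumes \<phi>: "Bseq (\<lambda>i. \<phi> (\<tau> i))"
  defines "V \<equiv> \<lambda>j. diag e (\<lambda>i. \<phi> (\<tau> i) * (\<tau> i + lam) powr (- real j)) v"
  shows "diag e (\<lambda>i. \<phi> (\<tau> i)) v =
    Q (real J) (V J) + (\<Sum>j<J. Q (real j) (diag e \<tau> (V (Suc j)) - diag f \<rho> (V (Suc j))))"
proof (induction J)
  case 0
  have "\<tau> i + lam \<noteq> 0" "\<rho> i + lam \<noteq> 0" for i using pos[of i] by auto
  then show ?case by (simp add: V_def f.diag_const)
next
  case (Suc J)
  have "V J = P 1 (V (Suc J))"
    unfolding V_def
    by (subst e.diag_diag[OF Bseq_powr(1) Bseq_mult[OF \<phi> Bseq_powr(1)]])
      (simp add: mult.left_commute del: powr_one' powr_one_gt_zero_iff flip: powr_add)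
  then have "V J = Q 1 (V (Suc J)) + (diag e \<tau> (V (Suc J)) - diag f \<rho> (V (Suc J)))"
    using P_Q by simp
  then have "Q (real J) (V J) = Q (real J) (Q 1 (V (Suc J))) +
      Q (real J) (diag e \<tau> (V (Suc J)) - diag f \<rho> (V (Suc J)))"
    by (simp only: f.diag_plus Bseq_powr)
  moreover have "Q (real J) (Q 1 (V (Suc J))) = Q (real (Suc J)) (V (Suc J))"
    by (subst f.diag_diag[OF Bseq_powr(2) Bseq_powr(2)])
      (simp add: add.commute[of 1] del: powr_one' powr_one_gt_zero_iff flip: powr_add)
  ultimately show ?case using Suc by simp
qed

text \<open>After the weight of exponent \<open>s\<close>, the qualification leaves
  \<open>q = \<nu> - s\<close> powers. Its integral part \<open>J\<close> is exchanged by
  \<open>telescope\<close>, the fractional part \<theta> by duality. The exchange errors carry a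
  factor \<epsilon>, so the crude bound \<Phi> on \<phi> is enough for them; the sharp bound
  \<open>F\<close> is spent on the main term.\<close>

lemma bias_bound:
  assumes r: "\<And>x a. x \<in> {0..\<eta>} \<Longrightarrow> 0 \<le> a \<Longrightarrow> a \<le> \<nu> \<Longrightarrow> \<bar>r x\<bar> * (x + lam) powr a \<le> Cr * lam powr a"
    and \<phi>: "\<And>x. x \<in> {0..\<eta>} \<Longrightarrow> \<bar>\<phi> x\<bar> \<le> \<Phi>"
      "\<And>x. x \<in> {0..\<eta>} \<Longrightarrow> \<bar>\<phi> x\<bar> * (x + lam) powr (- (\<nu> - s)) \<le> F * lam powr (- (\<nu> - s))"
    and s: "0 \<le> s" "s \<le> 1/2" and \<nu>: "1 \<le> \<nu>" and nn: "0 \<le> Cr" "0 \<le> F" "0 \<le> \<Phi>"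
  shows "norm (diag e (\<lambda>i. rpow s (\<tau> i)) (diag f (\<lambda>i. r (\<rho> i)) (diag e (\<lambda>i. \<phi> (\<tau> i)) v))) \<le>
    C1 * C1 * Cr * (F + (\<nu> - s) * \<epsilon> * \<Phi>) * lam powr s * norm v"
proof -
  define q where "q = \<nu> - s"
  define J where "J = nat \<lfloor>q\<rfloor>"
  have q: "0 < q" using s \<nu> by (simp add: q_def)
  then have J: "real J \<le> q" "q \<le> real J + 1" unfolding J_def by linarith+
  have B\<phi>: "Bseq (\<lambda>i. \<phi> (\<tau> i))" by (rule Bseq_fun) (use \<phi> in auto)
  have Br: "Bseq (\<lambda>i. r (\<rho> i))"
  proof (rule Bseq_fun)
    fix x assume "x \<in> {0..\<eta>}"
    then show "\<bar>r x\<bar> \<le> Cr" using r[of x 0] \<nu> lam by (simp split: if_splits)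
  qed
  define V where "V j = diag e (\<lambda>i. \<phi> (\<tau> i) * (\<tau> i + lam) powr (- real j)) v" for j
  define D where "D w = diag e \<tau> w - diag f \<rho> w" for w
  \<comment> \<open>The filter residual together with the weight of exponent \<open>s\<close> and
    the \<open>j\<close> powers released by the telescoping.\<close>
  define h where "h j i = (\<rho> i + lam) powr s * (r (\<rho> i) * (\<rho> i + lam) powr (real j))" for j i
  have Bh: "Bseq (h j)" for j unfolding h_def by (intro Bseq_mult Bseq_powr Br)
  have habs: "\<bar>h j i\<bar> * (\<rho> i + lam) powr \<theta> \<le> Cr * lam powr (s + real j + \<theta>)"
    if "0 \<le> \<theta>" "s + real j + \<theta> \<le> \<nu>" for j i \<theta>
  proof -
    have "\<bar>h j i\<bar> * (\<rho> i + lam) powr \<theta> = \<bar>r (\<rho> i)\<bar> * (\<rho> i + lam) powr (s + real j + \<theta>)"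
      by (simp add: h_def abs_mult powr_add mult_ac)
    then show ?thesis using r[of "\<rho> i" "s + real j + \<theta>"] \<rho> that s by auto
  qed
  have Bs: "Bseq (\<lambda>i. rpow s (\<tau> i))"
    by (rule Bseq_fun(1)[of "rpow s" "(\<eta> + lam) powr s"])
      (use rpow_le lam s in \<open>auto intro: order.trans[OF rpow_le(2)[of _ lam]] intro!: powr_mono2\<close>)
  define U where "U = diag e (\<lambda>i. \<phi> (\<tau> i)) v"
  have U: "U = Q (real J) (V J) + (\<Sum>j<J. Q (real j) (D (V (Suc j))))"
    unfolding U_def V_def D_def by (rule telescope[OF B\<phi>])
  have "norm (diag e (\<lambda>i. rpow s (\<tau> i)) (diag f (\<lambda>i. r (\<rho> i)) U)) \<le> 1 * norm (P s (diag f (\<lambda>i. r (\<rho> i)) U))"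
    by (rule e.norm_diag_mono[OF Bs Bseq_powr(1)]) (use rpow_le[OF \<tau>(1) lam(1) s(1)] in auto)
  also have "\<dots> \<le> C1 * norm (Q s (diag f (\<lambda>i. r (\<rho> i)) U))"
    using heinz[of s] s by simp
  also have "Q s (diag f (\<lambda>i. r (\<rho> i)) U) = diag f (h J) (V J) + (\<Sum>j<J. diag f (h j) (D (V (Suc j))))"
  proof -
    have *: "Q s (diag f (\<lambda>i. r (\<rho> i)) (Q (real j) w)) = diag f (h j) w" for j w
      by (simp add: f.diag_diag Bseq_powr Br Bseq_mult h_def[abs_def])
    show ?thesis
      unfolding U by (simp add: f.diag_plus Br Bseq_powr f.diag_sum *)
  qed
  also have "C1 * norm (diag f (h J) (V J) + (\<Sum>j<J. diag f (h j) (D (V (Suc j))))) \<le>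
     C1 * (F * C1 * Cr * lam powr s * norm v + (\<Sum>j<J. \<epsilon> * \<Phi> * C1 * Cr * lam powr s * norm v))"
  proof (intro mult_left_mono order.trans[OF norm_triangle_ineq] add_mono order.trans[OF norm_sum] sum_mono)
    define \<theta> where "\<theta> = q - real J"
    have \<theta>: "0 \<le> \<theta>" "\<theta> \<le> 1" using J by (auto simp: \<theta>_def)
    define w where "w = diag e (\<lambda>i. \<phi> (\<tau> i) * (\<tau> i + lam) powr (- q)) v"
    have "norm w \<le> F * lam powr (- q) * norm v"
      unfolding w_def
      by (rule e.norm_diag_le) (use \<phi>(2) \<tau> nn in \<open>auto simp: abs_mult q_def\<close>)
    \<comment> \<open>All \<open>q\<close> negative powers go into \<open>w\<close>, where
      \<open>F\<close> applies; the fractional power \<theta> is kept outside for the duality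
      bound.\<close>
    have VJ: "V J = P \<theta> w"
      unfolding V_def w_def \<theta>_def
      by (subst e.diag_diag) (auto intro!: Bseq_mult B\<phi> Bseq_powr e.diag_cong simp: mult_ac simp flip: powr_add)
    have "norm (diag f (h J) (V J)) \<le> norm w * C1 * (Cr * lam powr \<nu>)"
    proof (rule norm_diag_dual[OF _ _ \<theta> Bh])
      show "V J \<bullet> a \<le> norm w * norm (P \<theta> a)" for a
        unfolding VJ by (subst e.diag_sym[OF Bseq_powr(1)]) (rule norm_cauchy_schwarz)
      \<comment> \<open>The residual is used here at its full qualification; with the factor
        \<open>lam powr (- q)\<close> from \<open>w\<close> this leaves
        \<open>lam powr s\<close>.\<close>
      have "s + real J + \<theta> = \<nu>" by (simp add: \<theta>_def q_def)
      then show "\<bar>h J i\<bar> * (\<rho> i + lam) powr \<theta> \<le> Cr * lam powr \<nu>" for i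
        using habs[OF \<theta>(1), of J i] by simp
    qed (use nn in auto)
    also have "\<dots> \<le> F * lam powr (- q) * norm v * C1 * (Cr * lam powr \<nu>)"
      using \<open>norm w \<le> _\<close> C1 nn by (intro mult_right_mono) auto
    also have "\<dots> = F * C1 * Cr * (lam powr (- q) * lam powr \<nu>) * norm v" by simp
    also have "lam powr (- q) * lam powr \<nu> = lam powr s"
      by (simp add: q_def flip: powr_add)
    finally show "norm (diag f (h J) (V J)) \<le> F * C1 * Cr * lam powr s * norm v" .
  next
    fix j assume "j \<in> {..<J}"
    then have j: "real j + 1 \<le> real J" by auto
    have V: "norm (V (Suc j)) \<le> \<Phi> * lam powr (- real (Suc j)) * norm v"
      unfolding V_def
    proof (rule e.norm_diag_le)
      fix i
      have "(\<tau> i + lam) powr (- real (Suc j)) \<le> lam powr (- real (Suc j))"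
        using \<tau>(1)[of i] lam by (intro powr_mono2') auto
      then show "\<bar>\<phi> (\<tau> i) * (\<tau> i + lam) powr (- real (Suc j))\<bar> \<le> \<Phi> * lam powr (- real (Suc j))"
        using \<phi>(1)[of "\<tau> i"] \<tau> unfolding abs_mult by (intro mult_mono) auto
    qed (use nn in simp)
    \<comment> \<open>The exponents \<open>- (j + 1)\<close>, \<open>1/2\<close> and
      \<open>s + j + 1/2\<close> add up to \<open>s\<close>. The last is within the qualification
      because \<open>j + 1 \<le> J \<le> \<nu> - s\<close>.\<close>
    have "norm (diag f (h j) (D (V (Suc j)))) \<le>
        norm (V (Suc j)) * (\<epsilon> * sqrt lam) * C1 * (Cr * lam powr (s + real j + 1/2))"
      unfolding D_def
      by (rule error_dual[OF _ Bh habs]) (use nn j J s in \<open>auto simp: q_def\<close>)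
    also have "\<dots> \<le> \<Phi> * lam powr (- real (Suc j)) * norm v * (\<epsilon> * sqrt lam) * C1 * (Cr * lam powr (s + real j + 1/2))"
      using V C1 nn \<epsilon> lam by (intro mult_right_mono) auto
    also have "\<dots> = \<epsilon> * \<Phi> * C1 * Cr * (lam powr (- real (Suc j)) * sqrt lam * lam powr (s + real j + 1/2)) * norm v"
      by simp
    also have "lam powr (- real (Suc j)) * sqrt lam * lam powr (s + real j + 1/2) = lam powr s"
      using lam by (simp add: powr_half_sqrt[symmetric] algebra_simps flip: powr_add)
    finally show "norm (diag f (h j) (D (V (Suc j)))) \<le> \<epsilon> * \<Phi> * C1 * Cr * lam powr s * norm v" .
  qed (use C1 in simp)
  also have "\<dots> = C1 * C1 * Cr * (F + real J * \<epsilon> * \<Phi>) * lam powr s * norm v"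
    by (simp add: algebra_simps)
  \<comment> \<open>There are \<open>J\<close> exchange errors, and
    \<open>J \<le> \<nu> - s\<close>.\<close>
  also have "\<dots> \<le> C1 * C1 * Cr * (F + (\<nu> - s) * \<epsilon> * \<Phi>) * lam powr s * norm v"
    using J(1) C1 nn \<epsilon> unfolding q_def
    by (intro mult_right_mono mult_left_mono add_left_mono) auto
  finally show ?thesis unfolding U_def .
qed

end

section \<open>The spectral theorem for positive Hilbert-Schmidt operators\<close>

locale positive_hs = d: onb d for d :: "nat \<Rightarrow> 'h::{real_inner,banach}" +
  fixes T :: "'h \<Rightarrow> 'h"
  assumes lin: "bounded_linear T"
    and sym: "\<And>u v. T u \<bullet> v = u \<bullet> T v"
    and pos: "\<And>u. 0 \<le> T u \<bullet> u"
    and hs: "summable (\<lambda>i. (norm (T (d i)))\<^sup>2)"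
begin

text \<open>A Hilbert-Schmidt operator is compact: a diagonal subsequence makes every coordinate
  \<open>x (r k) \<bullet> T (d n)\<close> of the images converge, and these coordinates are
  dominated by the square-summable \<open>norm (T (d n))\<close>, so Tannery's theorem upgrades this
  to norm convergence.\<close>

lemma compact_image:
  fixes x :: "nat \<Rightarrow> 'h"
  assumes x: "\<And>n. norm (x n) \<le> 1"
  shows "\<exists>r z. strict_mono r \<and> (\<lambda>n. T (x (r n))) \<longlonglongrightarrow> z"
proof -
  let ?P = "\<lambda>n s. convergent (\<lambda>k. x (s k) \<bullet> T (d n))"
  have bd: "\<bar>x k \<bullet> T (d i)\<bar> \<le> norm (T (d i))" for k i
    using Cauchy_Schwarz_ineq2[of "x k" "T (d i)"] mult_right_mono[OF x[of k] norm_ge_zero[of "T (d i)"]]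
    by simp
  interpret sub: subseqs ?P
  proof
    fix n :: nat and s :: "nat \<Rightarrow> nat" assume s: "strict_mono s"
    let ?I = "{- norm (T (d n))..norm (T (d n))}"
    have "seq_compact ?I" by (intro compact_imp_seq_compact compact_Icc)
    moreover have "\<forall>k. x (s k) \<bullet> T (d n) \<in> ?I" using bd[of _ n] by (auto simp: abs_le_iff minus_le_iff)
    ultimately obtain l r where "strict_mono r" "((\<lambda>k. x (s k) \<bullet> T (d n)) \<circ> r) \<longlonglongrightarrow> l"
      unfolding seq_compact_def by metis
    then show "\<exists>r'. strict_mono r' \<and> ?P n (s \<circ> r')"
      by (auto simp: o_def convergent_def)
  qed
  define r where "r = sub.diagseq"
  have r: "strict_mono r" unfolding r_def by (rule sub.subseq_diagseq)
  \<comment> \<open>The diagonal sequence is a subsequence of the n-th one only from index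
    \<open>Suc n\<close> on, hence the shift.\<close>
  have "?P n (r \<circ> (+) (Suc n))" for n
    unfolding r_def
  proof (rule sub.diagseq_holds)
    fix q s :: "nat \<Rightarrow> nat" and n :: nat assume "strict_mono q" "?P n s"
    then show "?P n (s \<circ> q)"
      using convergent_subseq_convergent[of "\<lambda>k. x (s k) \<bullet> T (d n)" q] by (simp add: o_def)
  qed
  moreover have "r \<circ> (+) (Suc n) = (\<lambda>k. r (k + Suc n))" for n
    by (simp add: fun_eq_iff add.commute)
  ultimately have "convergent (\<lambda>k. x (r (k + Suc n)) \<bullet> T (d n))" for n
    by metis
  then have "\<exists>a. (\<lambda>k. x (r k) \<bullet> T (d n)) \<longlonglongrightarrow> a" for n
    using convergent_ignore_initial_segment[where m = "Suc n" and f = "\<lambda>k. x (r k) \<bullet> T (d n)"]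
    by (simp add: convergent_def)
  then obtain a where a: "\<And>n. (\<lambda>k. x (r k) \<bullet> T (d n)) \<longlonglongrightarrow> a n" by metis
  have abd: "\<bar>a i\<bar> \<le> norm (T (d i))" for i
    by (rule LIMSEQ_le_const2[OF tendsto_rabs[OF a]]) (use bd in blast)
  have sa: "summable (\<lambda>i. (a i)\<^sup>2)"
    by (rule summable_comparison_test'[OF hs, of 0]) (use abd in \<open>auto simp: abs_le_square_iff[symmetric]\<close>)
  define z where "z = (\<Sum>i. a i *\<^sub>R d i)"
  \<comment> \<open>The limit coefficients vanish at padding indices, so they are coefficients of an
    actual vector.\<close>
  have ad: "a i * (d i \<bullet> d i) = a i" for i
  proof (cases "d i = 0")
    case True
    then have "T (d i) = 0" using lin linear_0 bounded_linear.linear by metis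
    then have "a i = 0" using abd[of i] by simp
    then show ?thesis by simp
  qed (use d.unit in simp)
  have z: "z \<bullet> d i = a i" for i
    unfolding z_def
    using orthogonal_series_inner[OF d.orth d.unit_le sa, where k = i] ad[of i] by (rule trans)
  have nz: "(norm (T (x (r k)) - z))\<^sup>2 = (\<Sum>i. (x (r k) \<bullet> T (d i) - a i)\<^sup>2)" for k
    using sums_unique[OF d.parseval[of "T (x (r k)) - z"]]
    by (simp add: power2_norm_eq_inner inner_diff_left z sym)
  have "(\<lambda>k. \<Sum>i. (x (r k) \<bullet> T (d i) - a i)\<^sup>2) \<longlonglongrightarrow> (\<Sum>i::nat. 0::real)"
  proof (rule tannerys_theorem[THEN conjunct2, THEN conjunct2])
    show "(\<lambda>k. (x (r k) \<bullet> T (d i) - a i)\<^sup>2) \<longlonglongrightarrow> 0" for i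
      using tendsto_power[OF tendsto_diff[OF a[of i] tendsto_const[of "a i"]], of 2] by simp
    show "\<forall>\<^sub>F (i, k) in at_top \<times>\<^sub>F sequentially. norm ((x (r k) \<bullet> T (d i) - a i)\<^sup>2) \<le> 4 * (norm (T (d i)))\<^sup>2"
    proof (intro always_eventually allI, clarify)
      fix i k
      have "\<bar>x (r k) \<bullet> T (d i) - a i\<bar> \<le> 2 * norm (T (d i))" using bd[of "r k" i] abd[of i] by linarith
      then have "\<bar>x (r k) \<bullet> T (d i) - a i\<bar>\<^sup>2 \<le> (2 * norm (T (d i)))\<^sup>2" by (intro power_mono) auto
      then show "norm ((x (r k) \<bullet> T (d i) - a i)\<^sup>2) \<le> 4 * (norm (T (d i)))\<^sup>2"
        by (simp add: power_mult_distrib)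
    qed
    show "summable (\<lambda>i. 4 * (norm (T (d i)))\<^sup>2)" by (intro summable_mult hs)
  qed simp
  then have "(\<lambda>k. sqrt ((norm (T (x (r k)) - z))\<^sup>2)) \<longlonglongrightarrow> sqrt 0"
    unfolding nz by (intro tendsto_real_sqrt) simp
  then have "(\<lambda>k. T (x (r k))) \<longlonglongrightarrow> z"
    by (simp add: LIM_zero_iff tendsto_norm_zero_iff)
  with r show ?thesis by blast
qed

text \<open>The form \<open>T u \<bullet> v\<close> is only semidefinite, hence the separate case
  \<open>T v \<bullet> v = 0\<close>.\<close>

lemma positive_cauchy_schwarz: "(T u \<bullet> v)\<^sup>2 \<le> (T u \<bullet> u) * (T v \<bullet> v)"
proof -
  interpret T: bounded_linear T by (rule lin)
  let ?a = "T u \<bullet> u" and ?b = "T u \<bullet> v" and ?c = "T v \<bullet> v"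
  have q: "0 \<le> ?a * (s * s) + 2 * s * t * ?b + ?c * (t * t)" for s t
    using pos[of "s *\<^sub>R u + t *\<^sub>R v"] sym[of v u] inner_commute[of v "T u"]
    by (simp add: T.add T.scaleR inner_simps algebra_simps)
  show ?thesis
  proof (cases "?c = 0")
    case True
    have "?b = 0"
    proof (rule ccontr)
      assume "?b \<noteq> 0"
      \<comment> \<open>With \<open>?c = 0\<close> this choice gives the quadratic form the value
        -1.\<close>
      define t where "t = - (?a + 1) / (2 * ?b)"
      have "2 * 1 * t * ?b = - (?a + 1)" using \<open>?b \<noteq> 0\<close> by (simp add: t_def)
      then show False using q[of 1 t] True by simp
    qed
    then show ?thesis using True by simp
  next
    case False
    then have "0 < ?c" using pos[of v] by simp
    moreover have "0 \<le> ?c * (?a * ?c - ?b\<^sup>2)"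
      using q[of ?c "- ?b"] by (simp add: power2_eq_square algebra_simps)
    ultimately show ?thesis by (simp add: zero_le_mult_iff)
  qed
qed

text \<open>Let \<open>m\<close> be the supremum of \<open>T x \<bullet> x\<close> over the unit
  sphere of \<open>M\<close>. A maximizing sequence is asymptotically an eigenvector for
  \<open>m\<close>, and compactness lets it converge if \<open>m > 0\<close>. If
  \<open>m = 0\<close>, then \<open>T\<close> vanishes on \<open>M\<close>.\<close>

lemma eigenvector_exists:
  assumes inv: "\<And>u. u \<in> M \<Longrightarrow> T u \<in> M" and scale: "\<And>c u. u \<in> M \<Longrightarrow> c *\<^sub>R u \<in> M"
    and closed: "closed M" and nz: "u0 \<in> M" "u0 \<noteq> 0"
  shows "\<exists>x\<in>M. norm x = 1 \<and> (\<exists>c\<ge>0. T x = c *\<^sub>R x)"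
proof -
  interpret T: bounded_linear T by (rule lin)
  define A where "A = (\<lambda>x. T x \<bullet> x) ` {x \<in> M. norm x = 1}"
  define m where "m = Sup A"
  have "sgn u0 \<in> {x \<in> M. norm x = 1}" using nz scale by (simp add: sgn_div_norm)
  then have ne: "A \<noteq> {}" unfolding A_def by blast
  have bdd: "bdd_above A"
  proof (rule bdd_aboveI)
    fix y assume "y \<in> A"
    then obtain x where x: "norm x = 1" "y = T x \<bullet> x" by (auto simp: A_def)
    have "T x \<bullet> x \<le> norm (T x) * norm x" by (rule norm_cauchy_schwarz)
    also have "\<dots> \<le> onorm T" using onorm[OF lin, of x] x by simp
    finally show "y \<le> onorm T" using x by simp
  qed
  have le_m: "T x \<bullet> x \<le> m * (norm x)\<^sup>2" if "x \<in> M" for x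
  proof (cases "x = 0")
    case False
    have "sgn x \<in> {x \<in> M. norm x = 1}" using that False scale by (simp add: sgn_div_norm)
    then have "T (sgn x) \<bullet> sgn x \<in> A" unfolding A_def by (rule imageI)
    then have "T (sgn x) \<bullet> sgn x \<le> m"
      unfolding m_def by (rule cSup_upper[OF _ bdd])
    then show ?thesis using False
      by (simp add: sgn_div_norm T.scaleR field_simps power2_eq_square)
  qed simp
  have m0: "0 \<le> m"
  proof -
    obtain y where "y \<in> A" using ne by blast
    then have "0 \<le> y" "y \<le> m" using pos cSup_upper[OF _ bdd] by (auto simp: A_def m_def)
    then show ?thesis by simp
  qed
  \<comment> \<open>Cauchy-Schwarz for the form of \<open>T\<close>, applied to \<open>x\<close> and
    \<open>T x\<close>. It bounds \<open>norm (T x - m x)\<close> squared by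
    \<open>m * (m - T x \<bullet> x)\<close> on the unit sphere.\<close>
  have nT: "(norm (T x))\<^sup>2 \<le> m * (T x \<bullet> x)" if "x \<in> M" for x
  proof (cases "T x = 0")
    case False
    have "(norm (T x))\<^sup>2 * (norm (T x))\<^sup>2 \<le> (T x \<bullet> x) * (T (T x) \<bullet> T x)"
      using positive_cauchy_schwarz[of x "T x"]
      unfolding power2_norm_eq_inner by (simp only: power2_eq_square)
    also have "\<dots> \<le> (T x \<bullet> x) * (m * (norm (T x))\<^sup>2)"
      by (intro mult_left_mono le_m inv that pos)
    finally have "(norm (T x))\<^sup>2 * (norm (T x))\<^sup>2 \<le> m * (T x \<bullet> x) * (norm (T x))\<^sup>2" by (simp only: mult_ac)
    then show ?thesis by (rule mult_right_le_imp_le) (use False in simp)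
  qed (use m0 pos in simp)
  have "\<forall>n. \<exists>x. x \<in> M \<and> norm x = 1 \<and> m - 1 / real (Suc n) < T x \<bullet> x"
  proof
    fix n
    have "\<exists>y\<in>A. m - 1 / real (Suc n) < y"
      using less_cSup_iff[OF ne bdd, of "m - 1 / real (Suc n)"] by (simp add: m_def)
    then show "\<exists>x. x \<in> M \<and> norm x = 1 \<and> m - 1 / real (Suc n) < T x \<bullet> x" by (auto simp: A_def)
  qed
  then obtain x where x: "\<And>n. x n \<in> M" "\<And>n. norm (x n) = 1" "\<And>n. m - 1 / real (Suc n) < T (x n) \<bullet> x n"
    by metis
  show ?thesis
  proof (cases "m = 0")
    case True
    then have "T (x 0) = 0" using nT[OF x(1)[of 0]] by simp
    then show ?thesis using x(1,2)[of 0] by (intro bexI[of _ "x 0"] conjI exI[of _ 0]) auto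
  next
    case False
    with m0 have m: "0 < m" by simp
    obtain r z where r: "strict_mono r" and z: "(\<lambda>n. T (x (r n))) \<longlonglongrightarrow> z"
      using compact_image[of x] x(2) by auto
    have "(norm (T (x n) - m *\<^sub>R x n))\<^sup>2 \<le> m * (1 / real (Suc n))" for n
    proof -
      have "(norm (T (x n) - m *\<^sub>R x n))\<^sup>2 = (norm (T (x n)))\<^sup>2 - 2 * m * (T (x n) \<bullet> x n) + m\<^sup>2 * (norm (x n))\<^sup>2"
        unfolding power2_norm_eq_inner
        by (simp add: inner_diff_left inner_diff_right inner_commute power2_eq_square algebra_simps)
      also have "\<dots> \<le> m * (m - T (x n) \<bullet> x n)"
        using nT[OF x(1)[of n]] x(2)[of n] by (simp add: power2_eq_square algebra_simps)
      also have "\<dots> \<le> m * (1 / real (Suc n))" using x(3)[of n] m by (intro mult_left_mono) auto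
      finally show ?thesis .
    qed
    then have le: "\<forall>n. (norm (T (x n) - m *\<^sub>R x n))\<^sup>2 \<le> m * (1 / real (Suc n))" by blast
    have lim: "(\<lambda>n. m * (1 / real (Suc n))) \<longlonglongrightarrow> 0"
      using tendsto_mult[OF tendsto_const[of m] LIMSEQ_Suc[OF lim_1_over_n]] by simp
    have "(\<lambda>n. (norm (T (x n) - m *\<^sub>R x n))\<^sup>2) \<longlonglongrightarrow> 0"
      by (rule tendsto_sandwich[OF always_eventually[OF allI] always_eventually[OF le] tendsto_const lim]) simp
    from tendsto_real_sqrt[OF this] have "(\<lambda>n. T (x n) - m *\<^sub>R x n) \<longlonglongrightarrow> 0"
      by (simp add: tendsto_norm_zero_iff)
    then have "(\<lambda>n. T (x (r n)) - m *\<^sub>R x (r n)) \<longlonglongrightarrow> 0"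
      using LIMSEQ_subseq_LIMSEQ[OF _ r] by (fastforce simp: o_def)
    from tendsto_diff[OF z this] have "(\<lambda>n. m *\<^sub>R x (r n)) \<longlonglongrightarrow> z" by simp
    from tendsto_scaleR[OF tendsto_const[of "1 / m"] this]
    have w: "(\<lambda>n. x (r n)) \<longlonglongrightarrow> (1 / m) *\<^sub>R z" (is "_ \<longlonglongrightarrow> ?w") using m by simp
    have "?w \<in> M" using closed_sequentially[OF closed _ w] x(1) by blast
    moreover have "norm ?w = 1"
    proof (rule LIMSEQ_unique[OF tendsto_norm[OF w]])
      show "(\<lambda>n. norm (x (r n))) \<longlonglongrightarrow> 1" by (simp add: x(2))
    qed
    moreover have "T ?w = m *\<^sub>R ?w"
      using LIMSEQ_unique[OF T.tendsto[OF w] z] m by simp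
    ultimately show ?thesis using m0 by blast
  qed
qed

text \<open>By Bessel's inequality each \<open>d i\<close> has nonzero product with at most
  countably many elements of \<open>B\<close>, and each element of \<open>B\<close> has nonzero
  product with some \<open>d i\<close>.\<close>

lemma orthonormal_countable:
  fixes B :: "'h set"
  assumes B: "\<And>x. x \<in> B \<Longrightarrow> norm x = 1" "\<And>x y. x \<in> B \<Longrightarrow> y \<in> B \<Longrightarrow> x \<noteq> y \<Longrightarrow> x \<bullet> y = 0"
  shows "countable B"
proof -
  have "countable {x \<in> B. (d i \<bullet> x)\<^sup>2 \<noteq> 0}" for i
  proof (rule summable_countable_real[OF nonneg_bdd_above_summable_on])
    show "bdd_above (sum (\<lambda>x. (d i \<bullet> x)\<^sup>2) ` {F. F \<subseteq> B \<and> finite F})"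
    proof (rule bdd_aboveI2)
      fix F assume F: "F \<in> {F. F \<subseteq> B \<and> finite F}"
      define w where "w = (\<Sum>x\<in>F. (d i \<bullet> x) *\<^sub>R x)"
      have "w \<bullet> w = (\<Sum>x\<in>F. (d i \<bullet> x)\<^sup>2)"
      proof -
        have "(\<Sum>y\<in>F. ((d i \<bullet> y) *\<^sub>R y) \<bullet> ((d i \<bullet> x) *\<^sub>R x)) = (d i \<bullet> x)\<^sup>2" if "x \<in> F" for x
        proof -
          have "x \<bullet> x = 1" using that F B(1)[of x] by (auto simp: norm_eq_1)
          then have "(\<Sum>y\<in>F. ((d i \<bullet> y) *\<^sub>R y) \<bullet> ((d i \<bullet> x) *\<^sub>R x)) = (\<Sum>y\<in>F. if y = x then (d i \<bullet> x)\<^sup>2 else 0)"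
            using that F by (intro sum.cong) (auto simp: B(2) subset_iff power2_eq_square)
          then show ?thesis using that F by simp
        qed
        then show ?thesis
          unfolding w_def inner_sum_left inner_sum_right by (simp del: inner_scaleR_left inner_scaleR_right)
      qed
      moreover have "d i \<bullet> w = (\<Sum>x\<in>F. (d i \<bullet> x)\<^sup>2)"
        by (simp add: w_def inner_sum_right power2_eq_square)
      moreover have "0 \<le> (d i - w) \<bullet> (d i - w)" by simp
      ultimately show "(\<Sum>x\<in>F. (d i \<bullet> x)\<^sup>2) \<le> d i \<bullet> d i"
        by (simp add: inner_diff_left inner_diff_right inner_commute[of w "d i"])
    qed
  qed simp
  then have "countable (\<Union>i. {x \<in> B. (d i \<bullet> x)\<^sup>2 \<noteq> 0})" by blast
  moreover have "B \<subseteq> (\<Union>i. {x \<in> B. (d i \<bullet> x)\<^sup>2 \<noteq> 0})"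
  proof
    fix x assume x: "x \<in> B"
    then have "x \<noteq> 0" using B(1) by force
    then have "\<exists>i. x \<bullet> d i \<noteq> 0" using d.eqI[of x 0] by auto
    then show "x \<in> (\<Union>i. {x \<in> B. (d i \<bullet> x)\<^sup>2 \<noteq> 0})" using x by (auto simp: inner_commute)
  qed
  ultimately show ?thesis by (rule countable_subset[rotated])
qed

text \<open>Zorn's lemma gives a maximal orthonormal set of eigenvectors, those for the eigenvalue 0
  included. Its orthogonal complement is closed and invariant under \<open>T\<close>, so if it were
  nonzero it would contain a further eigenvector.\<close>

theorem spectral_theorem:
  obtains e \<tau> where "onb e" "\<And>i. T (e i) = \<tau> i *\<^sub>R e i" "\<And>i::nat. 0 \<le> \<tau> i" "\<And>i. e i = 0 \<Longrightarrow> \<tau> i = 0"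
proof -
  interpret T: bounded_linear T by (rule lin)
  define \<A> where "\<A> = {B. (\<forall>x\<in>B. norm x = 1 \<and> (\<exists>c\<ge>0. T x = c *\<^sub>R x)) \<and>
    (\<forall>x\<in>B. \<forall>y\<in>B. x \<noteq> y \<longrightarrow> x \<bullet> y = 0)}"
  have "{} \<in> \<A>" by (simp add: \<A>_def)
  moreover have "\<Union>\<C> \<in> \<A>" if "\<C> \<noteq> {}" "subset.chain \<A> \<C>" for \<C>
  proof -
    have sub: "\<C> \<subseteq> \<A>" and ch: "\<And>X Y. X \<in> \<C> \<Longrightarrow> Y \<in> \<C> \<Longrightarrow> X \<subseteq> Y \<or> Y \<subseteq> X"
      using that(2) by (auto simp: subset_chain_def)
    have orth: "x \<bullet> y = 0" if "X \<in> \<C>" "x \<in> X" "Y \<in> \<C>" "y \<in> Y" "x \<noteq> y" for x y X Y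
      using ch[OF that(1,3)] sub that unfolding \<A>_def by blast
    have eig: "norm x = 1 \<and> (\<exists>c\<ge>0. T x = c *\<^sub>R x)" if "X \<in> \<C>" "x \<in> X" for x X
      using sub that unfolding \<A>_def by blast
    show ?thesis
      unfolding \<A>_def
    proof (intro CollectI conjI ballI impI)
      fix x y assume "x \<in> \<Union>\<C>" "y \<in> \<Union>\<C>" "x \<noteq> y"
      then show "x \<bullet> y = 0" using orth by (elim UnionE)
    qed (use eig in \<open>elim UnionE, blast\<close>)+
  qed
  ultimately obtain B where B: "B \<in> \<A>" and max: "\<And>X. X \<in> \<A> \<Longrightarrow> B \<subseteq> X \<Longrightarrow> X = B"
    using subset_Zorn_nonempty[of \<A>] by blast
  have B1: "\<And>x. x \<in> B \<Longrightarrow> norm x = 1" and B2: "\<And>x. x \<in> B \<Longrightarrow> \<exists>c\<ge>0. T x = c *\<^sub>R x"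
    and B3: "\<And>x y. x \<in> B \<Longrightarrow> y \<in> B \<Longrightarrow> x \<noteq> y \<Longrightarrow> x \<bullet> y = 0"
    using B by (auto simp: \<A>_def)
  have total: "u = 0" if u: "\<And>x. x \<in> B \<Longrightarrow> u \<bullet> x = 0" for u
  proof (rule ccontr)
    assume "u \<noteq> 0"
    define M where "M = (\<Inter>x\<in>B. {u. u \<bullet> x = 0})"
    have "\<exists>x\<in>M. norm x = 1 \<and> (\<exists>c\<ge>0. T x = c *\<^sub>R x)"
    proof (rule eigenvector_exists)
      show "T v \<in> M" if "v \<in> M" for v
        using that B2 by (fastforce simp: M_def sym)
      show "closed M" unfolding M_def
        by (intro closed_INT ballI closed_Collect_eq continuous_intros)
      show "u \<in> M" "u \<noteq> 0" using u \<open>u \<noteq> 0\<close> by (auto simp: M_def)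
    qed (auto simp: M_def)
    then obtain x c where x: "x \<in> M" "norm x = 1" "0 \<le> c" "T x = c *\<^sub>R x" by blast
    then have xB: "x \<bullet> y = 0" "y \<bullet> x = 0" if "y \<in> B" for y
      using that by (simp_all add: M_def inner_commute[of y])
    have "insert x B \<in> \<A>"
      unfolding \<A>_def
    proof (intro CollectI conjI ballI impI)
      fix y z assume "y \<in> insert x B" "z \<in> insert x B" "y \<noteq> z"
      then show "y \<bullet> z = 0" using xB B3 by (elim insertE) simp_all
    qed (use x B1 B2 in \<open>elim insertE; blast\<close>)+
    from max[OF this] have "x \<in> B" by blast
    with x(1,2) show False by (auto simp: M_def)
  qed
  have cB: "countable B" by (rule orthonormal_countable[OF B1 B3])
  \<comment> \<open>\<open>B\<close> may be finite, so indices that number no element of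
    \<open>B\<close> receive the zero vector and later the eigenvalue 0.\<close>
  define e where "e i = (if \<exists>x\<in>B. to_nat_on B x = i then from_nat_into B i else 0)" for i
  have eB: "e i \<in> B" if "e i \<noteq> 0" for i
    using that cB by (auto simp: e_def split: if_splits)
  have e_to: "e (to_nat_on B x) = x" if "x \<in> B" for x
    using that cB by (auto simp: e_def)
  have onb: "onb e"
  proof (rule total_imp_onb)
    show "e i \<bullet> e j = 0" if "i \<noteq> j" for i j
    proof (cases "e i = 0 \<or> e j = 0")
      case False
      have "e i \<noteq> e j"
        using False that cB by (auto simp: e_def split: if_splits)
      then show ?thesis using B3 eB False by blast
    qed auto
    show "e i \<bullet> e i = 1" if "e i \<noteq> 0" for i
      using B1[OF eB[OF that]] by (simp add: norm_eq_1)
    show "u = 0" if "\<And>i. u \<bullet> e i = 0" for u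
      by (rule total) (metis e_to that)
  qed
  have "\<exists>c\<ge>0. T (e i) = c *\<^sub>R e i \<and> (e i = 0 \<longrightarrow> c = 0)" for i
  proof (cases "e i = 0")
    case True
    then show ?thesis using T.zero by (intro exI[of _ 0]) simp
  next
    case False
    then show ?thesis using B2[OF eB[OF False]] by simp
  qed
  then have "\<exists>\<tau>. \<forall>i. 0 \<le> \<tau> i \<and> T (e i) = \<tau> i *\<^sub>R e i \<and> (e i = 0 \<longrightarrow> \<tau> i = 0)"
    by (intro choice) blast
  then obtain \<tau> where \<tau>: "\<And>i. 0 \<le> \<tau> i \<and> T (e i) = \<tau> i *\<^sub>R e i \<and> (e i = 0 \<longrightarrow> \<tau> i = 0)"
    by (elim exE) blast
  show thesis by (rule that[OF onb, of \<tau>]) (use \<tau> in auto)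
qed

end

lemma eigenbasis_eq_diag:
  assumes "onb e" "bounded_linear T" "\<And>u v. T u \<bullet> v = u \<bullet> T v" "\<And>i. T (e i) = \<tau> i *\<^sub>R e i" "Bseq \<tau>"
  shows "T u = diag e \<tau> u"
proof -
  interpret onb e by fact
  show ?thesis
    by (rule eqI) (simp add: diag_coeff assms(3-5))
qed

section \<open>The sequence space\<close>

text \<open>The spectral theory above concerns types of class \<open>real_inner\<close> and
  \<open>banach\<close>, whereas the model spaces consist of representatives. This type is the
  common target of their coordinate maps.\<close>

typedef ell2 = "{x :: nat \<Rightarrow> real. summable (\<lambda>i. (x i)\<^sup>2)}"
  morphisms coord Abs_ell2
  by (rule exI[of _ "\<lambda>_. 0"]) simp

setup_lifting type_definition_ell2

lemma coord_summable: "summable (\<lambda>i. (coord x i)\<^sup>2)"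
  using coord[of x] by simp

lemma square_summable_add:
  fixes x y :: "nat \<Rightarrow> real"
  assumes "summable (\<lambda>i. (x i)\<^sup>2)" "summable (\<lambda>i. (y i)\<^sup>2)"
  shows "summable (\<lambda>i. (x i + y i)\<^sup>2)"
proof (rule summable_comparison_test'[OF summable_add[OF summable_mult[OF assms(1), of 2] summable_mult[OF assms(2), of 2]], of 0])
  fix n
  have "(x n + y n)\<^sup>2 + (x n - y n)\<^sup>2 = 2 * (x n)\<^sup>2 + 2 * (y n)\<^sup>2"
    by (simp add: power2_eq_square algebra_simps)
  then show "norm ((x n + y n)\<^sup>2) \<le> 2 * (x n)\<^sup>2 + 2 * (y n)\<^sup>2"
    unfolding real_norm_def abs_of_nonneg[OF zero_le_power2]
    using zero_le_power2[of "x n - y n"] by linarith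
qed

lemma square_summable_mult:
  fixes x y :: "nat \<Rightarrow> real"
  assumes "summable (\<lambda>i. (x i)\<^sup>2)" "summable (\<lambda>i. (y i)\<^sup>2)"
  shows "summable (\<lambda>i. x i * y i)"
proof (rule summable_comparison_test'[OF summable_add[OF assms], of 0])
  fix n
  have "\<bar>x n\<bar> * \<bar>y n\<bar> \<le> (x n)\<^sup>2 + (y n)\<^sup>2"
    using zero_le_power2[of "\<bar>x n\<bar> - \<bar>y n\<bar>"] mult_nonneg_nonneg[OF abs_ge_zero[of "x n"] abs_ge_zero[of "y n"]]
    unfolding power2_diff power2_abs by linarith
  then show "norm (x n * y n) \<le> (x n)\<^sup>2 + (y n)\<^sup>2"
    by (simp add: abs_mult)
qed

instantiation ell2 :: real_inner
begin

lift_definition zero_ell2 :: ell2 is "\<lambda>_. 0" by simp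
lift_definition plus_ell2 :: "ell2 \<Rightarrow> ell2 \<Rightarrow> ell2" is "\<lambda>x y i. x i + y i" by (rule square_summable_add)
lift_definition scaleR_ell2 :: "real \<Rightarrow> ell2 \<Rightarrow> ell2" is "\<lambda>c x i. c * x i"
  by (simp add: power_mult_distrib summable_mult)
lift_definition uminus_ell2 :: "ell2 \<Rightarrow> ell2" is "\<lambda>x i. - x i" by simp
lift_definition minus_ell2 :: "ell2 \<Rightarrow> ell2 \<Rightarrow> ell2" is "\<lambda>x y i. x i - y i"
  using square_summable_add[of _ "\<lambda>i. - y i" for y] by force
lift_definition inner_ell2 :: "ell2 \<Rightarrow> ell2 \<Rightarrow> real" is "\<lambda>x y. \<Sum>i. x i * y i" .
definition norm_ell2 :: "ell2 \<Rightarrow> real" where "norm_ell2 x = sqrt (inner x x)"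
definition dist_ell2 :: "ell2 \<Rightarrow> ell2 \<Rightarrow> real" where "dist_ell2 x y = norm (x - y)"
definition sgn_ell2 :: "ell2 \<Rightarrow> ell2" where "sgn_ell2 x = scaleR (inverse (norm x)) x"
definition uniformity_ell2 :: "(ell2 \<times> ell2) filter"
  where "uniformity_ell2 = (INF e\<in>{0 <..}. principal {(x, y). dist x y < e})"
definition open_ell2 :: "ell2 set \<Rightarrow> bool"
  where "open_ell2 S = (\<forall>x\<in>S. \<forall>\<^sub>F (x', y) in uniformity. x' = x \<longrightarrow> y \<in> S)"

instance
proof
  fix x y z :: ell2 and a b :: real
  show "x + y + z = x + (y + z)" "x + y = y + x" "0 + x = x" "- x + x = 0" "x - y = x + - y"
    by (transfer; simp add: algebra_simps)+
  show "a *\<^sub>R (x + y) = a *\<^sub>R x + a *\<^sub>R y" "(a + b) *\<^sub>R x = a *\<^sub>R x + b *\<^sub>R x"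
    "a *\<^sub>R b *\<^sub>R x = (a * b) *\<^sub>R x" "1 *\<^sub>R x = x"
    by (transfer; simp add: algebra_simps)+
  show "inner x y = inner y x" by transfer (simp add: mult.commute)
  show "inner (x + y) z = inner x z + inner y z"
  proof transfer
    fix x y z :: "nat \<Rightarrow> real"
    assume "summable (\<lambda>i. (x i)\<^sup>2)" "summable (\<lambda>i. (y i)\<^sup>2)" "summable (\<lambda>i. (z i)\<^sup>2)"
    then show "(\<Sum>i. (x i + y i) * z i) = (\<Sum>i. x i * z i) + (\<Sum>i. y i * z i)"
      by (subst suminf_add) (auto intro!: square_summable_mult simp: distrib_right)
  qed
  show "inner (a *\<^sub>R x) y = a * inner x y"
    by transfer (simp add: mult.assoc suminf_mult square_summable_mult)
  show "0 \<le> inner x x" by transfer (auto intro!: suminf_nonneg simp: power2_eq_square)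
  show "inner x x = 0 \<longleftrightarrow> x = 0"
  proof transfer
    fix x :: "nat \<Rightarrow> real" assume "summable (\<lambda>i. (x i)\<^sup>2)"
    then show "((\<Sum>i. x i * x i) = 0) = (x = (\<lambda>_. 0))"
      by (subst suminf_eq_zero_iff) (auto simp: power2_eq_square)
  qed
qed (rule norm_ell2_def dist_ell2_def sgn_ell2_def uniformity_ell2_def open_ell2_def)+

end

lemma coord_simps [simp]:
  "coord 0 i = 0" "coord (x + y) i = coord x i + coord y i" "coord (x - y) i = coord x i - coord y i"
  "coord (c *\<^sub>R x) i = c * coord x i" "coord (- x) i = - coord x i"
  by (transfer; simp)+

lemma ell2_inner_sums: "(\<lambda>i. coord x i * coord y i) sums (x \<bullet> y)"
  unfolding inner_ell2.rep_eq by (intro summable_sums square_summable_mult coord_summable)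

lemma ell2_norm_sums: "(\<lambda>i. (coord x i)\<^sup>2) sums (norm x)\<^sup>2"
  using ell2_inner_sums[of x x] unfolding power2_norm_eq_inner by (simp only: power2_eq_square)

lemma coord_le_norm: "\<bar>coord x i\<bar> \<le> norm x"
proof -
  have "(\<Sum>j\<in>{i}. (coord x j)\<^sup>2) \<le> (norm x)\<^sup>2"
    using ell2_norm_sums[of x] by (subst sums_unique, assumption, intro sum_le_suminf) (auto intro: coord_summable)
  then show ?thesis using abs_le_square_iff[of "coord x i" "norm x"] by simp
qed

lemma sum_coord_le: "(\<Sum>i<N. (coord x i)\<^sup>2) \<le> (norm x)\<^sup>2"
  using ell2_norm_sums[of x] by (subst sums_unique, assumption, intro sum_le_suminf) (auto intro: coord_summable)

lemma coord_Abs: "summable (\<lambda>i. (x i)\<^sup>2) \<Longrightarrow> coord (Abs_ell2 x) = x"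
  by (simp add: Abs_ell2_inverse)

lemma ell2_eqI: "(\<And>i. coord x i = coord y i) \<Longrightarrow> x = y"
  by (simp add: coord_inject[symmetric] fun_eq_iff)

instance ell2 :: banach
proof
  fix X :: "nat \<Rightarrow> ell2"
  assume X: "Cauchy X"
  have "Cauchy (\<lambda>n. coord (X n) i)" for i
  proof (rule metric_CauchyI)
    fix \<epsilon> :: real assume "0 < \<epsilon>"
    then obtain M where "\<And>m n. m \<ge> M \<Longrightarrow> n \<ge> M \<Longrightarrow> dist (X m) (X n) < \<epsilon>"
      using X unfolding Cauchy_def by blast
    then show "\<exists>M. \<forall>m\<ge>M. \<forall>n\<ge>M. dist (coord (X m) i) (coord (X n) i) < \<epsilon>"
      using coord_le_norm[of "X m - X n" i for m n] unfolding dist_norm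
      by (intro exI[of _ M] allI impI) (metis coord_simps(3) le_less_trans real_norm_def)
  qed
  then have "\<exists>a. (\<lambda>n. coord (X n) i) \<longlonglongrightarrow> a" for i
    using Cauchy_convergent convergent_def by blast
  then obtain a where a: "\<And>i. (\<lambda>n. coord (X n) i) \<longlonglongrightarrow> a i" by metis
  \<comment> \<open>Partial sums are bounded uniformly in their length before passing to the limit
    in \<open>n\<close>, so the estimate survives for the whole series.\<close>
  have key: "\<exists>M. \<forall>m\<ge>M. \<forall>N. (\<Sum>i<N. (coord (X m) i - a i)\<^sup>2) \<le> \<epsilon>\<^sup>2" if \<epsilon>: "0 < \<epsilon>" for \<epsilon>
  proof -
    obtain M where M: "\<And>m n. m \<ge> M \<Longrightarrow> n \<ge> M \<Longrightarrow> norm (X m - X n) < \<epsilon>"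
      using X \<epsilon> unfolding Cauchy_def dist_norm by blast
    have "(\<Sum>i<N. (coord (X m) i - a i)\<^sup>2) \<le> \<epsilon>\<^sup>2" if m: "m \<ge> M" for m N
    proof (rule LIMSEQ_le_const2)
      show "(\<lambda>n. \<Sum>i<N. (coord (X m) i - coord (X n) i)\<^sup>2) \<longlonglongrightarrow> (\<Sum>i<N. (coord (X m) i - a i)\<^sup>2)"
        by (intro tendsto_intros a)
      have "(\<Sum>i<N. (coord (X m) i - coord (X n) i)\<^sup>2) \<le> \<epsilon>\<^sup>2" if "n \<ge> M" for n
        using sum_coord_le[where x = "X m - X n" and N = N] power_mono[OF less_imp_le[OF M[OF m that]] norm_ge_zero, of 2]
        by simp
      then show "\<exists>K. \<forall>n\<ge>K. (\<Sum>i<N. (coord (X m) i - coord (X n) i)\<^sup>2) \<le> \<epsilon>\<^sup>2" by blast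
    qed
    then show ?thesis by blast
  qed
  have sd: "summable (\<lambda>i. (coord (X m) i - a i)\<^sup>2)" if "\<And>N. (\<Sum>i<N. (coord (X m) i - a i)\<^sup>2) \<le> \<epsilon>\<^sup>2" for m \<epsilon>
    by (rule summableI_nonneg_bounded[OF _ that]) simp
  have sa: "summable (\<lambda>i. (a i)\<^sup>2)"
  proof -
    obtain M where "\<And>N. (\<Sum>i<N. (coord (X M) i - a i)\<^sup>2) \<le> 1\<^sup>2" using key[of 1] by auto
    from square_summable_add[OF sd[OF this] coord_summable[of "- X M"]]
    show ?thesis by simp
  qed
  have "X \<longlonglongrightarrow> Abs_ell2 a"
  proof (rule metric_LIMSEQ_I)
    fix \<epsilon> :: real assume "0 < \<epsilon>"
    then obtain M where M: "\<And>m N. m \<ge> M \<Longrightarrow> (\<Sum>i<N. (coord (X m) i - a i)\<^sup>2) \<le> (\<epsilon> / 2)\<^sup>2"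
      using key[of "\<epsilon> / 2"] by auto
    have "dist (X m) (Abs_ell2 a) < \<epsilon>" if "m \<ge> M" for m
    proof -
      have "(norm (X m - Abs_ell2 a))\<^sup>2 = (\<Sum>i. (coord (X m) i - a i)\<^sup>2)"
        using sums_unique[OF ell2_norm_sums[of "X m - Abs_ell2 a"]] by (simp add: coord_Abs sa)
      also have "\<dots> \<le> (\<epsilon> / 2)\<^sup>2"
        by (rule suminf_le_const[OF sd[OF M[OF that]] M[OF that]])
      finally have "norm (X m - Abs_ell2 a) \<le> \<epsilon> / 2"
        by (rule power2_le_imp_le) (use \<open>0 < \<epsilon>\<close> in simp)
      then show ?thesis using \<open>0 < \<epsilon>\<close> by (simp add: dist_norm)
    qed
    then show "\<exists>M. \<forall>m\<ge>M. dist (X m) (Abs_ell2 a) < \<epsilon>" by blast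
  qed
  then show "convergent X" by (auto simp: convergent_def)
qed

definition unit_vec :: "nat \<Rightarrow> ell2" where
  "unit_vec i = Abs_ell2 (\<lambda>j. if j = i then 1 else 0)"

lemma coord_unit_vec: "coord (unit_vec i) j = (if j = i then 1 else 0)"
proof -
  have "(\<lambda>j. (if j = i then 1 else 0 :: real)\<^sup>2) = (\<lambda>j. if j = i then 1 else 0)" by auto
  then have "summable (\<lambda>j. (if j = i then 1 else 0 :: real)\<^sup>2)"
    using sums_summable[OF sums_single[of i "\<lambda>_. 1::real"]] by simp
  then show ?thesis by (simp add: unit_vec_def coord_Abs)
qed

lemma inner_unit_vec: "x \<bullet> unit_vec i = coord x i"
proof -
  have "(\<lambda>j. coord x j * coord (unit_vec i) j) = (\<lambda>j. if j = i then coord x i else 0)"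
    by (auto simp: coord_unit_vec)
  then show ?thesis
    using sums_unique2[OF ell2_inner_sums[of x "unit_vec i"]] sums_single[of i "\<lambda>_. coord x i"] by metis
qed

lemma onb_unit_vec: "onb unit_vec"
  by standard (use ell2_norm_sums in \<open>auto simp: inner_unit_vec coord_unit_vec power2_norm_eq_inner\<close>)

section \<open>Square-integrable functions\<close>

lemma L2_measurable: "u \<in> L2 N \<Longrightarrow> u \<in> borel_measurable N"
  and L2_square: "u \<in> L2 N \<Longrightarrow> integrable N (\<lambda>x. (u x)\<^sup>2)"
  by (simp_all add: L2_def)

lemma L2_mult:
  assumes "u \<in> L2 N" "v \<in> L2 N" shows "integrable N (\<lambda>x. u x * v x)"
proof (rule Bochner_Integration.integrable_bound[OF Bochner_Integration.integrable_add[OF L2_square[OF assms(1)] L2_square[OF assms(2)]]])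
  show "(\<lambda>x. u x * v x) \<in> borel_measurable N"
    using assms[THEN L2_measurable] by simp
  have "\<bar>u x * v x\<bar> \<le> (u x)\<^sup>2 + (v x)\<^sup>2" for x
    using zero_le_power2[of "\<bar>u x\<bar> - \<bar>v x\<bar>"] mult_nonneg_nonneg[OF abs_ge_zero[of "u x"] abs_ge_zero[of "v x"]]
    unfolding power2_diff power2_abs abs_mult by linarith
  then show "AE x in N. norm (u x * v x) \<le> norm ((u x)\<^sup>2 + (v x)\<^sup>2)" by simp
qed

lemma L2_add: "u \<in> L2 N \<Longrightarrow> v \<in> L2 N \<Longrightarrow> (\<lambda>x. u x + v x) \<in> L2 N"
  unfolding L2_def
  using L2_mult[of u N v] by (auto simp: L2_def power2_sum intro!: Bochner_Integration.integrable_add)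
    (simp add: mult.assoc)

lemma L2_scale: "u \<in> L2 N \<Longrightarrow> (\<lambda>x. c * u x) \<in> L2 N"
  by (auto simp: L2_def power_mult_distrib)

lemma L2_diff: "u \<in> L2 N \<Longrightarrow> v \<in> L2 N \<Longrightarrow> (\<lambda>x. u x - v x) \<in> L2 N"
  using L2_add[of u N "\<lambda>x. (- 1) * v x"] L2_scale[of v N "- 1"] by simp

lemma L2_0: "(\<lambda>x. 0) \<in> L2 N"
  by (simp add: L2_def)

lemma L2_sum: "(\<And>i. i \<in> I \<Longrightarrow> f i \<in> L2 N) \<Longrightarrow> (\<lambda>x. \<Sum>i\<in>I. f i x) \<in> L2 N"
  by (induction I rule: infinite_finite_induct) (auto intro: L2_0 L2_add)

lemma (in finite_measure) L2_indicator: "A \<in> sets M \<Longrightarrow> (\<lambda>x. indicator A x) \<in> L2 M"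
  by (auto simp: L2_def intro!: integrable_const_bound[where B=1]) (simp add: indicator_def)

lemma (in finite_measure) L2_integrable: "u \<in> L2 M \<Longrightarrow> integrable M u"
  using L2_mult[of u M "\<lambda>_. 1"] by (simp add: L2_def)

lemma L2_inner_commute: "L2_inner N u v = L2_inner N v u"
  by (simp add: L2_inner_def mult.commute)

lemma L2_inner_ge_0: "0 \<le> L2_inner N u u"
  by (simp add: L2_inner_def)

lemma L2_inner_add: "u \<in> L2 N \<Longrightarrow> v \<in> L2 N \<Longrightarrow> w \<in> L2 N \<Longrightarrow>
    L2_inner N (\<lambda>x. u x + v x) w = L2_inner N u w + L2_inner N v w"
  unfolding L2_inner_def distrib_right by (intro Bochner_Integration.integral_add L2_mult)

lemma L2_inner_diff: "u \<in> L2 N \<Longrightarrow> v \<in> L2 N \<Longrightarrow> w \<in> L2 N \<Longrightarrow>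
    L2_inner N (\<lambda>x. u x - v x) w = L2_inner N u w - L2_inner N v w"
  unfolding L2_inner_def left_diff_distrib by (intro Bochner_Integration.integral_diff L2_mult)

lemma L2_inner_scale: "L2_inner N (\<lambda>x. c * u x) w = c * L2_inner N u w"
  unfolding L2_inner_def by (simp add: mult.assoc)

lemma L2_inner_add_right: "u \<in> L2 N \<Longrightarrow> v \<in> L2 N \<Longrightarrow> w \<in> L2 N \<Longrightarrow>
    L2_inner N w (\<lambda>x. u x + v x) = L2_inner N w u + L2_inner N w v"
  using L2_inner_add[of u N v w] by (simp add: L2_inner_commute)

lemma L2_inner_diff_right: "u \<in> L2 N \<Longrightarrow> v \<in> L2 N \<Longrightarrow> w \<in> L2 N \<Longrightarrow>
    L2_inner N w (\<lambda>x. u x - v x) = L2_inner N w u - L2_inner N w v"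
  using L2_inner_diff[of u N v w] by (simp add: L2_inner_commute)

lemma L2_inner_scale_right: "L2_inner N w (\<lambda>x. c * u x) = c * L2_inner N w u"
  using L2_inner_scale[of N c u w] by (simp add: L2_inner_commute)

lemma L2_inner_sum: "(\<And>i. i \<in> I \<Longrightarrow> f i \<in> L2 N) \<Longrightarrow> w \<in> L2 N \<Longrightarrow>
    L2_inner N (\<lambda>x. \<Sum>i\<in>I. f i x) w = (\<Sum>i\<in>I. L2_inner N (f i) w)"
  unfolding L2_inner_def sum_distrib_right by (intro Bochner_Integration.integral_sum L2_mult)

lemma L2_cauchy_schwarz:
  assumes u: "u \<in> L2 N" and v: "v \<in> L2 N"
  shows "(L2_inner N u v)\<^sup>2 \<le> L2_inner N u u * L2_inner N v v"
proof -
  let ?a = "L2_inner N u u" and ?b = "L2_inner N u v" and ?c = "L2_inner N v v"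
  have q: "0 \<le> s * s * ?a + 2 * (s * t * ?b) + t * t * ?c" for s t
  proof -
    have "0 \<le> L2_inner N (\<lambda>x. s * u x + t * v x) (\<lambda>x. s * u x + t * v x)" by (rule L2_inner_ge_0)
    then show ?thesis
      by (simp add: L2_inner_add L2_inner_add_right L2_inner_scale L2_inner_scale_right L2_scale L2_add u v
          L2_inner_commute[of N v u] algebra_simps)
  qed
  show ?thesis
  proof (cases "?c = 0")
    case True
    have "?b = 0"
    proof (rule ccontr)
      assume b: "?b \<noteq> 0"
      define t where "t = - (?a + 1) / (2 * ?b)"
      have "2 * (1 * t * ?b) = - (?a + 1)" using b by (simp add: t_def)
      then show False using q[of 1 t] True by simp
    qed
    then show ?thesis using True by simp
  next
    case False
    then have "0 < ?c" using L2_inner_ge_0[of N v] by simp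
    moreover have "0 \<le> ?c * (?a * ?c - ?b\<^sup>2)"
      using q[of ?c "- ?b"] by (simp add: power2_eq_square algebra_simps)
    ultimately show ?thesis by (simp add: zero_le_mult_iff)
  qed
qed

lemma L2_inner_null:
  assumes "u \<in> L2 N" "v \<in> L2 N" "L2_inner N u u = 0" shows "L2_inner N u v = 0"
  using L2_cauchy_schwarz[OF assms(1,2)] assms(3) by simp

lemma L2_inner_cong_AE:
  assumes "AE x in N. u x = u' x" "u \<in> borel_measurable N" "u' \<in> borel_measurable N" "v \<in> borel_measurable N"
  shows "L2_inner N u v = L2_inner N u' v"
  unfolding L2_inner_def by (rule integral_cong_AE) (use assms in auto)

lemma L2_null_AE:
  assumes "u \<in> L2 N" "L2_inner N u u = 0" shows "AE x in N. u x = 0"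
proof -
  have "AE x in N. u x * u x = 0"
    using assms integral_nonneg_eq_0_iff_AE[OF L2_mult[OF assms(1,1)]] by (simp add: L2_inner_def)
  then show ?thesis by simp
qed

lemma L2_norm_ennreal: "u \<in> L2 N \<Longrightarrow> ennreal (L2_inner N u u) = (\<integral>\<^sup>+x. ennreal ((u x)\<^sup>2) \<partial>N)"
  unfolding L2_inner_def by (subst nn_integral_eq_integral) (auto simp: L2_square power2_eq_square L2_mult)

lemma L2_I_nn_integral:
  assumes "u \<in> borel_measurable N" "(\<integral>\<^sup>+x. ennreal ((u x)\<^sup>2) \<partial>N) < \<infinity>" shows "u \<in> L2 N"
  using assms by (auto simp: L2_def intro!: integrableI_nonneg)

text \<open>The usual Riesz-Fischer argument: a rapidly Cauchy subsequence converges almost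
  everywhere, and Fatou's lemma identifies its limit as the limit of the whole sequence in the
  norm.\<close>

theorem (in finite_measure) L2_complete:
  fixes f :: "nat \<Rightarrow> 'a \<Rightarrow> real"
  assumes f: "\<And>n. f n \<in> L2 M"
    and cauchy: "\<And>\<epsilon>. 0 < \<epsilon> \<Longrightarrow> \<exists>K. \<forall>m\<ge>K. \<forall>n\<ge>K. L2_inner M (\<lambda>x. f m x - f n x) (\<lambda>x. f m x - f n x) \<le> \<epsilon>"
  shows "\<exists>u\<in>L2 M. (\<lambda>n. L2_inner M (\<lambda>x. f n x - u x) (\<lambda>x. f n x - u x)) \<longlonglongrightarrow> 0"
proof -
  note [measurable] = f[THEN L2_measurable]
  have "\<exists>K. \<forall>m\<ge>K. \<forall>n\<ge>K. L2_inner M (\<lambda>x. f m x - f n x) (\<lambda>x. f m x - f n x) \<le> (1/4) ^ k" for k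
    by (rule cauchy) simp
  then obtain K where K: "\<And>k m n. m \<ge> K k \<Longrightarrow> n \<ge> K k \<Longrightarrow>
      L2_inner M (\<lambda>x. f m x - f n x) (\<lambda>x. f m x - f n x) \<le> (1/4) ^ k" by metis
  \<comment> \<open>Dominates \<open>K\<close> and is monotone, so consecutive terms of the
    subsequence are at distance at most 2 to the power -k.\<close>
  define r where "r k = k + (\<Sum>i\<le>k. K i)" for k
  have rK: "K k \<le> r k" for k unfolding r_def by (simp add: sum.remove[of "{..k}" k] trans_le_add2)
  have rmono: "r k \<le> r (Suc k)" for k unfolding r_def by simp
  define d where "d k x = f (r (Suc k)) x - f (r k) x" for k x
  have [measurable]: "d k \<in> borel_measurable M" for k unfolding d_def[abs_def] by simp
  have dL2: "d k \<in> L2 M" for k unfolding d_def[abs_def] by (intro L2_diff f)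
  define C where "C = sqrt (measure M (space M))"
  \<comment> \<open>Finiteness of the measure turns the bound on the norm of \<open>L2\<close> into
    a summable bound on the integral of the absolute value.\<close>
  have d1: "(\<integral>\<^sup>+x. ennreal \<bar>d k x\<bar> \<partial>M) \<le> ennreal (C * (1/2) ^ k)" for k
  proof -
    have ad: "(\<lambda>x. \<bar>d k x\<bar>) \<in> L2 M" using dL2[of k] by (auto simp: L2_def)
    have cs: "(L2_inner M (\<lambda>x. \<bar>d k x\<bar>) (\<lambda>_. 1))\<^sup>2 \<le>
        L2_inner M (\<lambda>x. \<bar>d k x\<bar>) (\<lambda>x. \<bar>d k x\<bar>) * L2_inner M (\<lambda>_. 1) (\<lambda>_. 1)"
      by (rule L2_cauchy_schwarz[OF ad]) (simp add: L2_def)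
    have "L2_inner M (\<lambda>x. \<bar>d k x\<bar>) (\<lambda>x. \<bar>d k x\<bar>) = L2_inner M (d k) (d k)"
      by (simp add: L2_inner_def flip: abs_mult)
    also have "\<dots> \<le> (1/4) ^ k"
      unfolding d_def[abs_def] by (rule K) (use rK[of k] rmono[of k] in auto)
    finally have dk: "L2_inner M (\<lambda>x. \<bar>d k x\<bar>) (\<lambda>x. \<bar>d k x\<bar>) \<le> (1/4) ^ k" .
    have C2: "L2_inner M (\<lambda>_. 1) (\<lambda>_. 1) = C\<^sup>2" by (simp add: L2_inner_def C_def)
    have "(L2_inner M (\<lambda>x. \<bar>d k x\<bar>) (\<lambda>_. 1))\<^sup>2 \<le> (1/4) ^ k * C\<^sup>2"
      using order.trans[OF cs[unfolded C2] mult_right_mono[OF dk zero_le_power2]] .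
    also have "(1/4) ^ k * C\<^sup>2 = (C * (1/2) ^ k)\<^sup>2"
      by (simp add: power_mult_distrib power_mult[symmetric] mult.commute[of k 2])
         (simp add: power_mult power2_eq_square)
    finally have "L2_inner M (\<lambda>x. \<bar>d k x\<bar>) (\<lambda>_. 1) \<le> C * (1/2) ^ k"
      by (rule power2_le_imp_le) (simp add: C_def)
    then show ?thesis
      using L2_integrable[OF ad] by (subst nn_integral_eq_integral) (auto simp: L2_inner_def intro: ennreal_leI)
  qed
  have "(\<integral>\<^sup>+x. (\<Sum>k. ennreal \<bar>d k x\<bar>) \<partial>M) = (\<Sum>k. \<integral>\<^sup>+x. ennreal \<bar>d k x\<bar> \<partial>M)"
    by (rule nn_integral_suminf) simp
  also have "\<dots> \<le> (\<Sum>k. ennreal (C * (1/2) ^ k))" by (intro suminf_le d1) auto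
  also have "\<dots> = ennreal (\<Sum>k. C * (1/2) ^ k)"
    by (intro suminf_ennreal2) (auto simp: C_def intro!: summable_mult)
  finally have "(\<integral>\<^sup>+x. (\<Sum>k. ennreal \<bar>d k x\<bar>) \<partial>M) \<noteq> \<infinity>" by (auto simp: top_unique)
  then have "AE x in M. (\<Sum>k. ennreal \<bar>d k x\<bar>) \<noteq> \<infinity>"
    by (intro nn_integral_PInf_AE) auto
  then have conv: "AE x in M. convergent (\<lambda>k. f (r k) x)"
  proof eventually_elim
    case (elim x)
    then have "summable (\<lambda>k. \<bar>d k x\<bar>)" by (intro summable_suminf_not_top) auto
    then have "summable (\<lambda>k. d k x)" by (rule summable_rabs_cancel)
    then have "convergent (\<lambda>n. \<Sum>k<n. d k x)" by (simp add: summable_iff_convergent)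
    then have "convergent (\<lambda>n. (\<Sum>k<n. d k x) + f (r 0) x)" by (intro convergent_add convergent_const)
    moreover have "(\<Sum>k<n. d k x) + f (r 0) x = f (r n) x" for n
      unfolding d_def by (subst sum_lessThan_telescope) simp
    ultimately show ?case by simp
  qed
  define u where "u x = lim (\<lambda>k. f (r k) x)" for x
  have [measurable]: "u \<in> borel_measurable M" unfolding u_def[abs_def] by (rule borel_measurable_lim_metric) simp
  have lim: "AE x in M. (\<lambda>k. f (r k) x) \<longlonglongrightarrow> u x"
    using conv by eventually_elim (simp add: u_def convergent_LIMSEQ_iff)
  have fatou: "(\<integral>\<^sup>+x. ennreal ((f n x - u x)\<^sup>2) \<partial>M) \<le> ennreal \<epsilon>"
    if n: "\<And>m. m \<ge> n0 \<Longrightarrow> L2_inner M (\<lambda>x. f n x - f m x) (\<lambda>x. f n x - f m x) \<le> \<epsilon>" for n n0 \<epsilon>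
  proof -
    have "(\<integral>\<^sup>+x. ennreal ((f n x - u x)\<^sup>2) \<partial>M) =
        (\<integral>\<^sup>+x. liminf (\<lambda>k. ennreal ((f n x - f (r k) x)\<^sup>2)) \<partial>M)"
    proof (rule nn_integral_cong_AE)
      show "AE x in M. ennreal ((f n x - u x)\<^sup>2) = liminf (\<lambda>k. ennreal ((f n x - f (r k) x)\<^sup>2))"
        using lim
      proof eventually_elim
        case (elim x)
        then have "(\<lambda>k. ennreal ((f n x - f (r k) x)\<^sup>2)) \<longlonglongrightarrow> ennreal ((f n x - u x)\<^sup>2)"
          by (intro tendsto_ennrealI tendsto_intros)
        from lim_imp_Liminf[OF _ this] show ?case by simp
      qed
    qed
    also have "\<dots> \<le> liminf (\<lambda>k. \<integral>\<^sup>+x. ennreal ((f n x - f (r k) x)\<^sup>2) \<partial>M)"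
      by (rule nn_integral_liminf) simp
    also have "\<dots> \<le> ennreal \<epsilon>"
    proof (rule Liminf_le)
      have "(\<integral>\<^sup>+x. ennreal ((f n x - f (r k) x)\<^sup>2) \<partial>M) \<le> ennreal \<epsilon>" if "k \<ge> n0" for k
        unfolding L2_norm_ennreal[OF L2_diff[OF f[of n] f[of "r k"]], symmetric]
        by (intro ennreal_leI n) (use that in \<open>simp add: r_def\<close>)
      then show "\<forall>\<^sub>F k in sequentially. (\<integral>\<^sup>+x. ennreal ((f n x - f (r k) x)\<^sup>2) \<partial>M) \<le> ennreal \<epsilon>"
        by (auto simp: eventually_sequentially)
    qed simp
    finally show ?thesis .
  qed
  have diff: "(\<lambda>x. f (K 0) x - u x) \<in> L2 M"
    using fatou[of "K 0" "K 0" 1] K[of 0 "K 0"] by (intro L2_I_nn_integral) (auto intro: le_less_trans)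
  have u: "u \<in> L2 M" using L2_diff[OF f[of "K 0"] diff] by simp
  have "(\<lambda>n. L2_inner M (\<lambda>x. f n x - u x) (\<lambda>x. f n x - u x)) \<longlonglongrightarrow> 0"
  proof (rule LIMSEQ_I)
    fix \<epsilon> :: real assume "0 < \<epsilon>"
    then obtain K' where K': "\<And>m n. m \<ge> K' \<Longrightarrow> n \<ge> K' \<Longrightarrow>
        L2_inner M (\<lambda>x. f m x - f n x) (\<lambda>x. f m x - f n x) \<le> \<epsilon> / 2" using cauchy[of "\<epsilon> / 2"] by auto
    have "L2_inner M (\<lambda>x. f n x - u x) (\<lambda>x. f n x - u x) \<le> \<epsilon> / 2" if "n \<ge> K'" for n
    proof -
      have "(\<integral>\<^sup>+x. ennreal ((f n x - u x)\<^sup>2) \<partial>M) \<le> ennreal (\<epsilon> / 2)"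
        using fatou[of K' n "\<epsilon> / 2"] K'[OF that] by simp
      then show ?thesis
        unfolding L2_norm_ennreal[OF L2_diff[OF f u], symmetric] using \<open>0 < \<epsilon>\<close> by simp
    qed
    then have "norm (L2_inner M (\<lambda>x. f n x - u x) (\<lambda>x. f n x - u x) - 0) < \<epsilon>" if "n \<ge> K'" for n
      using that \<open>0 < \<epsilon>\<close> by (force simp: abs_of_nonneg[OF L2_inner_ge_0])
    then show "\<exists>no. \<forall>n\<ge>no. norm (L2_inner M (\<lambda>x. f n x - u x) (\<lambda>x. f n x - u x) - 0) < \<epsilon>"
      by blast
  qed
  with u show ?thesis by blast
qed

text \<open>An orthonormal basis in which zero vectors are allowed.\<close>

locale frame = finite_measure N for N :: "'a measure" +
  fixes e :: "nat \<Rightarrow> 'a \<Rightarrow> real"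
  assumes frame_L2: "\<And>i. e i \<in> L2 N"
    and frame_orth: "\<And>i j. i \<noteq> j \<Longrightarrow> L2_inner N (e i) (e j) = 0"
    and frame_unit: "\<And>i. L2_inner N (e i) (e i) = 0 \<or> L2_inner N (e i) (e i) = 1"
    and frame_parseval: "\<And>u. u \<in> L2 N \<Longrightarrow> (\<lambda>i. (L2_inner N u (e i))\<^sup>2) sums L2_inner N u u"

text \<open>The conditions of \<open>frame\<close> without completeness, so that the Riesz-Fischer
  theorem is available for proving completeness.\<close>

locale orthonormal_L2 = finite_measure N for N :: "'a measure" +
  fixes e :: "nat \<Rightarrow> 'a \<Rightarrow> real"
  assumes L2: "\<And>i. e i \<in> L2 N"
    and orth: "\<And>i j. i \<noteq> j \<Longrightarrow> L2_inner N (e i) (e j) = 0"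
    and unit: "\<And>i. L2_inner N (e i) (e i) = 0 \<or> L2_inner N (e i) (e i) = 1"
begin

lemma inner_unit: "u \<in> L2 N \<Longrightarrow> L2_inner N u (e i) * L2_inner N (e i) (e i) = L2_inner N u (e i)"
  using unit[of i] L2_inner_null[OF L2[of i], of u] by (auto simp: L2_inner_commute)

lemma partial_L2: "(\<lambda>x. \<Sum>i\<in>I. c i * e i x) \<in> L2 N"
  by (intro L2_sum L2_scale L2)

lemma partial_inner: "u \<in> L2 N \<Longrightarrow>
    L2_inner N (\<lambda>x. \<Sum>i\<in>I. c i * e i x) u = (\<Sum>i\<in>I. c i * L2_inner N (e i) u)"
  by (subst L2_inner_sum) (auto intro: L2_scale L2 simp: L2_inner_scale)

lemma partial_coeff: "finite I \<Longrightarrow> L2_inner N (\<lambda>x. \<Sum>i\<in>I. c i * e i x) (e k) =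
    (if k \<in> I then c k * L2_inner N (e k) (e k) else 0)"
proof -
  assume I: "finite I"
  have "(\<Sum>i\<in>I. c i * L2_inner N (e i) (e k)) = (\<Sum>i\<in>I. if i = k then c k * L2_inner N (e k) (e k) else 0)"
    by (intro sum.cong) (auto simp: orth)
  then show ?thesis using I by (simp add: partial_inner L2)
qed

lemma partial_norm: "finite I \<Longrightarrow>
    L2_inner N (\<lambda>x. \<Sum>i\<in>I. c i * e i x) (\<lambda>x. \<Sum>i\<in>I. c i * e i x) = (\<Sum>i\<in>I. (c i)\<^sup>2 * L2_inner N (e i) (e i))"
  by (subst partial_inner[OF partial_L2], subst L2_inner_commute)
    (auto simp: partial_coeff power2_eq_square mult.assoc)

text \<open>The prescribed coefficients appear multiplied by \<open>L2_inner N (e k) (e k)\<close>,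
  because a null basis function cannot carry a coefficient.\<close>

lemma riesz_fischer:
  assumes c: "summable (\<lambda>i. (c i)\<^sup>2)"
  shows "\<exists>u\<in>L2 N. (\<forall>k. L2_inner N u (e k) = c k * L2_inner N (e k) (e k)) \<and>
    (\<lambda>n. L2_inner N (\<lambda>x. (\<Sum>i<n. c i * e i x) - u x) (\<lambda>x. (\<Sum>i<n. c i * e i x) - u x)) \<longlonglongrightarrow> 0"
proof -
  define f where "f n x = (\<Sum>i<n. c i * e i x)" for n x
  have f: "f n \<in> L2 N" for n unfolding f_def[abs_def] by (rule partial_L2)
  have le: "L2_inner N (\<lambda>x. f m x - f n x) (\<lambda>x. f m x - f n x) \<le> (\<Sum>i=n..<m. (c i)\<^sup>2)" if "n \<le> m" for m n
  proof -
    have "f m x - f n x = (\<Sum>i=n..<m. c i * e i x)" for x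
      unfolding f_def using that by (simp add: sum_diff_nat_ivl[of 0 n m, symmetric] lessThan_atLeast0)
    then have "L2_inner N (\<lambda>x. f m x - f n x) (\<lambda>x. f m x - f n x) = (\<Sum>i=n..<m. (c i)\<^sup>2 * L2_inner N (e i) (e i))"
      by (simp add: partial_norm)
    also have "\<dots> \<le> (\<Sum>i=n..<m. (c i)\<^sup>2)"
    proof (intro sum_mono mult_left_le)
      show "L2_inner N (e i) (e i) \<le> 1" for i using unit[of i] by auto
    qed simp
    finally show ?thesis .
  qed
  have "\<exists>u\<in>L2 N. (\<lambda>n. L2_inner N (\<lambda>x. f n x - u x) (\<lambda>x. f n x - u x)) \<longlonglongrightarrow> 0"
  proof (rule L2_complete[OF f])
    fix \<epsilon> :: real assume "0 < \<epsilon>"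
    then obtain K where K: "\<And>m n. m \<ge> K \<Longrightarrow> norm (\<Sum>i=m..<n. (c i)\<^sup>2) < \<epsilon>"
      using c unfolding summable_Cauchy by blast
    have "L2_inner N (\<lambda>x. f m x - f n x) (\<lambda>x. f m x - f n x) \<le> \<epsilon>" if "m \<ge> K" "n \<ge> K" for m n
    proof -
      have sym: "L2_inner N (\<lambda>x. f m x - f n x) (\<lambda>x. f m x - f n x) = L2_inner N (\<lambda>x. f n x - f m x) (\<lambda>x. f n x - f m x)"
        by (simp add: L2_inner_def algebra_simps)
      show ?thesis
        using le[of n m] le[of m n] K[of n m] K[of m n] that sym by (cases "n \<le> m") auto
    qed
    then show "\<exists>K. \<forall>m\<ge>K. \<forall>n\<ge>K. L2_inner N (\<lambda>x. f m x - f n x) (\<lambda>x. f m x - f n x) \<le> \<epsilon>" by blast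
  qed
  then obtain u where u: "u \<in> L2 N" and lim: "(\<lambda>n. L2_inner N (\<lambda>x. f n x - u x) (\<lambda>x. f n x - u x)) \<longlonglongrightarrow> 0"
    by blast
  have "L2_inner N u (e k) = c k * L2_inner N (e k) (e k)" for k
  proof -
    have "(L2_inner N u (e k) - c k * L2_inner N (e k) (e k))\<^sup>2 \<le>
        L2_inner N (\<lambda>x. f n x - u x) (\<lambda>x. f n x - u x)" if "n > k" for n
    proof -
      have "L2_inner N (\<lambda>x. f n x - u x) (e k) = c k * L2_inner N (e k) (e k) - L2_inner N u (e k)"
        using that unfolding f_def by (simp add: L2_inner_diff partial_L2 u L2 partial_coeff)
      then have "(L2_inner N u (e k) - c k * L2_inner N (e k) (e k))\<^sup>2 \<le>
          L2_inner N (\<lambda>x. f n x - u x) (\<lambda>x. f n x - u x) * L2_inner N (e k) (e k)"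
        using L2_cauchy_schwarz[OF L2_diff[OF f[of n] u] L2[of k]] by (simp add: power2_commute)
      also have "\<dots> \<le> L2_inner N (\<lambda>x. f n x - u x) (\<lambda>x. f n x - u x)"
        using unit[of k] L2_inner_ge_0 by (auto simp: mult_left_le)
      finally show ?thesis .
    qed
    then have "(L2_inner N u (e k) - c k * L2_inner N (e k) (e k))\<^sup>2 \<le> 0"
      by (intro LIMSEQ_le_const[OF lim]) (auto intro!: exI[of _ "Suc k"])
    then show ?thesis by simp
  qed
  with u lim show ?thesis unfolding f_def by blast
qed

text \<open>The Fourier series of \<open>u\<close> has a limit \<open>w\<close> with the same
  coefficients. Totality makes \<open>u - w\<close> null, so \<open>u\<close> and \<open>w\<close>
  agree almost everywhere and the remainder of the series of \<open>u\<close> tends to 0.\<close>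

lemma total_imp_frame:
  assumes total: "\<And>u. u \<in> L2 N \<Longrightarrow> (\<And>i. L2_inner N u (e i) = 0) \<Longrightarrow> L2_inner N u u = 0"
  shows "frame N e"
proof
  fix u assume u: "u \<in> L2 N"
  define c where "c i = L2_inner N u (e i)" for i
  define f where "f n x = (\<Sum>i<n. c i * e i x)" for n x
  have f: "f n \<in> L2 N" for n unfolding f_def[abs_def] by (rule partial_L2)
  have cc: "c i * L2_inner N (e i) (e i) = c i" for i unfolding c_def by (rule inner_unit[OF u])
  have fu: "L2_inner N (f n) u = (\<Sum>i<n. (c i)\<^sup>2)" for n
    unfolding f_def[abs_def] by (simp add: partial_inner u c_def power2_eq_square L2_inner_commute[of N "e _" u])
  have ff: "L2_inner N (f n) (f n) = (\<Sum>i<n. (c i)\<^sup>2)" for n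
    unfolding f_def[abs_def] by (simp add: partial_norm power2_eq_square mult.assoc cc)
  have fmu: "L2_inner N (\<lambda>x. f n x - u x) (\<lambda>x. f n x - u x) = L2_inner N u u - (\<Sum>i<n. (c i)\<^sup>2)" for n
    using f[of n] u by (simp add: L2_inner_diff L2_inner_diff_right L2_diff fu ff L2_inner_commute[of N u "f n"])
  have "(\<Sum>i<n. (c i)\<^sup>2) \<le> L2_inner N u u" for n
    using fmu[of n] L2_inner_ge_0[of N "\<lambda>x. f n x - u x"] by simp
  then have "summable (\<lambda>i. (c i)\<^sup>2)"
    by (intro summableI_nonneg_bounded[where x="L2_inner N u u"]) auto
  from riesz_fischer[OF this] obtain w where w: "w \<in> L2 N" "\<And>k. L2_inner N w (e k) = c k"
    and lim: "(\<lambda>n. L2_inner N (\<lambda>x. f n x - w x) (\<lambda>x. f n x - w x)) \<longlonglongrightarrow> 0"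
    by (auto simp: f_def cc)
  have "L2_inner N (\<lambda>x. u x - w x) (\<lambda>x. u x - w x) = 0"
    by (rule total) (use u w in \<open>auto simp: L2_inner_diff L2_diff L2 c_def\<close>)
  then have "AE x in N. u x = w x" using L2_null_AE[OF L2_diff[OF u w(1)]] by simp
  then have "AE x in N. (f n x - w x) * (f n x - w x) = (f n x - u x) * (f n x - u x)" for n
    by eventually_elim simp
  then have "L2_inner N (\<lambda>x. f n x - w x) (\<lambda>x. f n x - w x) = L2_inner N (\<lambda>x. f n x - u x) (\<lambda>x. f n x - u x)" for n
    unfolding L2_inner_def using f[THEN L2_measurable] u[THEN L2_measurable] w(1)[THEN L2_measurable]
    by (intro integral_cong_AE) simp_all
  with lim have "(\<lambda>n. L2_inner N u u - (\<Sum>i<n. (c i)\<^sup>2)) \<longlonglongrightarrow> 0" by (simp add: fmu)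
  from tendsto_diff[OF tendsto_const[of "L2_inner N u u"] this]
  show "(\<lambda>i. (L2_inner N u (e i))\<^sup>2) sums L2_inner N u u"
    by (simp add: sums_def c_def)
qed (use L2 orth unit in auto)

end

sublocale frame \<subseteq> orthonormal_L2 N e
  by standard (use frame_L2 frame_orth frame_unit in auto)

context frame
begin

lemma frame_sums:
  assumes u: "u \<in> L2 N" and v: "v \<in> L2 N"
  shows "(\<lambda>i. L2_inner N u (e i) * L2_inner N v (e i)) sums L2_inner N u v"
proof -
  have "(\<lambda>i. ((L2_inner N (\<lambda>x. u x + v x) (e i))\<^sup>2 - (L2_inner N (\<lambda>x. u x - v x) (e i))\<^sup>2) / 4) sums
      ((L2_inner N (\<lambda>x. u x + v x) (\<lambda>x. u x + v x) - L2_inner N (\<lambda>x. u x - v x) (\<lambda>x. u x - v x)) / 4)"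
    by (intro sums_divide sums_diff frame_parseval L2_add L2_diff u v)
  moreover have "((L2_inner N (\<lambda>x. u x + v x) (e i))\<^sup>2 - (L2_inner N (\<lambda>x. u x - v x) (e i))\<^sup>2) / 4 =
      L2_inner N u (e i) * L2_inner N v (e i)" for i
    by (simp add: L2_inner_add L2_inner_diff u v frame_L2 power2_eq_square algebra_simps)
  moreover have "(L2_inner N (\<lambda>x. u x + v x) (\<lambda>x. u x + v x) - L2_inner N (\<lambda>x. u x - v x) (\<lambda>x. u x - v x)) / 4 =
      L2_inner N u v"
    by (simp add: L2_inner_add L2_inner_diff L2_inner_add_right L2_inner_diff_right u v L2_add L2_diff
        L2_inner_commute[of N v u])
  ultimately show ?thesis by simp
qed

end


subsection \<open>Gram-Schmidt orthonormalization\<close>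

text \<open>A null remainder is sent to the zero function instead of being normalized, so linearly
  dependent families need no thinning and the numbering of \<open>t\<close> is kept.\<close>

function gram_schmidt :: "'a measure \<Rightarrow> (nat \<Rightarrow> 'a \<Rightarrow> real) \<Rightarrow> nat \<Rightarrow> 'a \<Rightarrow> real" where
  "gram_schmidt N t n =
    (let v = (\<lambda>x. t n x - (\<Sum>i | i < n. L2_inner N (t n) (gram_schmidt N t i) * gram_schmidt N t i x))
     in (\<lambda>x. (if L2_inner N v v = 0 then 0 else 1 / sqrt (L2_inner N v v)) * v x))"
  by pat_completeness auto
termination by (relation "Wellfounded.measure (\<lambda>(N, t, n). n)") auto

declare gram_schmidt.simps [simp del]

context finite_measure
begin

text \<open>The induction principle expresses that each member is a finite linear combination of the
  \<open>t n\<close>. It transports properties that hold for the explicit functions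
  \<open>t n\<close>, above all measurability, to the orthonormal basis.\<close>

lemma gram_schmidt_frame:
  assumes t: "\<And>n. t n \<in> L2 M"
    and total: "\<And>u. u \<in> L2 M \<Longrightarrow> (\<And>n. L2_inner M u (t n) = 0) \<Longrightarrow> L2_inner M u u = 0"
  shows "frame M (gram_schmidt M t)"
    and gram_schmidt_induct: "\<And>Q. (\<And>n. Q (t n)) \<Longrightarrow> Q (\<lambda>x. 0) \<Longrightarrow>
      (\<And>u v c. u \<in> L2 M \<Longrightarrow> v \<in> L2 M \<Longrightarrow> Q u \<Longrightarrow> Q v \<Longrightarrow> Q (\<lambda>x. u x + c * v x)) \<Longrightarrow> Q (gram_schmidt M t n)"
proof -
  let ?e = "gram_schmidt M t"
  define v where "v n = (\<lambda>x. t n x - (\<Sum>i | i < n. L2_inner M (t n) (?e i) * ?e i x))" for n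
  define s where "s n = (if L2_inner M (v n) (v n) = 0 then 0 else 1 / sqrt (L2_inner M (v n) (v n)))" for n
  have e: "?e n = (\<lambda>x. s n * v n x)" for n
    by (subst gram_schmidt.simps) (simp add: Let_def v_def s_def)
  have eL2: "?e n \<in> L2 M" for n
  proof (induction n rule: less_induct)
    case (less n)
    then show ?case
      unfolding e[of n] v_def by (intro L2_scale L2_diff t L2_sum) auto
  qed
  have vL2: "v n \<in> L2 M" for n
    unfolding v_def by (intro L2_scale L2_diff t L2_sum eL2)
  have unit: "L2_inner M (?e n) (?e n) = 0 \<or> L2_inner M (?e n) (?e n) = 1" for n
    using L2_inner_ge_0[of M "v n"]
    by (auto simp: e[of n] L2_inner_scale L2_inner_scale_right s_def)
  have unit': "L2_inner M u (?e n) * L2_inner M (?e n) (?e n) = L2_inner M u (?e n)" if "u \<in> L2 M" for u n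
    using unit[of n] L2_inner_null[OF eL2[of n] that] by (auto simp: L2_inner_commute)
  have orth: "\<forall>i<n. L2_inner M (?e n) (?e i) = 0" for n
  proof (induction n rule: less_induct)
    case (less n)
    show ?case
    proof (intro allI impI)
      fix k assume k: "k < n"
      have "L2_inner M (v n) (?e k) = L2_inner M (t n) (?e k) -
          (\<Sum>i | i < n. L2_inner M (t n) (?e i) * L2_inner M (?e i) (?e k))"
        unfolding v_def
        by (subst L2_inner_diff) (auto intro!: t L2_sum L2_scale eL2 simp: L2_inner_sum L2_inner_scale L2_scale eL2)
      also have "(\<Sum>i | i < n. L2_inner M (t n) (?e i) * L2_inner M (?e i) (?e k)) =
          (\<Sum>i | i < n. if i = k then L2_inner M (t n) (?e k) else 0)"
      proof (intro sum.cong refl)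
        fix i assume "i \<in> {i. i < n}"
        then show "L2_inner M (t n) (?e i) * L2_inner M (?e i) (?e k) = (if i = k then L2_inner M (t n) (?e k) else 0)"
          using less[of i] less[of k] k unit'[OF t[of n]] L2_inner_commute[of M "?e i" "?e k"]
          by (cases i k rule: linorder_cases) auto
      qed
      also have "\<dots> = L2_inner M (t n) (?e k)" using k by simp
      finally show "L2_inner M (?e n) (?e k) = 0"
        unfolding e[of n] by (simp add: L2_inner_scale)
    qed
  qed
  interpret orthonormal_L2 M ?e
  proof
    show "L2_inner M (?e i) (?e j) = 0" if "i \<noteq> j" for i j
      using that orth L2_inner_commute[of M "?e i" "?e j"] by (cases i j rule: linorder_cases) auto
  qed (use eL2 unit in auto)
  show "frame M ?e"
  proof (rule total_imp_frame, rule total)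
    fix u n assume u: "u \<in> L2 M" and 0: "\<And>i. L2_inner M u (?e i) = 0"
    have "L2_inner M u (v n) = 0"
    proof (cases "L2_inner M (v n) (v n) = 0")
      case True
      then show ?thesis using L2_inner_null[OF vL2 u] by (simp add: L2_inner_commute)
    next
      case False
      then have "s n \<noteq> 0" by (simp add: s_def)
      then show ?thesis using 0[of n] unfolding e[of n] by (simp add: L2_inner_scale_right)
    qed
    moreover have "L2_inner M u (v n) = L2_inner M u (t n) -
        L2_inner M u (\<lambda>x. \<Sum>i | i < n. L2_inner M (t n) (?e i) * ?e i x)"
      unfolding v_def by (rule L2_inner_diff_right[OF t partial_L2 u])
    moreover have "L2_inner M u (\<lambda>x. \<Sum>i | i < n. L2_inner M (t n) (?e i) * ?e i x) = 0"
      using 0 by (subst L2_inner_commute) (simp add: partial_inner[OF u] L2_inner_commute[of M "?e _" u])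
    ultimately show "L2_inner M u (t n) = 0" by simp
  qed
  fix Q assume Q: "\<And>n. Q (t n)" "Q (\<lambda>x. 0)"
    and comb: "\<And>u v c. u \<in> L2 M \<Longrightarrow> v \<in> L2 M \<Longrightarrow> Q u \<Longrightarrow> Q v \<Longrightarrow> Q (\<lambda>x. u x + c * v x)"
  show "Q (?e n)"
  proof (induction n rule: less_induct)
    case (less n)
    have sum: "Q (\<lambda>x. \<Sum>i\<in>I. c i * ?e i x)" if "finite I" "I \<subseteq> {i. i < n}" for I c
      using that
    proof (induction I)
      case (insert i I)
      then show ?case
        using comb[of "\<lambda>x. \<Sum>i\<in>I. c i * ?e i x" "?e i" "c i"] less[of i]
        by (simp add: partial_L2 eL2 add.commute)
    qed (simp add: Q)
    have "Q (\<lambda>x. t n x + (- 1) * (\<Sum>i | i < n. L2_inner M (t n) (?e i) * ?e i x))"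
      by (intro comb t partial_L2 Q(1) sum) auto
    then have "Q (v n)" by (simp add: v_def)
    from comb[OF L2_0 vL2 Q(2) this, of "s n"] show ?case unfolding e[of n] by simp
  qed
qed

end

subsection \<open>Totality\<close>

text \<open>Dynkin's theorem extends the vanishing of the integrals from the stable generator to all
  measurable sets; the condition \<open>top\<close> serves the complements, as \<open>E\<close> need
  not contain the whole space.\<close>

lemma AE_zero_if_set_integrals_zero:
  fixes u :: "'a \<Rightarrow> real"
  assumes u: "integrable N u"
    and E: "sets N = sigma_sets (space N) E" "Int_stable E" "E \<subseteq> Pow (space N)"
    and top: "(LINT x|N. u x) = 0"
    and 0: "\<And>A. A \<in> E \<Longrightarrow> (LINT x|N. indicator A x * u x) = 0"
  shows "AE x in N. u x = 0"
proof -
  have all: "(LINT x|N. indicator A x * u x) = 0" if "A \<in> sets N" for A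
  proof (rule sigma_sets_induct_disjoint[OF E(2,3), where P = "\<lambda>A. (LINT x|N. indicator A x * u x) = 0"])
    show "A \<in> sigma_sets (space N) E" using that E(1) by simp
  next
    fix A :: "nat \<Rightarrow> 'a set"
    assume A: "disjoint_family A" "range A \<subseteq> sigma_sets (space N) E" "\<And>i. (LINT x|N. indicator (A i) x * u x) = 0"
    then have AN: "A i \<in> sets N" for i using E(1) by auto
    have "(LINT x:(\<Union>i. A i)|N. u x) = (\<Sum>i. (LINT x:(A i)|N. u x))"
    proof (rule lebesgue_integral_countable_add)
      show "set_integrable N (\<Union>i. A i) u"
        unfolding set_integrable_def using AN by (intro integrable_mult_indicator u) auto
      show "A i \<inter> A j = {}" if "i \<noteq> j" for i j
        using A(1) that by (auto simp: disjoint_family_on_def)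
    qed (rule AN)
    then show "(LINT x|N. indicator (\<Union>i. A i) x * u x) = 0"
      using A(3) by (simp add: set_lebesgue_integral_def)
  next
    fix A assume A: "A \<in> sigma_sets (space N) E" and 0: "(LINT x|N. indicator A x * u x) = 0"
    then have AN: "A \<in> sets N" using E(1) by auto
    have i: "integrable N (\<lambda>x. indicator A x * u x)"
      using integrable_mult_indicator[OF AN u] by simp
    have "(LINT x|N. indicator (space N - A) x * u x) = (LINT x|N. u x - indicator A x * u x)"
      by (rule Bochner_Integration.integral_cong) (auto simp: indicator_def)
    also have "\<dots> = 0" using i u top 0 by simp
    finally show "(LINT x|N. indicator (space N - A) x * u x) = 0" .
  qed (simp_all add: 0)
  have [measurable]: "u \<in> borel_measurable N" using u by auto
  \<comment> \<open>Applied with \<open>c\<close> equal to 1 and -1 this excludes both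
    signs.\<close>
  have pos: "AE x in N. \<not> c * u x > 0" for c :: real
  proof -
    define A where "A = {x \<in> space N. c * u x > 0}"
    have A: "A \<in> sets N" unfolding A_def by measurable
    have "(LINT x|N. indicator A x * (c * u x)) = 0"
    proof -
      have "(LINT x|N. indicator A x * (c * u x)) = (LINT x|N. c * (indicator A x * u x))"
        by (simp add: mult_ac)
      then show ?thesis using all[OF A] by simp
    qed
    moreover have "integrable N (\<lambda>x. indicator A x * (c * u x))"
      using integrable_mult_indicator[OF A, of "\<lambda>x. c * u x"] u by simp
    moreover have "AE x in N. 0 \<le> indicator A x * (c * u x)"
      by (auto simp: A_def indicator_def)
    ultimately have "AE x in N. indicator A x * (c * u x) = 0"
      using integral_nonneg_eq_0_iff_AE by blast
    then show ?thesis using AE_space by eventually_elim (auto simp: A_def indicator_def)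
  qed
  show ?thesis using pos[of 1] pos[of "-1"] by eventually_elim auto
qed

subsection \<open>Product measures\<close>

locale finite_pair = N1: finite_measure N1 + N2: finite_measure N2 for N1 :: "'a measure" and N2 :: "'b measure"

sublocale finite_pair \<subseteq> pair_sigma_finite N1 N2 ..

sublocale finite_pair \<subseteq> finite_measure "N1 \<Otimes>\<^sub>M N2"
  by (rule finite_measure_pair_measure) unfold_locales

context finite_pair
begin

lemma L2_tensor:
  assumes h: "h \<in> L2 N1" and g: "g \<in> L2 N2"
  shows "(\<lambda>(x, y). h x * g y) \<in> L2 (N1 \<Otimes>\<^sub>M N2)"
proof -
  note [measurable] = h[THEN L2_measurable] g[THEN L2_measurable]
  have "integrable (N1 \<Otimes>\<^sub>M N2) (\<lambda>(x, y). (h x)\<^sup>2 * (g y)\<^sup>2)"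
    using L2_square[OF h] L2_square[OF g] by (intro Fubini_integrable) auto
  then show ?thesis
    by (simp add: L2_def split_beta' power_mult_distrib)
qed


text \<open>Integration of one variable against \<open>g\<close> is the adjoint of tensoring with
  \<open>g\<close>. Square integrability of the result is Cauchy-Schwarz on almost every
  section.\<close>

lemma
  assumes u: "u \<in> L2 (N1 \<Otimes>\<^sub>M N2)" and g: "g \<in> L2 N2"
  shows L2_slice: "(\<lambda>x. LINT y|N2. u (x, y) * g y) \<in> L2 N1"
    and L2_slice_inner: "\<And>h. h \<in> L2 N1 \<Longrightarrow> L2_inner N1 (\<lambda>x. LINT y|N2. u (x, y) * g y) h =
      L2_inner (N1 \<Otimes>\<^sub>M N2) u (\<lambda>(x, y). h x * g y)"
proof -
  note [measurable] = u[THEN L2_measurable] g[THEN L2_measurable]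
  let ?s = "\<lambda>x. LINT y|N2. u (x, y) * g y"
  have "integrable N1 (\<lambda>x. (?s x)\<^sup>2)"
  proof (rule Bochner_Integration.integrable_bound)
    show "integrable N1 (\<lambda>x. (LINT y|N2. (u (x, y))\<^sup>2) * L2_inner N2 g g)"
      using integrable_fst'[OF L2_square[OF u]] by simp
    show "AE x in N1. norm ((?s x)\<^sup>2) \<le> norm ((LINT y|N2. (u (x, y))\<^sup>2) * L2_inner N2 g g)"
      using AE_integrable_fst'[OF L2_square[OF u]] AE_space
    proof eventually_elim
      case (elim x)
      then have "(\<lambda>y. u (x, y)) \<in> L2 N2" by (simp add: L2_def)
      from L2_cauchy_schwarz[OF this g] show ?case
        unfolding real_norm_def abs_of_nonneg[OF zero_le_power2]
        by (intro order.trans[OF _ abs_ge_self]) (simp add: L2_inner_def power2_eq_square)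
    qed
  qed simp
  then show "?s \<in> L2 N1" by (simp add: L2_def)
  fix h assume h: "h \<in> L2 N1"
  have "integrable (N1 \<Otimes>\<^sub>M N2) (\<lambda>(x, y). u (x, y) * (h x * g y))"
    using L2_mult[OF u L2_tensor[OF h g]] by (simp add: split_beta')
  from integral_fst[OF this]
  have "(LINT x|N1. LINT y|N2. u (x, y) * (h x * g y)) = L2_inner (N1 \<Otimes>\<^sub>M N2) u (\<lambda>(x, y). h x * g y)"
    by (simp add: L2_inner_def split_beta')
  moreover have "(LINT y|N2. u (x, y) * (h x * g y)) = ?s x * h x" for x
    by (subst Bochner_Integration.integral_mult_left_zero[symmetric]) (simp only: mult_ac)
  ultimately show "L2_inner N1 ?s h = L2_inner (N1 \<Otimes>\<^sub>M N2) u (\<lambda>(x, y). h x * g y)"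
    by (simp add: L2_inner_def)
qed

lemma
  assumes u: "u \<in> L2 (N1 \<Otimes>\<^sub>M N2)" and h: "h \<in> L2 N1"
  shows L2_slice2: "(\<lambda>y. LINT x|N1. u (x, y) * h x) \<in> L2 N2"
    and L2_slice2_inner: "\<And>g. g \<in> L2 N2 \<Longrightarrow> L2_inner N2 (\<lambda>y. LINT x|N1. u (x, y) * h x) g =
      L2_inner (N1 \<Otimes>\<^sub>M N2) u (\<lambda>(x, y). h x * g y)"
proof -
  note [measurable] = u[THEN L2_measurable] h[THEN L2_measurable]
  let ?s = "\<lambda>y. LINT x|N1. u (x, y) * h x"
  have u2: "integrable (N1 \<Otimes>\<^sub>M N2) (\<lambda>(x, y). (u (x, y))\<^sup>2)"
    using L2_square[OF u] by (simp add: split_beta')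
  have "integrable N2 (\<lambda>y. (?s y)\<^sup>2)"
  proof (rule Bochner_Integration.integrable_bound)
    show "integrable N2 (\<lambda>y. (LINT x|N1. (u (x, y))\<^sup>2) * L2_inner N1 h h)"
      using integrable_snd[OF u2] by simp
    show "AE y in N2. norm ((?s y)\<^sup>2) \<le> norm ((LINT x|N1. (u (x, y))\<^sup>2) * L2_inner N1 h h)"
      using AE_integrable_snd[OF u2] AE_space
    proof eventually_elim
      case (elim y)
      then have "(\<lambda>x. u (x, y)) \<in> L2 N1" by (simp add: L2_def)
      from L2_cauchy_schwarz[OF this h] show ?case
        unfolding real_norm_def abs_of_nonneg[OF zero_le_power2]
        by (intro order.trans[OF _ abs_ge_self]) (simp add: L2_inner_def power2_eq_square)
    qed
  qed simp
  then show "?s \<in> L2 N2" by (simp add: L2_def)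
  fix g assume g: "g \<in> L2 N2"
  have "integrable (N1 \<Otimes>\<^sub>M N2) (\<lambda>(x, y). u (x, y) * (h x * g y))"
    using L2_mult[OF u L2_tensor[OF h g]] by (simp add: split_beta')
  from integral_snd[OF this]
  have "(LINT y|N2. LINT x|N1. u (x, y) * (h x * g y)) = L2_inner (N1 \<Otimes>\<^sub>M N2) u (\<lambda>(x, y). h x * g y)"
    by (simp add: L2_inner_def split_beta')
  moreover have "(LINT x|N1. u (x, y) * (h x * g y)) = ?s y * g y" for y
    by (subst Bochner_Integration.integral_mult_left_zero[symmetric]) (simp only: mult_ac)
  ultimately show "L2_inner N2 ?s g = L2_inner (N1 \<Otimes>\<^sub>M N2) u (\<lambda>(x, y). h x * g y)"
    by (simp add: L2_inner_def)
qed

lemma L2_inner_tensor: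
  assumes "h \<in> L2 N1" "g \<in> L2 N2" "h' \<in> L2 N1" "g' \<in> L2 N2"
  shows "L2_inner (N1 \<Otimes>\<^sub>M N2) (\<lambda>(x, y). h x * g y) (\<lambda>(x, y). h' x * g' y) = L2_inner N1 h h' * L2_inner N2 g g'"
proof -
  have "(LINT y|N2. h x * g y * g' y) = L2_inner N2 g g' * h x" for x
    unfolding L2_inner_def by (subst Bochner_Integration.integral_mult_left_zero[symmetric]) (simp only: mult_ac)
  then show ?thesis
    using L2_slice_inner[OF L2_tensor[OF assms(1,2)] assms(4,3)]
    by (simp add: L2_inner_scale mult.commute[of "L2_inner N1 _ _"])
qed

lemma L2_rectangles_total:
  assumes u: "u \<in> L2 (N1 \<Otimes>\<^sub>M N2)"
    and 0: "\<And>A B. A \<in> sets N1 \<Longrightarrow> B \<in> sets N2 \<Longrightarrow>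
      L2_inner (N1 \<Otimes>\<^sub>M N2) u (\<lambda>(x, y). indicator A x * indicator B y) = 0"
  shows "AE z in N1 \<Otimes>\<^sub>M N2. u z = 0"
proof (rule AE_zero_if_set_integrals_zero)
  show "integrable (N1 \<Otimes>\<^sub>M N2) u" by (rule L2_integrable[OF u])
  let ?E = "{A \<times> B | A B. A \<in> sets N1 \<and> B \<in> sets N2}"
  show "sets (N1 \<Otimes>\<^sub>M N2) = sigma_sets (space (N1 \<Otimes>\<^sub>M N2)) ?E"
    by (simp add: sets_pair_measure space_pair_measure)
  show "Int_stable ?E" by (rule Int_stable_pair_measure_generator)
  show "?E \<subseteq> Pow (space (N1 \<Otimes>\<^sub>M N2))"
    by (auto simp: space_pair_measure dest: sets.sets_into_space)
  have eq: "(LINT z|(N1 \<Otimes>\<^sub>M N2). indicator (A \<times> B) z * u z) = 0" if "A \<in> sets N1" "B \<in> sets N2" for A B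
    using 0[OF that] by (simp add: L2_inner_def split_beta' indicator_times mult.commute)
  then show "(LINT z|(N1 \<Otimes>\<^sub>M N2). indicator A z * u z) = 0" if "A \<in> ?E" for A
    using that by auto
  have "(LINT z|(N1 \<Otimes>\<^sub>M N2). u z) = (LINT z|(N1 \<Otimes>\<^sub>M N2). indicator (space N1 \<times> space N2) z * u z)"
    by (intro Bochner_Integration.integral_cong) (auto simp: space_pair_measure)
  then show "(LINT z|(N1 \<Otimes>\<^sub>M N2). u z) = 0" using eq by simp
qed

end

definition tensor_frame :: "(nat \<Rightarrow> 'a \<Rightarrow> real) \<Rightarrow> (nat \<Rightarrow> 'b \<Rightarrow> real) \<Rightarrow> nat \<Rightarrow> 'a \<times> 'b \<Rightarrow> real" where
  "tensor_frame e b n = (\<lambda>(x, y). e (fst (prod_decode n)) x * b (snd (prod_decode n)) y)"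

text \<open>A function orthogonal to all products of basis functions is, by Parseval in one variable
  after the other, orthogonal to all products \<open>h x * g y\<close>, in particular to indicators
  of rectangles.\<close>

lemma frame_tensor:
  assumes "frame N1 e" "frame N2 b"
  shows "frame (N1 \<Otimes>\<^sub>M N2) (tensor_frame e b)"
proof -
  interpret e: frame N1 e by fact
  interpret b: frame N2 b by fact
  interpret finite_pair N1 N2 ..
  interpret orthonormal_L2 "N1 \<Otimes>\<^sub>M N2" "tensor_frame e b"
  proof
    show "tensor_frame e b i \<in> L2 (N1 \<Otimes>\<^sub>M N2)" for i
      unfolding tensor_frame_def by (intro L2_tensor e.L2 b.L2)
    show "L2_inner (N1 \<Otimes>\<^sub>M N2) (tensor_frame e b i) (tensor_frame e b j) = 0" if "i \<noteq> j" for i j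
    proof -
      have "prod_decode i \<noteq> prod_decode j" using that by (metis prod_decode_inverse)
      then show ?thesis
        unfolding tensor_frame_def using e.orth b.orth
        by (subst L2_inner_tensor) (auto intro: e.L2 b.L2 simp: prod_eq_iff)
    qed
    show "L2_inner (N1 \<Otimes>\<^sub>M N2) (tensor_frame e b i) (tensor_frame e b i) = 0 \<or>
        L2_inner (N1 \<Otimes>\<^sub>M N2) (tensor_frame e b i) (tensor_frame e b i) = 1" for i
      unfolding tensor_frame_def
      using e.unit[of "fst (prod_decode i)"] b.unit[of "snd (prod_decode i)"]
      by (subst (1 2) L2_inner_tensor) (auto intro: e.L2 b.L2)
  qed
  show ?thesis
  proof (rule total_imp_frame)
    fix u assume u: "u \<in> L2 (N1 \<Otimes>\<^sub>M N2)" and 0: "\<And>i. L2_inner (N1 \<Otimes>\<^sub>M N2) u (tensor_frame e b i) = 0"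
    have 1: "L2_inner (N1 \<Otimes>\<^sub>M N2) u (\<lambda>(x, y). e j x * b k y) = 0" for j k
      using 0[of "prod_encode (j, k)"] by (simp add: tensor_frame_def)
    have 2: "L2_inner (N1 \<Otimes>\<^sub>M N2) u (\<lambda>(x, y). h x * b k y) = 0" if h: "h \<in> L2 N1" for h k
    proof -
      let ?s = "\<lambda>x. LINT y|N2. u (x, y) * b k y"
      note s = L2_slice[OF u b.L2] L2_slice_inner[OF u b.L2]
      have "(\<lambda>j. (L2_inner N1 ?s (e j) * L2_inner N1 h (e j))) sums L2_inner N1 ?s h"
        by (rule e.frame_sums[OF s(1) h])
      then show ?thesis using sums_unique2[OF _ sums_zero] by (simp add: s(2) e.L2 h 1)
    qed
    have 3: "L2_inner (N1 \<Otimes>\<^sub>M N2) u (\<lambda>(x, y). h x * g y) = 0" if h: "h \<in> L2 N1" and g: "g \<in> L2 N2" for h g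
    proof -
      let ?s = "\<lambda>y. LINT x|N1. u (x, y) * h x"
      note s = L2_slice2[OF u h] L2_slice2_inner[OF u h]
      have "(\<lambda>k. (L2_inner N2 ?s (b k) * L2_inner N2 g (b k))) sums L2_inner N2 ?s g"
        by (rule b.frame_sums[OF s(1) g])
      then show ?thesis using sums_unique2[OF _ sums_zero] by (simp add: s(2) b.L2 g 2 h)
    qed
    have "AE z in N1 \<Otimes>\<^sub>M N2. u z = 0"
      by (rule L2_rectangles_total[OF u]) (intro 3 e.L2_indicator b.L2_indicator)
    then have "L2_inner (N1 \<Otimes>\<^sub>M N2) u u = (LINT z|(N1 \<Otimes>\<^sub>M N2). 0)"
      unfolding L2_inner_def using u[THEN L2_measurable] by (intro integral_cong_AE) auto
    then show "L2_inner (N1 \<Otimes>\<^sub>M N2) u u = 0" by simp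
  qed
qed

section \<open>Explicit bases on powers of a compact set\<close>

lemma space_leb [simp]: "space (leb S) = S"
  by (simp add: leb_def space_restrict_space)

lemma finite_measure_leb:
  assumes "compact S" shows "finite_measure (leb S)"
proof
  have "S \<in> sets lborel" using assms by (simp add: borel_compact)
  then show "emeasure (leb S) (space (leb S)) \<noteq> \<infinity>"
    using emeasure_compact_finite[OF assms] by (simp add: leb_def emeasure_restrict_space space_restrict_space)
qed

text \<open>A countable stable generator is the source of a total sequence of indicators, hence of a
  basis indexed by the natural numbers.\<close>

lemma sets_leb:
  assumes "compact S"
  shows "sets (leb S) = sigma_sets S (range (\<lambda>q. S \<inter> {..real_of_rat q}))"
proof -
  have gen: "sets (borel :: real measure) = sigma_sets UNIV (range (\<lambda>q. {..real_of_rat q}))"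
  proof -
    have "{..a} \<in> sets (sigma UNIV (range (\<lambda>q. {..real_of_rat q})))" for a :: real
    proof -
      \<comment> \<open>Approximation of an arbitrary half-line from the right by rational
        ones.\<close>
      have "{..a} = (\<Inter>q\<in>{q. a \<le> real_of_rat q}. {..real_of_rat q})"
      proof (intro equalityI subsetI)
        fix x assume x: "x \<in> (\<Inter>q\<in>{q. a \<le> real_of_rat q}. {..real_of_rat q})"
        show "x \<in> {..a}"
        proof (rule ccontr)
          assume "x \<notin> {..a}"
          then obtain q where "a < real_of_rat q" "real_of_rat q < x" using of_rat_dense[of a x] by auto
          moreover from this have "x \<le> real_of_rat q" using x by auto
          ultimately show False by linarith
        qed
      qed auto
      moreover have "{q. a \<le> real_of_rat q} \<noteq> {}"
        using of_rat_dense[of a "a + 1"] by (auto intro: less_imp_le)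
      ultimately show ?thesis
        by (simp only:) (intro sets.countable_INT'; auto)
    qed
    then have "borel = sigma UNIV (range (\<lambda>q. {..real_of_rat q}))"
      by (intro borel_eq_sigmaI1[OF borel_eq_atMost]) auto
    from arg_cong[OF this, of sets] show ?thesis by (rule trans) (rule sets_measure_of, simp)
  qed
  have "sets (leb S) = (\<inter>) S ` sigma_sets UNIV (range (\<lambda>q. {..real_of_rat q}))"
    by (simp add: leb_def sets_restrict_space gen)
  also have "\<dots> = sigma_sets S ((\<inter>) S ` range (\<lambda>q. {..real_of_rat q}))"
  proof (rule sigma_sets_Int)
    show "S \<in> sigma_sets UNIV (range (\<lambda>q. {..real_of_rat q}))"
      unfolding gen[symmetric] using assms by (simp add: borel_compact)
  qed simp
  finally show ?thesis by (simp add: image_image)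
qed


lemma of_rat_min: "real_of_rat (min q r) = min (real_of_rat q) (real_of_rat r)"
  by (simp add: min_def of_rat_less_eq)

lemma rational_bound:
  assumes "compact S" obtains q where "S \<subseteq> {..real_of_rat q}"
proof -
  obtain B where B: "\<And>x. x \<in> S \<Longrightarrow> norm x \<le> B"
    using compact_imp_bounded[OF assms] unfolding bounded_iff by blast
  obtain q where "B < real_of_rat q" using of_rat_dense[of B "B + 1"] by auto
  then have "S \<subseteq> {..real_of_rat q}" using B by (force simp: abs_le_iff)
  then show thesis by (rule that)
qed

text \<open>Starting from indicators of rational half-lines, since orthogonality to all of them
  already forces a function on the bounded set \<open>S\<close> to vanish almost everywhere.\<close>

definition leb_basis :: "real set \<Rightarrow> nat \<Rightarrow> real \<Rightarrow> real" where
  "leb_basis S = gram_schmidt (leb S) (\<lambda>n x. indicator {..real_of_rat (nat_to_rat_surj n)} x)"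

lemma indicator_L2_leb:
  assumes "compact S" "A \<in> sets borel" shows "(\<lambda>x. indicator A x) \<in> L2 (leb S)"
proof -
  interpret finite_measure "leb S" by (rule finite_measure_leb[OF assms(1)])
  have [measurable]: "A \<in> sets borel" by fact
  have "(\<lambda>x. indicator A x :: real) \<in> borel_measurable (leb S)"
    unfolding leb_def by (intro measurable_restrict_space1) simp
  then show ?thesis
    by (auto simp: L2_def indicator_def intro!: integrable_const_bound[where B=1])
qed

lemma frame_leb:
  assumes S: "compact S" shows "frame (leb S) (leb_basis S)"
proof -
  interpret finite_measure "leb S" by (rule finite_measure_leb[OF S])
  show ?thesis
    unfolding leb_basis_def
  proof (rule gram_schmidt_frame)
    show "(\<lambda>x. indicator {..real_of_rat (nat_to_rat_surj n)} x) \<in> L2 (leb S)" for n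
      by (rule indicator_L2_leb[OF S]) simp
    fix u assume u: "u \<in> L2 (leb S)"
      and 0: "\<And>n. L2_inner (leb S) u (\<lambda>x. indicator {..real_of_rat (nat_to_rat_surj n)} x) = 0"
    have 1: "L2_inner (leb S) u (\<lambda>x. indicator {..real_of_rat q} x) = 0" for q
      using 0 surj_nat_to_rat_surj by (metis surjD)
    have 2: "(LINT x|leb S. indicator (S \<inter> {..real_of_rat q}) x * u x) = 0" for q
    proof -
      have "(LINT x|leb S. indicator (S \<inter> {..real_of_rat q}) x * u x) = L2_inner (leb S) u (\<lambda>x. indicator {..real_of_rat q} x)"
        unfolding L2_inner_def by (rule Bochner_Integration.integral_cong) (auto simp: indicator_def)
      then show ?thesis using 1 by simp
    qed
    have "AE x in leb S. u x = 0"
    proof (rule AE_zero_if_set_integrals_zero[where E = "range (\<lambda>q. S \<inter> {..real_of_rat q})"])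
      show "integrable (leb S) u" by (rule L2_integrable[OF u])
      show "sets (leb S) = sigma_sets (space (leb S)) (range (\<lambda>q. S \<inter> {..real_of_rat q}))"
        using sets_leb[OF S] by simp
      show "Int_stable (range (\<lambda>q. S \<inter> {..real_of_rat q}))"
      proof (rule Int_stableI)
        fix A B assume "A \<in> range (\<lambda>q. S \<inter> {..real_of_rat q})" "B \<in> range (\<lambda>q. S \<inter> {..real_of_rat q})"
        then obtain q r where "A = S \<inter> {..real_of_rat q}" "B = S \<inter> {..real_of_rat r}" by auto
        then have "A \<inter> B = S \<inter> {..real_of_rat (min q r)}" by (auto simp: of_rat_min)
        then show "A \<inter> B \<in> range (\<lambda>q. S \<inter> {..real_of_rat q})" by blast
      qed
      \<comment> \<open>Boundedness of \<open>S\<close> makes the whole space itself a member of the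
        generator.\<close>
      obtain q where q: "S \<subseteq> {..real_of_rat q}" by (rule rational_bound[OF S])
      have "(LINT x|leb S. u x) = (LINT x|leb S. indicator (S \<inter> {..real_of_rat q}) x * u x)"
        by (rule Bochner_Integration.integral_cong) (use q in auto)
      then show "(LINT x|leb S. u x) = 0" using 2 by simp
    qed (use 2 in auto)
    then have "L2_inner (leb S) u u = (LINT z|leb S. 0)"
      unfolding L2_inner_def using u[THEN L2_measurable] by (intro integral_cong_AE) auto
    then show "L2_inner (leb S) u u = 0" by simp
  qed
qed

lemma product_sigma_finite_leb: "compact S \<Longrightarrow> product_sigma_finite (\<lambda>_::nat. leb S)"
  using finite_measure_leb[of S] by (intro product_sigma_finite.intro finite_measure.axioms)

lemma space_S_pow: "space (S_pow S l) = (\<Pi>\<^sub>E i\<in>{..<l}. S)"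
  by (simp add: S_pow_def space_PiM)

lemma finite_measure_S_pow:
  assumes "compact S" shows "finite_measure (S_pow S l)"
proof
  interpret finite_measure "leb S" by (rule finite_measure_leb[OF assms])
  interpret product_sigma_finite "\<lambda>_::nat. leb S" by (rule product_sigma_finite_leb[OF assms])
  have "emeasure (S_pow S l) (\<Pi>\<^sub>E i\<in>{..<l}. S) = (\<Prod>i<l. emeasure (leb S) S)"
    unfolding S_pow_def by (rule emeasure_PiM) (use sets.top[of "leb S"] in auto)
  also have "\<dots> < \<infinity>" using emeasure_finite[of S] by (cases "emeasure (leb S) S") (simp_all add: ennreal_power)
  finally show "emeasure (S_pow S l) (space (S_pow S l)) \<noteq> \<infinity>" by (simp add: space_S_pow)
qed

definition rat_box :: "real set \<Rightarrow> nat \<Rightarrow> (nat \<Rightarrow> rat) \<Rightarrow> (nat \<Rightarrow> real) set" where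
  "rat_box S l q = (\<Pi>\<^sub>E i\<in>{..<l}. S \<inter> {..real_of_rat (q i)})"

text \<open>Each coordinate map is measurable for the \<sigma>-algebra of the rational boxes, and
  the coordinate maps generate the product \<sigma>-algebra.\<close>

lemma sets_S_pow:
  assumes S: "compact S"
  shows "sets (S_pow S l) = sigma_sets (space (S_pow S l)) (range (rat_box S l))"
proof (intro equalityI subsetI)
  let ?\<Omega> = "\<Pi>\<^sub>E i\<in>{..<l}. S"
  obtain q0 where q0: "S \<subseteq> {..real_of_rat q0}" by (rule rational_bound[OF S])
  have sub: "range (rat_box S l) \<subseteq> Pow ?\<Omega>" by (auto simp: rat_box_def)
  let ?M = "sigma ?\<Omega> (range (rat_box S l))"
  have spM: "space ?M = ?\<Omega>" and seM: "sets ?M = sigma_sets ?\<Omega> (range (rat_box S l))"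
    using sub by (rule space_measure_of, rule sets_measure_of)
  have cyl: "{f \<in> ?\<Omega>. f i \<in> A} \<in> sigma_sets ?\<Omega> (range (rat_box S l))" if i: "i < l" and A: "A \<in> sets (leb S)" for i A
  proof -
    have "(\<lambda>f. f i) \<in> ?M \<rightarrow>\<^sub>M leb S"
    proof (rule measurable_sigma_sets[OF sets_leb[OF S]])
      show "(\<lambda>f. f i) \<in> space ?M \<rightarrow> S" using i by (auto simp: spM)
      fix a assume "a \<in> range (\<lambda>q. S \<inter> {..real_of_rat q})"
      then obtain q where a: "a = S \<inter> {..real_of_rat q}" by auto
      \<comment> \<open>A cylinder over one coordinate is a box because \<open>q0\<close> bounds
        \<open>S\<close> and so imposes nothing on the other coordinates.\<close>
      have "(\<lambda>f. f i) -` a \<inter> space ?M = rat_box S l (\<lambda>j. if j = i then q else q0)"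
      proof (intro set_eqI)
        fix f
        have "f \<in> rat_box S l (\<lambda>j. if j = i then q else q0) \<longleftrightarrow>
            f \<in> extensional {..<l} \<and> (\<forall>j<l. f j \<in> S \<and> f j \<le> real_of_rat (if j = i then q else q0))"
          by (auto simp: rat_box_def PiE_iff)
        also have "\<dots> \<longleftrightarrow> f \<in> extensional {..<l} \<and> (\<forall>j<l. f j \<in> S) \<and> f i \<le> real_of_rat q"
          using i q0 by (auto simp: subset_iff)
        also have "\<dots> \<longleftrightarrow> f \<in> (\<lambda>f. f i) -` a \<inter> space ?M"
          using i by (auto simp: a PiE_iff spM)
        finally show "f \<in> (\<lambda>f. f i) -` a \<inter> space ?M \<longleftrightarrow> f \<in> rat_box S l (\<lambda>j. if j = i then q else q0)" by blast
      qed
      then show "(\<lambda>f. f i) -` a \<inter> space ?M \<in> sets ?M"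
        unfolding seM by (auto intro: sigma_sets.Basic)
    qed auto
    from measurable_sets[OF this A] have "(\<lambda>f. f i) -` A \<inter> ?\<Omega> \<in> sigma_sets ?\<Omega> (range (rat_box S l))"
      by (simp only: spM seM)
    moreover have "(\<lambda>f. f i) -` A \<inter> ?\<Omega> = {f \<in> ?\<Omega>. f i \<in> A}" by blast
    ultimately show ?thesis by simp
  qed
  show "A \<in> sigma_sets (space (S_pow S l)) (range (rat_box S l))" if "A \<in> sets (S_pow S l)" for A
  proof -
    have "sets (S_pow S l) = sigma_sets ?\<Omega> {{f \<in> ?\<Omega>. f i \<in> A} |i A. i \<in> {..<l} \<and> A \<in> sets (leb S)}"
      unfolding S_pow_def sets_PiM_single by simp
    also have "\<dots> \<subseteq> sigma_sets ?\<Omega> (range (rat_box S l))"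
      by (rule sigma_sets_mono) (use cyl in auto)
    finally show ?thesis using that by (auto simp: space_S_pow)
  qed
  have "rat_box S l q \<in> sets (S_pow S l)" for q
    unfolding rat_box_def S_pow_def
    by (rule sets_PiM_I_finite) (auto simp: sets_leb[OF S] intro!: sigma_sets.Basic)
  then show "A \<in> sets (S_pow S l)" if "A \<in> sigma_sets (space (S_pow S l)) (range (rat_box S l))" for A
    using that sets.sigma_sets_subset[of "range (rat_box S l)" "S_pow S l"] by blast
qed

text \<open>The code \<open>n\<close> stands for the list of corners. The product form matters:
  against \<open>chi x l\<close> the inner product factors into one-variable inner products of
  \<open>x\<close>, which gives measurability in \<open>x\<close>.\<close>

definition box_fun :: "nat \<Rightarrow> nat \<Rightarrow> (nat \<Rightarrow> real) \<Rightarrow> real" where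
  "box_fun l n s = (\<Prod>i<l. indicator {..real_of_rat ((from_nat n :: rat list) ! i)} (s i))"

definition pow_basis :: "real set \<Rightarrow> nat \<Rightarrow> nat \<Rightarrow> (nat \<Rightarrow> real) \<Rightarrow> real" where
  "pow_basis S l = gram_schmidt (S_pow S l) (box_fun l)"

lemma product_L2:
  assumes S: "compact S" and h: "\<And>i. i < l \<Longrightarrow> h i \<in> L2 (leb S)"
  shows "(\<lambda>s. \<Prod>i<l. h i (s i)) \<in> L2 (S_pow S l)"
proof -
  interpret product_sigma_finite "\<lambda>_::nat. leb S" by (rule product_sigma_finite_leb[OF S])
  have "integrable (S_pow S l) (\<lambda>s. \<Prod>i\<in>{..<l}. (h i (s i))\<^sup>2)"
    unfolding S_pow_def by (rule product_integrable_prod) (use h in \<open>auto intro: L2_square\<close>)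
  moreover have "(\<lambda>s. \<Prod>i<l. h i (s i)) \<in> borel_measurable (S_pow S l)"
    unfolding S_pow_def using h[THEN L2_measurable] by measurable
  ultimately show ?thesis by (simp add: L2_def prod_power_distrib)
qed

lemma product_inner:
  assumes S: "compact S" and h: "\<And>i. i < l \<Longrightarrow> h i \<in> L2 (leb S)" and g: "\<And>i. i < l \<Longrightarrow> g i \<in> L2 (leb S)"
  shows "L2_inner (S_pow S l) (\<lambda>s. \<Prod>i<l. h i (s i)) (\<lambda>s. \<Prod>i<l. g i (s i)) = (\<Prod>i<l. L2_inner (leb S) (h i) (g i))"
proof -
  interpret product_sigma_finite "\<lambda>_::nat. leb S" by (rule product_sigma_finite_leb[OF S])
  have "(LINT s|S_pow S l. (\<Prod>i\<in>{..<l}. h i (s i) * g i (s i))) = (\<Prod>i<l. (LINT x|leb S. h i x * g i x))"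
    unfolding S_pow_def by (rule product_integral_prod) (use h g in \<open>auto intro: L2_mult\<close>)
  then show ?thesis by (simp add: L2_inner_def prod.distrib)
qed

lemma box_fun_L2: "compact S \<Longrightarrow> box_fun l n \<in> L2 (S_pow S l)"
  unfolding box_fun_def[abs_def] by (intro product_L2 indicator_L2_leb) auto

lemma box_fun_total:
  assumes S: "compact S" and u: "u \<in> L2 (S_pow S l)"
    and 0: "\<And>n. L2_inner (S_pow S l) u (box_fun l n) = 0"
  shows "L2_inner (S_pow S l) u u = 0"
proof -
  interpret finite_measure "S_pow S l" by (rule finite_measure_S_pow[OF S])
  have 2: "(LINT s|S_pow S l. indicator (rat_box S l q) s * u s) = 0" for q
  proof -
    define n where "n = to_nat (map q [0..<l])"
    have n: "(from_nat n :: rat list) ! i = q i" if "i < l" for i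
      using that by (simp add: n_def)
    have "(LINT s|S_pow S l. indicator (rat_box S l q) s * u s) = L2_inner (S_pow S l) u (box_fun l n)"
      unfolding L2_inner_def
    proof (rule Bochner_Integration.integral_cong)
      fix s assume "s \<in> space (S_pow S l)"
      then have s: "s \<in> (\<Pi>\<^sub>E i\<in>{..<l}. S)" by (simp add: space_S_pow)
      have "box_fun l n s = (\<Prod>i<l. indicator {..real_of_rat (q i)} (s i))"
        unfolding box_fun_def by (rule prod.cong) (simp_all add: n)
      also have "\<dots> = indicator (rat_box S l q) s"
      proof (cases "s \<in> rat_box S l q")
        case True
        have "s i \<le> real_of_rat (q i)" if "i < l" for i
          using PiE_mem[OF True[unfolded rat_box_def], of i] that by simp
        then have "(\<Prod>i<l. indicator {..real_of_rat (q i)} (s i)) = (1 :: real)"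
          by (intro prod.neutral) simp
        then show ?thesis using True by simp
      next
        case False
        have "\<exists>i\<in>{..<l}. (indicator {..real_of_rat (q i)} (s i) :: real) = 0"
        proof (rule ccontr)
          assume *: "\<not> ?thesis"
          have "s i \<in> S \<inter> {..real_of_rat (q i)}" if "i \<in> {..<l}" for i
            using * that PiE_mem[OF s that] by (auto simp: indicator_def split: if_splits)
          moreover have "s i = undefined" if "i \<notin> {..<l}" for i using PiE_arb[OF s that] .
          ultimately have "s \<in> rat_box S l q" unfolding rat_box_def by (rule PiE_I)
          with False show False by contradiction
        qed
        then have "(\<Prod>i<l. indicator {..real_of_rat (q i)} (s i)) = (0 :: real)"
          by (intro prod_zero) auto
        then show ?thesis using False by simp
      qed
      finally have "box_fun l n s = indicator (rat_box S l q) s" .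
      then show "indicator (rat_box S l q) s * u s = u s * box_fun l n s" by simp
    qed simp
    then show ?thesis using 0 by simp
  qed
  have "AE s in S_pow S l. u s = 0"
  proof (rule AE_zero_if_set_integrals_zero[OF L2_integrable[OF u] sets_S_pow[OF S]])
    show "Int_stable (range (rat_box S l))"
    proof (rule Int_stableI)
      fix A B assume "A \<in> range (rat_box S l)" "B \<in> range (rat_box S l)"
      then obtain q r where "A = rat_box S l q" "B = rat_box S l r" by auto
      then have "A \<inter> B = rat_box S l (\<lambda>i. min (q i) (r i))"
        by (simp only: rat_box_def PiE_Int) (intro PiE_cong, auto simp: of_rat_min)
      then show "A \<inter> B \<in> range (rat_box S l)" by blast
    qed
    show "range (rat_box S l) \<subseteq> Pow (space (S_pow S l))" by (auto simp: rat_box_def space_S_pow)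
    obtain q where q: "S \<subseteq> {..real_of_rat q}" by (rule rational_bound[OF S])
    have "(LINT s|S_pow S l. u s) = (LINT s|S_pow S l. indicator (rat_box S l (\<lambda>_. q)) s * u s)"
      by (rule Bochner_Integration.integral_cong) (use q in \<open>auto simp: space_S_pow rat_box_def Int_absorb2\<close>)
    then show "(LINT s|S_pow S l. u s) = 0" using 2 by simp
  qed (use 2 in auto)
  then have "L2_inner (S_pow S l) u u = (LINT z|S_pow S l. 0)"
    unfolding L2_inner_def using u[THEN L2_measurable] by (intro integral_cong_AE) auto
  then show ?thesis by simp
qed

lemma frame_pow:
  assumes S: "compact S" shows "frame (S_pow S l) (pow_basis S l)"
proof -
  interpret finite_measure "S_pow S l" by (rule finite_measure_S_pow[OF S])
  show ?thesis unfolding pow_basis_def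
    by (rule gram_schmidt_frame[OF box_fun_L2[OF S] box_fun_total[OF S]])
qed

lemma chi_L2: "compact S \<Longrightarrow> x \<in> L2 (leb S) \<Longrightarrow> chi x l \<in> L2 (S_pow S l)"
  unfolding chi_def[abs_def] by (rule product_L2)

lemma chi_inner:
  assumes "compact S" "x \<in> L2 (leb S)"
  shows "L2_inner (S_pow S l) (chi x l) (chi x l) = (L2_inner (leb S) x x) ^ l"
  unfolding chi_def[abs_def] using product_inner[of S l "\<lambda>_. x" "\<lambda>_. x"] assms by simp

section \<open>Measurability of the coordinates of tensor powers\<close>

lemma space_L2_sigma [simp]: "space (L2_sigma N) = L2 N"
  unfolding L2_sigma_def by (rule space_measure_of) auto

lemma measurable_L2_inner:
  assumes "h \<in> L2 N" shows "(\<lambda>x. L2_inner N x h) \<in> borel_measurable (L2_sigma N)"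
proof (rule measurableI)
  fix B :: "real set" assume B: "B \<in> sets borel"
  have "(\<lambda>x. L2_inner N x h) -` B \<inter> space (L2_sigma N) = {f \<in> L2 N. L2_inner N f h \<in> B}" by auto
  also have "\<dots> \<in> sets (L2_sigma N)"
    unfolding L2_sigma_def using assms B by (subst sets_measure_of) (auto intro!: sigma_sets.Basic)
  finally show "(\<lambda>x. L2_inner N x h) -` B \<inter> space (L2_sigma N) \<in> sets (L2_sigma N)" .
qed simp

lemma measurable_L2_sigma:
  assumes "\<And>w. w \<in> space M \<Longrightarrow> Z w \<in> L2 N"
    and "\<And>h. h \<in> L2 N \<Longrightarrow> (\<lambda>w. L2_inner N (Z w) h) \<in> borel_measurable M"
  shows "Z \<in> M \<rightarrow>\<^sub>M L2_sigma N"
  unfolding L2_sigma_def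
proof (rule measurable_measure_of)
  fix A assume "A \<in> {{f \<in> L2 N. L2_inner N f h \<in> B} |h B. h \<in> L2 N \<and> B \<in> sets borel}"
  then obtain h B where A: "A = {f \<in> L2 N. L2_inner N f h \<in> B}" and h: "h \<in> L2 N" "B \<in> sets borel" by auto
  have "Z -` A \<inter> space M = (\<lambda>w. L2_inner N (Z w) h) -` B \<inter> space M"
    using assms(1) by (auto simp: A)
  then show "Z -` A \<inter> space M \<in> sets M"
    using measurable_sets[OF assms(2)[OF h(1)] h(2)] by simp
qed (use assms in auto)

text \<open>\<open>chi x l\<close> is not linear in \<open>x\<close>, so its coefficients are not
  among the functionals generating \<open>L2_sigma\<close>. Against a box function they are products
  of such functionals, and \<open>gram_schmidt_induct\<close> passes to the basis.\<close>

lemma measurable_chi_basis: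
  assumes S: "compact S"
  shows "(\<lambda>x. L2_inner (S_pow S l) (chi x l) (pow_basis S l n)) \<in> borel_measurable (L2_sigma (leb S))"
proof -
  interpret finite_measure "S_pow S l" by (rule finite_measure_S_pow[OF S])
  show ?thesis unfolding pow_basis_def
  proof (rule gram_schmidt_induct[OF box_fun_L2[OF S] box_fun_total[OF S]])
    show "(\<lambda>x. L2_inner (S_pow S l) (chi x l) (box_fun l n)) \<in> borel_measurable (L2_sigma (leb S))" for n
    proof (subst measurable_cong)
      show "L2_inner (S_pow S l) (chi x l) (box_fun l n) =
          (\<Prod>i<l. L2_inner (leb S) x (\<lambda>y. indicator {..real_of_rat ((from_nat n :: rat list) ! i)} y))"
        if "x \<in> space (L2_sigma (leb S))" for x
        unfolding chi_def[abs_def] box_fun_def[abs_def] using that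
        by (intro product_inner[OF S] indicator_L2_leb[OF S]) auto
      show "(\<lambda>x. \<Prod>i<l. L2_inner (leb S) x (\<lambda>y. indicator {..real_of_rat ((from_nat n :: rat list) ! i)} y))
          \<in> borel_measurable (L2_sigma (leb S))"
        by (intro borel_measurable_prod measurable_L2_inner indicator_L2_leb[OF S]) simp
    qed
    show "(\<lambda>x. L2_inner (S_pow S l) (chi x l) (\<lambda>x. 0)) \<in> borel_measurable (L2_sigma (leb S))"
      by (simp add: L2_inner_def)
    fix u v c assume u: "u \<in> L2 (S_pow S l)" and v: "v \<in> L2 (S_pow S l)"
      and m: "(\<lambda>x. L2_inner (S_pow S l) (chi x l) u) \<in> borel_measurable (L2_sigma (leb S))"
        "(\<lambda>x. L2_inner (S_pow S l) (chi x l) v) \<in> borel_measurable (L2_sigma (leb S))"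
    show "(\<lambda>x. L2_inner (S_pow S l) (chi x l) (\<lambda>x. u x + c * v x)) \<in> borel_measurable (L2_sigma (leb S))"
    proof (subst measurable_cong)
      show "L2_inner (S_pow S l) (chi x l) (\<lambda>x. u x + c * v x) =
          L2_inner (S_pow S l) (chi x l) u + c * L2_inner (S_pow S l) (chi x l) v"
        if "x \<in> space (L2_sigma (leb S))" for x
        using that chi_L2[OF S, of x l] u v
        by (simp add: L2_inner_add_right L2_scale L2_inner_scale_right)
    qed (use m in measurable)
  qed
qed

section \<open>Functional calculus for diagonal operators\<close>

text \<open>Makes the description in \<open>spectral_measure\<close> unique. Both measures live on
  one compact interval, where polynomials approximate continuous functions; these in turn
  approximate the distribution functions.\<close>

lemma moments_determine_measure:
  fixes m1 m2 :: "real measure"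
  assumes m1: "sets m1 = sets borel" "finite_measure m1" "AE x in m1. \<bar>x\<bar> \<le> r1"
    and m2: "sets m2 = sets borel" "finite_measure m2" "AE x in m2. \<bar>x\<bar> \<le> r2"
    and mom: "\<And>k. (LINT x|m1. x ^ k) = (LINT x|m2. x ^ k)"
  shows "m1 = m2"
proof -
  interpret m1: finite_measure m1 by fact
  interpret m2: finite_measure m2 by fact
  have [measurable_cong]: "sets m1 = sets borel" "sets m2 = sets borel" by fact+
  define r where "r = max r1 r2"
  have AE1: "AE x in m1. \<bar>x\<bar> \<le> r" using m1(3) by eventually_elim (simp add: r_def)
  have AE2: "AE x in m2. \<bar>x\<bar> \<le> r" using m2(3) by eventually_elim (simp add: r_def)
  have pw: "integrable m (\<lambda>x. x ^ k)" if "finite_measure m" "sets m = sets borel" "AE x in m. \<bar>x\<bar> \<le> r" for m and k :: nat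
  proof -
    interpret finite_measure m by fact
    have [measurable_cong]: "sets m = sets borel" by fact
    show ?thesis
    proof (rule integrable_const_bound[where B = "r ^ k"])
      show "AE x in m. norm (x ^ k) \<le> r ^ k"
        using that(3) by eventually_elim (simp add: power_abs power_mono)
    qed measurable
  qed
  have cont: "(LINT x|m1. h x) = (LINT x|m2. h x)" if h: "continuous_on UNIV h" "\<And>x. \<bar>h x\<bar> \<le> 1" for h :: "real \<Rightarrow> real"
  proof -
    have [measurable]: "h \<in> borel_measurable borel" using h(1) by (rule borel_measurable_continuous_onI)
    have hi: "integrable m1 h" "integrable m2 h"
      using h(2) by (auto intro!: m1.integrable_const_bound[where B=1] m2.integrable_const_bound[where B=1])
    have *: "\<bar>(LINT x|m1. h x) - (LINT x|m2. h x)\<bar> \<le> \<epsilon> * (measure m1 (space m1) + measure m2 (space m2))"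
      if \<epsilon>: "0 < \<epsilon>" for \<epsilon>
    proof -
      obtain g where g: "real_polynomial_function g" "\<And>x. x \<in> {-r..r} \<Longrightarrow> \<bar>h x - g x\<bar> < \<epsilon>"
        using Stone_Weierstrass_real_polynomial_function[OF compact_Icc continuous_on_subset[OF h(1) subset_UNIV] \<epsilon>] by metis
      obtain a n where gs: "g = (\<lambda>x. \<Sum>i\<le>n. a i * x ^ i)"
        using g(1) unfolding real_polynomial_function_iff_sum by blast
      have gi: "integrable m1 g" "integrable m2 g"
        unfolding gs using pw[OF m1(2,1) AE1] pw[OF m2(2,1) AE2] by auto
      have geq: "(LINT x|m1. g x) = (LINT x|m2. g x)"
        unfolding gs using pw[OF m1(2,1) AE1] pw[OF m2(2,1) AE2] by (simp add: mom)
      have d: "\<bar>(LINT x|m. h x) - (LINT x|m. g x)\<bar> \<le> \<epsilon> * measure m (space m)"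
        if "finite_measure m" "AE x in m. \<bar>x\<bar> \<le> r" "integrable m h" "integrable m g" for m
      proof -
        interpret finite_measure m by fact
        have "\<bar>(LINT x|m. h x) - (LINT x|m. g x)\<bar> = \<bar>LINT x|m. h x - g x\<bar>" using that by simp
        also have "\<dots> \<le> (LINT x|m. \<bar>h x - g x\<bar>)" by (rule integral_abs_bound)
        also have "\<dots> \<le> (LINT x|m. \<epsilon>)"
        proof (rule integral_mono_AE)
          show "AE x in m. \<bar>h x - g x\<bar> \<le> \<epsilon>"
            using that(2) by eventually_elim (rule less_imp_le, rule g(2), auto simp: abs_le_iff)
        qed (use that in auto)
        finally show ?thesis by (simp add: mult.commute)
      qed
      from d[OF m1(2) AE1 hi(1) gi(1)] d[OF m2(2) AE2 hi(2) gi(2)] geq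
      show ?thesis unfolding distrib_left abs_le_iff by linarith
    qed
    have "\<bar>(LINT x|m1. h x) - (LINT x|m2. h x)\<bar> \<le> 0"
    proof (rule field_le_epsilon)
      fix e :: real assume "0 < e"
      define c where "c = measure m1 (space m1) + measure m2 (space m2)"
      have c: "0 \<le> c" by (simp add: c_def)
      have "e / (c + 1) * c \<le> e" using \<open>0 < e\<close> c by (simp add: field_simps)
      then show "\<bar>(LINT x|m1. h x) - (LINT x|m2. h x)\<bar> \<le> 0 + e"
        using *[of "e / (c + 1)"] \<open>0 < e\<close> c by (simp add: c_def[symmetric])
    qed
    then show ?thesis by simp
  qed
  \<comment> \<open>Continuous ramps that fall from 1 at \<open>a\<close> to 0 and converge
    pointwise to the indicator of the half-line up to \<open>a\<close>.\<close>
  have lim: "(\<lambda>n. LINT x|m. max 0 (min 1 (1 - real n * (x - a)))) \<longlonglongrightarrow> measure m {..a}"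
    if "finite_measure m" "sets m = sets borel" for m and a :: real
  proof -
    interpret finite_measure m by fact
    have [measurable_cong]: "sets m = sets borel" by fact
    have "(\<lambda>n. LINT x|m. max 0 (min 1 (1 - real n * (x - a)))) \<longlonglongrightarrow> (LINT x|m. indicator {..a} x)"
    proof (rule integral_dominated_convergence[where w = "\<lambda>_. 1"])
      show "AE x in m. (\<lambda>n. max 0 (min 1 (1 - real n * (x - a)))) \<longlonglongrightarrow> indicator {..a} x"
      proof (rule AE_I2)
        fix x
        show "(\<lambda>n. max 0 (min 1 (1 - real n * (x - a)))) \<longlonglongrightarrow> indicator {..a} x"
        proof (cases "x \<le> a")
          case True
          then have "max 0 (min 1 (1 - real n * (x - a))) = 1" for n
            by (simp add: mult_nonneg_nonpos)
          then show ?thesis using True by simp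
        next
          case False
          obtain n0 :: nat where n0: "1 / (x - a) < real n0" using reals_Archimedean2 by blast
          have "max 0 (min 1 (1 - real n * (x - a))) = 0" if "n \<ge> n0" for n
          proof -
            have "1 / (x - a) \<le> real n" using n0 that by linarith
            then have "1 \<le> real n * (x - a)" using False by (simp add: divide_le_eq)
            then show ?thesis by simp
          qed
          then have "eventually (\<lambda>n. max 0 (min 1 (1 - real n * (x - a))) = 0) sequentially"
            by (auto simp: eventually_sequentially)
          then have "(\<lambda>n. max 0 (min 1 (1 - real n * (x - a)))) \<longlonglongrightarrow> 0" by (rule tendsto_eventually)
          then show ?thesis using False by simp
        qed
      qed
    qed auto
    then show ?thesis using that(2) by (simp add: sets_eq_imp_space_eq)
  qed
  show ?thesis
  proof (rule cdf_unique')
    show "finite_borel_measure m1" "finite_borel_measure m2"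
      by (auto intro!: finite_borel_measure.intro finite_borel_measure_axioms.intro m1 m2)
    show "cdf m1 = cdf m2"
    proof
      fix a
      have "(LINT x|m1. max 0 (min 1 (1 - real n * (x - a)))) = (LINT x|m2. max 0 (min 1 (1 - real n * (x - a))))" for n
        by (rule cont) (auto intro!: continuous_intros)
      then show "cdf m1 a = cdf m2 a"
        using LIMSEQ_unique[OF lim[OF m1(2,1), of a]] lim[OF m2(2,1), of a] by (simp add: cdf_def)
    qed
  qed
qed

lemma ennreal_suminf_swap:
  fixes f :: "nat \<Rightarrow> nat \<Rightarrow> ennreal"
  shows "(\<Sum>i. \<Sum>j. f i j) = (\<Sum>j. \<Sum>i. f i j)"
proof -
  have "(\<Sum>j. \<Sum>i. f i j) = (\<integral>\<^sup>+j. (\<Sum>i. f i j) \<partial>count_space UNIV)"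
    by (simp add: nn_integral_count_space_nat)
  also have "\<dots> = (\<Sum>i. \<integral>\<^sup>+j. f i j \<partial>count_space UNIV)" by (rule nn_integral_suminf) simp
  finally show ?thesis by (simp add: nn_integral_count_space_nat)
qed

lemma ennreal_suminf_sums:
  assumes "\<And>i. 0 \<le> f i" "(\<Sum>i. ennreal (f i)) = ennreal L" "0 \<le> L"
  shows "f sums L"
proof -
  have s: "summable f" by (rule summable_suminf_not_top) (use assms in auto)
  then have "ennreal (\<Sum>i. f i) = ennreal L" using suminf_ennreal2[OF assms(1) s] assms(2) by simp
  then have "(\<Sum>i. f i) = L"
    using ennreal_inj[OF suminf_nonneg[OF s assms(1)] assms(3)] by blast
  then show ?thesis using s by (simp add: sums_iff)
qed

text \<open>\<open>hat u j\<close> is the coefficient of \<open>u\<close> at the j-th basis function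
  of one tensor factor, itself a vector in the coordinates of the other factor. Null basis functions
  make some vectors unattainable; \<open>A j\<close> collects the attainable ones, and
  \<open>realize\<close> says that nothing else restricts \<open>hat\<close>.\<close>

locale coordinate_space =
  fixes p :: nat and N :: "nat \<Rightarrow> 'a measure" and hat :: "(nat \<Rightarrow> 'a \<Rightarrow> real) \<Rightarrow> nat \<Rightarrow> ell2"
    and A :: "nat \<Rightarrow> ell2 set"
  assumes hat_sums: "\<And>u v. u \<in> dsum p N \<Longrightarrow> v \<in> dsum p N \<Longrightarrow> (\<lambda>j. hat u j \<bullet> hat v j) sums dinner p N u v"
    and dsum_lincomb: "\<And>u v c. u \<in> dsum p N \<Longrightarrow> v \<in> dsum p N \<Longrightarrow> (\<lambda>l z. u l z + c * v l z) \<in> dsum p N"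
    and hat_lincomb: "\<And>u v c j. u \<in> dsum p N \<Longrightarrow> v \<in> dsum p N \<Longrightarrow>
      hat (\<lambda>l z. u l z + c * v l z) j = hat u j + c *\<^sub>R hat v j"
    and hat_A: "\<And>u j. u \<in> dsum p N \<Longrightarrow> hat u j \<in> A j"
    and realize: "\<And>w. (\<And>j. w j \<in> A j) \<Longrightarrow> summable (\<lambda>j. (norm (w j))\<^sup>2) \<Longrightarrow>
      \<exists>u\<in>dsum p N. \<forall>j. hat u j = w j"
begin

lemma ddiff_dsum: "u \<in> dsum p N \<Longrightarrow> v \<in> dsum p N \<Longrightarrow> ddiff u v \<in> dsum p N"
  using dsum_lincomb[of u v "-1"] by (simp add: ddiff_def)

lemma hat_ddiff: "u \<in> dsum p N \<Longrightarrow> v \<in> dsum p N \<Longrightarrow> hat (ddiff u v) j = hat u j - hat v j"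
  using hat_lincomb[of u v "-1" j] by (simp add: ddiff_def)

lemma hat_norm_sums: "u \<in> dsum p N \<Longrightarrow> (\<lambda>j. (norm (hat u j))\<^sup>2) sums (dnorm p N u)\<^sup>2"
proof -
  assume u: "u \<in> dsum p N"
  have "(\<lambda>j. (norm (hat u j))\<^sup>2) sums dinner p N u u"
    using hat_sums[OF u u] by (simp add: power2_norm_eq_inner)
  moreover from this have "0 \<le> dinner p N u u"
    using suminf_nonneg[OF sums_summable] sums_unique by fastforce
  ultimately show ?thesis by (simp add: dnorm_def)
qed

lemma hat_eq_0: "u \<in> dsum p N \<Longrightarrow> dnorm p N u = 0 \<Longrightarrow> hat u j = 0"
  using hat_norm_sums[of u] suminf_eq_zero_iff[OF sums_summable[OF hat_norm_sums[of u]]] sums_unique[OF hat_norm_sums[of u]]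
  by simp

lemma dinner_sym: "u \<in> dsum p N \<Longrightarrow> v \<in> dsum p N \<Longrightarrow> dinner p N u v = dinner p N v u"
  unfolding dinner_def by (intro sum.cong L2_inner_commute) simp

lemma dinner_lincomb:
  assumes "u \<in> dsum p N" "v \<in> dsum p N" "w \<in> dsum p N"
  shows "dinner p N (\<lambda>l z. u l z + c * v l z) w = dinner p N u w + c * dinner p N v w"
proof (rule sums_unique2[OF hat_sums[OF dsum_lincomb[OF assms(1,2)] assms(3)]])
  have "(\<lambda>j. hat u j \<bullet> hat w j + c * (hat v j \<bullet> hat w j)) sums (dinner p N u w + c * dinner p N v w)"
    by (intro sums_add sums_mult hat_sums assms)
  then show "(\<lambda>j. hat (\<lambda>l z. u l z + c * v l z) j \<bullet> hat w j) sums (dinner p N u w + c * dinner p N v w)"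
    using assms by (simp add: hat_lincomb inner_add_left)
qed

text \<open>Polarization. The definition of \<open>fcalc\<close> fixes only the diagonal values of
  the form; the symmetry of \<open>F\<close> on the whole space supplies the linearity that
  polarization uses.\<close>

lemma symmetric_determined:
  assumes F: "\<And>u. u \<in> dsum p N \<Longrightarrow> F u \<in> dsum p N"
    "\<And>u v. u \<in> dsum p N \<Longrightarrow> v \<in> dsum p N \<Longrightarrow> dinner p N (F u) v = dinner p N u (F v)"
    and u: "u \<in> dsum p N" and v: "v \<in> dsum p N"
  shows "4 * dinner p N (F u) v =
    dinner p N (F (\<lambda>l z. u l z + 1 * v l z)) (\<lambda>l z. u l z + 1 * v l z) -
    dinner p N (F (\<lambda>l z. u l z + (-1) * v l z)) (\<lambda>l z. u l z + (-1) * v l z)"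
proof -
  have q: "dinner p N (F (\<lambda>l z. u l z + c * v l z)) (\<lambda>l z. u l z + c * v l z) =
      dinner p N (F u) u + 2 * (c * dinner p N (F u) v) + c * c * dinner p N (F v) v" for c
  proof -
    let ?w = "\<lambda>l z. u l z + c * v l z"
    have w: "?w \<in> dsum p N" by (rule dsum_lincomb[OF u v])
    have *: "dinner p N (F a) ?w = dinner p N (F a) u + c * dinner p N (F a) v" if "a \<in> dsum p N" for a
      using dinner_lincomb[OF u v F(1)[OF that], of c] by (simp add: dinner_sym F that u v w)
    have "dinner p N (F ?w) ?w = dinner p N u (F ?w) + c * dinner p N v (F ?w)"
      using F(2)[OF w w] dinner_lincomb[OF u v F(1)[OF w], of c] by simp
    also have "\<dots> = dinner p N (F u) ?w + c * dinner p N (F v) ?w" using F(2) u v w by simp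
    also have "\<dots> = dinner p N (F u) u + c * dinner p N (F u) v + c * (dinner p N (F v) u + c * dinner p N (F v) v)"
      using u v by (simp only: *)
    also have "dinner p N (F v) u = dinner p N (F u) v"
      using F(2)[OF v u] by (simp add: dinner_sym F u v)
    finally show ?thesis by (simp add: algebra_simps)
  qed
  show ?thesis unfolding q by simp
qed

end

locale diagonal_operator = coordinate_space p N hat A + x: onb x
  for p :: nat and N :: "nat \<Rightarrow> 'a measure" and hat A and x :: "nat \<Rightarrow> ell2" +
  fixes \<tau> :: "nat \<Rightarrow> real" and T :: "(nat \<Rightarrow> 'a \<Rightarrow> real) \<Rightarrow> nat \<Rightarrow> 'a \<Rightarrow> real"
  assumes \<tau>: "Bseq \<tau>"
    and T_dsum: "\<And>u. u \<in> dsum p N \<Longrightarrow> T u \<in> dsum p N"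
    and T_hat: "\<And>u j. u \<in> dsum p N \<Longrightarrow> hat (T u) j = diag x \<tau> (hat u j)"
begin

text \<open>The mass that the scalar spectral measure of \<open>u\<close> receives from the i-th
  eigenvector, collected over all coordinates \<open>j\<close>.\<close>

definition weight :: "(nat \<Rightarrow> 'a \<Rightarrow> real) \<Rightarrow> nat \<Rightarrow> real" where
  "weight u i = (\<Sum>j. (hat u j \<bullet> x i)\<^sup>2)"

definition quad :: "(nat \<Rightarrow> real) \<Rightarrow> (nat \<Rightarrow> 'a \<Rightarrow> real) \<Rightarrow> real" where
  "quad a u = (\<Sum>j. diag x a (hat u j) \<bullet> hat u j)"

text \<open>The spectral measure in explicit form. Taking the image under \<open>\<tau>\<close>
  merges the masses belonging to equal eigenvalues.\<close>

definition atomic_measure :: "(nat \<Rightarrow> 'a \<Rightarrow> real) \<Rightarrow> real measure" where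
  "atomic_measure u = distr (density (count_space UNIV) (\<lambda>i. ennreal (weight u i))) borel \<tau>"

lemma norm_summable: "u \<in> dsum p N \<Longrightarrow> summable (\<lambda>j. (norm (hat u j))\<^sup>2)"
  using hat_norm_sums by (rule sums_summable)

lemma weight_nonneg: "u \<in> dsum p N \<Longrightarrow> 0 \<le> weight u i"
  and weight_summable: "u \<in> dsum p N \<Longrightarrow> summable (\<lambda>j. (hat u j \<bullet> x i)\<^sup>2)"
proof -
  assume u: "u \<in> dsum p N"
  show "summable (\<lambda>j. (hat u j \<bullet> x i)\<^sup>2)"
  proof (rule summable_comparison_test'[OF norm_summable[OF u], of 0])
    fix j
    have "(hat u j \<bullet> x i)\<^sup>2 \<le> (norm (hat u j))\<^sup>2 * (x i \<bullet> x i)"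
      using Cauchy_Schwarz_ineq[of "hat u j" "x i"] by (simp add: power2_norm_eq_inner)
    also have "\<dots> \<le> (norm (hat u j))\<^sup>2" using x.unit_le[of i] by (simp add: mult_left_le)
    finally show "norm ((hat u j \<bullet> x i)\<^sup>2) \<le> (norm (hat u j))\<^sup>2" by simp
  qed
  then show "0 \<le> weight u i" unfolding weight_def by (intro suminf_nonneg) auto
qed

lemma quad_summable:
  assumes "Bseq a" "u \<in> dsum p N" shows "summable (\<lambda>j. diag x a (hat u j) \<bullet> hat u j)"
proof -
  obtain C where C: "0 < C" "\<And>i. \<bar>a i\<bar> \<le> C" using assms(1) unfolding Bseq_def by auto
  show ?thesis
  proof (rule summable_comparison_test'[OF summable_mult[OF norm_summable[OF assms(2)], of C], of 0])
    fix j
    have "\<bar>diag x a (hat u j) \<bullet> hat u j\<bar> \<le> norm (diag x a (hat u j)) * norm (hat u j)"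
      by (rule Cauchy_Schwarz_ineq2)
    also have "\<dots> \<le> (C * norm (hat u j)) * norm (hat u j)"
      by (intro mult_right_mono x.norm_diag_le) (use C in auto)
    finally show "norm (diag x a (hat u j) \<bullet> hat u j) \<le> C * (norm (hat u j))\<^sup>2"
      by (simp add: power2_eq_square mult.assoc)
  qed
qed

text \<open>The double sum over eigenvectors and coordinates may be interchanged by Tonelli when
  \<open>a\<close> is nonnegative; bounded signed sequences are reduced to that case.\<close>

lemma weight_sums:
  assumes a: "Bseq a" and u: "u \<in> dsum p N" shows "(\<lambda>i. a i * weight u i) sums quad a u"
proof -
  have nonneg: "(\<lambda>i. a i * weight u i) sums quad a u" if a: "Bseq a" "\<And>i. 0 \<le> a i" for a
  proof (rule ennreal_suminf_sums)
    have nn: "0 \<le> diag x a (hat u j) \<bullet> hat u j" for j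
      unfolding sums_unique[OF x.diag_inner_sums[OF a(1)]]
      by (rule suminf_nonneg[OF sums_summable[OF x.diag_inner_sums[OF a(1)]]]) (simp add: a mult.assoc)
    show "0 \<le> quad a u" unfolding quad_def by (intro suminf_nonneg quad_summable a u nn)
    have "(\<Sum>i. ennreal (a i * weight u i)) = (\<Sum>i. \<Sum>j. ennreal (a i * (hat u j \<bullet> x i)\<^sup>2))"
    proof (rule suminf_cong)
      fix i
      have "(\<lambda>j. a i * (hat u j \<bullet> x i)\<^sup>2) sums (a i * weight u i)"
        unfolding weight_def by (intro sums_mult summable_sums weight_summable u)
      then show "ennreal (a i * weight u i) = (\<Sum>j. ennreal (a i * (hat u j \<bullet> x i)\<^sup>2))"
        by (intro suminf_ennreal_eq[symmetric]) (use a in auto)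
    qed
    also have "\<dots> = (\<Sum>j. \<Sum>i. ennreal (a i * (hat u j \<bullet> x i)\<^sup>2))" by (rule ennreal_suminf_swap)
    also have "\<dots> = (\<Sum>j. ennreal (diag x a (hat u j) \<bullet> hat u j))"
    proof (rule suminf_cong)
      fix j
      have "(\<lambda>i. a i * (hat u j \<bullet> x i)\<^sup>2) sums (diag x a (hat u j) \<bullet> hat u j)"
        using x.diag_inner_sums[OF a(1), of "hat u j" "hat u j"] by (simp add: power2_eq_square mult.assoc)
      then show "(\<Sum>i. ennreal (a i * (hat u j \<bullet> x i)\<^sup>2)) = ennreal (diag x a (hat u j) \<bullet> hat u j)"
        by (intro suminf_ennreal_eq) (use a in auto)
    qed
    also have "\<dots> = ennreal (quad a u)"
      unfolding quad_def by (intro suminf_ennreal2 nn quad_summable a u)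
    finally show "(\<Sum>i. ennreal (a i * weight u i)) = ennreal (quad a u)" .
  qed (use a that weight_nonneg[OF u] in auto)
  \<comment> \<open>Adding the bound \<open>C\<close> makes the sequence nonnegative; the constant
    part is subtracted afterwards.\<close>
  obtain C where C: "0 < C" "\<And>i. \<bar>a i\<bar> \<le> C" using a unfolding Bseq_def by auto
  have BC: "Bseq (\<lambda>i::nat. C)" by (rule BseqI'[of _ "\<bar>C\<bar>"]) simp
  have "0 \<le> a i + C" for i using C(2)[of i] by simp
  then have "(\<lambda>i. (a i + C) * weight u i - C * weight u i) sums (quad (\<lambda>i. a i + C) u - quad (\<lambda>i. C) u)"
    by (intro sums_diff nonneg Bseq_plus a BC) (use C in auto)
  moreover have "quad (\<lambda>i. a i + C) u = quad a u + quad (\<lambda>i. C) u"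
    unfolding quad_def
    by (subst suminf_add) (use a BC u in \<open>auto simp: x.diag_add_fun inner_add_left intro!: quad_summable\<close>)
  ultimately show ?thesis by (simp add: algebra_simps)
qed

lemma one_Bseq: "Bseq (\<lambda>i::nat. 1::real)"
  by (rule BseqI'[of _ 1]) simp

lemma weight_total_summable: "u \<in> dsum p N \<Longrightarrow> summable (weight u)"
  using weight_sums[OF one_Bseq] by (auto dest: sums_summable)

lemma integral_atomic_measure:
  assumes u: "u \<in> dsum p N" and h: "h \<in> borel_measurable borel" "Bseq (\<lambda>i. h (\<tau> i))"
  shows "(LINT y|atomic_measure u. h y) = quad (\<lambda>i. h (\<tau> i)) u"
proof -
  have [measurable]: "h \<in> borel_measurable borel" by fact
  have nn: "AE i in count_space UNIV. 0 \<le> weight u i" using weight_nonneg[OF u] by simp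
  obtain C where C: "0 < C" "\<And>i. \<bar>h (\<tau> i)\<bar> \<le> C" using h(2) unfolding Bseq_def by auto
  have i: "integrable (count_space UNIV) (\<lambda>i. weight u i *\<^sub>R h (\<tau> i))"
    unfolding integrable_count_space_nat_iff
  proof (rule summable_comparison_test'[OF summable_mult[OF weight_total_summable[OF u], of C], of 0])
    show "norm (norm (weight u i *\<^sub>R h (\<tau> i))) \<le> C * weight u i" for i
      using C(2)[of i] weight_nonneg[OF u, of i] by (simp add: abs_mult mult.commute[of "weight u i"] mult_right_mono)
  qed
  have "(LINT y|atomic_measure u. h y) = (LINT i|density (count_space UNIV) (\<lambda>i. ennreal (weight u i)). h (\<tau> i))"
    unfolding atomic_measure_def by (rule integral_distr) auto
  also have "\<dots> = (LINT i|count_space UNIV. weight u i *\<^sub>R h (\<tau> i))"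
    by (rule integral_density[OF _ _ nn]) auto
  also have "\<dots> = (\<Sum>i. weight u i *\<^sub>R h (\<tau> i))" by (rule integral_count_space_nat[OF i])
  also have "\<dots> = quad (\<lambda>i. h (\<tau> i)) u"
    using sums_unique[OF weight_sums[OF h(2) u]] by (simp add: mult.commute)
  finally show ?thesis .
qed

lemma AE_atomic_measure: "(\<And>i. P (\<tau> i)) \<Longrightarrow> {y. P y} \<in> sets borel \<Longrightarrow> AE y in atomic_measure u. P y"
  unfolding atomic_measure_def by (subst AE_distr_iff) auto

lemma finite_measure_atomic:
  assumes u: "u \<in> dsum p N" shows "finite_measure (atomic_measure u)"
proof
  have "emeasure (atomic_measure u) (space (atomic_measure u)) =
      emeasure (density (count_space UNIV) (\<lambda>i. ennreal (weight u i))) UNIV"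
    unfolding atomic_measure_def by (subst emeasure_distr) auto
  also have "\<dots> = (\<Sum>i. ennreal (weight u i))"
    by (subst emeasure_density) (auto simp: nn_integral_count_space_nat)
  also have "\<dots> = ennreal (\<Sum>i. weight u i)"
    by (intro suminf_ennreal2 weight_nonneg weight_total_summable u)
  finally show "emeasure (atomic_measure u) (space (atomic_measure u)) \<noteq> \<infinity>" by simp
qed

lemma pow_Bseq: "Bseq (\<lambda>i. (\<tau> i) ^ k)"
proof -
  obtain C where C: "0 < C" "\<And>i. \<bar>\<tau> i\<bar> \<le> C" using \<tau> unfolding Bseq_def by auto
  show ?thesis by (rule BseqI'[of _ "C ^ k"]) (use C in \<open>auto simp: power_abs power_mono\<close>)
qed

lemma T_power: "u \<in> dsum p N \<Longrightarrow> (T ^^ k) u \<in> dsum p N \<and> (\<forall>j. hat ((T ^^ k) u) j = diag x (\<lambda>i. (\<tau> i) ^ k) (hat u j))"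
proof (induction k)
  case 0
  then show ?case by (simp add: x.diag_const)
next
  case (Suc k)
  then show ?case by (simp add: T_dsum T_hat x.diag_diag \<tau> pow_Bseq)
qed

text \<open>The atomic measure has the required moments, because powers of \<open>T\<close> are
  diagonal, and moments determine a compactly supported measure.\<close>

lemma spectral_measure_eq:
  assumes u: "u \<in> dsum p N" shows "spectral_measure p N T u = atomic_measure u"
  unfolding spectral_measure_def
proof (rule the_equality)
  obtain C where C: "0 < C" "\<And>i. \<bar>\<tau> i\<bar> \<le> C" using \<tau> unfolding Bseq_def by auto
  have "(LINT y|atomic_measure u. y ^ k) = dinner p N u ((T ^^ k) u)" for k
  proof -
    have "(\<lambda>j. hat u j \<bullet> hat ((T ^^ k) u) j) sums dinner p N u ((T ^^ k) u)"
      using T_power[OF u] u by (intro hat_sums) auto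
    then have "quad (\<lambda>i. (\<tau> i) ^ k) u = dinner p N u ((T ^^ k) u)"
      using T_power[OF u] by (simp add: quad_def sums_iff inner_commute)
    then show ?thesis using integral_atomic_measure[OF u _ pow_Bseq] by simp
  qed
  moreover have "AE y in atomic_measure u. \<bar>y\<bar> \<le> C"
    by (rule AE_atomic_measure) (use C in auto)
  moreover have "sets (atomic_measure u) = sets borel" by (simp add: atomic_measure_def)
  ultimately show P: "sets (atomic_measure u) = sets borel \<and> finite_measure (atomic_measure u) \<and>
    (\<exists>r. AE x in atomic_measure u. \<bar>x\<bar> \<le> r) \<and> (\<forall>k. (LINT x|atomic_measure u. x ^ k) = dinner p N u ((T ^^ k) u))"
    using finite_measure_atomic[OF u] by blast
  fix m :: "real measure"
  assume m: "sets m = sets borel \<and> finite_measure m \<and> (\<exists>r. AE x in m. \<bar>x\<bar> \<le> r) \<and>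
    (\<forall>k. (LINT x|m. x ^ k) = dinner p N u ((T ^^ k) u))"
  then obtain r where "AE x in m. \<bar>x\<bar> \<le> r" by blast
  then show "m = atomic_measure u"
    using m P \<open>AE y in atomic_measure u. \<bar>y\<bar> \<le> C\<close> by (intro moments_determine_measure) auto
qed

text \<open>Off the countably many atoms the values of \<open>f\<close> are immaterial, even for measurability, because
  the integral is taken with respect to the completion.\<close>

lemma integral_completion_atomic:
  assumes u: "u \<in> dsum p N" and f: "Bseq (\<lambda>i. f (\<tau> i))"
  shows "(LINT y|completion (atomic_measure u). f y) = quad (\<lambda>i. f (\<tau> i)) u"
proof -
  let ?m = "atomic_measure u"
  have sets_m: "sets ?m = sets borel" and space_m: "space ?m = UNIV" by (simp_all add: atomic_measure_def)
  define f' where "f' y = (if y \<in> range \<tau> then f y else 0)" for y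
  have cnt: "countable (range \<tau>)" by simp
  have cs: "X \<in> sets borel" if "countable X" for X :: "real set"
    by (rule sets.countable[OF _ that]) simp
  have rb: "range \<tau> \<in> sets borel" by (rule cs[OF cnt])
  have f': "f' \<in> borel_measurable borel"
    by (rule measurable_discrete_difference[of "\<lambda>_. 0" _ _ "range \<tau>"]) (auto simp: f'_def)
  then have f'm: "f' \<in> borel_measurable ?m" by (simp add: measurable_cong_sets[OF sets_m refl])
  have ae: "AE y in ?m. y \<in> range \<tau>"
    by (rule AE_atomic_measure) (use rb in auto)
  from AE_completion[OF ae] have eq: "AE y in completion ?m. f y = f' y"
    by eventually_elim (simp add: f'_def)
  have fm: "f \<in> borel_measurable (completion ?m)"
  proof (rule measurableI)
    fix B :: "real set" assume B: "B \<in> sets borel"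
    have "AE y in ?m. \<not> (y \<notin> range \<tau> \<and> f y \<in> B)" using ae by eventually_elim auto
    then have "Measurable.pred (completion ?m) (\<lambda>y. y \<notin> range \<tau> \<and> f y \<in> B)" by (rule sets_completion_AE)
    then have 1: "{y. y \<notin> range \<tau> \<and> f y \<in> B} \<in> sets (completion ?m)"
      by (simp add: pred_def space_m)
    have "countable (range \<tau> \<inter> f -` B)" using cnt by (rule countable_Int1)
    then have "range \<tau> \<inter> f -` B \<in> sets ?m" unfolding sets_m by (rule cs)
    then have 2: "range \<tau> \<inter> f -` B \<in> sets (completion ?m)" by simp
    have "f -` B \<inter> space (completion ?m) = {y. y \<notin> range \<tau> \<and> f y \<in> B} \<union> (range \<tau> \<inter> f -` B)"
      by (auto simp: space_m)
    then show "f -` B \<inter> space (completion ?m) \<in> sets (completion ?m)" using 1 2 by auto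
  qed simp
  have "(LINT y|completion ?m. f y) = (LINT y|completion ?m. f' y)"
    by (rule integral_cong_AE[OF fm measurable_completion[OF f'm] eq])
  also have "\<dots> = (LINT y|?m. f' y)" by (rule integral_completion[OF f'm])
  also have "\<dots> = quad (\<lambda>i. f' (\<tau> i)) u"
    by (rule integral_atomic_measure[OF u f']) (use f in \<open>simp add: f'_def\<close>)
  finally show ?thesis by (simp add: f'_def)
qed

text \<open>The diagonal operator \<open>F0\<close> meets the description in \<open>fcalc\<close>,
  so the chosen operator meets it too, and symmetric operators with equal quadratic forms agree up
  to norm 0. The invariance \<open>inv\<close> is what allows the images to be realized by elements
  of the space.\<close>

theorem fcalc_diag:
  assumes f: "Bseq (\<lambda>i. f (\<tau> i))" and inv: "\<And>j y. y \<in> A j \<Longrightarrow> diag x (\<lambda>i. f (\<tau> i)) y \<in> A j"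
    and u: "u \<in> dsum p N"
  shows "fcalc p N f T u \<in> dsum p N" "hat (fcalc p N f T u) j = diag x (\<lambda>i. f (\<tau> i)) (hat u j)"
proof -
  define P where "P F \<longleftrightarrow> (\<forall>u\<in>dsum p N. F u \<in> dsum p N) \<and>
     (\<forall>u\<in>dsum p N. \<forall>v\<in>dsum p N. dinner p N (F u) v = dinner p N u (F v)) \<and>
     (\<forall>u\<in>dsum p N. dinner p N (F u) u = (LINT x|completion (spectral_measure p N T u). f x))" for F
  obtain C where C: "0 < C" "\<And>i. \<bar>f (\<tau> i)\<bar> \<le> C" using f unfolding Bseq_def by auto
  have "\<exists>w. v \<in> dsum p N \<longrightarrow> (w \<in> dsum p N \<and> (\<forall>j. hat w j = diag x (\<lambda>i. f (\<tau> i)) (hat v j)))" for v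
  proof (cases "v \<in> dsum p N")
    case True
    have "\<exists>w\<in>dsum p N. \<forall>j. hat w j = diag x (\<lambda>i. f (\<tau> i)) (hat v j)"
    proof (rule realize)
      show "diag x (\<lambda>i. f (\<tau> i)) (hat v j) \<in> A j" for j by (intro inv hat_A True)
      show "summable (\<lambda>j. (norm (diag x (\<lambda>i. f (\<tau> i)) (hat v j)))\<^sup>2)"
      proof (rule summable_comparison_test'[OF summable_mult[OF norm_summable[OF True], of "C\<^sup>2"], of 0])
        fix j
        have "(norm (diag x (\<lambda>i. f (\<tau> i)) (hat v j)))\<^sup>2 \<le> (C * norm (hat v j))\<^sup>2"
          by (intro power_mono x.norm_diag_le) (use C in auto)
        then show "norm ((norm (diag x (\<lambda>i. f (\<tau> i)) (hat v j)))\<^sup>2) \<le> C\<^sup>2 * (norm (hat v j))\<^sup>2"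
          by (simp add: power_mult_distrib)
      qed
    qed
    then show ?thesis by blast
  qed simp
  then obtain F0 where F0: "\<And>v. v \<in> dsum p N \<Longrightarrow> F0 v \<in> dsum p N"
    "\<And>v j. v \<in> dsum p N \<Longrightarrow> hat (F0 v) j = diag x (\<lambda>i. f (\<tau> i)) (hat v j)" by metis
  have "P F0"
    unfolding P_def
  proof (intro conjI ballI F0)
    fix v w assume v: "v \<in> dsum p N" and w: "w \<in> dsum p N"
    show "dinner p N (F0 v) w = dinner p N v (F0 w)"
      using hat_sums[OF F0(1)[OF v] w] hat_sums[OF v F0(1)[OF w]] v w
      by (simp add: F0 x.diag_sym f sums_iff)
  next
    fix v assume v: "v \<in> dsum p N"
    show "dinner p N (F0 v) v = (LINT x|completion (spectral_measure p N T v). f x)"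
      using hat_sums[OF F0(1)[OF v] v] v
      by (simp add: spectral_measure_eq integral_completion_atomic f F0 quad_def sums_iff)
  qed
  then have "P (Eps P)" by (rule someI[of P])
  moreover have fc: "fcalc p N f T = Eps P" unfolding fcalc_def P_def ..
  ultimately have PF: "P (fcalc p N f T)" by simp
  then show Fu: "fcalc p N f T u \<in> dsum p N" using u by (simp add: P_def)
  have eq: "dinner p N (fcalc p N f T u) v = dinner p N (F0 u) v" if v: "v \<in> dsum p N" for v
  proof -
    have q: "dinner p N (fcalc p N f T w) w = dinner p N (F0 w) w" if "w \<in> dsum p N" for w
      using PF \<open>P F0\<close> that unfolding P_def by (metis (no_types, lifting))
    have "4 * dinner p N (fcalc p N f T u) v =
        dinner p N (fcalc p N f T (\<lambda>l z. u l z + 1 * v l z)) (\<lambda>l z. u l z + 1 * v l z) -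
        dinner p N (fcalc p N f T (\<lambda>l z. u l z + (-1) * v l z)) (\<lambda>l z. u l z + (-1) * v l z)"
      by (rule symmetric_determined[OF _ _ u v]) (use PF in \<open>auto simp: P_def\<close>)
    also have "\<dots> = dinner p N (F0 (\<lambda>l z. u l z + 1 * v l z)) (\<lambda>l z. u l z + 1 * v l z) -
        dinner p N (F0 (\<lambda>l z. u l z + (-1) * v l z)) (\<lambda>l z. u l z + (-1) * v l z)"
      by (simp only: q dsum_lincomb[OF u v])
    also have "\<dots> = 4 * dinner p N (F0 u) v"
      by (rule symmetric_determined[OF _ _ u v, symmetric]) (use \<open>P F0\<close> in \<open>auto simp: P_def\<close>)
    finally have "4 * dinner p N (fcalc p N f T u) v = 4 * dinner p N (F0 u) v" .
    then show ?thesis by simp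
  qed
  define d where "d = ddiff (fcalc p N f T u) (F0 u)"
  have d: "d \<in> dsum p N" unfolding d_def by (intro ddiff_dsum Fu F0 u)
  have "dinner p N d d = 0"
    using dinner_lincomb[OF Fu F0(1)[OF u] d, of "-1"] eq[OF d] by (simp add: d_def ddiff_def)
  then have "hat d j = 0" by (intro hat_eq_0 d) (simp add: dnorm_def)
  then show "hat (fcalc p N f T u) j = diag x (\<lambda>i. f (\<tau> i)) (hat u j)"
    using hat_ddiff[OF Fu F0(1)[OF u], of j] F0(2)[OF u, of j] by (simp add: d_def)
qed

end

section \<open>Coordinates of the model spaces\<close>

lemma strict_mono_prod_encode: "strict_mono (\<lambda>k. prod_encode (l, k))"
  by (rule strict_mono_Suc_iff[THEN iffD2]) (simp add: prod_encode_def)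

text \<open>The pairing function interleaves the bases of the components \<open>l \<le> p\<close>
  into a single sequence; codes with larger \<open>l\<close> contribute zeros.\<close>

lemma block_sums:
  fixes g :: "nat \<Rightarrow> nat \<Rightarrow> real"
  assumes "\<And>l. l \<le> p \<Longrightarrow> g l sums G l"
  shows "(\<lambda>m. case prod_decode m of (l, k) \<Rightarrow> if l \<le> p then g l k else 0) sums (\<Sum>l\<le>p. G l)"
proof -
  have "(\<lambda>m. if fst (prod_decode m) = l then g l (snd (prod_decode m)) else 0) sums G l" if "l \<le> p" for l
  proof (subst sums_mono_reindex[OF strict_mono_prod_encode[of l], symmetric])
    show "(if fst (prod_decode n) = l then g l (snd (prod_decode n)) else 0) = 0"
      if "n \<notin> range (\<lambda>k. prod_encode (l, k))" for n
      using that by (metis prod.collapse prod_decode_inverse rangeI)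
    show "(\<lambda>n. if fst (prod_decode (prod_encode (l, n))) = l then g l (snd (prod_decode (prod_encode (l, n)))) else 0) sums G l"
      using assms[OF that] by simp
  qed
  then have "(\<lambda>m. \<Sum>l\<le>p. if fst (prod_decode m) = l then g l (snd (prod_decode m)) else 0) sums (\<Sum>l\<le>p. G l)"
    by (intro sums_sum) auto
  moreover have "(\<Sum>l\<le>p. if fst (prod_decode m) = l then g l (snd (prod_decode m)) else 0) =
      (case prod_decode m of (l, k) \<Rightarrow> if l \<le> p then g l k else 0)" for m
    by (simp add: split_beta')
  ultimately show ?thesis by simp
qed

lemma block_coord_summable:
  "summable (\<lambda>k. (coord x (prod_encode (l, k)))\<^sup>2)" "(\<Sum>k. (coord x (prod_encode (l, k)))\<^sup>2) \<le> (norm x)\<^sup>2"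
proof -
  have le: "(\<Sum>k<n. (coord x (prod_encode (l, k)))\<^sup>2) \<le> (norm x)\<^sup>2" for n
  proof -
    have inj: "inj_on (\<lambda>k. prod_encode (l, k)) {..<n}" by (auto simp: inj_on_def)
    have "(\<Sum>k<n. (coord x (prod_encode (l, k)))\<^sup>2) = (\<Sum>m\<in>(\<lambda>k. prod_encode (l, k)) ` {..<n}. (coord x m)\<^sup>2)"
      by (simp add: sum.reindex[OF inj] o_def)
    also have "\<dots> \<le> (\<Sum>m. (coord x m)\<^sup>2)" by (intro sum_le_suminf coord_summable) auto
    also have "\<dots> = (norm x)\<^sup>2" using sums_unique[OF ell2_norm_sums[of x]] by simp
    finally show ?thesis .
  qed
  show s: "summable (\<lambda>k. (coord x (prod_encode (l, k)))\<^sup>2)"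
    by (rule summableI_nonneg_bounded[OF _ le]) simp
  show "(\<Sum>k. (coord x (prod_encode (l, k)))\<^sup>2) \<le> (norm x)\<^sup>2" by (rule suminf_le_const[OF s le])
qed

locale compact_domain =
  fixes p :: nat and S1 S2 :: "real set"
  assumes S1: "compact S1" and S2: "compact S2"
begin

sublocale e: frame "leb S2" "leb_basis S2" by (rule frame_leb[OF S2])
sublocale b: frame "S_pow S1 l" "pow_basis S1 l" for l by (rule frame_pow[OF S1])

abbreviation "e \<equiv> leb_basis S2"
abbreviation "b \<equiv> pow_basis S1"
abbreviation "H \<equiv> dsum p (LL_meas S1 S2)"
abbreviation "K \<equiv> dsum p (S_pow S1)"

sublocale pr: finite_pair "leb S2" "S_pow S1 l" for l ..

lemma LL_meas_eq: "LL_meas S1 S2 l = leb S2 \<Otimes>\<^sub>M S_pow S1 l"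
  by (simp add: LL_meas_def)

lemma H_D: "u \<in> H \<Longrightarrow> l \<le> p \<Longrightarrow> u l \<in> L2 (leb S2 \<Otimes>\<^sub>M S_pow S1 l)"
  by (simp add: dsum_def LL_meas_eq)

lemma K_D: "f \<in> K \<Longrightarrow> l \<le> p \<Longrightarrow> f l \<in> L2 (S_pow S1 l)"
  by (simp add: dsum_def)

definition kvec :: "(nat \<Rightarrow> (nat \<Rightarrow> real) \<Rightarrow> real) \<Rightarrow> ell2" where
  "kvec f = Abs_ell2 (\<lambda>m. case prod_decode m of (l, k) \<Rightarrow> if l \<le> p then L2_inner (S_pow S1 l) (f l) (b l k) else 0)"

lemma coord_kvec:
  assumes f: "f \<in> K"
  shows "coord (kvec f) m = (case prod_decode m of (l, k) \<Rightarrow> if l \<le> p then L2_inner (S_pow S1 l) (f l) (b l k) else 0)"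
proof -
  have "(\<lambda>m. case prod_decode m of (l, k) \<Rightarrow> if l \<le> p then (L2_inner (S_pow S1 l) (f l) (b l k))\<^sup>2 else 0) sums
      (\<Sum>l\<le>p. L2_inner (S_pow S1 l) (f l) (f l))"
    by (intro block_sums b.frame_parseval K_D f)
  moreover have "(case prod_decode m of (l, k) \<Rightarrow> if l \<le> p then (L2_inner (S_pow S1 l) (f l) (b l k))\<^sup>2 else 0) =
      (case prod_decode m of (l, k) \<Rightarrow> if l \<le> p then L2_inner (S_pow S1 l) (f l) (b l k) else 0)\<^sup>2" for m
    by (simp add: split_beta')
  ultimately have "summable (\<lambda>m. (case prod_decode m of (l, k) \<Rightarrow> if l \<le> p then L2_inner (S_pow S1 l) (f l) (b l k) else 0)\<^sup>2)"
    by (simp add: sums_iff)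
  then show ?thesis unfolding kvec_def by (simp add: coord_Abs)
qed

lemma kvec_inner:
  assumes f: "f \<in> K" and g: "g \<in> K"
  shows "kvec f \<bullet> kvec g = dinner p (S_pow S1) f g"
proof -
  have "(\<lambda>m. case prod_decode m of (l, k) \<Rightarrow> if l \<le> p then L2_inner (S_pow S1 l) (f l) (b l k) * L2_inner (S_pow S1 l) (g l) (b l k) else 0)
      sums (\<Sum>l\<le>p. L2_inner (S_pow S1 l) (f l) (g l))"
    by (intro block_sums b.frame_sums K_D f g)
  moreover have "(case prod_decode m of (l, k) \<Rightarrow> if l \<le> p then L2_inner (S_pow S1 l) (f l) (b l k) * L2_inner (S_pow S1 l) (g l) (b l k) else 0) =
      coord (kvec f) m * coord (kvec g) m" for m
    by (simp add: coord_kvec f g split_beta')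
  ultimately show ?thesis
    using sums_unique2[OF ell2_inner_sums[of "kvec f" "kvec g"]] by (simp add: dinner_def)
qed

text \<open>A coordinate is dead if it belongs to a zero vector of the padded basis.\<close>

definition dead :: "nat \<Rightarrow> bool" where
  "dead m = (case prod_decode m of (l, k) \<Rightarrow> \<not> l \<le> p \<or> L2_inner (S_pow S1 l) (b l k) (b l k) = 0)"

lemma kvec_dead: "f \<in> K \<Longrightarrow> dead m \<Longrightarrow> coord (kvec f) m = 0"
  using L2_inner_null[OF b.L2 K_D] by (auto simp: coord_kvec dead_def split_beta' L2_inner_commute)

text \<open>Vanishing at dead coordinates is the only restriction on the range of
  \<open>kvec\<close>; the components are found by the Riesz-Fischer theorem.\<close>

lemma kvec_realize:
  assumes "\<And>m. dead m \<Longrightarrow> coord x m = 0"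
  shows "\<exists>f\<in>K. kvec f = x"
proof -
  have "\<exists>u\<in>L2 (S_pow S1 l). \<forall>k. L2_inner (S_pow S1 l) u (b l k) =
      coord x (prod_encode (l, k)) * L2_inner (S_pow S1 l) (b l k) (b l k)" for l
    using b.riesz_fischer[OF block_coord_summable(1)[of x l], of l] by blast
  then obtain f where f: "\<And>l. f l \<in> L2 (S_pow S1 l)" "\<And>l k. L2_inner (S_pow S1 l) (f l) (b l k) =
      coord x (prod_encode (l, k)) * L2_inner (S_pow S1 l) (b l k) (b l k)" by metis
  then have fK: "f \<in> K" by (simp add: dsum_def)
  have "kvec f = x"
  proof (rule ell2_eqI)
    fix m
    obtain l k where m: "m = prod_encode (l, k)" by (metis prod.exhaust prod_decode_inverse)
    show "coord (kvec f) m = coord x m"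
      using assms[of m] b.unit[of l k] by (auto simp: coord_kvec[OF fK] f(2) m dead_def)
  qed
  with fK show ?thesis by blast
qed

definition slice :: "(nat \<Rightarrow> real \<times> (nat \<Rightarrow> real) \<Rightarrow> real) \<Rightarrow> nat \<Rightarrow> nat \<Rightarrow> (nat \<Rightarrow> real) \<Rightarrow> real" where
  "slice u j l s = (LINT t|leb S2. u l (t, s) * e j t)"

definition hat :: "(nat \<Rightarrow> real \<times> (nat \<Rightarrow> real) \<Rightarrow> real) \<Rightarrow> nat \<Rightarrow> ell2" where
  "hat u j = kvec (slice u j)"

text \<open>The two sources of unattainable coordinates: a null basis function of the response space
  and a dead coordinate of the predictor space.\<close>

definition range_space :: "nat \<Rightarrow> ell2 set" where
  "range_space j = {x. \<forall>m. L2_inner (leb S2) (e j) (e j) = 0 \<or> dead m \<longrightarrow> coord x m = 0}"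

lemma slice_K: "u \<in> H \<Longrightarrow> slice u j \<in> K"
  using pr.L2_slice2[OF H_D e.L2] unfolding dsum_def slice_def[abs_def] by blast

lemma slice_inner:
  "u \<in> H \<Longrightarrow> l \<le> p \<Longrightarrow> g \<in> L2 (S_pow S1 l) \<Longrightarrow>
    L2_inner (S_pow S1 l) (slice u j l) g = L2_inner (leb S2 \<Otimes>\<^sub>M S_pow S1 l) (u l) (\<lambda>(t, s). e j t * g s)"
  unfolding slice_def[abs_def] by (rule pr.L2_slice2_inner[OF H_D e.L2])

lemma coord_hat: "u \<in> H \<Longrightarrow> coord (hat u j) (prod_encode (l, k)) =
    (if l \<le> p then L2_inner (leb S2 \<Otimes>\<^sub>M S_pow S1 l) (u l) (\<lambda>(t, s). e j t * b l k s) else 0)"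
  by (simp add: hat_def coord_kvec slice_K slice_inner b.L2)

lemma hat_kvec_inner: "u \<in> H \<Longrightarrow> f \<in> K \<Longrightarrow>
    hat u j \<bullet> kvec f = (\<Sum>l\<le>p. L2_inner (leb S2 \<Otimes>\<^sub>M S_pow S1 l) (u l) (\<lambda>(t, s). e j t * f l s))"
  unfolding hat_def by (simp add: kvec_inner slice_K dinner_def slice_inner K_D)

lemma H_lincomb: "u \<in> H \<Longrightarrow> v \<in> H \<Longrightarrow> (\<lambda>l z. u l z + c * v l z) \<in> H"
  by (simp add: dsum_def L2_add L2_scale)

lemma ell2_block_eqI: "(\<And>l k. coord x (prod_encode (l, k)) = coord y (prod_encode (l, k))) \<Longrightarrow> x = y"
  by (rule ell2_eqI) (metis prod.exhaust prod_decode_inverse)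

lemma hat_lincomb: "u \<in> H \<Longrightarrow> v \<in> H \<Longrightarrow> hat (\<lambda>l z. u l z + c * v l z) j = hat u j + c *\<^sub>R hat v j"
proof (rule ell2_block_eqI)
  fix l k assume u: "u \<in> H" and v: "v \<in> H"
  show "coord (hat (\<lambda>l z. u l z + c * v l z) j) (prod_encode (l, k)) = coord (hat u j + c *\<^sub>R hat v j) (prod_encode (l, k))"
    using H_D[OF u] H_D[OF v] pr.L2_tensor[OF e.L2[of j] b.L2[of l k]]
    by (simp add: coord_hat H_lincomb u v L2_inner_add L2_scale L2_inner_scale)
qed

text \<open>Parseval for the tensor basis, read as an iterated sum. Working in extended nonnegative
  reals makes every reordering a case of Tonelli.\<close>

lemma hat_norm_sums': "u \<in> H \<Longrightarrow> (\<lambda>j. hat u j \<bullet> hat u j) sums dinner p (LL_meas S1 S2) u u"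
proof (rule ennreal_suminf_sums)
  assume u: "u \<in> H"
  let ?c = "\<lambda>l j k. L2_inner (leb S2 \<Otimes>\<^sub>M S_pow S1 l) (u l) (\<lambda>(t, s). e j t * b l k s)"
  have "(\<Sum>j. ennreal (hat u j \<bullet> hat u j)) = (\<Sum>j. \<Sum>l\<le>p. \<Sum>k. ennreal ((?c l j k)\<^sup>2))"
  proof (rule suminf_cong)
    fix j
    have "hat u j \<bullet> hat u j = (\<Sum>l\<le>p. L2_inner (S_pow S1 l) (slice u j l) (slice u j l))"
      unfolding hat_def by (simp add: kvec_inner slice_K u dinner_def)
    then have "ennreal (hat u j \<bullet> hat u j) = (\<Sum>l\<le>p. ennreal (L2_inner (S_pow S1 l) (slice u j l) (slice u j l)))"
      by (simp add: L2_inner_ge_0)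
    also have "\<dots> = (\<Sum>l\<le>p. \<Sum>k. ennreal ((?c l j k)\<^sup>2))"
    proof (rule sum.cong)
      fix l assume "l \<in> {..p}"
      then have "(\<lambda>k. (?c l j k)\<^sup>2) sums L2_inner (S_pow S1 l) (slice u j l) (slice u j l)"
        using b.frame_parseval[OF K_D[OF slice_K[OF u]], of l j] by (simp add: slice_inner u b.L2)
      then show "ennreal (L2_inner (S_pow S1 l) (slice u j l) (slice u j l)) = (\<Sum>k. ennreal ((?c l j k)\<^sup>2))"
        by (intro suminf_ennreal_eq[symmetric]) auto
    qed simp
    finally show "ennreal (hat u j \<bullet> hat u j) = (\<Sum>l\<le>p. \<Sum>k. ennreal ((?c l j k)\<^sup>2))" .
  qed
  also have "\<dots> = (\<Sum>l\<le>p. \<Sum>j. \<Sum>k. ennreal ((?c l j k)\<^sup>2))"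
    by (rule suminf_sum) auto
  also have "\<dots> = (\<Sum>l\<le>p. ennreal (L2_inner (LL_meas S1 S2 l) (u l) (u l)))"
  proof (rule sum.cong)
    fix l assume l: "l \<in> {..p}"
    interpret t: frame "leb S2 \<Otimes>\<^sub>M S_pow S1 l" "tensor_frame e (b l)"
      by (rule frame_tensor) unfold_locales
    have "(\<Sum>j. \<Sum>k. ennreal ((?c l j k)\<^sup>2)) =
        (\<Sum>n. (case prod_decode n of (j, k) \<Rightarrow> ennreal ((?c l j k)\<^sup>2)))"
      by (rule suminf_ennreal_2dimen[symmetric]) simp
    also have "\<dots> = (\<Sum>n. ennreal ((L2_inner (leb S2 \<Otimes>\<^sub>M S_pow S1 l) (u l) (tensor_frame e (b l) n))\<^sup>2))"
      by (simp add: tensor_frame_def split_beta')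
    also have "\<dots> = ennreal (L2_inner (LL_meas S1 S2 l) (u l) (u l))"
      using t.frame_parseval[OF H_D[OF u]] l by (intro suminf_ennreal_eq) (auto simp: LL_meas_eq)
    finally show "(\<Sum>j. \<Sum>k. ennreal ((?c l j k)\<^sup>2)) = ennreal (L2_inner (LL_meas S1 S2 l) (u l) (u l))" .
  qed simp
  also have "\<dots> = ennreal (dinner p (LL_meas S1 S2) u u)"
    by (simp add: dinner_def L2_inner_ge_0)
  finally show "(\<Sum>j. ennreal (hat u j \<bullet> hat u j)) = ennreal (dinner p (LL_meas S1 S2) u u)" .
qed (auto simp: dinner_def intro!: sum_nonneg L2_inner_ge_0)

lemma hat_range_space: "u \<in> H \<Longrightarrow> hat u j \<in> range_space j"
proof -
  assume u: "u \<in> H"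
  have "coord (hat u j) (prod_encode (l, k)) = 0" if "L2_inner (leb S2) (e j) (e j) = 0" for l k
  proof (cases "l \<le> p")
    case True
    have "L2_inner (leb S2 \<Otimes>\<^sub>M S_pow S1 l) (\<lambda>(t, s). e j t * b l k s) (\<lambda>(t, s). e j t * b l k s) = 0"
      using that by (simp add: pr.L2_inner_tensor e.L2 b.L2)
    from L2_inner_null[OF pr.L2_tensor[OF e.L2 b.L2] H_D[OF u True] this] show ?thesis
      by (simp add: coord_hat u L2_inner_commute)
  qed (simp add: coord_hat u)
  then have "coord (hat u j) m = 0" if "L2_inner (leb S2) (e j) (e j) = 0" for m
    using that by (metis prod.exhaust prod_decode_inverse)
  then show ?thesis
    unfolding range_space_def using kvec_dead[OF slice_K[OF u]] by (auto simp: hat_def)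
qed

text \<open>For each \<open>l\<close> the coefficients in block \<open>l\<close> of all
  \<open>w j\<close> form a square-summable double sequence, and the Riesz-Fischer theorem for the
  tensor basis produces the component.\<close>

lemma hat_realize:
  assumes w: "\<And>j. w j \<in> range_space j" and s: "summable (\<lambda>j. (norm (w j))\<^sup>2)"
  shows "\<exists>u\<in>H. \<forall>j. hat u j = w j"
proof -
  have "\<exists>v\<in>L2 (leb S2 \<Otimes>\<^sub>M S_pow S1 l). \<forall>j k. L2_inner (leb S2 \<Otimes>\<^sub>M S_pow S1 l) v (\<lambda>(t, s). e j t * b l k s) =
      coord (w j) (prod_encode (l, k)) * (L2_inner (leb S2) (e j) (e j) * L2_inner (S_pow S1 l) (b l k) (b l k))" for l
  proof -
    interpret t: frame "leb S2 \<Otimes>\<^sub>M S_pow S1 l" "tensor_frame e (b l)"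
      by (rule frame_tensor) unfold_locales
    define c where "c n = (case prod_decode n of (j, k) \<Rightarrow> coord (w j) (prod_encode (l, k)))" for n
    have "(\<Sum>n. ennreal ((c n)\<^sup>2)) = (\<Sum>n. (case prod_decode n of (j, k) \<Rightarrow> ennreal ((coord (w j) (prod_encode (l, k)))\<^sup>2)))"
      by (simp add: c_def split_beta')
    also have "\<dots> = (\<Sum>j. \<Sum>k. ennreal ((coord (w j) (prod_encode (l, k)))\<^sup>2))"
      by (rule suminf_ennreal_2dimen) simp
    also have "\<dots> \<le> (\<Sum>j. ennreal ((norm (w j))\<^sup>2))"
    proof (rule suminf_le)
      show "(\<Sum>k. ennreal ((coord (w j) (prod_encode (l, k)))\<^sup>2)) \<le> ennreal ((norm (w j))\<^sup>2)" for j
        using block_coord_summable[of "w j" l] by (subst suminf_ennreal2) (auto intro: ennreal_leI)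
    qed auto
    also have "\<dots> = ennreal (\<Sum>j. (norm (w j))\<^sup>2)" by (intro suminf_ennreal2 s) simp
    finally have "(\<Sum>n. ennreal ((c n)\<^sup>2)) \<noteq> \<top>" by (auto simp: top_unique)
    then have "summable (\<lambda>n. (c n)\<^sup>2)" by (intro summable_suminf_not_top) auto
    from t.riesz_fischer[OF this] obtain v where v: "v \<in> L2 (leb S2 \<Otimes>\<^sub>M S_pow S1 l)"
      "\<And>n. L2_inner (leb S2 \<Otimes>\<^sub>M S_pow S1 l) v (tensor_frame e (b l) n) =
        c n * L2_inner (leb S2 \<Otimes>\<^sub>M S_pow S1 l) (tensor_frame e (b l) n) (tensor_frame e (b l) n)" by blast
    show ?thesis
    proof (intro bexI[OF _ v(1)] allI)
      fix j k
      show "L2_inner (leb S2 \<Otimes>\<^sub>M S_pow S1 l) v (\<lambda>(t, s). e j t * b l k s) =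
        coord (w j) (prod_encode (l, k)) * (L2_inner (leb S2) (e j) (e j) * L2_inner (S_pow S1 l) (b l k) (b l k))"
        using v(2)[of "prod_encode (j, k)"] by (simp add: tensor_frame_def c_def pr.L2_inner_tensor e.L2 b.L2)
    qed
  qed
  then obtain u where u: "\<And>l. u l \<in> L2 (leb S2 \<Otimes>\<^sub>M S_pow S1 l)"
    "\<And>l j k. L2_inner (leb S2 \<Otimes>\<^sub>M S_pow S1 l) (u l) (\<lambda>(t, s). e j t * b l k s) =
      coord (w j) (prod_encode (l, k)) * (L2_inner (leb S2) (e j) (e j) * L2_inner (S_pow S1 l) (b l k) (b l k))"
    by metis
  then have uH: "u \<in> H" by (simp add: dsum_def LL_meas_eq)
  have "hat u j = w j" for j
  proof (rule ell2_block_eqI)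
    fix l k
    show "coord (hat u j) (prod_encode (l, k)) = coord (w j) (prod_encode (l, k))"
      using w[of j] e.unit[of j] b.unit[of l k]
      by (auto simp: coord_hat uH u(2) range_space_def dead_def)
  qed
  with uH show ?thesis by blast
qed

sublocale coordinate_space p "LL_meas S1 S2" hat range_space
proof
  fix u v assume u: "u \<in> H" and v: "v \<in> H"
  have q: "(\<lambda>j. (hat u j + c *\<^sub>R hat v j) \<bullet> (hat u j + c *\<^sub>R hat v j)) sums
      dinner p (LL_meas S1 S2) (\<lambda>l z. u l z + c * v l z) (\<lambda>l z. u l z + c * v l z)" for c
    using hat_norm_sums'[OF H_lincomb[OF u v]] by (simp add: hat_lincomb u v)
  \<comment> \<open>Polarization reduces the inner product to the norm identity for
    \<open>u + v\<close> and \<open>u - v\<close>.\<close>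
  have "(\<lambda>j. ((hat u j + 1 *\<^sub>R hat v j) \<bullet> (hat u j + 1 *\<^sub>R hat v j) -
      (hat u j + (-1) *\<^sub>R hat v j) \<bullet> (hat u j + (-1) *\<^sub>R hat v j)) / 4) sums
      ((dinner p (LL_meas S1 S2) (\<lambda>l z. u l z + 1 * v l z) (\<lambda>l z. u l z + 1 * v l z) -
        dinner p (LL_meas S1 S2) (\<lambda>l z. u l z + (-1) * v l z) (\<lambda>l z. u l z + (-1) * v l z)) / 4)"
    by (intro sums_divide sums_diff q)
  moreover have "((hat u j + 1 *\<^sub>R hat v j) \<bullet> (hat u j + 1 *\<^sub>R hat v j) -
      (hat u j + (-1) *\<^sub>R hat v j) \<bullet> (hat u j + (-1) *\<^sub>R hat v j)) / 4 = hat u j \<bullet> hat v j" for j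
    by (simp add: inner_simps inner_commute[of "hat v j" "hat u j"])
  moreover have "(dinner p (LL_meas S1 S2) (\<lambda>l z. u l z + 1 * v l z) (\<lambda>l z. u l z + 1 * v l z) -
        dinner p (LL_meas S1 S2) (\<lambda>l z. u l z + (-1) * v l z) (\<lambda>l z. u l z + (-1) * v l z)) / 4 =
      dinner p (LL_meas S1 S2) u v"
  proof -
    have "L2_inner (LL_meas S1 S2 l) (\<lambda>z. u l z + 1 * v l z) (\<lambda>z. u l z + 1 * v l z) -
        L2_inner (LL_meas S1 S2 l) (\<lambda>z. u l z + (-1) * v l z) (\<lambda>z. u l z + (-1) * v l z) =
        4 * L2_inner (LL_meas S1 S2 l) (u l) (v l)" if "l \<le> p" for l
      using H_D[OF u that] H_D[OF v that]
      by (simp add: LL_meas_eq L2_inner_add L2_inner_diff L2_inner_add_right L2_inner_diff_right L2_add L2_diff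
          L2_inner_commute[of _ "v l" "u l"])
    then show ?thesis
      by (simp add: dinner_def sum_subtractf[symmetric] sum_distrib_left[symmetric])
  qed
  ultimately show "(\<lambda>j. hat u j \<bullet> hat v j) sums dinner p (LL_meas S1 S2) u v" by simp
qed (simp_all add: H_lincomb hat_lincomb hat_range_space hat_realize)

subsection \<open>The operators attached to one observation\<close>

lemma chi_K: "x \<in> L2 (leb S1) \<Longrightarrow> chi x \<in> K"
  by (simp add: dsum_def chi_L2[OF S1])

definition chivec :: "(real \<Rightarrow> real) \<Rightarrow> ell2" where
  "chivec x = kvec (chi x)"

lemma B_op_L2: "x \<in> L2 (leb S1) \<Longrightarrow> u \<in> H \<Longrightarrow> B_op p S1 x u \<in> L2 (leb S2)"
  unfolding B_op_def[abs_def] by (intro L2_sum pr.L2_slice H_D chi_L2[OF S1]) auto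

lemma B_op_inner: "x \<in> L2 (leb S1) \<Longrightarrow> u \<in> H \<Longrightarrow> h \<in> L2 (leb S2) \<Longrightarrow>
    L2_inner (leb S2) (B_op p S1 x u) h = (\<Sum>l\<le>p. L2_inner (leb S2 \<Otimes>\<^sub>M S_pow S1 l) (u l) (\<lambda>(t, s). h t * chi x l s))"
  unfolding B_op_def[abs_def]
  by (subst L2_inner_sum) (auto intro!: pr.L2_slice H_D chi_L2[OF S1] simp: pr.L2_slice_inner H_D chi_L2[OF S1])

text \<open>With \<open>B_adj_hat\<close> this shows that the operator of one observation acts on
  every coordinate as the same rank-one operator, the tensor square of
  \<open>chivec x\<close>.\<close>

lemma B_op_coeff: "x \<in> L2 (leb S1) \<Longrightarrow> u \<in> H \<Longrightarrow> L2_inner (leb S2) (B_op p S1 x u) (e j) = hat u j \<bullet> chivec x"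
  by (simp add: B_op_inner e.L2 chivec_def hat_kvec_inner chi_K)

lemma B_adj_H: "x \<in> L2 (leb S1) \<Longrightarrow> h \<in> L2 (leb S2) \<Longrightarrow> B_adj x h \<in> H"
  by (auto simp: dsum_def B_adj_def LL_meas_eq intro!: pr.L2_tensor chi_L2[OF S1])

lemma B_adj_hat: "x \<in> L2 (leb S1) \<Longrightarrow> h \<in> L2 (leb S2) \<Longrightarrow> hat (B_adj x h) j = L2_inner (leb S2) h (e j) *\<^sub>R chivec x"
proof (rule ell2_block_eqI)
  fix l k assume x: "x \<in> L2 (leb S1)" and h: "h \<in> L2 (leb S2)"
  show "coord (hat (B_adj x h) j) (prod_encode (l, k)) = coord (L2_inner (leb S2) h (e j) *\<^sub>R chivec x) (prod_encode (l, k))"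
    using x h by (simp add: coord_hat B_adj_H chivec_def coord_kvec chi_K B_adj_def[of x h l]
        pr.L2_inner_tensor e.L2 b.L2 chi_L2[OF S1])
qed

lemma hat_sum:
  assumes "finite I" "\<And>i. i \<in> I \<Longrightarrow> u i \<in> H"
  shows "(\<lambda>l z. (\<Sum>i\<in>I. u i l z)) \<in> H" "hat (\<lambda>l z. (\<Sum>i\<in>I. u i l z)) j = (\<Sum>i\<in>I. hat (u i) j)"
proof -
  have 0: "(\<lambda>l z. 0) \<in> H" by (simp add: dsum_def L2_0)
  have hat0: "hat (\<lambda>l z. 0) j = 0" using hat_lincomb[OF 0 0, of "-1" j] by simp
  have "(\<lambda>l z. (\<Sum>i\<in>I. u i l z)) \<in> H \<and> hat (\<lambda>l z. (\<Sum>i\<in>I. u i l z)) j = (\<Sum>i\<in>I. hat (u i) j)"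
    using assms
  proof (induction I rule: finite_induct)
    case (insert i I)
    then show ?case
      using H_lincomb[of "u i" "\<lambda>l z. (\<Sum>i\<in>I. u i l z)" 1] hat_lincomb[of "u i" "\<lambda>l z. (\<Sum>i\<in>I. u i l z)" 1 j]
      by simp
  qed (simp add: 0 hat0)
  then show "(\<lambda>l z. (\<Sum>i\<in>I. u i l z)) \<in> H" "hat (\<lambda>l z. (\<Sum>i\<in>I. u i l z)) j = (\<Sum>i\<in>I. hat (u i) j)" by auto
qed

lemma hat_scale:
  assumes "u \<in> H" shows "(\<lambda>l z. c * u l z) \<in> H" "hat (\<lambda>l z. c * u l z) j = c *\<^sub>R hat u j"
proof -
  have "(\<lambda>l z. u l z + (c - 1) * u l z) = (\<lambda>l z. c * u l z)" by (simp add: algebra_simps)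
  then show "(\<lambda>l z. c * u l z) \<in> H" "hat (\<lambda>l z. c * u l z) j = c *\<^sub>R hat u j"
    using H_lincomb[OF assms assms, of "c - 1"] hat_lincomb[OF assms assms, of "c - 1" j]
    by (simp_all add: scaleR_left_diff_distrib)
qed

lemma AA_emp_hat:
  assumes X: "\<And>i. i \<in> {1..n} \<Longrightarrow> Xs i \<omega> \<in> L2 (leb S1)" and u: "u \<in> H"
  shows "AA_emp p S1 Xs n \<omega> u \<in> H"
    "hat (AA_emp p S1 Xs n \<omega> u) j = (1 / real n) *\<^sub>R (\<Sum>i=1..n. (hat u j \<bullet> chivec (Xs i \<omega>)) *\<^sub>R chivec (Xs i \<omega>))"
proof -
  let ?v = "\<lambda>l z. \<Sum>i=1..n. B_adj (Xs i \<omega>) (B_op p S1 (Xs i \<omega>) u) l z"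
  have v: "?v \<in> H" "hat ?v j = (\<Sum>i=1..n. (hat u j \<bullet> chivec (Xs i \<omega>)) *\<^sub>R chivec (Xs i \<omega>))"
    using X u by (subst hat_sum, (auto simp: B_adj_H B_op_L2 B_adj_hat B_op_coeff)[3])+
  have eq: "AA_emp p S1 Xs n \<omega> u = (\<lambda>l z. (1 / real n) * ?v l z)" by (simp add: AA_emp_def)
  show "AA_emp p S1 Xs n \<omega> u \<in> H" unfolding eq by (rule hat_scale[OF v(1)])
  show "hat (AA_emp p S1 Xs n \<omega> u) j = (1 / real n) *\<^sub>R (\<Sum>i=1..n. (hat u j \<bullet> chivec (Xs i \<omega>)) *\<^sub>R chivec (Xs i \<omega>))"
    unfolding eq hat_scale(2)[OF v(1)] v(2) ..
qed

lemma AY_emp_hat: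
  assumes X: "\<And>i. i \<in> {1..n} \<Longrightarrow> Xs i \<omega> \<in> L2 (leb S1)" and Y: "\<And>i. i \<in> {1..n} \<Longrightarrow> Ys i \<omega> \<in> L2 (leb S2)"
  shows "AY_emp Xs Ys n \<omega> \<in> H"
    "hat (AY_emp Xs Ys n \<omega>) j = (1 / real n) *\<^sub>R (\<Sum>i=1..n. L2_inner (leb S2) (Ys i \<omega>) (e j) *\<^sub>R chivec (Xs i \<omega>))"
proof -
  let ?v = "\<lambda>l z. \<Sum>i=1..n. B_adj (Xs i \<omega>) (Ys i \<omega>) l z"
  have v: "?v \<in> H" "hat ?v j = (\<Sum>i=1..n. L2_inner (leb S2) (Ys i \<omega>) (e j) *\<^sub>R chivec (Xs i \<omega>))"
    using X Y by (subst hat_sum, (auto simp: B_adj_H B_adj_hat)[3])+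
  have eq: "AY_emp Xs Ys n \<omega> = (\<lambda>l z. (1 / real n) * ?v l z)" by (simp add: AY_emp_def)
  show "AY_emp Xs Ys n \<omega> \<in> H" unfolding eq by (rule hat_scale[OF v(1)])
  show "hat (AY_emp Xs Ys n \<omega>) j = (1 / real n) *\<^sub>R (\<Sum>i=1..n. L2_inner (leb S2) (Ys i \<omega>) (e j) *\<^sub>R chivec (Xs i \<omega>))"
    unfolding eq hat_scale(2)[OF v(1)] v(2) ..
qed

lemma chivec_norm:
  assumes "x \<in> L2 (leb S1)"
  shows "(norm (chivec x))\<^sup>2 = (\<Sum>l\<le>p. (L2_norm (leb S1) x)\<^sup>2 ^ l)"
  using assms by (simp add: chivec_def power2_norm_eq_inner kvec_inner chi_K dinner_def chi_inner[OF S1]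
      L2_norm_def L2_inner_ge_0)

lemma measurable_chivec_coord: "(\<lambda>x. coord (chivec x) m) \<in> borel_measurable (L2_sigma (leb S1))"
proof (subst measurable_cong)
  show "coord (chivec x) m = (case prod_decode m of (l, k) \<Rightarrow> if l \<le> p then L2_inner (S_pow S1 l) (chi x l) (b l k) else 0)"
    if "x \<in> space (L2_sigma (leb S1))" for x
    using that by (simp add: chivec_def coord_kvec chi_K)
  show "(\<lambda>x. case prod_decode m of (l, k) \<Rightarrow> if l \<le> p then L2_inner (S_pow S1 l) (chi x l) (b l k) else 0)
      \<in> borel_measurable (L2_sigma (leb S1))"
  proof (cases "fst (prod_decode m) \<le> p")
    case True
    then show ?thesis using measurable_chi_basis[OF S1] by (simp add: split_beta')
  qed (simp add: split_beta')
qed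

lemma measurable_chivec_inner: "(\<lambda>x. chivec x \<bullet> y) \<in> borel_measurable (L2_sigma (leb S1))"
proof -
  have "(\<lambda>x. \<Sum>m. coord (chivec x) m * coord y m) \<in> borel_measurable (L2_sigma (leb S1))"
    by (intro borel_measurable_suminf borel_measurable_times measurable_chivec_coord) simp
  then show ?thesis by (simp add: sums_unique[OF ell2_inner_sums, symmetric])
qed

end

section \<open>Second moment operators\<close>

text \<open>The locale is used twice: for the population, with the probability space of the model,
  and for the sample, with the uniform distribution on the indices of the observations.\<close>

locale second_moment = prob_space M for M :: "'w measure" +
  fixes \<xi> :: "'w \<Rightarrow> ell2" and \<kappa> :: real
  assumes meas [measurable]: "\<And>m. (\<lambda>\<omega>. coord (\<xi> \<omega>) m) \<in> borel_measurable M"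
    and bound: "\<And>\<omega>. \<omega> \<in> space M \<Longrightarrow> (norm (\<xi> \<omega>))\<^sup>2 \<le> \<kappa>"
begin

lemma \<kappa>_nonneg: "0 \<le> \<kappa>"
  using bound order.trans[OF zero_le_power2] not_empty by blast

lemma inner_meas [measurable]: "(\<lambda>\<omega>. \<xi> \<omega> \<bullet> y) \<in> borel_measurable M"
proof -
  have "(\<lambda>\<omega>. \<Sum>m. coord (\<xi> \<omega>) m * coord y m) \<in> borel_measurable M" by measurable
  then show ?thesis by (simp add: sums_unique[OF ell2_inner_sums, symmetric])
qed

lemma inner_bound: "\<omega> \<in> space M \<Longrightarrow> \<bar>\<xi> \<omega> \<bullet> y\<bar> \<le> sqrt \<kappa> * norm y"
  using Cauchy_Schwarz_ineq2[of "\<xi> \<omega>" y] mult_right_mono[OF real_le_rsqrt[OF bound], of \<omega> "norm y"] by simp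

lemma inner_square_bound: "\<omega> \<in> space M \<Longrightarrow> (\<xi> \<omega> \<bullet> y)\<^sup>2 \<le> \<kappa> * (norm y)\<^sup>2"
  using power_mono[OF inner_bound[of \<omega> y] abs_ge_zero, of 2] \<kappa>_nonneg by (simp add: power_mult_distrib)

lemma inner_L2: "(\<lambda>\<omega>. \<xi> \<omega> \<bullet> y) \<in> L2 M"
  unfolding L2_def using inner_square_bound[of _ y]
  by (auto intro!: integrable_const_bound[where B = "\<kappa> * (norm y)\<^sup>2"])

lemma inner_integrable: "integrable M (\<lambda>\<omega>. (\<xi> \<omega> \<bullet> y) * (\<xi> \<omega> \<bullet> z))"
  by (intro L2_mult inner_L2)

lemma coord_square_sums:
  "summable (\<lambda>m. expectation (\<lambda>\<omega>. (\<xi> \<omega> \<bullet> unit_vec m)\<^sup>2))"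
proof (rule summableI_nonneg_bounded)
  fix N
  have "(\<Sum>m<N. expectation (\<lambda>\<omega>. (\<xi> \<omega> \<bullet> unit_vec m)\<^sup>2)) = expectation (\<lambda>\<omega>. \<Sum>m<N. (\<xi> \<omega> \<bullet> unit_vec m)\<^sup>2)"
    by (rule Bochner_Integration.integral_sum[symmetric]) (rule L2_square[OF inner_L2])
  also have "\<dots> \<le> expectation (\<lambda>\<omega>. \<kappa>)"
    by (intro integral_mono Bochner_Integration.integrable_sum L2_square[OF inner_L2])
      (use bound order.trans[OF sum_coord_le] in \<open>auto simp: inner_unit_vec\<close>)
  finally show "(\<Sum>m<N. expectation (\<lambda>\<omega>. (\<xi> \<omega> \<bullet> unit_vec m)\<^sup>2)) \<le> \<kappa>" by (simp add: prob_space)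
qed simp

text \<open>The second moment operator defined through its coordinates, which avoids a vector-valued
  integral; \<open>Gam_inner\<close> recovers the weak characterization by dominated
  convergence.\<close>

definition Gam :: "ell2 \<Rightarrow> ell2" where
  "Gam y = Abs_ell2 (\<lambda>m. expectation (\<lambda>\<omega>. (\<xi> \<omega> \<bullet> unit_vec m) * (\<xi> \<omega> \<bullet> y)))"

lemma expectation_square_le: "expectation (\<lambda>\<omega>. (\<xi> \<omega> \<bullet> y)\<^sup>2) \<le> \<kappa> * (norm y)\<^sup>2"
proof -
  have "expectation (\<lambda>\<omega>. (\<xi> \<omega> \<bullet> y)\<^sup>2) \<le> expectation (\<lambda>\<omega>. \<kappa> * (norm y)\<^sup>2)"
    by (intro integral_mono L2_square[OF inner_L2]) (use inner_square_bound in auto)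
  then show ?thesis by (simp add: prob_space)
qed

lemma expectation_cauchy_schwarz:
  "(expectation (\<lambda>\<omega>. (\<xi> \<omega> \<bullet> y) * (\<xi> \<omega> \<bullet> z)))\<^sup>2 \<le> expectation (\<lambda>\<omega>. (\<xi> \<omega> \<bullet> y)\<^sup>2) * expectation (\<lambda>\<omega>. (\<xi> \<omega> \<bullet> z)\<^sup>2)"
  using L2_cauchy_schwarz[OF inner_L2 inner_L2] by (simp add: L2_inner_def power2_eq_square)

lemma coord_Gam: "coord (Gam y) m = expectation (\<lambda>\<omega>. (\<xi> \<omega> \<bullet> unit_vec m) * (\<xi> \<omega> \<bullet> y))"
proof -
  have "summable (\<lambda>m. (expectation (\<lambda>\<omega>. (\<xi> \<omega> \<bullet> unit_vec m) * (\<xi> \<omega> \<bullet> y)))\<^sup>2)"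
  proof (rule summable_comparison_test'[OF summable_mult2[OF coord_square_sums, of "\<kappa> * (norm y)\<^sup>2"], of 0])
    fix m
    have "(expectation (\<lambda>\<omega>. (\<xi> \<omega> \<bullet> unit_vec m) * (\<xi> \<omega> \<bullet> y)))\<^sup>2 \<le>
        expectation (\<lambda>\<omega>. (\<xi> \<omega> \<bullet> unit_vec m)\<^sup>2) * (\<kappa> * (norm y)\<^sup>2)"
      using order.trans[OF expectation_cauchy_schwarz mult_left_mono[OF expectation_square_le]] by simp
    then show "norm ((expectation (\<lambda>\<omega>. (\<xi> \<omega> \<bullet> unit_vec m) * (\<xi> \<omega> \<bullet> y)))\<^sup>2) \<le>
        expectation (\<lambda>\<omega>. (\<xi> \<omega> \<bullet> unit_vec m)\<^sup>2) * (\<kappa> * (norm y)\<^sup>2)" by simp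
  qed
  then show ?thesis unfolding Gam_def by (simp add: coord_Abs)
qed

lemma Gam_inner: "Gam y \<bullet> z = expectation (\<lambda>\<omega>. (\<xi> \<omega> \<bullet> y) * (\<xi> \<omega> \<bullet> z))"
proof (rule LIMSEQ_unique)
  show "(\<lambda>N. \<Sum>m<N. coord (Gam y) m * coord z m) \<longlonglongrightarrow> Gam y \<bullet> z"
    using ell2_inner_sums[of "Gam y" z] by (simp add: sums_def)
  have "(\<Sum>m<N. coord (Gam y) m * coord z m) = expectation (\<lambda>\<omega>. (\<xi> \<omega> \<bullet> y) * (\<Sum>m<N. coord (\<xi> \<omega>) m * coord z m))" for N
  proof -
    have "(\<Sum>m<N. coord (Gam y) m * coord z m) =
        (\<Sum>m<N. expectation (\<lambda>\<omega>. (\<xi> \<omega> \<bullet> unit_vec m) * (\<xi> \<omega> \<bullet> y) * coord z m))"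
      by (simp add: coord_Gam)
    also have "\<dots> = expectation (\<lambda>\<omega>. \<Sum>m<N. (\<xi> \<omega> \<bullet> unit_vec m) * (\<xi> \<omega> \<bullet> y) * coord z m)"
      by (intro Bochner_Integration.integral_sum[symmetric] integrable_mult_left inner_integrable)
    finally show ?thesis by (simp add: inner_unit_vec sum_distrib_left mult_ac)
  qed
  moreover have "(\<lambda>N. expectation (\<lambda>\<omega>. (\<xi> \<omega> \<bullet> y) * (\<Sum>m<N. coord (\<xi> \<omega>) m * coord z m))) \<longlonglongrightarrow>
      expectation (\<lambda>\<omega>. (\<xi> \<omega> \<bullet> y) * (\<xi> \<omega> \<bullet> z))"
  proof (rule integral_dominated_convergence[where w = "\<lambda>_. (sqrt \<kappa> * norm y) * (sqrt \<kappa> * norm z)"])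
    show "AE \<omega> in M. (\<lambda>N. (\<xi> \<omega> \<bullet> y) * (\<Sum>m<N. coord (\<xi> \<omega>) m * coord z m)) \<longlonglongrightarrow> (\<xi> \<omega> \<bullet> y) * (\<xi> \<omega> \<bullet> z)"
      using ell2_inner_sums by (intro AE_I2 tendsto_mult tendsto_const) (simp add: sums_def)
    show "AE \<omega> in M. norm ((\<xi> \<omega> \<bullet> y) * (\<Sum>m<N. coord (\<xi> \<omega>) m * coord z m)) \<le> (sqrt \<kappa> * norm y) * (sqrt \<kappa> * norm z)" for N
    proof (rule AE_I2)
      fix \<omega> assume \<omega>: "\<omega> \<in> space M"
      have "(\<Sum>m<N. coord (\<xi> \<omega>) m * coord z m)\<^sup>2 \<le> (\<Sum>m<N. (coord (\<xi> \<omega>) m)\<^sup>2) * (\<Sum>m<N. (coord z m)\<^sup>2)"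
        by (rule Cauchy_Schwarz_ineq_sum)
      also have "\<dots> \<le> \<kappa> * (norm z)\<^sup>2"
        using \<kappa>_nonneg by (intro mult_mono order.trans[OF sum_coord_le bound[OF \<omega>]] sum_coord_le) (auto intro: sum_nonneg)
      also have "\<dots> = (sqrt \<kappa> * norm z)\<^sup>2" using \<kappa>_nonneg by (simp add: power_mult_distrib)
      finally have "\<bar>\<Sum>m<N. coord (\<xi> \<omega>) m * coord z m\<bar> \<le> sqrt \<kappa> * norm z"
        using abs_le_square_iff[of "\<Sum>m<N. coord (\<xi> \<omega>) m * coord z m" "sqrt \<kappa> * norm z"] \<kappa>_nonneg by simp
      then show "norm ((\<xi> \<omega> \<bullet> y) * (\<Sum>m<N. coord (\<xi> \<omega>) m * coord z m)) \<le> (sqrt \<kappa> * norm y) * (sqrt \<kappa> * norm z)"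
        using inner_bound[OF \<omega>, of y] \<kappa>_nonneg unfolding real_norm_def abs_mult by (intro mult_mono) auto
    qed
  qed auto
  ultimately show "(\<lambda>N. \<Sum>m<N. coord (Gam y) m * coord z m) \<longlonglongrightarrow> expectation (\<lambda>\<omega>. (\<xi> \<omega> \<bullet> y) * (\<xi> \<omega> \<bullet> z))"
    by simp
qed

text \<open>Testing \<open>Gam y\<close> against itself and applying Cauchy-Schwarz. Summed over the
  unit vectors it yields the Hilbert-Schmidt property, since the expected squared coordinates are
  summable.\<close>

lemma Gam_norm_square: "(norm (Gam y))\<^sup>2 \<le> \<kappa> * expectation (\<lambda>\<omega>. (\<xi> \<omega> \<bullet> y)\<^sup>2)"
proof (cases "Gam y = 0")
  case False
  have "(norm (Gam y))\<^sup>2 * (norm (Gam y))\<^sup>2 = (expectation (\<lambda>\<omega>. (\<xi> \<omega> \<bullet> y) * (\<xi> \<omega> \<bullet> Gam y)))\<^sup>2"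
    by (simp add: power2_norm_eq_inner Gam_inner[symmetric]) (simp add: power2_eq_square)
  also have "\<dots> \<le> expectation (\<lambda>\<omega>. (\<xi> \<omega> \<bullet> y)\<^sup>2) * (\<kappa> * (norm (Gam y))\<^sup>2)"
    using order.trans[OF expectation_cauchy_schwarz mult_left_mono[OF expectation_square_le]] by simp
  finally have "(norm (Gam y))\<^sup>2 * (norm (Gam y))\<^sup>2 \<le> (\<kappa> * expectation (\<lambda>\<omega>. (\<xi> \<omega> \<bullet> y)\<^sup>2)) * (norm (Gam y))\<^sup>2"
    by (simp only: mult_ac)
  then show ?thesis by (rule mult_right_le_imp_le) (use False in simp)
qed (use \<kappa>_nonneg in simp)

lemma Gam_linear: "bounded_linear Gam"
proof (rule bounded_linear_intro)
  show "Gam (y + z) = Gam y + Gam z" for y z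
    by (rule ell2_eqI) (simp add: coord_Gam inner_add_right distrib_left inner_integrable)
  show "Gam (c *\<^sub>R y) = c *\<^sub>R Gam y" for c y
    by (rule ell2_eqI) (simp add: coord_Gam mult.left_commute[of _ c])
  show "norm (Gam y) \<le> norm y * \<kappa>" for y
  proof (rule power2_le_imp_le)
    have "(norm (Gam y))\<^sup>2 \<le> \<kappa> * (\<kappa> * (norm y)\<^sup>2)"
      using order.trans[OF Gam_norm_square mult_left_mono[OF expectation_square_le \<kappa>_nonneg]] .
    then show "(norm (Gam y))\<^sup>2 \<le> (norm y * \<kappa>)\<^sup>2" by (simp add: power_mult_distrib power2_eq_square mult_ac)
  qed (use \<kappa>_nonneg in simp)
qed

sublocale positive_hs unit_vec Gam
proof (intro positive_hs.intro positive_hs_axioms.intro onb_unit_vec)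
  show "bounded_linear Gam" by (rule Gam_linear)
  show "Gam y \<bullet> z = y \<bullet> Gam z" for y z
    unfolding inner_commute[of y "Gam z"] Gam_inner by (simp add: mult.commute)
  show "0 \<le> Gam y \<bullet> y" for y unfolding Gam_inner by simp
  show "summable (\<lambda>m. (norm (Gam (unit_vec m)))\<^sup>2)"
    by (rule summable_comparison_test'[OF summable_mult[OF coord_square_sums, of \<kappa>], of 0])
      (use Gam_norm_square in simp)
qed

end

section \<open>Sample means\<close>

text \<open>Independence makes the centred terms pairwise orthogonal, so the mean square is a single
  variance divided by \<open>n\<close>, and a variance is at most the second moment. The extended
  integral is chosen for later interchange with infinite sums.\<close>

lemma (in prob_space) sample_mean_square:
  assumes indep: "indep_vars (\<lambda>_. P) Z {1..}" and distr: "\<And>i. 1 \<le> i \<Longrightarrow> distr M P (Z i) = distr M P Z0"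
    and Z0: "Z0 \<in> M \<rightarrow>\<^sub>M P" and f: "f \<in> borel_measurable P"
    and f2: "integrable M (\<lambda>\<omega>. (f (Z0 \<omega>))\<^sup>2)" and n: "1 \<le> n"
  shows "(\<integral>\<^sup>+\<omega>. ennreal (((\<Sum>i=1..n. f (Z i \<omega>)) / real n - expectation (\<lambda>\<omega>. f (Z0 \<omega>)))\<^sup>2) \<partial>M) \<le>
    ennreal (expectation (\<lambda>\<omega>. (f (Z0 \<omega>))\<^sup>2) / real n)"
proof -
  note [measurable] = f Z0
  have Z: "Z i \<in> M \<rightarrow>\<^sub>M P" if "1 \<le> i" for i using indep that unfolding indep_vars_def2 by auto
  have transfer_i: "integrable M (\<lambda>\<omega>. h (Z i \<omega>)) \<longleftrightarrow> integrable M (\<lambda>\<omega>. h (Z0 \<omega>))"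
    and transfer: "expectation (\<lambda>\<omega>. h (Z i \<omega>)) = expectation (\<lambda>\<omega>. h (Z0 \<omega>))"
    if "1 \<le> i" "h \<in> borel_measurable P" for i and h :: "'b \<Rightarrow> real"
    using integrable_distr_eq[OF Z[OF that(1)] that(2)] integrable_distr_eq[OF Z0 that(2)]
      integral_distr[OF Z[OF that(1)] that(2)] integral_distr[OF Z0 that(2)] distr[OF that(1)] by auto
  define m where "m = expectation (\<lambda>\<omega>. f (Z0 \<omega>))"
  have f1: "integrable M (\<lambda>\<omega>. f (Z0 \<omega>))"
    by (rule L2_integrable) (use f2 in \<open>simp add: L2_def\<close>)
  define g where "g i \<omega> = f (Z i \<omega>) - m" for i \<omega>
  have gm [measurable]: "g i \<in> borel_measurable M" if "1 \<le> i" for i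
    unfolding g_def[abs_def] using Z[OF that] by simp
  have gL2: "g i \<in> L2 M" if "1 \<le> i" for i
  proof -
    have "(\<lambda>\<omega>. f (Z i \<omega>)) \<in> L2 M"
      using transfer_i[OF that, of "\<lambda>z. (f z)\<^sup>2"] f2 Z[OF that] by (simp add: L2_def)
    then show ?thesis unfolding g_def[abs_def] by (rule L2_diff) (simp add: L2_def)
  qed
  have g0: "expectation (g i) = 0" if "1 \<le> i" for i
    unfolding g_def[abs_def] using transfer_i[OF that f] transfer[OF that f] f1 by (simp add: m_def prob_space)
  have g2: "expectation (\<lambda>\<omega>. g i \<omega> * g i \<omega>) \<le> expectation (\<lambda>\<omega>. (f (Z0 \<omega>))\<^sup>2)" if "1 \<le> i" for i
  proof -
    have "expectation (\<lambda>\<omega>. g i \<omega> * g i \<omega>) = expectation (\<lambda>\<omega>. (f (Z0 \<omega>) - m) * (f (Z0 \<omega>) - m))"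
      unfolding g_def by (rule transfer[OF that, of "\<lambda>z. (f z - m) * (f z - m)"]) simp
    also have "\<dots> = expectation (\<lambda>\<omega>. (f (Z0 \<omega>))\<^sup>2 - 2 * m * f (Z0 \<omega>) + m\<^sup>2)"
      by (simp add: power2_eq_square algebra_simps)
    also have "\<dots> = expectation (\<lambda>\<omega>. (f (Z0 \<omega>))\<^sup>2) - m\<^sup>2"
      using f1 f2 by (simp add: prob_space m_def[symmetric] power2_eq_square)
    finally show ?thesis by simp
  qed
  have gij: "expectation (\<lambda>\<omega>. g i \<omega> * g j \<omega>) = 0" if "1 \<le> i" "1 \<le> j" "i \<noteq> j" for i j
  proof -
    have "indep_vars (\<lambda>_. borel) (\<lambda>k \<omega>. f (Z k \<omega>) - m) {i, j}"
      by (rule indep_vars_compose2[OF indep_vars_subset[OF indep], of _ "\<lambda>_ z. f z - m"]) (use that in auto)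
    then have "indep_vars (\<lambda>_. borel) g {i, j}" by (simp add: g_def[abs_def])
    then have "expectation (\<lambda>\<omega>. \<Prod>k\<in>{i, j}. g k \<omega>) = (\<Prod>k\<in>{i, j}. expectation (g k))"
      using L2_integrable[OF gL2[OF that(1)]] L2_integrable[OF gL2[OF that(2)]]
      by (intro indep_vars_lebesgue_integral) auto
    then show ?thesis using that g0 by simp
  qed
  define F where "F \<omega> = (\<Sum>i=1..n. f (Z i \<omega>)) / real n - m" for \<omega>
  have F: "F = (\<lambda>\<omega>. (1 / real n) * (\<Sum>i\<in>{1..n}. g i \<omega>))"
    using n by (auto simp: F_def g_def sum_subtractf field_simps)
  have FL2: "F \<in> L2 M" unfolding F by (intro L2_scale L2_sum gL2) auto
  have "L2_inner M F F = (1 / real n)\<^sup>2 * L2_inner M (\<lambda>\<omega>. \<Sum>i\<in>{1..n}. g i \<omega>) (\<lambda>\<omega>. \<Sum>i\<in>{1..n}. g i \<omega>)"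
    unfolding F by (simp only: L2_inner_scale L2_inner_scale_right power2_eq_square mult.assoc)
  also have "L2_inner M (\<lambda>\<omega>. \<Sum>i\<in>{1..n}. g i \<omega>) (\<lambda>\<omega>. \<Sum>i\<in>{1..n}. g i \<omega>) =
      (\<Sum>i\<in>{1..n}. \<Sum>j\<in>{1..n}. L2_inner M (g j) (g i))"
    by (subst L2_inner_sum, (auto intro!: L2_sum gL2)[2], rule sum.cong[OF refl], subst L2_inner_commute,
        subst L2_inner_sum, auto intro!: L2_sum gL2)
  also have "\<dots> = (\<Sum>i\<in>{1..n}. \<Sum>j\<in>{1..n}. if j = i then L2_inner M (g i) (g i) else 0)"
    by (intro sum.cong refl) (auto simp: L2_inner_def gij)
  also have "\<dots> = (\<Sum>i\<in>{1..n}. L2_inner M (g i) (g i))" by simp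
  also have "\<dots> \<le> (\<Sum>i\<in>{1..n}. expectation (\<lambda>\<omega>. (f (Z0 \<omega>))\<^sup>2))"
    by (intro sum_mono) (use g2 in \<open>auto simp: L2_inner_def\<close>)
  also have "\<dots> = real n * expectation (\<lambda>\<omega>. (f (Z0 \<omega>))\<^sup>2)" by simp
  finally have "L2_inner M F F \<le> (1 / real n)\<^sup>2 * (real n * expectation (\<lambda>\<omega>. (f (Z0 \<omega>))\<^sup>2))"
    by (simp add: mult_left_mono)
  also have "\<dots> = expectation (\<lambda>\<omega>. (f (Z0 \<omega>))\<^sup>2) / real n" using n by (simp add: power2_eq_square)
  finally have "L2_inner M F F \<le> expectation (\<lambda>\<omega>. (f (Z0 \<omega>))\<^sup>2) / real n" .
  from ennreal_leI[OF this] show ?thesis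
    unfolding L2_norm_ennreal[OF FL2] F_def m_def .
qed

section \<open>The effective dimension\<close>

text \<open>Comparison with the antiderivative, carried out one step at a time with the mean value
  theorem so that the sum telescopes.\<close>

lemma sum_powr_tail:
  assumes b: "1 < b" and m: "1 \<le> (m::nat)"
  shows "(\<Sum>i\<in>{m<..m+n}. real i powr (- b)) \<le> real m powr (1 - b) / (b - 1)"
proof -
  have "(\<Sum>i\<in>{m<..m+n}. real i powr (- b)) \<le> (real m powr (1 - b) - real (m + n) powr (1 - b)) / (b - 1)"
  proof (induction n)
    case (Suc n)
    define x where "x = real (m + n)"
    have x: "1 \<le> x" using m by (simp add: x_def)
    have "\<exists>z>x. z < x + 1 \<and> - ((x + 1) powr (1 - b)) - - (x powr (1 - b)) = (x + 1 - x) * ((b - 1) * z powr (- b))"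
    proof (rule MVT2)
      fix z assume "x \<le> z" "z \<le> x + 1"
      then show "DERIV (\<lambda>z. - (z powr (1 - b))) z :> (b - 1) * z powr (- b)"
        using x by (auto intro!: derivative_eq_intros simp: algebra_simps)
    qed simp
    then obtain z where z: "x < z" "z < x + 1" "x powr (1 - b) - (x + 1) powr (1 - b) = (b - 1) * z powr (- b)"
      by auto
    have "(x + 1) powr (- b) \<le> z powr (- b)" using z x b by (intro powr_mono2') auto
    moreover have "z powr (- b) = (x powr (1 - b) - (x + 1) powr (1 - b)) / (b - 1)"
      using z(3) b by simp
    ultimately have "(x + 1) powr (- b) \<le> (x powr (1 - b) - (x + 1) powr (1 - b)) / (b - 1)" by simp
    moreover have "{m<..m + Suc n} = insert (m + Suc n) {m<..m + n}" by auto
    ultimately show ?case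
      using Suc by (simp add: x_def diff_divide_distrib add.commute[of 1])
  qed simp
  also have "\<dots> \<le> real m powr (1 - b) / (b - 1)" using b by (simp add: divide_right_mono)
  finally show ?thesis .
qed

text \<open>The sum is cut at about \<open>lam powr (- 1 / b)\<close>, where the eigenvalue bound
  reaches the order of \<open>lam\<close>. Up to there each term is at most 1; beyond, it is at most
  the eigenvalue divided by \<open>lam\<close>, and the tail estimate applies.\<close>

lemma effective_dimension_bound:
  assumes b: "1 < b" and C: "0 < C" and \<eta>: "0 < \<eta>"
  shows "\<exists>N0>0. \<forall>lam I \<mu>. 0 < lam \<longrightarrow> lam \<le> \<eta> \<longrightarrow> finite I \<longrightarrow>
    (\<forall>i\<in>I. 1 \<le> i \<and> 0 < \<mu> i \<and> \<mu> i \<le> C * real i powr (- b)) \<longrightarrow>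
    (\<Sum>i\<in>I. \<mu> i / (\<mu> i + lam)) \<le> N0 * lam powr (- 1 / b)"
proof (intro exI conjI allI impI)
  show N0: "0 < 1 + 2 * \<eta> powr (1 / b) + C / (b - 1)" using assms by (intro add_pos_nonneg add_nonneg_nonneg) auto
  fix lam :: real and I :: "nat set" and \<mu> :: "nat \<Rightarrow> real"
  assume lam: "0 < lam" "lam \<le> \<eta>" and I: "finite I" "\<forall>i\<in>I. 1 \<le> i \<and> 0 < \<mu> i \<and> \<mu> i \<le> C * real i powr (- b)"
  define a where "a = lam powr (- 1 / b)"
  have a: "0 < a" using lam by (simp add: a_def)
  define m where "m = nat \<lceil>a\<rceil>"
  have m: "a \<le> real m" "real m \<le> a + 1" "1 \<le> m"
    using a unfolding m_def by linarith+
  \<comment> \<open>As \<open>lam \<le> \<eta>\<close>, the rounding error 1 of the cut can be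
    charged to \<open>a\<close> itself; this is the origin of the summand with
    \<open>\<eta> powr (1 / b)\<close>.\<close>
  have one: "1 \<le> \<eta> powr (1 / b) * a"
  proof -
    have "lam powr (1 / b) \<le> \<eta> powr (1 / b)" using lam b by (intro powr_mono2) auto
    then have "lam powr (1 / b) * a \<le> \<eta> powr (1 / b) * a" using a by (intro mult_right_mono) auto
    moreover have "lam powr (1 / b) * a = 1" using lam by (simp add: a_def flip: powr_add)
    ultimately show ?thesis by simp
  qed
  have "(\<Sum>i\<in>I. \<mu> i / (\<mu> i + lam)) = (\<Sum>i\<in>I \<inter> {..m}. \<mu> i / (\<mu> i + lam)) + (\<Sum>i\<in>I - {..m}. \<mu> i / (\<mu> i + lam))"
    using I(1) by (rule sum.Int_Diff)
  also have "(\<Sum>i\<in>I \<inter> {..m}. \<mu> i / (\<mu> i + lam)) \<le> (\<Sum>i\<in>I \<inter> {..m}. 1)"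
    by (intro sum_mono) (use I lam in auto)
  also have "\<dots> \<le> real m"
  proof -
    have "I \<inter> {..m} \<subseteq> {1..m}" using I by auto
    from card_mono[OF _ this] show ?thesis by simp
  qed
  also have "(\<Sum>i\<in>I - {..m}. \<mu> i / (\<mu> i + lam)) \<le> (\<Sum>i\<in>I - {..m}. C / lam * real i powr (- b))"
  proof (intro sum_mono)
    fix i assume "i \<in> I - {..m}"
    then have \<mu>: "0 < \<mu> i" "\<mu> i \<le> C * real i powr (- b)" using I by auto
    have "\<mu> i / (\<mu> i + lam) \<le> \<mu> i / lam" using \<mu> lam by (intro divide_left_mono) auto
    also have "\<dots> \<le> C * real i powr (- b) / lam" using \<mu> lam by (intro divide_right_mono) auto
    finally show "\<mu> i / (\<mu> i + lam) \<le> C / lam * real i powr (- b)" by simp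
  qed
  also have "\<dots> \<le> (\<Sum>i\<in>{m<..m + Max (insert 0 I)}. C / lam * real i powr (- b))"
  proof (rule sum_mono2)
    show "I - {..m} \<subseteq> {m<..m + Max (insert 0 I)}"
    proof
      fix i assume i: "i \<in> I - {..m}"
      then have "i \<le> Max (insert 0 I)" using I(1) by (intro Max_ge) auto
      then show "i \<in> {m<..m + Max (insert 0 I)}" using i by auto
    qed
  qed (use C lam in auto)
  also have "\<dots> = C / lam * (\<Sum>i\<in>{m<..m + Max (insert 0 I)}. real i powr (- b))" by (simp add: sum_distrib_left)
  also have "\<dots> \<le> C / lam * (real m powr (1 - b) / (b - 1))"
    using C lam by (intro mult_left_mono sum_powr_tail b m) auto
  also have "\<dots> \<le> C / lam * (a powr (1 - b) / (b - 1))"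
    using C lam b a m by (intro mult_left_mono divide_right_mono powr_mono2') auto
  also have "\<dots> = C / (b - 1) * a"
  proof -
    have "a powr (1 - b) = a * lam"
    proof -
      have "a powr (1 - b) = lam powr (- 1 / b * (1 - b))" by (simp add: a_def powr_powr)
      also have "- 1 / b * (1 - b) = - 1 / b + 1" using b by (simp add: field_simps)
      also have "lam powr (- 1 / b + 1) = a * lam" unfolding a_def powr_add using lam by simp
      finally show ?thesis .
    qed
    then show ?thesis using lam by simp
  qed
  finally have "(\<Sum>i\<in>I. \<mu> i / (\<mu> i + lam)) \<le> real m + C / (b - 1) * a" by simp
  also have "\<dots> \<le> (1 + 2 * \<eta> powr (1 / b) + C / (b - 1)) * a"
    using m(2) one a by (simp add: algebra_simps)
  finally show "(\<Sum>i\<in>I. \<mu> i / (\<mu> i + lam)) \<le> (1 + 2 * \<eta> powr (1 / b) + C / (b - 1)) * lam powr (- 1 / b)"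
    by (simp add: a_def)
qed

section \<open>The population operators in coordinates\<close>

context compact_domain
begin

definition tens :: "(real \<Rightarrow> real) \<Rightarrow> (nat \<Rightarrow> (nat \<Rightarrow> real) \<Rightarrow> real) \<Rightarrow> nat \<Rightarrow> real \<times> (nat \<Rightarrow> real) \<Rightarrow> real" where
  "tens h f l = (\<lambda>(t, s). h t * f l s)"

lemma tens_H: "h \<in> L2 (leb S2) \<Longrightarrow> f \<in> K \<Longrightarrow> tens h f \<in> H"
  by (auto simp: dsum_def tens_def LL_meas_eq intro!: pr.L2_tensor)

lemma tens_hat: "h \<in> L2 (leb S2) \<Longrightarrow> f \<in> K \<Longrightarrow> hat (tens h f) j = L2_inner (leb S2) h (e j) *\<^sub>R kvec f"
proof (rule ell2_block_eqI)
  fix l k assume h: "h \<in> L2 (leb S2)" and f: "f \<in> K"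
  show "coord (hat (tens h f) j) (prod_encode (l, k)) = coord (L2_inner (leb S2) h (e j) *\<^sub>R kvec f) (prod_encode (l, k))"
    using h f by (simp add: coord_hat tens_H coord_kvec tens_def[of h f l]
        pr.L2_inner_tensor e.L2 b.L2 K_D)
qed

lemma hat_null: "u \<in> H \<Longrightarrow> L2_inner (leb S2) (e j) (e j) = 0 \<Longrightarrow> hat u j = 0"
  using hat_range_space[of u j] by (intro ell2_eqI) (simp add: range_space_def)

lemma hat_unit: "u \<in> H \<Longrightarrow> L2_inner (leb S2) (e j) (e j) *\<^sub>R hat u j = hat u j"
  using hat_null[of u j] e.unit[of j] by auto

text \<open>Tensoring with \<open>e j\<close> isolates the j-th coordinate, which gives enough test
  elements to identify an operator in coordinates.\<close>

lemma dinner_tens: "f \<in> K \<Longrightarrow> w \<in> H \<Longrightarrow> dinner p (LL_meas S1 S2) (tens (e j) f) w = kvec f \<bullet> hat w j"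
proof -
  assume f: "f \<in> K" and w: "w \<in> H"
  have "hat (tens (e j) f) i \<bullet> hat w i = (if i = j then kvec f \<bullet> hat w j else 0)" for i
  proof (cases "i = j")
    case True
    then show ?thesis
      using arg_cong[OF hat_unit[OF w, of j], of "\<lambda>y. kvec f \<bullet> y"] by (simp add: tens_hat e.L2 f)
  next
    case False
    then show ?thesis using e.orth[of j i] by (simp add: tens_hat e.L2 f)
  qed
  then have "(\<lambda>i. if i = j then kvec f \<bullet> hat w j else 0) sums dinner p (LL_meas S1 S2) (tens (e j) f) w"
    using hat_sums[OF tens_H[OF e.L2 f, of j] w] by simp
  moreover have "(\<lambda>i. if i = j then kvec f \<bullet> hat w j else 0) sums (kvec f \<bullet> hat w j)"
    using sums_single[of j "\<lambda>_. kvec f \<bullet> hat w j"] by simp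
  ultimately show ?thesis by (rule sums_unique2)
qed

lemma kvec_lincomb: "f \<in> K \<Longrightarrow> g \<in> K \<Longrightarrow> (\<lambda>l s. f l s + c * g l s) \<in> K \<and> kvec (\<lambda>l s. f l s + c * g l s) = kvec f + c *\<^sub>R kvec g"
proof
  assume f: "f \<in> K" and g: "g \<in> K"
  show fg: "(\<lambda>l s. f l s + c * g l s) \<in> K" using f g by (simp add: dsum_def L2_add L2_scale)
  show "kvec (\<lambda>l s. f l s + c * g l s) = kvec f + c *\<^sub>R kvec g"
  proof (rule ell2_block_eqI)
    fix l k
    show "coord (kvec (\<lambda>l s. f l s + c * g l s)) (prod_encode (l, k)) = coord (kvec f + c *\<^sub>R kvec g) (prod_encode (l, k))"
      using K_D[OF f] K_D[OF g] by (simp add: coord_kvec f g fg L2_inner_add L2_scale b.L2 L2_inner_scale)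
  qed
qed

lemma range_eqI:
  assumes "\<And>m. dead m \<Longrightarrow> coord x m = 0" "\<And>m. dead m \<Longrightarrow> coord y m = 0"
    and "\<And>f. f \<in> K \<Longrightarrow> kvec f \<bullet> x = kvec f \<bullet> y"
  shows "x = y"
proof -
  obtain f where "f \<in> K" "kvec f = x - y" using kvec_realize[of "x - y"] assms(1,2) by auto
  then have "(x - y) \<bullet> (x - y) = 0" using assms(3)[of f] by (simp add: inner_diff_right)
  then show ?thesis by simp
qed

lemma hat_dead: "u \<in> H \<Longrightarrow> dead m \<Longrightarrow> coord (hat u j) m = 0"
  using hat_range_space[of u j] by (simp add: range_space_def)

text \<open>For an eigenvector \<open>u\<close> the element \<open>T u - t u\<close> has norm 0. A
  bounded inverse \<open>R\<close> would send it to an element of norm 0, yet the result must agree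
  with \<open>u\<close>, whose j-th coordinate is nonzero.\<close>

lemma eigenvalue_in_spectrum:
  assumes T: "\<And>u. u \<in> H \<Longrightarrow> T u \<in> H" "\<And>u j. u \<in> H \<Longrightarrow> hat (T u) j = S (hat u j)"
    and S: "\<And>c. S (c *\<^sub>R y) = (c * t) *\<^sub>R y" and y: "y \<noteq> 0" "\<And>m. dead m \<Longrightarrow> coord y m = 0"
    and j: "L2_inner (leb S2) (e j) (e j) \<noteq> 0"
  shows "t \<in> spectrum_on p (LL_meas S1 S2) T"
  unfolding spectrum_on_def
proof (intro CollectI notI, elim exE)
  let ?N = "LL_meas S1 S2"
  fix R C
  assume R: "\<forall>u\<in>H. R u \<in> H \<and> dnorm p ?N (R u) \<le> C * dnorm p ?N u \<and>
     dnorm p ?N (ddiff (R (ddiff (T u) (dscale t u))) u) = 0 \<and>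
     dnorm p ?N (ddiff (ddiff (T (R u)) (dscale t (R u))) u) = 0"
  obtain f where f: "f \<in> K" "kvec f = y" using kvec_realize[OF y(2)] by blast
  define u where "u = tens (e j) f"
  have u: "u \<in> H" unfolding u_def by (rule tens_H[OF e.L2 f(1)])
  define d where "d = ddiff (T u) (dscale t u)"
  have su: "dscale t u \<in> H" "hat (dscale t u) i = t *\<^sub>R hat u i" for i
    using hat_scale[OF u, of t] by (auto simp: dscale_def)
  have d: "d \<in> H" unfolding d_def by (intro ddiff_dsum T u su)
  have hu: "hat u i = L2_inner (leb S2) (e j) (e i) *\<^sub>R y" for i
    by (simp add: u_def tens_hat e.L2 f)
  have hd: "hat d i = 0" for i
    by (simp add: d_def hat_ddiff T u su hu S mult.commute)
  have d0: "dnorm p ?N d = 0"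
    using sums_unique[OF hat_norm_sums[OF d]] by (simp add: hd)
  have Rd: "R d \<in> H" "dnorm p ?N (R d) \<le> 0" "dnorm p ?N (ddiff (R d) u) = 0"
    using R d u d0 by (auto simp: d_def)
  moreover have "0 \<le> dnorm p ?N (R d)" by (simp add: dnorm_def dinner_def sum_nonneg L2_inner_ge_0)
  ultimately have "dnorm p ?N (R d) = 0" by simp
  then have "hat (R d) j = 0" by (rule hat_eq_0[OF Rd(1)])
  moreover have "hat (ddiff (R d) u) j = 0" by (rule hat_eq_0[OF ddiff_dsum[OF Rd(1) u] Rd(3)])
  ultimately have "hat u j = 0" by (simp add: hat_ddiff Rd(1) u)
  then show False using j y(1) by (simp add: u_def tens_hat e.L2 f)
qed

end

section \<open>The random design\<close>

locale design = compact_domain p S1 S2 + prob_space M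
  for p :: nat and S1 S2 :: "real set" and M :: "'w measure" +
  fixes X :: "'w \<Rightarrow> real \<Rightarrow> real" and \<kappa> :: real
  assumes X: "L2_process M S1 X"
    and X_bound: "\<And>\<omega>. \<omega> \<in> space M \<Longrightarrow> (L2_norm (leb S1) (X \<omega>))\<^sup>2 \<le> \<kappa>"
begin

text \<open>Joint measurability makes the pairing with each fixed function measurable by Fubini, and
  these pairings generate \<open>L2_sigma\<close>.\<close>

lemma process_measurable:
  assumes "compact S" "L2_process M S Z" shows "Z \<in> M \<rightarrow>\<^sub>M L2_sigma (leb S)"
proof (rule measurable_L2_sigma)
  interpret S: finite_measure "leb S" by (rule finite_measure_leb) fact
  fix h assume h: "h \<in> L2 (leb S)"
  note [measurable] = L2_measurable[OF h]
  have [measurable]: "(\<lambda>(\<omega>, t). Z \<omega> t) \<in> borel_measurable (M \<Otimes>\<^sub>M leb S)"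
    using assms by (simp add: L2_process_def)
  have "(\<lambda>(\<omega>, t). Z \<omega> t * h t) \<in> borel_measurable (M \<Otimes>\<^sub>M leb S)" by measurable
  then show "(\<lambda>\<omega>. L2_inner (leb S) (Z \<omega>) h) \<in> borel_measurable M"
    unfolding L2_inner_def by (rule S.borel_measurable_lebesgue_integral)
qed (use assms in \<open>simp add: L2_process_def\<close>)

lemma X_L2: "\<omega> \<in> space M \<Longrightarrow> X \<omega> \<in> L2 (leb S1)"
  using X by (simp add: L2_process_def)

lemma X_meas: "X \<in> M \<rightarrow>\<^sub>M L2_sigma (leb S1)"
  by (rule process_measurable[OF S1 X])

abbreviation "\<xi> \<omega> \<equiv> chivec (X \<omega>)"
definition "\<kappa>\<^sub>p = (\<Sum>l\<le>p. \<kappa> ^ l)"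

sublocale second_moment M \<xi> \<kappa>\<^sub>p
proof
  show "(\<lambda>\<omega>. coord (\<xi> \<omega>) m) \<in> borel_measurable M" for m
    by (rule measurable_compose[OF X_meas measurable_chivec_coord])
  show "(norm (\<xi> \<omega>))\<^sup>2 \<le> \<kappa>\<^sub>p" if "\<omega> \<in> space M" for \<omega>
    unfolding chivec_norm[OF X_L2[OF that]] \<kappa>\<^sub>p_def
    by (intro sum_mono power_mono X_bound that) simp
qed

lemma chi_joint_measurable [measurable]: "(\<lambda>(\<omega>, s). chi (X \<omega>) l s) \<in> borel_measurable (M \<Otimes>\<^sub>M S_pow S1 l)"
proof -
  have Xm: "(\<lambda>(\<omega>, t). X \<omega> t) \<in> borel_measurable (M \<Otimes>\<^sub>M leb S1)"
    using X by (simp add: L2_process_def)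
  have "(\<lambda>z. X (fst z) (snd z i)) \<in> borel_measurable (M \<Otimes>\<^sub>M S_pow S1 l)" if "i < l" for i
  proof -
    have "(\<lambda>z. (fst z, snd z i)) \<in> M \<Otimes>\<^sub>M S_pow S1 l \<rightarrow>\<^sub>M M \<Otimes>\<^sub>M leb S1"
    proof -
      have "(\<lambda>s. s i) \<in> S_pow S1 l \<rightarrow>\<^sub>M leb S1"
        unfolding S_pow_def by (rule measurable_component_singleton) (use that in simp)
      then show ?thesis by simp
    qed
    from measurable_compose[OF this Xm] show ?thesis by simp
  qed
  then show ?thesis unfolding chi_def split_beta' by (intro borel_measurable_prod) auto
qed

lemma chi_norm_le: "\<omega> \<in> space M \<Longrightarrow> L2_inner (S_pow S1 l) (chi (X \<omega>) l) (chi (X \<omega>) l) \<le> \<kappa> ^ l"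
  using chi_inner[OF S1 X_L2, of \<omega> l] power_mono[OF X_bound, of \<omega> l]
  by (simp add: L2_norm_def L2_inner_ge_0)

text \<open>For fixed \<open>\<omega>\<close>, Parseval in \<open>t\<close> writes the squared norm
  as the sum of the squares of \<open>\<xi> \<omega> \<bullet> hat u j\<close>, so the bound on
  \<open>\<xi>\<close> controls it uniformly in \<open>\<omega>\<close>.\<close>

lemma A_op_L2: "u \<in> H \<Longrightarrow> A_op p S1 X u \<in> L2 (M \<Otimes>\<^sub>M leb S2)"
proof (rule L2_I_nn_integral)
  assume u: "u \<in> H"
  have "(\<lambda>z. LINT s|S_pow S1 l. u l (snd z, s) * chi (X (fst z)) l s) \<in> borel_measurable (M \<Otimes>\<^sub>M leb S2)"
    if "l \<in> {..p}" for l
  proof -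
    have [measurable]: "u l \<in> borel_measurable (leb S2 \<Otimes>\<^sub>M S_pow S1 l)"
      using H_D[OF u] that by (auto dest: L2_measurable)
    have [measurable]: "(\<lambda>z. chi (X (fst z)) l (snd z)) \<in> borel_measurable (M \<Otimes>\<^sub>M S_pow S1 l)"
      using chi_joint_measurable[of l] by (simp add: split_beta')
    have "(\<lambda>w. chi (X (fst (fst w))) l (snd w)) \<in> borel_measurable ((M \<Otimes>\<^sub>M leb S2) \<Otimes>\<^sub>M S_pow S1 l)"
      using measurable_compose[of "\<lambda>w. (fst (fst w), snd w)" "(M \<Otimes>\<^sub>M leb S2) \<Otimes>\<^sub>M S_pow S1 l" "M \<Otimes>\<^sub>M S_pow S1 l"
        "\<lambda>z. chi (X (fst z)) l (snd z)" borel] by simp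
    then have "(\<lambda>(z, s). u l (snd z, s) * chi (X (fst z)) l s) \<in> borel_measurable ((M \<Otimes>\<^sub>M leb S2) \<Otimes>\<^sub>M S_pow S1 l)"
      by (simp add: split_beta')
    then show ?thesis by (rule b.borel_measurable_lebesgue_integral)
  qed
  then show m [measurable]: "A_op p S1 X u \<in> borel_measurable (M \<Otimes>\<^sub>M leb S2)"
    unfolding A_op_def B_op_def split_beta' by (intro borel_measurable_sum) auto
  have "(\<integral>\<^sup>+z. ennreal ((A_op p S1 X u z)\<^sup>2) \<partial>(M \<Otimes>\<^sub>M leb S2)) =
      (\<integral>\<^sup>+\<omega>. \<integral>\<^sup>+t. ennreal ((A_op p S1 X u (\<omega>, t))\<^sup>2) \<partial>leb S2 \<partial>M)"
    by (rule e.nn_integral_fst[symmetric]) measurable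
  also have "\<dots> \<le> (\<integral>\<^sup>+\<omega>. ennreal (\<kappa>\<^sub>p * (dnorm p (LL_meas S1 S2) u)\<^sup>2) \<partial>M)"
  proof (rule nn_integral_mono)
    fix \<omega> assume \<omega>: "\<omega> \<in> space M"
    let ?B = "B_op p S1 (X \<omega>) u"
    have "(\<integral>\<^sup>+t. ennreal ((A_op p S1 X u (\<omega>, t))\<^sup>2) \<partial>leb S2) = ennreal (L2_inner (leb S2) ?B ?B)"
      using L2_norm_ennreal[OF B_op_L2[OF X_L2[OF \<omega>] u]] by (simp add: A_op_def)
    also have "L2_inner (leb S2) ?B ?B \<le> \<kappa>\<^sub>p * (dnorm p (LL_meas S1 S2) u)\<^sup>2"
    proof (rule sums_le[OF _ e.frame_parseval[OF B_op_L2[OF X_L2[OF \<omega>] u]] sums_mult[OF hat_norm_sums[OF u]]])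
      show "(L2_inner (leb S2) ?B (e j))\<^sup>2 \<le> \<kappa>\<^sub>p * (norm (hat u j))\<^sup>2" for j
        using inner_square_bound[OF \<omega>, of "hat u j"] by (simp add: B_op_coeff X_L2 \<omega> u inner_commute)
    qed
    finally show "(\<integral>\<^sup>+t. ennreal ((A_op p S1 X u (\<omega>, t))\<^sup>2) \<partial>leb S2) \<le> ennreal (\<kappa>\<^sub>p * (dnorm p (LL_meas S1 S2) u)\<^sup>2)"
      by (simp add: ennreal_leI)
  qed
  also have "\<dots> < \<infinity>" by (simp add: emeasure_space_1)
  finally show "(\<integral>\<^sup>+z. ennreal ((A_op p S1 X u z)\<^sup>2) \<partial>(M \<Otimes>\<^sub>M leb S2)) < \<infinity>" .
qed

text \<open>An explicit adjoint is needed because \<open>dadjoint\<close> is a choice that carries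
  information only if a witness exists.\<close>

lemma A_op_adjoint:
  assumes h: "h \<in> L2 (M \<Otimes>\<^sub>M leb S2)"
  shows "\<exists>w\<in>H. \<forall>u\<in>H. L2_inner (M \<Otimes>\<^sub>M leb S2) (A_op p S1 X u) h = dinner p (LL_meas S1 S2) u w"
proof -
  interpret MG: finite_pair M "leb S2" ..
  note [measurable] = L2_measurable[OF h]
  define F where "F l z = h (fst z, fst (snd z)) * chi (X (fst z)) l (snd (snd z))" for l and z :: "'w \<times> real \<times> (nat \<Rightarrow> real)"
  have F: "F l \<in> L2 (M \<Otimes>\<^sub>M (leb S2 \<Otimes>\<^sub>M S_pow S1 l))" for l
  proof (rule L2_I_nn_integral)
    interpret MP: finite_pair M "leb S2 \<Otimes>\<^sub>M S_pow S1 l" ..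
    have cm [measurable]: "(\<lambda>z. chi (X (fst z)) l (snd z)) \<in> borel_measurable (M \<Otimes>\<^sub>M S_pow S1 l)"
      using chi_joint_measurable[of l] by (simp add: split_beta')
    have "(\<lambda>z. chi (X (fst z)) l (snd (snd z))) \<in> borel_measurable (M \<Otimes>\<^sub>M (leb S2 \<Otimes>\<^sub>M S_pow S1 l))"
      using measurable_compose[of "\<lambda>w. (fst w, snd (snd w))" "M \<Otimes>\<^sub>M (leb S2 \<Otimes>\<^sub>M S_pow S1 l)" "M \<Otimes>\<^sub>M S_pow S1 l"
        "\<lambda>z. chi (X (fst z)) l (snd z)" borel] by simp
    then show Fm [measurable]: "F l \<in> borel_measurable (M \<Otimes>\<^sub>M (leb S2 \<Otimes>\<^sub>M S_pow S1 l))"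
      unfolding F_def[abs_def] by measurable
    have "(\<integral>\<^sup>+z. ennreal ((F l z)\<^sup>2) \<partial>(M \<Otimes>\<^sub>M (leb S2 \<Otimes>\<^sub>M S_pow S1 l))) =
        (\<integral>\<^sup>+\<omega>. \<integral>\<^sup>+z. ennreal ((F l (\<omega>, z))\<^sup>2) \<partial>(leb S2 \<Otimes>\<^sub>M S_pow S1 l) \<partial>M)"
    proof -
      have "sigma_finite_measure (leb S2 \<Otimes>\<^sub>M S_pow S1 l)" by unfold_locales
      then show ?thesis by (rule sigma_finite_measure.nn_integral_fst[symmetric]) measurable
    qed
    also have "\<dots> \<le> (\<integral>\<^sup>+\<omega>. ennreal (\<kappa> ^ l) * (\<integral>\<^sup>+t. ennreal ((h (\<omega>, t))\<^sup>2) \<partial>leb S2) \<partial>M)"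
    proof (rule nn_integral_mono)
      fix \<omega> assume \<omega>: "\<omega> \<in> space M"
      note [measurable] = L2_measurable[OF chi_L2[OF S1 X_L2[OF \<omega>], of l]]
      have [measurable]: "(\<lambda>t. h (\<omega>, t)) \<in> borel_measurable (leb S2)" using \<omega> by measurable
      have "(\<integral>\<^sup>+z. ennreal ((F l (\<omega>, z))\<^sup>2) \<partial>(leb S2 \<Otimes>\<^sub>M S_pow S1 l)) =
          (\<integral>\<^sup>+t. \<integral>\<^sup>+s. ennreal ((h (\<omega>, t))\<^sup>2) * ennreal ((chi (X \<omega>) l s)\<^sup>2) \<partial>S_pow S1 l \<partial>leb S2)"
        by (subst b.nn_integral_fst[symmetric]) (auto simp: F_def power_mult_distrib ennreal_mult)
      also have "\<dots> = (\<integral>\<^sup>+t. ennreal ((h (\<omega>, t))\<^sup>2) * ennreal (L2_inner (S_pow S1 l) (chi (X \<omega>) l) (chi (X \<omega>) l)) \<partial>leb S2)"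
        by (simp add: nn_integral_cmult L2_norm_ennreal[OF chi_L2[OF S1 X_L2[OF \<omega>]]])
      also have "\<dots> \<le> (\<integral>\<^sup>+t. ennreal ((h (\<omega>, t))\<^sup>2) * ennreal (\<kappa> ^ l) \<partial>leb S2)"
        by (intro nn_integral_mono mult_left_mono ennreal_leI chi_norm_le \<omega>) simp
      also have "\<dots> = ennreal (\<kappa> ^ l) * (\<integral>\<^sup>+t. ennreal ((h (\<omega>, t))\<^sup>2) \<partial>leb S2)"
        by (subst nn_integral_multc) (auto simp: mult.commute)
      finally show "(\<integral>\<^sup>+z. ennreal ((F l (\<omega>, z))\<^sup>2) \<partial>(leb S2 \<Otimes>\<^sub>M S_pow S1 l)) \<le>
          ennreal (\<kappa> ^ l) * (\<integral>\<^sup>+t. ennreal ((h (\<omega>, t))\<^sup>2) \<partial>leb S2)" .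
    qed
    also have "\<dots> = ennreal (\<kappa> ^ l) * (\<integral>\<^sup>+\<omega>. \<integral>\<^sup>+t. ennreal ((h (\<omega>, t))\<^sup>2) \<partial>leb S2 \<partial>M)"
      by (rule nn_integral_cmult) measurable
    also have "(\<integral>\<^sup>+\<omega>. \<integral>\<^sup>+t. ennreal ((h (\<omega>, t))\<^sup>2) \<partial>leb S2 \<partial>M) = (\<integral>\<^sup>+z. ennreal ((h z)\<^sup>2) \<partial>(M \<Otimes>\<^sub>M leb S2))"
      by (rule e.nn_integral_fst) measurable
    also have "\<dots> = ennreal (L2_inner (M \<Otimes>\<^sub>M leb S2) h h)" using L2_norm_ennreal[OF h] by simp
    finally show "(\<integral>\<^sup>+z. ennreal ((F l z)\<^sup>2) \<partial>(M \<Otimes>\<^sub>M (leb S2 \<Otimes>\<^sub>M S_pow S1 l))) < \<infinity>"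
      by (simp add: ennreal_mult_less_top le_less_trans)
  qed
  \<comment> \<open>The components are the expectations of \<open>h\<close> times
    \<open>chi\<close>; the factor 1 puts them into the form of a slice.\<close>
  define w where "w l z = (LINT \<omega>|M. F l (\<omega>, z) * 1)" for l z
  have one: "(\<lambda>_. 1) \<in> L2 M" by (simp add: L2_def)
  have pairM: "finite_pair M (leb S2 \<Otimes>\<^sub>M S_pow S1 l)" for l ..
  have w: "w l \<in> L2 (leb S2 \<Otimes>\<^sub>M S_pow S1 l)" for l
    unfolding w_def[abs_def] by (rule finite_pair.L2_slice2[OF pairM F one])
  have wu: "L2_inner (leb S2 \<Otimes>\<^sub>M S_pow S1 l) (w l) v = (LINT \<omega>|M. LINT z|(leb S2 \<Otimes>\<^sub>M S_pow S1 l). F l (\<omega>, z) * v z)"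
    and wi: "integrable M (\<lambda>\<omega>. LINT z|(leb S2 \<Otimes>\<^sub>M S_pow S1 l). F l (\<omega>, z) * v z)"
    if v: "v \<in> L2 (leb S2 \<Otimes>\<^sub>M S_pow S1 l)" for l v
  proof -
    interpret MP: finite_pair M "leb S2 \<Otimes>\<^sub>M S_pow S1 l" by (rule pairM)
    have i: "integrable (M \<Otimes>\<^sub>M (leb S2 \<Otimes>\<^sub>M S_pow S1 l)) (\<lambda>(\<omega>, z). F l (\<omega>, z) * v z)"
      using L2_mult[OF F MP.L2_tensor[OF one v]] by (simp add: split_beta')
    show "L2_inner (leb S2 \<Otimes>\<^sub>M S_pow S1 l) (w l) v = (LINT \<omega>|M. LINT z|(leb S2 \<Otimes>\<^sub>M S_pow S1 l). F l (\<omega>, z) * v z)"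
      unfolding w_def[abs_def] MP.L2_slice2_inner[OF F one v] MP.integral_fst[OF i]
      by (simp add: L2_inner_def split_beta')
    show "integrable M (\<lambda>\<omega>. LINT z|(leb S2 \<Otimes>\<^sub>M S_pow S1 l). F l (\<omega>, z) * v z)"
      by (rule MP.integrable_fst[OF i])
  qed
  show ?thesis
  proof (intro bexI ballI)
    show wH: "w \<in> H" by (simp add: dsum_def LL_meas_eq w)
    fix u assume u: "u \<in> H"
    have i: "integrable (M \<Otimes>\<^sub>M leb S2) (\<lambda>(\<omega>, t). A_op p S1 X u (\<omega>, t) * h (\<omega>, t))"
      using L2_mult[OF A_op_L2[OF u] h] by (simp add: split_beta')
    have "L2_inner (M \<Otimes>\<^sub>M leb S2) (A_op p S1 X u) h = (LINT \<omega>|M. LINT t|leb S2. A_op p S1 X u (\<omega>, t) * h (\<omega>, t))"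
      unfolding MG.integral_fst[OF i] by (simp add: L2_inner_def split_beta')
    also have "\<dots> = (LINT \<omega>|M. (\<Sum>l\<le>p. LINT z|(leb S2 \<Otimes>\<^sub>M S_pow S1 l). F l (\<omega>, z) * u l z))"
    proof (rule integral_cong_AE)
      show "(\<lambda>\<omega>. LINT t|leb S2. A_op p S1 X u (\<omega>, t) * h (\<omega>, t)) \<in> borel_measurable M"
        using MG.integrable_fst[OF i] by (rule borel_measurable_integrable)
      show "(\<lambda>\<omega>. \<Sum>l\<le>p. LINT z|(leb S2 \<Otimes>\<^sub>M S_pow S1 l). F l (\<omega>, z) * u l z) \<in> borel_measurable M"
        using wi[OF H_D[OF u]] by (intro borel_measurable_sum) auto
      show "AE \<omega> in M. (LINT t|leb S2. A_op p S1 X u (\<omega>, t) * h (\<omega>, t)) =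
          (\<Sum>l\<le>p. LINT z|(leb S2 \<Otimes>\<^sub>M S_pow S1 l). F l (\<omega>, z) * u l z)"
        using MG.AE_integrable_fst'[OF L2_square[OF h]] AE_space
      proof eventually_elim
        case (elim \<omega>)
        then have h\<omega>: "(\<lambda>t. h (\<omega>, t)) \<in> L2 (leb S2)" by (simp add: L2_def)
        show ?case
          using B_op_inner[OF X_L2 u h\<omega>, of \<omega>] elim
          by (simp add: A_op_def L2_inner_def F_def split_beta' mult.commute)
      qed
    qed
    also have "\<dots> = (\<Sum>l\<le>p. LINT \<omega>|M. LINT z|(leb S2 \<Otimes>\<^sub>M S_pow S1 l). F l (\<omega>, z) * u l z)"
      by (rule Bochner_Integration.integral_sum) (use wi[OF H_D[OF u]] in auto)
    also have "\<dots> = (\<Sum>l\<le>p. L2_inner (leb S2 \<Otimes>\<^sub>M S_pow S1 l) (w l) (u l))"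
      by (intro sum.cong refl) (use wu[OF H_D[OF u]] in auto)
    also have "\<dots> = dinner p (LL_meas S1 S2) u w"
      by (simp add: dinner_def LL_meas_eq L2_inner_commute)
    finally show "L2_inner (M \<Otimes>\<^sub>M leb S2) (A_op p S1 X u) h = dinner p (LL_meas S1 S2) u w" .
  qed
qed

lemma AA_op_H: "u \<in> H \<Longrightarrow> AA_op M p S1 S2 X u \<in> H"
  and AA_op_inner: "u \<in> H \<Longrightarrow> v \<in> H \<Longrightarrow> dinner p (LL_meas S1 S2) v (AA_op M p S1 S2 X u) =
    L2_inner (M \<Otimes>\<^sub>M leb S2) (A_op p S1 X v) (A_op p S1 X u)"
proof -
  let ?P = "\<lambda>T'. \<forall>h\<in>L2 (M \<Otimes>\<^sub>M leb S2). T' h \<in> H \<and>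
     (\<forall>u\<in>H. L2_inner (M \<Otimes>\<^sub>M leb S2) (A_op p S1 X u) h = dinner p (LL_meas S1 S2) u (T' h))"
  have "\<exists>T'. ?P T'" using A_op_adjoint by metis
  then have "?P (dadjoint p (LL_meas S1 S2) (M \<Otimes>\<^sub>M leb S2) (A_op p S1 X))"
    unfolding dadjoint_def by (rule someI_ex)
  then show "u \<in> H \<Longrightarrow> AA_op M p S1 S2 X u \<in> H"
    and "u \<in> H \<Longrightarrow> v \<in> H \<Longrightarrow> dinner p (LL_meas S1 S2) v (AA_op M p S1 S2 X u) =
    L2_inner (M \<Otimes>\<^sub>M leb S2) (A_op p S1 X v) (A_op p S1 X u)"
    using A_op_L2 by (auto simp: AA_op_def)
qed

lemma Gam_dead: "dead m \<Longrightarrow> coord (Gam y) m = 0"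
proof -
  assume m: "dead m"
  have "coord (Gam y) m = expectation (\<lambda>\<omega>. 0)"
    unfolding coord_Gam
    by (rule Bochner_Integration.integral_cong) (use m in \<open>auto simp: inner_unit_vec chivec_def kvec_dead chi_K X_L2\<close>)
  then show ?thesis by simp
qed

text \<open>Testing with \<open>tens (e j) f\<close> reduces the claim to the weak form of
  \<open>Gam\<close>; in the Parseval sum over \<open>t\<close> only the index \<open>j\<close>
  survives.\<close>

lemma AA_op_hat: "u \<in> H \<Longrightarrow> hat (AA_op M p S1 S2 X u) j = Gam (hat u j)"
proof (rule range_eqI)
  assume u: "u \<in> H"
  fix f assume f: "f \<in> K"
  interpret MG: finite_pair M "leb S2" ..
  let ?v = "tens (e j) f"
  have v: "?v \<in> H" by (rule tens_H[OF e.L2 f])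
  have "kvec f \<bullet> hat (AA_op M p S1 S2 X u) j = L2_inner (M \<Otimes>\<^sub>M leb S2) (A_op p S1 X ?v) (A_op p S1 X u)"
    using dinner_tens[OF f AA_op_H[OF u], of j] AA_op_inner[OF u v] by simp
  also have "\<dots> = (LINT \<omega>|M. LINT t|leb S2. A_op p S1 X ?v (\<omega>, t) * A_op p S1 X u (\<omega>, t))"
  proof -
    have i: "integrable (M \<Otimes>\<^sub>M leb S2) (\<lambda>(\<omega>, t). A_op p S1 X ?v (\<omega>, t) * A_op p S1 X u (\<omega>, t))"
      using L2_mult[OF A_op_L2[OF v] A_op_L2[OF u]] by (simp add: split_beta')
    show ?thesis unfolding MG.integral_fst[OF i] by (simp add: L2_inner_def split_beta')
  qed
  also have "\<dots> = expectation (\<lambda>\<omega>. (\<xi> \<omega> \<bullet> hat u j) * (\<xi> \<omega> \<bullet> kvec f))"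
  proof (rule Bochner_Integration.integral_cong)
    fix \<omega> assume \<omega>: "\<omega> \<in> space M"
    note x = X_L2[OF \<omega>]
    have "(\<lambda>i. L2_inner (leb S2) (B_op p S1 (X \<omega>) ?v) (e i) * L2_inner (leb S2) (B_op p S1 (X \<omega>) u) (e i)) sums
        L2_inner (leb S2) (B_op p S1 (X \<omega>) ?v) (B_op p S1 (X \<omega>) u)"
      by (rule e.frame_sums[OF B_op_L2[OF x v] B_op_L2[OF x u]])
    moreover have "L2_inner (leb S2) (B_op p S1 (X \<omega>) ?v) (e i) * L2_inner (leb S2) (B_op p S1 (X \<omega>) u) (e i) =
        (if i = j then (\<xi> \<omega> \<bullet> hat u j) * (\<xi> \<omega> \<bullet> kvec f) else 0)" for i
      using e.orth[of j i] e.unit[of j] hat_null[OF u, of j]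
      by (auto simp: B_op_coeff[OF x] v u tens_hat e.L2 f inner_commute)
    ultimately have "L2_inner (leb S2) (B_op p S1 (X \<omega>) ?v) (B_op p S1 (X \<omega>) u) = (\<xi> \<omega> \<bullet> hat u j) * (\<xi> \<omega> \<bullet> kvec f)"
      using sums_unique2[OF _ sums_single[of j "\<lambda>_. (\<xi> \<omega> \<bullet> hat u j) * (\<xi> \<omega> \<bullet> kvec f)"]] by simp
    then show "(LINT t|leb S2. A_op p S1 X ?v (\<omega>, t) * A_op p S1 X u (\<omega>, t)) = (\<xi> \<omega> \<bullet> hat u j) * (\<xi> \<omega> \<bullet> kvec f)"
      by (simp add: A_op_def L2_inner_def)
  qed simp
  also have "\<dots> = kvec f \<bullet> Gam (hat u j)" by (simp add: Gam_inner inner_commute[of "kvec f"])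
  finally show "kvec f \<bullet> hat (AA_op M p S1 S2 X u) j = kvec f \<bullet> Gam (hat u j)" .
qed (auto simp: Gam_dead hat_dead AA_op_H)

text \<open>The operator whose eigenvalues are assumed to decay is, in coordinates, the same
  \<open>Gam\<close> that describes the model operator by \<open>AA_op_hat\<close>. The proof is
  Fubini between the expectation and the inner product.\<close>

lemma Gamma_op_kvec:
  assumes f: "f \<in> K" shows "Gamma_op M p S1 X f \<in> K" "kvec (Gamma_op M p S1 X f) = Gam (kvec f)"
proof -
  have pairM: "finite_pair M (S_pow S1 l)" for l ..
  have F: "(\<lambda>z. chi (X (fst z)) l (snd z)) \<in> L2 (M \<Otimes>\<^sub>M S_pow S1 l)" for l
  proof (rule L2_I_nn_integral)
    show cm [measurable]: "(\<lambda>z. chi (X (fst z)) l (snd z)) \<in> borel_measurable (M \<Otimes>\<^sub>M S_pow S1 l)"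
      using chi_joint_measurable[of l] by (simp add: split_beta')
    have "(\<integral>\<^sup>+z. ennreal ((chi (X (fst z)) l (snd z))\<^sup>2) \<partial>(M \<Otimes>\<^sub>M S_pow S1 l)) =
        (\<integral>\<^sup>+\<omega>. \<integral>\<^sup>+s. ennreal ((chi (X \<omega>) l s)\<^sup>2) \<partial>S_pow S1 l \<partial>M)"
      by (subst b.nn_integral_fst[symmetric]) auto
    also have "\<dots> \<le> (\<integral>\<^sup>+\<omega>. ennreal (\<kappa> ^ l) \<partial>M)"
      by (intro nn_integral_mono) (auto simp: L2_norm_ennreal[symmetric] chi_L2[OF S1] X_L2 chi_norm_le ennreal_leI)
    finally show "(\<integral>\<^sup>+z. ennreal ((chi (X (fst z)) l (snd z))\<^sup>2) \<partial>(M \<Otimes>\<^sub>M S_pow S1 l)) < \<infinity>"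
      by (simp add: emeasure_space_1 le_less_trans)
  qed
  define c where "c \<omega> = \<xi> \<omega> \<bullet> kvec f" for \<omega>
  have c: "c \<in> L2 M" unfolding c_def[abs_def] by (rule inner_L2)
  have eq: "Gamma_op M p S1 X f l = (\<lambda>s. LINT \<omega>|M. chi (X \<omega>) l s * c \<omega>)" for l
    unfolding Gamma_op_def
    by (rule ext, rule Bochner_Integration.integral_cong)
      (auto simp: c_def chivec_def kvec_inner chi_K X_L2 f)
  have sl: "(\<lambda>s. LINT \<omega>|M. chi (X \<omega>) l s * c \<omega>) \<in> L2 (S_pow S1 l)" for l
    using finite_pair.L2_slice2[OF pairM F c] by simp
  then show GK: "Gamma_op M p S1 X f \<in> K" by (simp add: dsum_def eq)
  show "kvec (Gamma_op M p S1 X f) = Gam (kvec f)"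
  proof (rule range_eqI)
    fix g assume g: "g \<in> K"
    have i: "integrable (M \<Otimes>\<^sub>M S_pow S1 l) (\<lambda>(\<omega>, s). chi (X \<omega>) l s * (c \<omega> * g l s))" if "l \<le> p" for l
      using L2_mult[OF F finite_pair.L2_tensor[OF pairM c K_D[OF g that]]] by (simp add: split_beta')
    have lin: "L2_inner (S_pow S1 l) (Gamma_op M p S1 X f l) (g l) =
        (LINT \<omega>|M. c \<omega> * L2_inner (S_pow S1 l) (chi (X \<omega>) l) (g l))" (is "?L = ?R")
      and int: "integrable M (\<lambda>\<omega>. c \<omega> * L2_inner (S_pow S1 l) (chi (X \<omega>) l) (g l))" if l: "l \<le> p" for l
    proof -
      interpret MP: finite_pair M "S_pow S1 l" by (rule pairM)
      have inner: "(LINT s|S_pow S1 l. chi (X \<omega>) l s * (c \<omega> * g l s)) = c \<omega> * L2_inner (S_pow S1 l) (chi (X \<omega>) l) (g l)" for \<omega>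
        unfolding L2_inner_def by (subst Bochner_Integration.integral_mult_right_zero[symmetric]) (simp add: mult.left_commute)
      have "?L = L2_inner (M \<Otimes>\<^sub>M S_pow S1 l) (\<lambda>z. chi (X (fst z)) l (snd z)) (\<lambda>(\<omega>, s). c \<omega> * g l s)"
        unfolding eq using MP.L2_slice2_inner[OF F c K_D[OF g l]] by simp
      also have "\<dots> = (LINT \<omega>|M. LINT s|S_pow S1 l. chi (X \<omega>) l s * (c \<omega> * g l s))"
        unfolding MP.integral_fst[OF i[OF l]] by (simp add: L2_inner_def split_beta')
      finally show "?L = ?R" by (simp add: inner)
      show "integrable M (\<lambda>\<omega>. c \<omega> * L2_inner (S_pow S1 l) (chi (X \<omega>) l) (g l))"
        using MP.integrable_fst[OF i[OF l]] by (simp add: inner)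
    qed
    have "kvec g \<bullet> kvec (Gamma_op M p S1 X f) = (\<Sum>l\<le>p. L2_inner (S_pow S1 l) (Gamma_op M p S1 X f l) (g l))"
      by (simp add: kvec_inner g GK dinner_def L2_inner_commute)
    also have "\<dots> = (\<Sum>l\<le>p. LINT \<omega>|M. c \<omega> * L2_inner (S_pow S1 l) (chi (X \<omega>) l) (g l))"
      by (intro sum.cong refl) (simp add: lin)
    also have "\<dots> = (LINT \<omega>|M. (\<Sum>l\<le>p. c \<omega> * L2_inner (S_pow S1 l) (chi (X \<omega>) l) (g l)))"
      by (rule Bochner_Integration.integral_sum[symmetric]) (use int in auto)
    also have "\<dots> = expectation (\<lambda>\<omega>. (\<xi> \<omega> \<bullet> kvec f) * (\<xi> \<omega> \<bullet> kvec g))"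
      by (rule Bochner_Integration.integral_cong)
        (auto simp: c_def chivec_def kvec_inner chi_K X_L2 f g dinner_def sum_distrib_left)
    also have "\<dots> = kvec g \<bullet> Gam (kvec f)" by (simp add: Gam_inner inner_commute[of "kvec g"])
    finally show "kvec g \<bullet> kvec (Gamma_op M p S1 X f) = kvec g \<bullet> Gam (kvec f)" .
  qed (auto simp: Gam_dead kvec_dead GK)
qed

text \<open>For a nonzero eigenvalue the eigenvector lies in the range of \<open>Gam\<close>, so its
  dead coordinates vanish and it comes from a function.\<close>

lemma eigenvector_lift:
  assumes y: "Gam y = t *\<^sub>R y" and t: "t \<noteq> 0"
  shows "\<exists>f\<in>eigenspace p (S_pow S1) (Gamma_op M p S1 X) t. f \<in> K \<and> kvec f = y"
proof -
  have "coord y m = 0" if "dead m" for m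
  proof -
    have "t * coord y m = 0" using Gam_dead[OF that, of y] by (simp add: y)
    then show ?thesis using t by simp
  qed
  then obtain f where f: "f \<in> K" "kvec f = y" using kvec_realize by blast
  let ?G = "Gamma_op M p S1 X f"
  have "ddiff ?G (dscale t f) = (\<lambda>l s. ?G l s + (- t) * f l s)" by (simp add: ddiff_def dscale_def)
  then have d: "ddiff ?G (dscale t f) \<in> K" "kvec (ddiff ?G (dscale t f)) = 0"
    using kvec_lincomb[OF Gamma_op_kvec(1)[OF f(1)] f(1), of "- t"] Gamma_op_kvec(2)[OF f(1)] by (auto simp: f(2) y)
  then have "dinner p (S_pow S1) (ddiff ?G (dscale t f)) (ddiff ?G (dscale t f)) = 0"
    using kvec_inner[OF d(1) d(1)] by simp
  with f show ?thesis by (auto simp: eigenspace_def dnorm_def)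
qed

text \<open>The lifted eigenvectors form an orthonormal family in the eigenspace, whose dimension is
  the multiplicity in the list \<mu>.\<close>

lemma eigenvalue_count:
  assumes x: "onb x" "\<And>i. Gam (x i) = \<tau> i *\<^sub>R x i" and ev: "eigenvalue_list p (S_pow S1) (Gamma_op M p S1 X) \<mu>"
    and t: "t \<noteq> 0" and I: "finite I" "\<And>i. i \<in> I \<Longrightarrow> \<tau> i = t \<and> x i \<noteq> 0"
  shows "card I \<le> card {i. 1 \<le> i \<and> \<mu> i = t}"
proof -
  interpret x: onb x by fact
  have "\<forall>i\<in>I. \<exists>f. f \<in> eigenspace p (S_pow S1) (Gamma_op M p S1 X) t \<and> f \<in> K \<and> kvec f = x i"
    using eigenvector_lift[OF _ t] x(2) I(2) by metis
  then obtain f where f: "\<And>i. i \<in> I \<Longrightarrow> f i \<in> eigenspace p (S_pow S1) (Gamma_op M p S1 X) t"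
    "\<And>i. i \<in> I \<Longrightarrow> f i \<in> K" "\<And>i. i \<in> I \<Longrightarrow> kvec (f i) = x i" by metis
  obtain h where h: "bij_betw h {0..<card I} I" using ex_bij_betw_nat_finite[OF I(1)] by blast
  have hI: "h i \<in> I" if "i < card I" for i using h that by (auto simp: bij_betw_def)
  have hinj: "h i = h j \<longleftrightarrow> i = j" if "i < card I" "j < card I" for i j
    using h that by (auto simp: bij_betw_def inj_on_def)
  have "enat (card I) \<le> ddim p (S_pow S1) (eigenspace p (S_pow S1) (Gamma_op M p S1 X) t)"
    unfolding ddim_def
  proof (rule Sup_upper, rule CollectI, rule exI[of _ "card I"], intro conjI exI[of _ "\<lambda>i. f (h i)"] allI impI refl)
    show "f (h i) \<in> eigenspace p (S_pow S1) (Gamma_op M p S1 X) t" if "i < card I" for i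
      by (rule f(1)[OF hI[OF that]])
    fix i j assume ij: "i < card I" "j < card I"
    have "dinner p (S_pow S1) (f (h i)) (f (h j)) = x (h i) \<bullet> x (h j)"
      using kvec_inner[OF f(2)[OF hI[OF ij(1)]] f(2)[OF hI[OF ij(2)]]] by (simp add: f(3) hI ij)
    also have "\<dots> = (if i = j then 1 else 0)"
      using x.unit I(2)[OF hI[OF ij(1)]] x.orth hinj[OF ij] by auto
    finally show "dinner p (S_pow S1) (f (h i)) (f (h j)) = (if i = j then 1 else 0)" .
  qed
  also have "\<dots> = enat (card {i. 1 \<le> i \<and> \<mu> i = t})" using ev t by (simp add: eigenvalue_list_def)
  finally show ?thesis by simp
qed

text \<open>Eigenvectors are grouped by eigenvalue and each group is counted against the list \<mu>.
  An upper bound on the multiplicities suffices because all terms are positive. \<open>N0\<close> is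
  chosen before \<open>lam\<close>.\<close>

lemma effective_dimension:
  fixes q :: real
  assumes x: "onb x" "\<And>i. Gam (x i) = \<tau> i *\<^sub>R x i" "\<And>i. 0 \<le> \<tau> i"
    and ev: "eigenvalue_list p (S_pow S1) (Gamma_op M p S1 X) \<mu>"
    and q: "1 < q" and C: "0 < C" "\<And>i. 1 \<le> i \<Longrightarrow> \<mu> i \<le> C * real i powr (- q)" and \<eta>: "0 < \<eta>"
  shows "\<exists>N0>0. \<forall>lam. 0 < lam \<longrightarrow> lam \<le> \<eta> \<longrightarrow>
    (\<Sum>i. ennreal (\<tau> i * (x i \<bullet> x i) / (\<tau> i + lam))) \<le> ennreal (N0 * lam powr (- 1 / q))"
proof -
  interpret x: onb x by fact
  obtain N0 where N0: "0 < N0" "\<And>lam I \<mu>. 0 < lam \<Longrightarrow> lam \<le> \<eta> \<Longrightarrow> finite I \<Longrightarrow>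
    (\<forall>i\<in>I. 1 \<le> i \<and> 0 < \<mu> i \<and> \<mu> i \<le> C * real i powr (- q)) \<Longrightarrow>
    (\<Sum>i\<in>I. \<mu> i / (\<mu> i + lam)) \<le> N0 * lam powr (- 1 / q)"
    using effective_dimension_bound[OF q C(1) \<eta>] by blast
  show ?thesis
  proof (intro exI conjI allI impI)
    show "0 < N0" by fact
    fix lam assume lam: "0 < lam" "lam \<le> \<eta>"
    let ?h = "\<lambda>t. t / (t + lam)"
    let ?J = "\<lambda>t. {i. 1 \<le> i \<and> \<mu> i = t}"
    show "(\<Sum>i. ennreal (\<tau> i * (x i \<bullet> x i) / (\<tau> i + lam))) \<le> ennreal (N0 * lam powr (- 1 / q))"
    proof (rule suminf_le_const)
      fix n
      define I where "I = {i. i < n \<and> x i \<noteq> 0 \<and> \<tau> i \<noteq> 0}"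
      have I: "finite I" by (simp add: I_def)
      have tpos: "0 < t" if "t \<in> \<tau> ` I" for t using that x(3) by (force simp: I_def less_le)
      have fJ: "finite (?J t)" if "t \<in> \<tau> ` I" for t
        using ev tpos[OF that] by (auto simp: eigenvalue_list_def)
      have "(\<Sum>i<n. \<tau> i * (x i \<bullet> x i) / (\<tau> i + lam)) = (\<Sum>i\<in>I. ?h (\<tau> i))"
        by (rule sum.mono_neutral_cong_right) (auto simp: I_def x.unit)
      also have "\<dots> = (\<Sum>t\<in>\<tau> ` I. \<Sum>i\<in>{i \<in> I. \<tau> i = t}. ?h (\<tau> i))" by (rule sum.image_gen[OF I])
      also have "\<dots> = (\<Sum>t\<in>\<tau> ` I. real (card {i \<in> I. \<tau> i = t}) * ?h t)" by (intro sum.cong) auto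
      also have "\<dots> \<le> (\<Sum>t\<in>\<tau> ` I. real (card (?J t)) * ?h t)"
      proof (intro sum_mono mult_right_mono)
        fix t assume t: "t \<in> \<tau> ` I"
        have "card {i \<in> I. \<tau> i = t} \<le> card (?J t)"
          by (rule eigenvalue_count[OF x(1,2) ev]) (use tpos[OF t] I in \<open>auto simp: I_def\<close>)
        then show "real (card {i \<in> I. \<tau> i = t}) \<le> real (card (?J t))" by simp
        show "0 \<le> ?h t" using tpos[OF t] lam by simp
      qed
      also have "\<dots> = (\<Sum>t\<in>\<tau> ` I. \<Sum>i\<in>?J t. ?h (\<mu> i))" by (intro sum.cong) auto
      also have "\<dots> = (\<Sum>i\<in>(\<Union>t\<in>\<tau> ` I. ?J t). ?h (\<mu> i))"
        by (rule sum.UNION_disjoint[symmetric]) (use I fJ in auto)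
      also have "\<dots> \<le> N0 * lam powr (- 1 / q)"
        by (rule N0(2)[OF lam]) (use I fJ tpos C in auto)
      finally have le: "(\<Sum>i<n. \<tau> i * (x i \<bullet> x i) / (\<tau> i + lam)) \<le> N0 * lam powr (- 1 / q)" .
      show "(\<Sum>i<n. ennreal (\<tau> i * (x i \<bullet> x i) / (\<tau> i + lam))) \<le> ennreal (N0 * lam powr (- 1 / q))"
        using le x(3) lam by (subst sum_ennreal) (auto intro: ennreal_leI add_nonneg_nonneg simp: less_imp_le)
    qed simp
  qed
qed

end

section \<open>The error of the estimator\<close>

context compact_domain
begin

abbreviation "alive j \<equiv> L2_inner (leb S2) (e j) (e j) \<noteq> 0"

text \<open>Shared by the population and the sample operator. The hypothesis on the spectrum turns
  into a bound on the eigenvalues of the coordinate operator \<open>S\<close>, which confines all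
  filters to the interval where they are controlled.\<close>

lemma operator_diagonalization:
  assumes T: "\<And>u. u \<in> H \<Longrightarrow> T u \<in> H" "\<And>u j. u \<in> H \<Longrightarrow> hat (T u) j = S (hat u j)"
    and S: "positive_hs unit_vec S" and S_dead: "\<And>m y. dead m \<Longrightarrow> coord (S y) m = 0"
    and spec: "spectrum_on p (LL_meas S1 S2) T \<subseteq> {0..\<eta>}" and \<eta>: "0 \<le> \<eta>"
  shows "\<exists>x \<tau>. onb x \<and> (\<forall>i. \<tau> i \<in> {0..\<eta>}) \<and>
    diagonal_operator p (LL_meas S1 S2) hat range_space x \<tau> T \<and>
    (\<forall>f j v. Bseq (\<lambda>i. f (\<tau> i)) \<longrightarrow> v \<in> range_space j \<longrightarrow> diag x (\<lambda>i. f (\<tau> i)) v \<in> range_space j) \<and>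
    (\<forall>j. alive j \<longrightarrow> (\<forall>v. S v = diag x \<tau> v) \<and> (\<forall>i. S (x i) = \<tau> i *\<^sub>R x i))"
proof -
  interpret S: positive_hs unit_vec S by (rule S)
  interpret lin: bounded_linear S by (rule S.lin)
  obtain x \<sigma> where x: "onb x" "\<And>i. S (x i) = \<sigma> i *\<^sub>R x i" "\<And>i::nat. 0 \<le> \<sigma> i" "\<And>i. x i = 0 \<Longrightarrow> \<sigma> i = 0"
    using S.spectral_theorem by blast
  interpret x: onb x by fact
  \<comment> \<open>If no \<open>e j\<close> is alive, every element has norm 0 and the spectrum
    says nothing about \<open>S\<close>. The eigenvalue 0 then keeps the interval condition
    true.\<close>
  define \<tau> where "\<tau> i = (if \<exists>j. alive j then \<sigma> i else 0)" for i
  have \<tau>: "\<tau> i \<in> {0..\<eta>}" for i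
  proof (cases "(\<exists>j. alive j) \<and> \<sigma> i \<noteq> 0")
    case True
    then obtain j where j: "alive j" and \<sigma>: "\<sigma> i \<noteq> 0" by blast
    have "\<sigma> i \<in> spectrum_on p (LL_meas S1 S2) T"
    proof (rule eigenvalue_in_spectrum[OF T])
      show "S (c *\<^sub>R x i) = (c * \<sigma> i) *\<^sub>R x i" for c by (simp add: lin.scaleR x(2))
      show "x i \<noteq> 0" using x(4) \<sigma> by blast
      show "coord (x i) m = 0" if "dead m" for m
        using S_dead[OF that, of "x i"] \<sigma> by (simp add: x(2))
      show "alive j" by fact
    qed
    then show ?thesis using spec True by (auto simp: \<tau>_def)
  qed (use \<eta> in \<open>auto simp: \<tau>_def\<close>)
  have B: "Bseq \<tau>" by (rule BseqI'[of _ \<eta>]) (use \<tau> in auto)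
  have al: "(\<forall>v. S v = diag x \<tau> v) \<and> (\<forall>i. S (x i) = \<tau> i *\<^sub>R x i)" if "alive j" for j
  proof -
    have eq: "\<tau> = \<sigma>" by (rule ext) (use that in \<open>auto simp: \<tau>_def\<close>)
    then show ?thesis
      using x(2) eigenbasis_eq_diag[OF x(1) S.lin S.sym x(2)] B by auto
  qed
  have dop: "diagonal_operator p (LL_meas S1 S2) hat range_space x \<tau> T"
  proof unfold_locales
    show "Bseq \<tau>" by (rule B)
    show "T u \<in> H" if "u \<in> H" for u by (rule T(1)[OF that])
    show "hat (T u) j = diag x \<tau> (hat u j)" if "u \<in> H" for u j
    proof (cases "alive j")
      case True
      then show ?thesis using al T(2)[OF that] by simp
    next
      case False
      then show ?thesis using hat_null[OF T(1)[OF that], of j] hat_null[OF that, of j] by (simp add: diag_def)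
    qed
  qed
  have inv: "diag x (\<lambda>i. f (\<tau> i)) v \<in> range_space j" if f: "Bseq (\<lambda>i. f (\<tau> i))" and v: "v \<in> range_space j" for f j v
  proof (cases "alive j")
    case False
    then have "v = 0" using v by (intro ell2_eqI) (simp add: range_space_def)
    then show ?thesis by (simp add: diag_def range_space_def)
  next
    case True
    have "coord (diag x (\<lambda>i. f (\<tau> i)) v) m = 0" if m: "dead m" for m
    proof -
      \<comment> \<open>A dead unit vector is in the kernel of \<open>S\<close>, so a function of
        the operator acts on it as the number \<open>f 0\<close> and cannot make a dead coordinate
        nonzero.\<close>
      have "S (unit_vec m) \<bullet> w = 0" for w
        using S_dead[OF m, of w] by (simp add: S.sym inner_commute[of "unit_vec m"] inner_unit_vec)
      then have Sm: "S (unit_vec m) = 0" using inner_eq_zero_iff by blast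
      have "diag x (\<lambda>i. f (\<tau> i)) (unit_vec m) = diag x (\<lambda>i. f 0) (unit_vec m)"
      proof (rule x.diag_cong)
        fix i assume "unit_vec m \<bullet> x i \<noteq> 0"
        moreover have "\<tau> i * (unit_vec m \<bullet> x i) = 0"
          using x.diag_coeff[OF B, of "unit_vec m" i] al[OF True] Sm by simp
        ultimately show "f (\<tau> i) = f 0" by simp
      qed
      then have "diag x (\<lambda>i. f (\<tau> i)) (unit_vec m) = f 0 *\<^sub>R unit_vec m" by (simp add: x.diag_const)
      then have "coord (diag x (\<lambda>i. f (\<tau> i)) v) m = f 0 * coord v m"
        using x.diag_sym[OF f, of v "unit_vec m"] by (simp add: inner_unit_vec)
      then show ?thesis using v m by (simp add: range_space_def)
    qed
    then show ?thesis using True by (simp add: range_space_def)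
  qed
  show ?thesis using x(1) \<tau> dop inv al by blast
qed

lemma dnorm_null:
  assumes "\<And>j. \<not> alive j" "u \<in> H" shows "dnorm p (LL_meas S1 S2) u = 0"
  using sums_unique[OF hat_norm_sums[OF assms(2)]] hat_null[OF assms(2)] assms(1) by simp

text \<open>Passage from one coordinate to the whole space: the bounds of
  \<open>perturbation\<close> hold with constants independent of \<open>j\<close>, so they may be
  squared and summed.\<close>

lemma error_bound:
  assumes T: "diagonal_operator p (LL_meas S1 S2) hat range_space x \<tau> T"
    and T': "diagonal_operator p (LL_meas S1 S2) hat range_space y \<rho> T'"
    and inv: "\<And>f j v. Bseq (\<lambda>i. f (\<tau> i)) \<Longrightarrow> v \<in> range_space j \<Longrightarrow> diag x (\<lambda>i. f (\<tau> i)) v \<in> range_space j"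
    and inv': "\<And>f j v. Bseq (\<lambda>i. f (\<rho> i)) \<Longrightarrow> v \<in> range_space j \<Longrightarrow> diag y (\<lambda>i. f (\<rho> i)) v \<in> range_space j"
    and pert: "perturbation x y \<tau> \<rho> \<eta> lam \<epsilon>"
    and v: "v \<in> H" and \<beta>: "\<beta> \<in> H" "\<And>j. hat \<beta> j = diag x (\<lambda>i. \<phi> (\<tau> i)) (hat v j)"
    and AY: "AY \<in> H" "\<And>j. hat AY j = diag y \<rho> (hat \<beta> j) + z j"
    and z: "\<And>j a. z j \<bullet> a \<le> \<zeta> j * norm (diag x (\<lambda>i. (\<tau> i + lam) powr (1/2)) a)" "\<And>j. 0 \<le> \<zeta> j"
      "\<And>j i. \<rho> i = 0 \<Longrightarrow> z j \<bullet> y i = 0" "(\<Sum>j. ennreal ((\<zeta> j)\<^sup>2)) \<le> ennreal Z" "0 \<le> Z"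
    and r: "\<And>t a. t \<in> {0..\<eta>} \<Longrightarrow> 0 \<le> a \<Longrightarrow> a \<le> \<nu> \<Longrightarrow> \<bar>1 - t * g t\<bar> * (t + lam) powr a \<le> Cr * lam powr a"
    and g: "Bseq (\<lambda>i. g (\<rho> i))" "\<And>t. 0 < t \<Longrightarrow> t \<le> \<eta> \<Longrightarrow> \<bar>g t\<bar> * (t + lam) \<le> Cg"
    and \<phi>: "\<And>t. t \<in> {0..\<eta>} \<Longrightarrow> \<bar>\<phi> t\<bar> \<le> \<Phi>"
      "\<And>t. t \<in> {0..\<eta>} \<Longrightarrow> \<bar>\<phi> t\<bar> * (t + lam) powr (- (\<nu> - s)) \<le> F * lam powr (- (\<nu> - s))"
    and s: "0 \<le> s" "s \<le> 1/2" and \<nu>: "1 \<le> \<nu>" and nn: "0 \<le> Cr" "0 \<le> Cg" "0 \<le> F" "0 \<le> \<Phi>"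
  shows "fcalc p (LL_meas S1 S2) g T' AY \<in> H"
    "(dnorm p (LL_meas S1 S2) (fcalc p (LL_meas S1 S2) (rpow s) T (ddiff (fcalc p (LL_meas S1 S2) g T' AY) \<beta>)))\<^sup>2 \<le>
      2 * (perturbation.C1 \<epsilon> * perturbation.C1 \<epsilon> * Cr * (F + (\<nu> - s) * \<epsilon> * \<Phi>) * lam powr s)\<^sup>2 * (dnorm p (LL_meas S1 S2) v)\<^sup>2 +
      2 * (lam powr (s - 1/2) * (perturbation.C1 \<epsilon> * perturbation.C1 \<epsilon> * Cg))\<^sup>2 * Z"
proof -
  let ?N = "LL_meas S1 S2"
  interpret pt: perturbation x y \<tau> \<rho> \<eta> lam \<epsilon> by (rule pert)
  interpret DT: diagonal_operator p ?N hat range_space x \<tau> T by (rule T)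
  interpret DT': diagonal_operator p ?N hat range_space y \<rho> T' by (rule T')
  let ?C1 = "pt.C1"
  define B1 where "B1 = ?C1 * ?C1 * Cr * (F + (\<nu> - s) * \<epsilon> * \<Phi>) * lam powr s"
  define B2 where "B2 = lam powr (s - 1/2) * (?C1 * ?C1 * Cg)"
  have Bs: "Bseq (\<lambda>i. rpow s (\<tau> i))"
    by (rule pt.Bseq_fun(1)[of "rpow s" "(\<eta> + lam) powr s"])
      (use rpow_le pt.lam s in \<open>auto intro: order.trans[OF rpow_le(2)[of _ lam]] intro!: powr_mono2\<close>)
  note est = DT'.fcalc_diag[OF g(1) inv'[OF g(1)] AY(1)]
  show estH: "fcalc p ?N g T' AY \<in> H" by (rule est(1))
  define w where "w = ddiff (fcalc p ?N g T' AY) \<beta>"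
  have w: "w \<in> H" unfolding w_def by (intro ddiff_dsum estH \<beta>)
  have Ts: "fcalc p ?N (rpow s) T w \<in> H" "\<And>j. hat (fcalc p ?N (rpow s) T w) j = diag x (\<lambda>i. rpow s (\<tau> i)) (hat w j)"
    by (rule DT.fcalc_diag[where f = "rpow s", OF Bs inv[where f = "rpow s", OF Bs] w], assumption)+
  have Br: "Bseq (\<lambda>i. 1 - \<rho> i * g (\<rho> i))"
    by (rule pt.Bseq_fun(2)[of "\<lambda>t. 1 - t * g t" Cr]) (use r[of _ 0] \<nu> pt.lam in \<open>auto split: if_splits\<close>)
  \<comment> \<open>The usual splitting of the error into filtered noise and the residual filter
    applied to the target.\<close>
  have hw: "hat w j = diag y (\<lambda>i. g (\<rho> i)) (z j) - diag y (\<lambda>i. 1 - \<rho> i * g (\<rho> i)) (hat \<beta> j)" for j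
  proof -
    have "diag y (\<lambda>i. 1 - \<rho> i * g (\<rho> i)) (hat \<beta> j) = hat \<beta> j - diag y (\<lambda>i. g (\<rho> i) * \<rho> i) (hat \<beta> j)"
      by (rule pt.f.eqI) (simp add: pt.f.diag_coeff Br Bseq_mult g(1) pt.Bseq_id inner_diff_left algebra_simps)
    then show ?thesis
      by (simp add: w_def hat_ddiff estH \<beta>(1) est(2) AY(2) pt.f.diag_plus g(1) pt.f.diag_diag pt.Bseq_id)
  qed
  have bnd: "norm (hat (fcalc p ?N (rpow s) T w) j) \<le> B1 * norm (hat v j) + B2 * \<zeta> j" for j
  proof -
    have "hat (fcalc p ?N (rpow s) T w) j = diag x (\<lambda>i. rpow s (\<tau> i)) (diag y (\<lambda>i. g (\<rho> i)) (z j)) -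
        diag x (\<lambda>i. rpow s (\<tau> i)) (diag y (\<lambda>i. 1 - \<rho> i * g (\<rho> i)) (diag x (\<lambda>i. \<phi> (\<tau> i)) (hat v j)))"
      unfolding Ts(2) hw \<beta>(2) by (rule pt.e.diag_minus[OF Bs])
    then have "norm (hat (fcalc p ?N (rpow s) T w) j) \<le> norm (diag x (\<lambda>i. rpow s (\<tau> i)) (diag y (\<lambda>i. g (\<rho> i)) (z j))) +
        norm (diag x (\<lambda>i. rpow s (\<tau> i)) (diag y (\<lambda>i. 1 - \<rho> i * g (\<rho> i)) (diag x (\<lambda>i. \<phi> (\<tau> i)) (hat v j))))"
      by (simp only: norm_triangle_ineq4)
    also have "norm (diag x (\<lambda>i. rpow s (\<tau> i)) (diag y (\<lambda>i. g (\<rho> i)) (z j))) \<le> lam powr (s - 1/2) * (?C1 * (\<zeta> j * ?C1 * Cg))"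
      by (rule pt.noise_bound[OF z(1,2,3) g nn(2) s])
    also have "\<dots> = B2 * \<zeta> j" by (simp add: B2_def)
    also have "norm (diag x (\<lambda>i. rpow s (\<tau> i)) (diag y (\<lambda>i. 1 - \<rho> i * g (\<rho> i)) (diag x (\<lambda>i. \<phi> (\<tau> i)) (hat v j)))) \<le> B1 * norm (hat v j)"
      unfolding B1_def by (rule pt.bias_bound[where r = "\<lambda>t. 1 - t * g t", OF r \<phi> s \<nu> nn(1,3,4)])
    finally show ?thesis by simp
  qed
  have sq: "(norm (hat (fcalc p ?N (rpow s) T w) j))\<^sup>2 \<le> 2 * B1\<^sup>2 * (norm (hat v j))\<^sup>2 + 2 * B2\<^sup>2 * (\<zeta> j)\<^sup>2" for j
  proof -
    have "(norm (hat (fcalc p ?N (rpow s) T w) j))\<^sup>2 \<le> (B1 * norm (hat v j) + B2 * \<zeta> j)\<^sup>2"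
      by (rule power_mono[OF bnd]) simp
    also have "\<dots> \<le> 2 * (B1 * norm (hat v j))\<^sup>2 + 2 * (B2 * \<zeta> j)\<^sup>2"
      using zero_le_power2[of "B1 * norm (hat v j) - B2 * \<zeta> j"] unfolding power2_sum power2_diff by linarith
    finally show ?thesis by (simp add: power_mult_distrib)
  qed
  have "ennreal ((dnorm p ?N (fcalc p ?N (rpow s) T w))\<^sup>2) = (\<Sum>j. ennreal ((norm (hat (fcalc p ?N (rpow s) T w) j))\<^sup>2))"
    by (rule suminf_ennreal_eq[symmetric]) (use hat_norm_sums[OF Ts(1)] in auto)
  also have "\<dots> \<le> (\<Sum>j. ennreal (2 * B1\<^sup>2) * ennreal ((norm (hat v j))\<^sup>2) + ennreal (2 * B2\<^sup>2) * ennreal ((\<zeta> j)\<^sup>2))"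
  proof (rule suminf_le)
    show "ennreal ((norm (hat (fcalc p ?N (rpow s) T w) j))\<^sup>2) \<le>
        ennreal (2 * B1\<^sup>2) * ennreal ((norm (hat v j))\<^sup>2) + ennreal (2 * B2\<^sup>2) * ennreal ((\<zeta> j)\<^sup>2)" for j
      using ennreal_leI[OF sq[of j]] by (simp add: ennreal_plus ennreal_mult)
  qed auto
  also have "\<dots> = (\<Sum>j. ennreal (2 * B1\<^sup>2) * ennreal ((norm (hat v j))\<^sup>2)) + (\<Sum>j. ennreal (2 * B2\<^sup>2) * ennreal ((\<zeta> j)\<^sup>2))"
    by (rule suminf_add[symmetric]) auto
  also have "\<dots> = ennreal (2 * B1\<^sup>2) * (\<Sum>j. ennreal ((norm (hat v j))\<^sup>2)) + ennreal (2 * B2\<^sup>2) * (\<Sum>j. ennreal ((\<zeta> j)\<^sup>2))"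
    by (simp only: ennreal_suminf_cmult)
  also have "(\<Sum>j. ennreal ((norm (hat v j))\<^sup>2)) = ennreal ((dnorm p ?N v)\<^sup>2)"
    by (rule suminf_ennreal_eq) (use hat_norm_sums[OF v] in auto)
  also have "ennreal (2 * B1\<^sup>2) * ennreal ((dnorm p ?N v)\<^sup>2) + ennreal (2 * B2\<^sup>2) * (\<Sum>j. ennreal ((\<zeta> j)\<^sup>2)) \<le>
      ennreal (2 * B1\<^sup>2) * ennreal ((dnorm p ?N v)\<^sup>2) + ennreal (2 * B2\<^sup>2) * ennreal Z"
    by (intro add_left_mono mult_left_mono z(4)) simp
  also have "\<dots> = ennreal (2 * B1\<^sup>2 * (dnorm p ?N v)\<^sup>2 + 2 * B2\<^sup>2 * Z)"
    using z(5) by (simp add: ennreal_plus ennreal_mult)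
  finally have "(dnorm p ?N (fcalc p ?N (rpow s) T w))\<^sup>2 \<le> 2 * B1\<^sup>2 * (dnorm p ?N v)\<^sup>2 + 2 * B2\<^sup>2 * Z"
    using z(5) by (subst (asm) ennreal_le_iff) auto
  then show "(dnorm p ?N (fcalc p ?N (rpow s) T (ddiff (fcalc p ?N g T' AY) \<beta>)))\<^sup>2 \<le>
      2 * (?C1 * ?C1 * Cr * (F + (\<nu> - s) * \<epsilon> * \<Phi>) * lam powr s)\<^sup>2 * (dnorm p ?N v)\<^sup>2 +
      2 * (lam powr (s - 1/2) * (?C1 * ?C1 * Cg))\<^sup>2 * Z"
    unfolding w_def B1_def B2_def .
qed

end

section \<open>Weighted Cauchy-Schwarz bounds\<close>

lemma series_cauchy_schwarz:
  fixes u v :: "nat \<Rightarrow> real"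
  assumes s: "(\<lambda>i. u i * v i) sums s" and A: "(\<lambda>i. (u i)\<^sup>2) sums A" and B: "(\<Sum>i. ennreal ((v i)\<^sup>2)) \<noteq> \<top>"
  shows "ennreal (s\<^sup>2) \<le> ennreal A * (\<Sum>i. ennreal ((v i)\<^sup>2))"
proof -
  have sv: "summable (\<lambda>i. (v i)\<^sup>2)" by (rule summable_suminf_not_top[OF _ B]) simp
  have A0: "0 \<le> A" using suminf_nonneg[OF sums_summable[OF A]] sums_unique[OF A] by simp
  have "s\<^sup>2 \<le> A * (\<Sum>i. (v i)\<^sup>2)"
  proof (rule LIMSEQ_le_const2)
    show "(\<lambda>n. (\<Sum>i<n. u i * v i)\<^sup>2) \<longlonglongrightarrow> s\<^sup>2" using s unfolding sums_def by (rule tendsto_power)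
    have "(\<Sum>i<n. u i * v i)\<^sup>2 \<le> A * (\<Sum>i. (v i)\<^sup>2)" for n
    proof -
      have "(\<Sum>i<n. u i * v i)\<^sup>2 \<le> (\<Sum>i<n. (u i)\<^sup>2) * (\<Sum>i<n. (v i)\<^sup>2)" by (rule Cauchy_Schwarz_ineq_sum)
      also have "\<dots> \<le> A * (\<Sum>i. (v i)\<^sup>2)"
      proof (rule mult_mono)
        show "(\<Sum>i<n. (u i)\<^sup>2) \<le> A"
          using sum_le_suminf[OF sums_summable[OF A], of "{..<n}"] sums_unique[OF A] by simp
        show "(\<Sum>i<n. (v i)\<^sup>2) \<le> (\<Sum>i. (v i)\<^sup>2)" by (rule sum_le_suminf[OF sv]) auto
      qed (use A0 in \<open>auto intro: sum_nonneg\<close>)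
      finally show ?thesis .
    qed
    then show "\<exists>N. \<forall>n\<ge>N. (\<Sum>i<n. u i * v i)\<^sup>2 \<le> A * (\<Sum>i. (v i)\<^sup>2)" by blast
  qed
  moreover have "(\<Sum>i. ennreal ((v i)\<^sup>2)) = ennreal (\<Sum>i. (v i)\<^sup>2)" by (intro suminf_ennreal2 sv) simp
  ultimately show ?thesis
    using A0 by (simp add: ennreal_leI ennreal_mult'[symmetric])
qed

text \<open>Cauchy-Schwarz with the weights \<open>\<tau> i + lam\<close> to the powers 1/2 and
  -1/2. The condition \<open>fin\<close> excludes an infinite series, whose product with 0 would be
  0 in extended arithmetic.\<close>

lemma weighted_functional_bound:
  assumes x: "onb x" and \<tau>: "\<And>i. 0 \<le> \<tau> i" "Bseq \<tau>" and lam: "0 < lam"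
    and fin: "(\<Sum>i. ennreal (1 / (\<tau> i + lam)) * ennreal ((z \<bullet> x i)\<^sup>2)) \<noteq> \<top>"
  shows "ennreal ((z \<bullet> a)\<^sup>2) \<le> ennreal ((norm (diag x (\<lambda>i. (\<tau> i + lam) powr (1/2)) a))\<^sup>2) *
    (\<Sum>i. ennreal (1 / (\<tau> i + lam)) * ennreal ((z \<bullet> x i)\<^sup>2))"
proof -
  interpret x: onb x by fact
  obtain C where C: "\<And>i. \<bar>\<tau> i\<bar> \<le> C" using \<tau>(2) unfolding Bseq_def by auto
  have pos: "0 < \<tau> i + lam" for i using \<tau>(1)[of i] lam by simp
  have B: "Bseq (\<lambda>i. (\<tau> i + lam) powr (1/2))"
    by (rule BseqI'[of _ "(C + lam) powr (1/2)"]) (use C \<tau>(1) lam in \<open>auto intro!: powr_mono2 simp: abs_le_iff\<close>)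
  have half: "(\<tau> i + lam) powr (1/2) * (\<tau> i + lam) powr (- 1/2) = 1" for i
    using pos[of i] by (simp flip: powr_add)
  have sq: "((\<tau> i + lam) powr (- 1/2))\<^sup>2 = 1 / (\<tau> i + lam)" for i
  proof -
    have "((\<tau> i + lam) powr (- 1/2))\<^sup>2 = (\<tau> i + lam) powr (- 1/2 + - 1/2)"
      unfolding power2_eq_square powr_add ..
    then show ?thesis using pos[of i] by (simp add: powr_minus inverse_eq_divide)
  qed
  have v2: "ennreal (((\<tau> i + lam) powr (- 1/2) * (z \<bullet> x i))\<^sup>2) = ennreal (1 / (\<tau> i + lam)) * ennreal ((z \<bullet> x i)\<^sup>2)" for i
    unfolding power_mult_distrib sq by (rule ennreal_mult) (use pos[of i] in auto)
  have "(\<lambda>i. ((\<tau> i + lam) powr (1/2) * (a \<bullet> x i)) * ((\<tau> i + lam) powr (- 1/2) * (z \<bullet> x i))) sums (z \<bullet> a)"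
  proof -
    have "((\<tau> i + lam) powr (1/2) * (a \<bullet> x i)) * ((\<tau> i + lam) powr (- 1/2) * (z \<bullet> x i)) = (z \<bullet> x i) * (a \<bullet> x i)" for i
      using half[of i] by (metis (no_types, opaque_lifting) mult.assoc mult.commute mult.left_commute mult_1)
    then show ?thesis using x.inner_sums[of z a] by presburger
  qed
  moreover have "(\<lambda>i. ((\<tau> i + lam) powr (1/2) * (a \<bullet> x i))\<^sup>2) sums (norm (diag x (\<lambda>i. (\<tau> i + lam) powr (1/2)) a))\<^sup>2"
    using x.norm_diag_sums[OF B, of a] by (simp add: power_mult_distrib)
  ultimately show ?thesis
    by (rule series_cauchy_schwarz[where u = "\<lambda>i. (\<tau> i + lam) powr (1/2) * (a \<bullet> x i)" and v = "\<lambda>i. (\<tau> i + lam) powr (- 1/2) * (z \<bullet> x i)", unfolded v2, OF _ _ fin])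
qed

text \<open>The double sum is the squared Hilbert-Schmidt norm of the weighted operator, which
  dominates its operator norm.\<close>

lemma weighted_operator_bound:
  assumes x: "onb x" and \<tau>: "\<And>i. 0 \<le> \<tau> i" "Bseq \<tau>" and lam: "0 < lam"
    and D: "\<And>u v. D u \<bullet> v = u \<bullet> D v"
    and W: "(\<Sum>i. \<Sum>j. ennreal (1 / (\<tau> i + lam)) * ennreal ((D (x i) \<bullet> x j)\<^sup>2)) \<le> ennreal c" and c: "0 \<le> c"
  shows "norm (D a) \<le> sqrt c * norm (diag x (\<lambda>i. (\<tau> i + lam) powr (1/2)) a)"
proof -
  interpret x: onb x by fact
  let ?n = "norm (diag x (\<lambda>i. (\<tau> i + lam) powr (1/2)) a)"
  let ?w = "\<lambda>j. \<Sum>i. ennreal (1 / (\<tau> i + lam)) * ennreal ((D (x j) \<bullet> x i)\<^sup>2)"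
  \<comment> \<open>The weight sits on the first index in \<open>W\<close> but is wanted on the
    summation index of \<open>weighted_functional_bound\<close>; symmetry of \<open>D\<close> allows
    the exchange.\<close>
  have "(\<Sum>j. ?w j) = (\<Sum>i. \<Sum>j. ennreal (1 / (\<tau> i + lam)) * ennreal ((D (x j) \<bullet> x i)\<^sup>2))"
    by (rule ennreal_suminf_swap[symmetric])
  also have "\<dots> = (\<Sum>i. \<Sum>j. ennreal (1 / (\<tau> i + lam)) * ennreal ((D (x i) \<bullet> x j)\<^sup>2))"
    using D by (simp add: inner_commute)
  finally have sw: "(\<Sum>j. ?w j) \<le> ennreal c" using W by simp
  have fin: "?w j \<noteq> \<top>" for j
  proof -
    have "?w j = (\<Sum>k\<in>{j}. ?w k)" by simp
    also have "\<dots> \<le> (\<Sum>j. ?w j)" by (rule sum_le_suminf) auto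
    finally show ?thesis using sw by (auto simp: top_unique)
  qed
  have "ennreal ((norm (D a))\<^sup>2) = (\<Sum>j. ennreal ((D a \<bullet> x j)\<^sup>2))"
    by (rule suminf_ennreal_eq[symmetric]) (use x.parseval[of "D a"] in \<open>auto simp: power2_norm_eq_inner\<close>)
  also have "\<dots> \<le> (\<Sum>j. ennreal (?n\<^sup>2) * ?w j)"
  proof (rule suminf_le)
    fix j
    have "D a \<bullet> x j = D (x j) \<bullet> a" by (simp add: D inner_commute)
    then show "ennreal ((D a \<bullet> x j)\<^sup>2) \<le> ennreal (?n\<^sup>2) * ?w j"
      using weighted_functional_bound[OF x \<tau> lam fin[of j], of a] by simp
  qed auto
  also have "\<dots> = ennreal (?n\<^sup>2) * (\<Sum>j. ?w j)" by simp
  also have "\<dots> \<le> ennreal (?n\<^sup>2) * ennreal c" by (intro mult_left_mono sw) simp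
  also have "\<dots> = ennreal (?n\<^sup>2 * c)" using c by (simp add: ennreal_mult)
  finally have "(norm (D a))\<^sup>2 \<le> ?n\<^sup>2 * c" using c by (subst (asm) ennreal_le_iff) auto
  also have "\<dots> = (sqrt c * ?n)\<^sup>2" using c by (simp add: power_mult_distrib)
  finally show ?thesis by (rule power2_le_imp_le) (use c in simp)
qed

section \<open>Deviation bounds\<close>

text \<open>One scheme for the Gram operator and for the noise. Row \<open>i\<close> contributes at
  most \<open>w i * c * a i / n\<close> in mean. With
  \<open>a i = \<tau> i * (x i \<bullet> x i)\<close> and \<open>w i = 1 / (\<tau> i + lam)\<close>
  the rows add up to the effective dimension.\<close>

lemma (in prob_space) weighted_deviation:
  fixes F :: "nat \<Rightarrow> nat \<Rightarrow> 'b \<Rightarrow> real"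
  assumes indep: "indep_vars (\<lambda>_. P) Z {1..}" and distr: "\<And>i. 1 \<le> i \<Longrightarrow> distr M P (Z i) = distr M P Z0"
    and Z0: "Z0 \<in> M \<rightarrow>\<^sub>M P" and n: "1 \<le> n"
    and F: "\<And>i j. F i j \<in> borel_measurable P" "\<And>i j. integrable M (\<lambda>\<omega>. (F i j (Z0 \<omega>))\<^sup>2)"
    and c: "\<And>i. (\<Sum>j. ennreal (expectation (\<lambda>\<omega>. (F i j (Z0 \<omega>))\<^sup>2))) \<le> ennreal (c * a i)" "0 \<le> c"
    and w: "\<And>i. 0 \<le> w i" and a: "\<And>i. 0 \<le> a i"
    and N: "(\<Sum>i. ennreal (w i * a i)) \<le> ennreal N" "0 \<le> N"
  defines "W \<equiv> \<lambda>\<omega>. \<Sum>i. \<Sum>j. ennreal (w i) * ennreal (((\<Sum>k=1..n. F i j (Z k \<omega>)) / real n - expectation (\<lambda>\<omega>. F i j (Z0 \<omega>)))\<^sup>2)"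
  shows "W \<in> borel_measurable M" "(\<integral>\<^sup>+\<omega>. W \<omega> \<partial>M) \<le> ennreal (c * N / real n)"
proof -
  let ?D = "\<lambda>i j \<omega>. ((\<Sum>k=1..n. F i j (Z k \<omega>)) / real n - expectation (\<lambda>\<omega>. F i j (Z0 \<omega>)))\<^sup>2"
  let ?E = "\<lambda>i j. expectation (\<lambda>\<omega>. (F i j (Z0 \<omega>))\<^sup>2)"
  have Zk: "Z k \<in> M \<rightarrow>\<^sub>M P" if "k \<in> {1..n}" for k
    using indep that unfolding indep_vars_def2 by auto
  have D [measurable]: "?D i j \<in> borel_measurable M" for i j
    by (intro borel_measurable_power borel_measurable_diff borel_measurable_divide borel_measurable_sum
        measurable_compose[OF Zk F(1)] borel_measurable_const)
  show "W \<in> borel_measurable M" unfolding W_def by measurable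
  have "(\<integral>\<^sup>+\<omega>. W \<omega> \<partial>M) = (\<Sum>i. \<Sum>j. ennreal (w i) * (\<integral>\<^sup>+\<omega>. ennreal (?D i j \<omega>) \<partial>M))"
  proof -
    have "(\<integral>\<^sup>+\<omega>. W \<omega> \<partial>M) = (\<Sum>i. \<integral>\<^sup>+\<omega>. (\<Sum>j. ennreal (w i) * ennreal (?D i j \<omega>)) \<partial>M)"
      unfolding W_def by (rule nn_integral_suminf) measurable
    also have "\<dots> = (\<Sum>i. \<Sum>j. \<integral>\<^sup>+\<omega>. ennreal (w i) * ennreal (?D i j \<omega>) \<partial>M)"
      by (intro suminf_cong nn_integral_suminf) measurable
    also have "\<dots> = (\<Sum>i. \<Sum>j. ennreal (w i) * (\<integral>\<^sup>+\<omega>. ennreal (?D i j \<omega>) \<partial>M))"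
      by (intro suminf_cong nn_integral_cmult) measurable
    finally show ?thesis .
  qed
  also have "\<dots> \<le> (\<Sum>i. ennreal (c / real n) * ennreal (w i * a i))"
  proof (rule suminf_le)
    fix i
    have "(\<Sum>j. ennreal (w i) * (\<integral>\<^sup>+\<omega>. ennreal (?D i j \<omega>) \<partial>M)) \<le> (\<Sum>j. ennreal (w i / real n) * ennreal (?E i j))"
    proof (rule suminf_le)
      fix j
      have "ennreal (w i) * (\<integral>\<^sup>+\<omega>. ennreal (?D i j \<omega>) \<partial>M) \<le> ennreal (w i) * ennreal (?E i j / real n)"
        by (intro mult_left_mono sample_mean_square[OF indep distr Z0 F n]) auto
      also have "\<dots> = ennreal (w i / real n) * ennreal (?E i j)"
        using w by (simp flip: ennreal_mult)
      finally show "ennreal (w i) * (\<integral>\<^sup>+\<omega>. ennreal (?D i j \<omega>) \<partial>M) \<le> ennreal (w i / real n) * ennreal (?E i j)" .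
    qed auto
    also have "\<dots> \<le> ennreal (w i / real n) * ennreal (c * a i)"
      by (simp only: ennreal_suminf_cmult) (intro mult_left_mono c, simp)
    also have "\<dots> = ennreal (c / real n) * ennreal (w i * a i)"
      using w[of i] a[of i] c(2) by (simp add: mult_ac flip: ennreal_mult)
    finally show "(\<Sum>j. ennreal (w i) * (\<integral>\<^sup>+\<omega>. ennreal (?D i j \<omega>) \<partial>M)) \<le> ennreal (c / real n) * ennreal (w i * a i)" .
  qed auto
  also have "\<dots> \<le> ennreal (c / real n) * ennreal N"
    by (simp only: ennreal_suminf_cmult) (intro mult_left_mono N, simp)
  also have "\<dots> = ennreal (c * N / real n)"
    using c(2) N(2) by (simp flip: ennreal_mult)
  finally show "(\<integral>\<^sup>+\<omega>. W \<omega> \<partial>M) \<le> ennreal (c * N / real n)" .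
qed

lemma (in prob_space) markov_bound:
  assumes W: "W \<in> borel_measurable M" and K: "(\<integral>\<^sup>+\<omega>. W \<omega> \<partial>M) \<le> ennreal K" "0 \<le> K" and T: "0 < T" "K \<le> \<theta> * T" and \<theta>: "0 \<le> \<theta>"
  shows "prob {\<omega>\<in>space M. \<not> W \<omega> \<le> ennreal T} \<le> \<theta>"
proof -
  note [measurable] = W
  have "emeasure M {\<omega>\<in>space M. \<not> W \<omega> \<le> ennreal T} \<le> emeasure M {\<omega>\<in>space M. 1 \<le> ennreal (1 / T) * W \<omega>}"
  proof (rule emeasure_mono)
    show "{\<omega>\<in>space M. \<not> W \<omega> \<le> ennreal T} \<subseteq> {\<omega>\<in>space M. 1 \<le> ennreal (1 / T) * W \<omega>}"
    proof safe
      fix \<omega> assume "\<not> W \<omega> \<le> ennreal T"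
      then have "ennreal (1 / T) * ennreal T \<le> ennreal (1 / T) * W \<omega>" by (intro mult_left_mono) auto
      then show "1 \<le> ennreal (1 / T) * W \<omega>" using T by (simp flip: ennreal_mult)
    qed
  qed measurable
  also have "\<dots> \<le> ennreal (1 / T) * (\<integral>\<^sup>+\<omega>. W \<omega> * indicator (space M) \<omega> \<partial>M)"
    by (rule nn_integral_Markov_inequality) auto
  also have "(\<integral>\<^sup>+\<omega>. W \<omega> * indicator (space M) \<omega> \<partial>M) = (\<integral>\<^sup>+\<omega>. W \<omega> \<partial>M)"
    by (rule nn_integral_cong) simp
  also have "ennreal (1 / T) * (\<integral>\<^sup>+\<omega>. W \<omega> \<partial>M) \<le> ennreal (1 / T) * ennreal K" by (intro mult_left_mono K) simp
  also have "\<dots> = ennreal (K / T)" using K T by (simp flip: ennreal_mult)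
  also have "\<dots> \<le> ennreal \<theta>" using T by (intro ennreal_leI) (simp add: field_simps)
  finally show ?thesis using \<theta> by (simp add: emeasure_eq_measure)
qed

section \<open>Sample deviations in the regression model\<close>

locale regression = design p S1 S2 M X \<kappa>
  for p :: nat and S1 S2 :: "real set" and M :: "'w measure" and X :: "'w \<Rightarrow> real \<Rightarrow> real" and \<kappa> :: real +
  fixes Y eps :: "'w \<Rightarrow> real \<Rightarrow> real" and Xs Ys :: "nat \<Rightarrow> 'w \<Rightarrow> real \<Rightarrow> real" and \<sigma> :: real
    and \<beta> :: "nat \<Rightarrow> real \<times> (nat \<Rightarrow> real) \<Rightarrow> real"
  assumes model: "regression_model M p S1 S2 X Y eps \<sigma> \<beta>" and data: "iid_copies M S1 S2 X Y Xs Ys"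
begin

lemma \<beta>: "\<beta> \<in> H" using model by (simp add: regression_model_def)

abbreviation "P \<equiv> L2_sigma (leb S1) \<Otimes>\<^sub>M L2_sigma (leb S2)"

lemma indep_data: "indep_vars (\<lambda>_. P) (\<lambda>i \<omega>. (Xs i \<omega>, Ys i \<omega>)) {1..}"
  and distr_data: "1 \<le> i \<Longrightarrow> distr M P (\<lambda>\<omega>. (Xs i \<omega>, Ys i \<omega>)) = distr M P (\<lambda>\<omega>. (X \<omega>, Y \<omega>))"
  using data by (auto simp: iid_copies_def Let_def)

lemma Y_meas: "Y \<in> M \<rightarrow>\<^sub>M L2_sigma (leb S2)"
  using model by (intro process_measurable S2) (simp add: regression_model_def)

lemma Z0_meas: "(\<lambda>\<omega>. (X \<omega>, Y \<omega>)) \<in> M \<rightarrow>\<^sub>M P"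
  by (intro measurable_Pair X_meas Y_meas)

lemma data_L2: "1 \<le> i \<Longrightarrow> \<omega> \<in> space M \<Longrightarrow> Xs i \<omega> \<in> L2 (leb S1)" "1 \<le> i \<Longrightarrow> \<omega> \<in> space M \<Longrightarrow> Ys i \<omega> \<in> L2 (leb S2)"
proof -
  assume "1 \<le> i" "\<omega> \<in> space M"
  then have "(Xs i \<omega>, Ys i \<omega>) \<in> space P"
    using indep_data unfolding indep_vars_def2 by (auto dest!: measurable_space)
  then show "Xs i \<omega> \<in> L2 (leb S1)" "Ys i \<omega> \<in> L2 (leb S2)" by (auto simp: space_pair_measure)
qed

definition "err j \<omega> = L2_inner (leb S2) (eps \<omega>) (e j)"
text \<open>The noise coefficient as a function of the observed pair. The assumption on the data
  concerns only the law of the pairs, so the errors of the sample must be expressed through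
  them.\<close>

definition "resid j z = L2_inner (leb S2) (snd z) (e j) - hat \<beta> j \<bullet> chivec (fst z)"
definition "V = L2_inner (M \<Otimes>\<^sub>M leb S2) (\<lambda>(\<omega>, t). eps \<omega> t) (\<lambda>(\<omega>, t). eps \<omega> t)"

lemma V_nonneg: "0 \<le> V" by (simp add: V_def L2_inner_ge_0)

lemma resid_meas: "resid j \<in> borel_measurable P"
proof -
  have "(\<lambda>z. L2_inner (leb S2) (snd z) (e j)) \<in> borel_measurable P"
    by (rule measurable_compose[OF measurable_snd measurable_L2_inner[OF e.L2]])
  moreover have "(\<lambda>z. chivec (fst z) \<bullet> hat \<beta> j) \<in> borel_measurable P"
    by (rule measurable_compose[OF measurable_fst measurable_chivec_inner])
  ultimately show ?thesis unfolding resid_def[abs_def] by (simp add: inner_commute)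
qed

lemma chivec_meas: "(\<lambda>z. chivec (fst z) \<bullet> y) \<in> borel_measurable P"
  by (rule measurable_compose[OF measurable_fst measurable_chivec_inner])

text \<open>The model equation holds almost everywhere on the product, hence for almost every
  \<open>\<omega>\<close> as an identity in \<open>L2\<close>; there the coefficient of the
  regression part is \<open>hat \<beta> j \<bullet> \<xi> \<omega>\<close>.\<close>

lemma resid_eq: "AE \<omega> in M. resid j (X \<omega>, Y \<omega>) = err j \<omega>"
proof -
  interpret MG: finite_pair M "leb S2" ..
  have "AE z in M \<Otimes>\<^sub>M leb S2. Y (fst z) (snd z) = A_op p S1 X \<beta> z + eps (fst z) (snd z)"
    using model by (simp add: regression_model_def split_beta')
  from MG.AE_pair[OF this] AE_space show ?thesis
  proof eventually_elim
    case (elim \<omega>)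
    have B: "B_op p S1 (X \<omega>) \<beta> \<in> L2 (leb S2)" by (rule B_op_L2[OF X_L2[OF elim(2)] \<beta>])
    have ep: "eps \<omega> \<in> L2 (leb S2)" and Yw: "Y \<omega> \<in> L2 (leb S2)"
      using model elim(2) by (auto simp: regression_model_def L2_process_def)
    have "L2_inner (leb S2) (Y \<omega>) (e j) = L2_inner (leb S2) (\<lambda>t. B_op p S1 (X \<omega>) \<beta> t + eps \<omega> t) (e j)"
      by (rule L2_inner_cong_AE) (use elim(1) B ep Yw e.L2 L2_measurable in \<open>auto simp: A_op_def intro!: borel_measurable_add\<close>)
    then show ?case
      using B_op_coeff[OF X_L2[OF elim(2)] \<beta>, of j]
      by (simp add: resid_def err_def L2_inner_add[OF B ep e.L2])
  qed
qed

lemma err_meas: "err j \<in> borel_measurable M"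
proof -
  have "eps \<in> M \<rightarrow>\<^sub>M L2_sigma (leb S2)"
    using model by (intro process_measurable S2) (simp add: regression_model_def)
  from measurable_compose[OF this measurable_L2_inner[OF e.L2]] show ?thesis
    unfolding err_def[abs_def] .
qed

lemma err_L2: "err j \<in> L2 M" and err_mean: "expectation (err j) = 0"
  and err_total: "(\<Sum>j. ennreal (expectation (\<lambda>\<omega>. (err j \<omega>)\<^sup>2))) = ennreal V"
proof -
  interpret MG: finite_pair M "leb S2" ..
  let ?u = "\<lambda>(\<omega>, t). eps \<omega> t"
  have u: "?u \<in> L2 (M \<Otimes>\<^sub>M leb S2)" and mean: "AE t in leb S2. (LINT \<omega>|M. eps \<omega> t) = 0"
    and pr: "L2_process M S2 eps"
    using model by (auto simp: regression_model_def)
  note [measurable] = L2_measurable[OF u]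
  have err: "err j = (\<lambda>\<omega>. LINT t|leb S2. ?u (\<omega>, t) * e j t)" for j
    by (simp add: err_def[abs_def] L2_inner_def)
  show L: "err j \<in> L2 M" for j unfolding err by (rule MG.L2_slice[OF u e.L2])
  have one: "(\<lambda>_. 1) \<in> L2 M" by (simp add: L2_def)
  have "expectation (err j) = L2_inner M (err j) (\<lambda>_. 1)" by (simp add: L2_inner_def)
  \<comment> \<open>Fubini moves the expectation inside, where the pointwise mean of the error
    vanishes for almost every \<open>t\<close>.\<close>
  also have "\<dots> = L2_inner (leb S2) (\<lambda>t. LINT \<omega>|M. ?u (\<omega>, t) * 1) (e j)"
    unfolding err MG.L2_slice_inner[OF u e.L2 one] by (rule MG.L2_slice2_inner[OF u one e.L2, symmetric])
  also have "\<dots> = 0"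
    unfolding L2_inner_def by (rule integral_eq_zero_AE) (use mean in auto)
  finally show "expectation (err j) = 0" .
  have "(\<Sum>j. ennreal (expectation (\<lambda>\<omega>. (err j \<omega>)\<^sup>2))) = (\<Sum>j. \<integral>\<^sup>+\<omega>. ennreal ((err j \<omega>)\<^sup>2) \<partial>M)"
    using L2_norm_ennreal[OF L] by (simp add: L2_inner_def power2_eq_square)
  also have "\<dots> = (\<integral>\<^sup>+\<omega>. (\<Sum>j. ennreal ((err j \<omega>)\<^sup>2)) \<partial>M)"
    using err_meas by (intro nn_integral_suminf[symmetric]) auto
  also have "\<dots> = (\<integral>\<^sup>+\<omega>. \<integral>\<^sup>+t. ennreal ((?u (\<omega>, t))\<^sup>2) \<partial>leb S2 \<partial>M)"
  proof (rule nn_integral_cong)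
    fix \<omega> assume \<omega>: "\<omega> \<in> space M"
    then have ep: "eps \<omega> \<in> L2 (leb S2)" using pr by (simp add: L2_process_def)
    have "(\<Sum>j. ennreal ((err j \<omega>)\<^sup>2)) = ennreal (L2_inner (leb S2) (eps \<omega>) (eps \<omega>))"
      by (rule suminf_ennreal_eq) (use e.frame_parseval[OF ep] in \<open>auto simp: err_def\<close>)
    then show "(\<Sum>j. ennreal ((err j \<omega>)\<^sup>2)) = (\<integral>\<^sup>+t. ennreal ((?u (\<omega>, t))\<^sup>2) \<partial>leb S2)"
      using L2_norm_ennreal[OF ep] by simp
  qed
  also have "\<dots> = (\<integral>\<^sup>+z. ennreal ((?u z)\<^sup>2) \<partial>(M \<Otimes>\<^sub>M leb S2))"
    by (rule e.nn_integral_fst) measurable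
  also have "\<dots> = ennreal V" unfolding V_def L2_norm_ennreal[OF u] ..
  finally show "(\<Sum>j. ennreal (expectation (\<lambda>\<omega>. (err j \<omega>)\<^sup>2))) = ennreal V" .
qed

lemma indep_integral:
  assumes f: "f \<in> borel_measurable (L2_sigma (leb S1))" and h: "h \<in> borel_measurable borel"
    and i: "integrable M (\<lambda>\<omega>. f (X \<omega>) :: real)" "integrable M (\<lambda>\<omega>. h (err j \<omega>) :: real)"
  shows "integrable M (\<lambda>\<omega>. f (X \<omega>) * h (err j \<omega>))"
    "expectation (\<lambda>\<omega>. f (X \<omega>) * h (err j \<omega>)) = expectation (\<lambda>\<omega>. f (X \<omega>)) * expectation (\<lambda>\<omega>. h (err j \<omega>))"
proof -
  have "indep_var (L2_sigma (leb S1)) X (L2_sigma (leb S2)) eps"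
    using model by (simp add: regression_model_def)
  from indep_var_compose[OF this f measurable_compose[OF measurable_L2_inner[OF e.L2] h]]
  have "indep_var borel (\<lambda>\<omega>. f (X \<omega>)) borel (\<lambda>\<omega>. h (err j \<omega>))"
    by (simp add: err_def o_def)
  from indep_var_integrable[OF this i] indep_var_lebesgue_integral[OF this i]
  show "integrable M (\<lambda>\<omega>. f (X \<omega>) * h (err j \<omega>))"
    "expectation (\<lambda>\<omega>. f (X \<omega>) * h (err j \<omega>)) = expectation (\<lambda>\<omega>. f (X \<omega>)) * expectation (\<lambda>\<omega>. h (err j \<omega>))" by auto
qed

text \<open>Up to a null set the residual is the error coefficient, which is independent of
  \<open>\<xi>\<close>, so first and second moments factor.\<close>

lemma resid_mean: "expectation (\<lambda>\<omega>. (\<xi> \<omega> \<bullet> y) * resid j (X \<omega>, Y \<omega>)) = 0"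
  and resid_square_integrable: "integrable M (\<lambda>\<omega>. ((\<xi> \<omega> \<bullet> y) * resid j (X \<omega>, Y \<omega>))\<^sup>2)"
  and resid_square: "expectation (\<lambda>\<omega>. ((\<xi> \<omega> \<bullet> y) * resid j (X \<omega>, Y \<omega>))\<^sup>2) =
    expectation (\<lambda>\<omega>. (\<xi> \<omega> \<bullet> y)\<^sup>2) * expectation (\<lambda>\<omega>. (err j \<omega>)\<^sup>2)"
proof -
  have m [measurable]: "(\<lambda>\<omega>. resid j (X \<omega>, Y \<omega>)) \<in> borel_measurable M"
    by (rule measurable_compose[OF Z0_meas resid_meas])
  note [measurable] = err_meas
  have "expectation (\<lambda>\<omega>. (\<xi> \<omega> \<bullet> y) * resid j (X \<omega>, Y \<omega>)) = expectation (\<lambda>\<omega>. (\<xi> \<omega> \<bullet> y) * err j \<omega>)"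
    by (rule integral_cong_AE) (use resid_eq[of j] in auto)
  also have "\<dots> = 0"
    using indep_integral(2)[OF measurable_chivec_inner, of "\<lambda>x. x" y j] L2_integrable[OF inner_L2] L2_integrable[OF err_L2] err_mean
    by simp
  finally show "expectation (\<lambda>\<omega>. (\<xi> \<omega> \<bullet> y) * resid j (X \<omega>, Y \<omega>)) = 0" .
  have ii: "integrable M (\<lambda>\<omega>. (\<xi> \<omega> \<bullet> y)\<^sup>2)" "integrable M (\<lambda>\<omega>. (err j \<omega>)\<^sup>2)"
    by (intro L2_square inner_L2 err_L2)+
  have ind: "integrable M (\<lambda>\<omega>. (\<xi> \<omega> \<bullet> y)\<^sup>2 * (err j \<omega>)\<^sup>2)"
    "expectation (\<lambda>\<omega>. (\<xi> \<omega> \<bullet> y)\<^sup>2 * (err j \<omega>)\<^sup>2) = expectation (\<lambda>\<omega>. (\<xi> \<omega> \<bullet> y)\<^sup>2) * expectation (\<lambda>\<omega>. (err j \<omega>)\<^sup>2)"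
    using indep_integral[of "\<lambda>x. (chivec x \<bullet> y)\<^sup>2" "\<lambda>x. x\<^sup>2" j] ii measurable_chivec_inner[of y] by auto
  have ae: "AE \<omega> in M. ((\<xi> \<omega> \<bullet> y) * resid j (X \<omega>, Y \<omega>))\<^sup>2 = (\<xi> \<omega> \<bullet> y)\<^sup>2 * (err j \<omega>)\<^sup>2"
    using resid_eq[of j] by eventually_elim (simp add: power_mult_distrib)
  show "integrable M (\<lambda>\<omega>. ((\<xi> \<omega> \<bullet> y) * resid j (X \<omega>, Y \<omega>))\<^sup>2)"
    by (subst integrable_cong_AE[OF _ _ ae]) (use ind in auto)
  have "expectation (\<lambda>\<omega>. ((\<xi> \<omega> \<bullet> y) * resid j (X \<omega>, Y \<omega>))\<^sup>2) = expectation (\<lambda>\<omega>. (\<xi> \<omega> \<bullet> y)\<^sup>2 * (err j \<omega>)\<^sup>2)"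
    by (rule integral_cong_AE[OF _ _ ae]) auto
  then show "expectation (\<lambda>\<omega>. ((\<xi> \<omega> \<bullet> y) * resid j (X \<omega>, Y \<omega>))\<^sup>2) =
    expectation (\<lambda>\<omega>. (\<xi> \<omega> \<bullet> y)\<^sup>2) * expectation (\<lambda>\<omega>. (err j \<omega>)\<^sup>2)" using ind(2) by simp
qed

definition "gram n \<omega> y z = (\<Sum>k=1..n. (chivec (Xs k \<omega>) \<bullet> y) * (chivec (Xs k \<omega>) \<bullet> z)) / real n"
definition "noise n \<omega> j y = (\<Sum>k=1..n. (chivec (Xs k \<omega>) \<bullet> y) * resid j (Xs k \<omega>, Ys k \<omega>)) / real n"

text \<open>In an eigenbasis \<open>x\<close> of \<open>Gam\<close>, the squared Hilbert-Schmidt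
  norm of the deviation of the empirical operator, weighted by the inverse square root of
  \<open>Gam + lam\<close>.\<close>

definition "gram_dev x \<tau> lam n \<omega> = (\<Sum>i. \<Sum>j. ennreal (1 / (\<tau> i + lam)) * ennreal ((gram n \<omega> (x i) (x j) - Gam (x i) \<bullet> x j)\<^sup>2))"
text \<open>The squared norms of the noise vectors of all coordinates \<open>j\<close>, added up
  after the same weighting.\<close>

definition "noise_dev x \<tau> lam n \<omega> = (\<Sum>i. \<Sum>j. ennreal (1 / (\<tau> i + lam)) * ennreal ((noise n \<omega> j (x i))\<^sup>2))"

context
  fixes x :: "nat \<Rightarrow> ell2" and \<tau> :: "nat \<Rightarrow> real" and lam :: real
  assumes x: "onb x" and \<tau>: "\<And>i. Gam (x i) = \<tau> i *\<^sub>R x i" "\<And>i. 0 \<le> \<tau> i" and lam: "0 < lam"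
begin

lemma expectation_eigen: "expectation (\<lambda>\<omega>. (\<xi> \<omega> \<bullet> x i)\<^sup>2) = \<tau> i * (x i \<bullet> x i)"
  using Gam_inner[of "x i" "x i"] \<tau>(1)[of i] by (simp add: power2_eq_square)

lemma deviation_bounds:
  assumes n: "1 \<le> n" and N: "(\<Sum>i. ennreal (\<tau> i * (x i \<bullet> x i) / (\<tau> i + lam))) \<le> ennreal N" "0 \<le> N"
  shows "gram_dev x \<tau> lam n \<in> borel_measurable M" "(\<integral>\<^sup>+\<omega>. gram_dev x \<tau> lam n \<omega> \<partial>M) \<le> ennreal (\<kappa>\<^sub>p * N / real n)"
    "noise_dev x \<tau> lam n \<in> borel_measurable M" "(\<integral>\<^sup>+\<omega>. noise_dev x \<tau> lam n \<omega> \<partial>M) \<le> ennreal (V * N / real n)"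
proof -
  interpret x: onb x by (rule x)
  have w: "0 \<le> 1 / (\<tau> i + lam)" for i using \<tau>(2)[of i] lam by simp
  have a: "0 \<le> \<tau> i * (x i \<bullet> x i)" for i using \<tau>(2)[of i] by simp
  have N': "(\<Sum>i. ennreal (1 / (\<tau> i + lam) * (\<tau> i * (x i \<bullet> x i)))) \<le> ennreal N" using N by simp
  define F1 where "F1 i j z = (chivec (fst z) \<bullet> x i) * (chivec (fst z) \<bullet> x j)" for i j and z :: "(real \<Rightarrow> real) \<times> (real \<Rightarrow> real)"
  define F2 where "F2 i j z = (chivec (fst z) \<bullet> x i) * resid j z" for i j and z :: "(real \<Rightarrow> real) \<times> (real \<Rightarrow> real)"
  have F1m: "F1 i j \<in> borel_measurable P" and F2m: "F2 i j \<in> borel_measurable P" for i j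
    unfolding F1_def[abs_def] F2_def[abs_def] by (intro borel_measurable_times chivec_meas resid_meas)+
  have sq: "(F1 i j (X \<omega>, Y \<omega>))\<^sup>2 = (\<xi> \<omega> \<bullet> x i)\<^sup>2 * (\<xi> \<omega> \<bullet> x j)\<^sup>2" for i j \<omega>
    by (simp add: F1_def power_mult_distrib)
  have F1i: "integrable M (\<lambda>\<omega>. (F1 i j (X \<omega>, Y \<omega>))\<^sup>2)" for i j
    unfolding sq
  proof (rule integrable_const_bound[where B = "(\<kappa>\<^sub>p * (norm (x i))\<^sup>2) * (\<kappa>\<^sub>p * (norm (x j))\<^sup>2)"])
    show "AE \<omega> in M. norm ((\<xi> \<omega> \<bullet> x i)\<^sup>2 * (\<xi> \<omega> \<bullet> x j)\<^sup>2) \<le> (\<kappa>\<^sub>p * (norm (x i))\<^sup>2) * (\<kappa>\<^sub>p * (norm (x j))\<^sup>2)"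
    proof (rule AE_I2)
      fix \<omega> assume "\<omega> \<in> space M"
      then have "(\<xi> \<omega> \<bullet> x i)\<^sup>2 * (\<xi> \<omega> \<bullet> x j)\<^sup>2 \<le> (\<kappa>\<^sub>p * (norm (x i))\<^sup>2) * (\<kappa>\<^sub>p * (norm (x j))\<^sup>2)"
        using \<kappa>_nonneg by (intro mult_mono inner_square_bound) auto
      then show "norm ((\<xi> \<omega> \<bullet> x i)\<^sup>2 * (\<xi> \<omega> \<bullet> x j)\<^sup>2) \<le> (\<kappa>\<^sub>p * (norm (x i))\<^sup>2) * (\<kappa>\<^sub>p * (norm (x j))\<^sup>2)" by simp
    qed
  qed measurable
  have F1s: "(\<Sum>j. ennreal (expectation (\<lambda>\<omega>. (F1 i j (X \<omega>, Y \<omega>))\<^sup>2))) \<le> ennreal (\<kappa>\<^sub>p * (\<tau> i * (x i \<bullet> x i)))" for i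
  proof -
    have "(\<Sum>j. ennreal (expectation (\<lambda>\<omega>. (F1 i j (X \<omega>, Y \<omega>))\<^sup>2))) = (\<Sum>j. \<integral>\<^sup>+\<omega>. ennreal ((\<xi> \<omega> \<bullet> x i)\<^sup>2 * (\<xi> \<omega> \<bullet> x j)\<^sup>2) \<partial>M)"
      unfolding sq[symmetric] by (intro suminf_cong nn_integral_eq_integral[symmetric] F1i) auto
    also have "\<dots> = (\<integral>\<^sup>+\<omega>. (\<Sum>j. ennreal ((\<xi> \<omega> \<bullet> x i)\<^sup>2 * (\<xi> \<omega> \<bullet> x j)\<^sup>2)) \<partial>M)"
      by (rule nn_integral_suminf[symmetric]) measurable
    also have "\<dots> \<le> (\<integral>\<^sup>+\<omega>. ennreal (\<kappa>\<^sub>p * (\<xi> \<omega> \<bullet> x i)\<^sup>2) \<partial>M)"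
    proof (rule nn_integral_mono)
      fix \<omega> assume \<omega>: "\<omega> \<in> space M"
      \<comment> \<open>Summing over the second index gives the full squared norm of
        \<open>\<xi> \<omega>\<close>, which is bounded by \<open>\<kappa>\<^sub>p\<close>; the
        first index keeps the weight.\<close>
      have "(\<Sum>j. ennreal ((\<xi> \<omega> \<bullet> x i)\<^sup>2 * (\<xi> \<omega> \<bullet> x j)\<^sup>2)) = ennreal ((\<xi> \<omega> \<bullet> x i)\<^sup>2 * (\<xi> \<omega> \<bullet> \<xi> \<omega>))"
        by (rule suminf_ennreal_eq) (use sums_mult[OF x.parseval[of "\<xi> \<omega>"]] in auto)
      also have "\<dots> \<le> ennreal (\<kappa>\<^sub>p * (\<xi> \<omega> \<bullet> x i)\<^sup>2)"
        using bound[OF \<omega>] by (intro ennreal_leI) (simp add: power2_norm_eq_inner mult.commute[of "(\<xi> \<omega> \<bullet> x i)\<^sup>2"] mult_right_mono)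
      finally show "(\<Sum>j. ennreal ((\<xi> \<omega> \<bullet> x i)\<^sup>2 * (\<xi> \<omega> \<bullet> x j)\<^sup>2)) \<le> ennreal (\<kappa>\<^sub>p * (\<xi> \<omega> \<bullet> x i)\<^sup>2)" .
    qed
    also have "\<dots> = ennreal (expectation (\<lambda>\<omega>. \<kappa>\<^sub>p * (\<xi> \<omega> \<bullet> x i)\<^sup>2))"
      using \<kappa>_nonneg by (intro nn_integral_eq_integral integrable_mult_right L2_square[OF inner_L2]) auto
    finally show ?thesis by (simp add: expectation_eigen)
  qed
  have F1e: "expectation (\<lambda>\<omega>. F1 i j (X \<omega>, Y \<omega>)) = Gam (x i) \<bullet> x j" for i j
    by (simp add: F1_def Gam_inner)
  note D1 = weighted_deviation[where F = F1 and c = "\<kappa>\<^sub>p" and N = N and w = "\<lambda>i. 1 / (\<tau> i + lam)" and a = "\<lambda>i. \<tau> i * (x i \<bullet> x i)", OF indep_data distr_data Z0_meas n F1m F1i F1s \<kappa>_nonneg w a N' N(2)]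
  have G: "gram_dev x \<tau> lam n = (\<lambda>\<omega>. \<Sum>i. \<Sum>j. ennreal (1 / (\<tau> i + lam)) * ennreal (((\<Sum>k=1..n. F1 i j (Xs k \<omega>, Ys k \<omega>)) / real n -
      expectation (\<lambda>\<omega>. F1 i j (X \<omega>, Y \<omega>)))\<^sup>2))"
    unfolding gram_dev_def[abs_def] gram_def F1e by (simp add: F1_def)
  show "gram_dev x \<tau> lam n \<in> borel_measurable M" unfolding G by (rule D1(1))
  show "(\<integral>\<^sup>+\<omega>. gram_dev x \<tau> lam n \<omega> \<partial>M) \<le> ennreal (\<kappa>\<^sub>p * N / real n)" unfolding G by (rule D1(2))
  have F2i: "integrable M (\<lambda>\<omega>. (F2 i j (X \<omega>, Y \<omega>))\<^sup>2)" for i j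
    using resid_square_integrable by (simp add: F2_def)
  have F2s: "(\<Sum>j. ennreal (expectation (\<lambda>\<omega>. (F2 i j (X \<omega>, Y \<omega>))\<^sup>2))) \<le> ennreal (V * (\<tau> i * (x i \<bullet> x i)))" for i
  proof -
    have "(\<Sum>j. ennreal (expectation (\<lambda>\<omega>. (F2 i j (X \<omega>, Y \<omega>))\<^sup>2))) =
        (\<Sum>j. ennreal (\<tau> i * (x i \<bullet> x i)) * ennreal (expectation (\<lambda>\<omega>. (err j \<omega>)\<^sup>2)))"
      by (simp add: F2_def resid_square expectation_eigen ennreal_mult a)
    also have "\<dots> = ennreal (\<tau> i * (x i \<bullet> x i)) * ennreal V"
      by (simp only: ennreal_suminf_cmult err_total)
    also have "\<dots> = ennreal (V * (\<tau> i * (x i \<bullet> x i)))"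
      using a V_nonneg by (simp add: mult_ac flip: ennreal_mult)
    finally show ?thesis by simp
  qed
  have F2e: "expectation (\<lambda>\<omega>. F2 i j (X \<omega>, Y \<omega>)) = 0" for i j
    using resid_mean by (simp add: F2_def)
  note D2 = weighted_deviation[where F = F2 and c = "V" and N = N and w = "\<lambda>i. 1 / (\<tau> i + lam)" and a = "\<lambda>i. \<tau> i * (x i \<bullet> x i)", OF indep_data distr_data Z0_meas n F2m F2i F2s V_nonneg w a N' N(2)]
  have G: "noise_dev x \<tau> lam n = (\<lambda>\<omega>. \<Sum>i. \<Sum>j. ennreal (1 / (\<tau> i + lam)) * ennreal (((\<Sum>k=1..n. F2 i j (Xs k \<omega>, Ys k \<omega>)) / real n -
      expectation (\<lambda>\<omega>. F2 i j (X \<omega>, Y \<omega>)))\<^sup>2))"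
    unfolding noise_dev_def[abs_def] noise_def F2e by (simp add: F2_def)
  show "noise_dev x \<tau> lam n \<in> borel_measurable M" unfolding G by (rule D2(1))
  show "(\<integral>\<^sup>+\<omega>. noise_dev x \<tau> lam n \<omega> \<partial>M) \<le> ennreal (V * N / real n)" unfolding G by (rule D2(2))
qed

end

lemma deviation_event:
  assumes x: "onb x" "\<And>i. Gam (x i) = \<tau> i *\<^sub>R x i" "\<And>i. 0 \<le> \<tau> i" and lam: "0 < lam" and n: "1 \<le> n"
    and N: "(\<Sum>i. ennreal (\<tau> i * (x i \<bullet> x i) / (\<tau> i + lam))) \<le> ennreal N" "0 < N"
    and \<delta>: "0 < \<delta>" and Q: "AE \<omega> in M. Q \<omega>"
  shows "\<exists>E\<in>sets M. 1 - \<delta> \<le> prob E \<and> (\<forall>\<omega>\<in>E. \<omega> \<in> space M \<and> Q \<omega> \<and>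
    gram_dev x \<tau> lam n \<omega> \<le> ennreal (2 / \<delta> * (\<kappa>\<^sub>p + 1) * N / real n) \<and>
    noise_dev x \<tau> lam n \<omega> \<le> ennreal (2 / \<delta> * (V + 1) * N / real n))"
proof -
  note dev = deviation_bounds[OF x lam n N(1) less_imp_le[OF N(2)]]
  let ?A1 = "{\<omega>\<in>space M. \<not> gram_dev x \<tau> lam n \<omega> \<le> ennreal (2 / \<delta> * (\<kappa>\<^sub>p + 1) * N / real n)}"
  let ?A2 = "{\<omega>\<in>space M. \<not> noise_dev x \<tau> lam n \<omega> \<le> ennreal (2 / \<delta> * (V + 1) * N / real n)}"
  have meas: "?A1 \<in> sets M" "?A2 \<in> sets M" using dev(1,3) by measurable
  \<comment> \<open>The set where \<open>Q\<close> fails need not be measurable, so it is covered by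
    a measurable null set.\<close>
  obtain U where U: "{\<omega>\<in>space M. \<not> Q \<omega>} \<subseteq> U" "emeasure M U = 0" "U \<in> sets M"
    using AE_E[OF Q] by blast
  \<comment> \<open>The factor 2 / \<delta> gives each of the two Markov bounds the share
    \<delta>/2; \<open>c + 1\<close> instead of \<open>c\<close> keeps the threshold positive when
    \<open>c = 0\<close>.\<close>
  have T: "0 < 2 / \<delta> * (c + 1) * N / real n" "c * N / real n \<le> \<delta> / 2 * (2 / \<delta> * (c + 1) * N / real n)" "0 \<le> c * N / real n"
    if "0 \<le> c" for c
  proof -
    have "\<delta> / 2 * (2 / \<delta> * (c + 1) * N / real n) = (c + 1) * N / real n" using \<delta> n by (simp add: field_simps)
    moreover have "c * N / real n \<le> (c + 1) * N / real n"
      using N(2) by (intro divide_right_mono mult_right_mono) auto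
    ultimately show "c * N / real n \<le> \<delta> / 2 * (2 / \<delta> * (c + 1) * N / real n)" by simp
    show "0 < 2 / \<delta> * (c + 1) * N / real n" "0 \<le> c * N / real n"
      using that \<delta> N(2) n by (auto intro!: divide_pos_pos mult_pos_pos)
  qed
  have P1: "prob ?A1 \<le> \<delta> / 2"
    by (rule markov_bound[OF dev(1,2) T(3,1,2)]) (use \<kappa>_nonneg \<delta> in auto)
  have P2: "prob ?A2 \<le> \<delta> / 2"
    by (rule markov_bound[OF dev(3,4) T(3,1,2)]) (use V_nonneg \<delta> in auto)
  have "prob (?A1 \<union> ?A2 \<union> U) \<le> prob (?A1 \<union> ?A2) + prob U"
    by (rule measure_Un_le[OF sets.Un[OF meas] U(3)])
  also have "prob (?A1 \<union> ?A2) \<le> prob ?A1 + prob ?A2"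
    by (rule measure_Un_le[OF meas])
  finally have "prob (?A1 \<union> ?A2 \<union> U) \<le> \<delta>"
    using P1 P2 U(2) by (simp add: measure_def)
  then have "1 - \<delta> \<le> prob (space M - (?A1 \<union> ?A2 \<union> U))"
    unfolding prob_compl[OF sets.Un[OF sets.Un[OF meas] U(3)]] by linarith
  moreover have "space M - (?A1 \<union> ?A2 \<union> U) \<in> sets M" by (intro sets.Diff sets.top sets.Un meas U(3))
  moreover have "\<omega> \<in> space M \<and> Q \<omega> \<and>
    gram_dev x \<tau> lam n \<omega> \<le> ennreal (2 / \<delta> * (\<kappa>\<^sub>p + 1) * N / real n) \<and>
    noise_dev x \<tau> lam n \<omega> \<le> ennreal (2 / \<delta> * (V + 1) * N / real n)" if "\<omega> \<in> space M - (?A1 \<union> ?A2 \<union> U)" for \<omega>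
    using that U(1) by blast
  ultimately show ?thesis by blast
qed

section \<open>From deviations to the error on one sample\<close>

lemma sample_error:
  assumes n: "1 \<le> n" and \<omega>: "\<omega> \<in> space M"
    and spec: "spectrum_on p (LL_meas S1 S2) (AA_emp p S1 Xs n \<omega>) \<subseteq> {0..\<eta>}"
    and x: "onb x" "\<And>i. \<tau> i \<in> {0..\<eta>}"
    and T: "diagonal_operator p (LL_meas S1 S2) hat range_space x \<tau> (AA_op M p S1 S2 X)"
    and inv: "\<And>f j v. Bseq (\<lambda>i. f (\<tau> i)) \<Longrightarrow> v \<in> range_space j \<Longrightarrow> diag x (\<lambda>i. f (\<tau> i)) v \<in> range_space j"
    and al: "\<And>j. alive j \<Longrightarrow> (\<forall>v. Gam v = diag x \<tau> v) \<and> (\<forall>i. Gam (x i) = \<tau> i *\<^sub>R x i)"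
    and dev: "\<And>j. alive j \<Longrightarrow> gram_dev x \<tau> lam n \<omega> \<le> ennreal T1 \<and> noise_dev x \<tau> lam n \<omega> \<le> ennreal T2"
    and T1: "0 \<le> T1" and T2: "0 \<le> T2"
    and lam: "0 < lam" "lam \<le> \<eta>"
    and v: "v \<in> H" and \<beta>_v: "\<And>j. hat \<beta> j = diag x (\<lambda>i. \<phi> (\<tau> i)) (hat v j)"
    and r: "\<And>t a. t \<in> {0..\<eta>} \<Longrightarrow> 0 \<le> a \<Longrightarrow> a \<le> \<nu> \<Longrightarrow> \<bar>1 - t * g t\<bar> * (t + lam) powr a \<le> Cr * lam powr a"
    and g: "\<And>t. t \<in> {0..\<eta>} \<Longrightarrow> \<bar>g t\<bar> \<le> Gb" "\<And>t. 0 < t \<Longrightarrow> t \<le> \<eta> \<Longrightarrow> \<bar>g t\<bar> * (t + lam) \<le> Cg"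
    and \<phi>: "\<And>t. t \<in> {0..\<eta>} \<Longrightarrow> \<bar>\<phi> t\<bar> \<le> \<Phi>"
      "\<And>t. t \<in> {0..\<eta>} \<Longrightarrow> \<bar>\<phi> t\<bar> * (t + lam) powr (- (\<nu> - s)) \<le> F * lam powr (- (\<nu> - s))"
    and s: "0 \<le> s" "s \<le> 1/2" and \<nu>: "1 \<le> \<nu>" and nn: "0 \<le> Cr" "0 \<le> Cg" "0 \<le> F" "0 \<le> \<Phi>"
  defines "\<epsilon> \<equiv> sqrt (T1 / lam)"
  shows "(dnorm p (LL_meas S1 S2) (fcalc p (LL_meas S1 S2) (rpow s) (AA_op M p S1 S2 X)
      (ddiff (fcalc p (LL_meas S1 S2) g (AA_emp p S1 Xs n \<omega>) (AY_emp Xs Ys n \<omega>)) \<beta>)))\<^sup>2 \<le>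
      2 * ((2 + \<epsilon>\<^sup>2) * (2 + \<epsilon>\<^sup>2) * Cr * (F + (\<nu> - s) * \<epsilon> * \<Phi>) * lam powr s)\<^sup>2 * (dnorm p (LL_meas S1 S2) v)\<^sup>2 +
      2 * (lam powr (s - 1/2) * ((2 + \<epsilon>\<^sup>2) * (2 + \<epsilon>\<^sup>2) * Cg))\<^sup>2 * T2" (is "?lhs \<le> ?rhs")
proof -
  let ?N = "LL_meas S1 S2" and ?U = "uniform_count_measure {1..n}"
  let ?\<chi> = "\<lambda>k. chivec (Xs k \<omega>)"
  have Xk: "Xs k \<omega> \<in> L2 (leb S1)" and Yk: "Ys k \<omega> \<in> L2 (leb S2)" if "k \<in> {1..n}" for k
    using data_L2[of k \<omega>] that \<omega> by auto
  \<comment> \<open>The empirical operator is the second moment operator of a uniformly chosen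
    observation. The sum of all squared norms is a crude bound for each of them and serves only to
    meet the locale condition.\<close>
  interpret emp: second_moment ?U ?\<chi> "\<Sum>k=1..n. (norm (?\<chi> k))\<^sup>2"
  proof (intro second_moment.intro second_moment_axioms.intro prob_space_uniform_count_measure)
    show "(norm (?\<chi> k))\<^sup>2 \<le> (\<Sum>k=1..n. (norm (?\<chi> k))\<^sup>2)" if "k \<in> space ?U" for k
      by (rule member_le_sum) (use that in \<open>auto simp: space_uniform_count_measure\<close>)
  qed (use n in \<open>auto simp: measurable_def space_uniform_count_measure sets_uniform_count_measure\<close>)
  define En where "En = emp.Gam"
  have En: "positive_hs unit_vec En" unfolding En_def by (rule emp.positive_hs_axioms)
  have En_sym: "En u \<bullet> v = u \<bullet> En v" for u v unfolding En_def by (rule emp.sym)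
  have G: "En y \<bullet> z = gram n \<omega> y z" for y z
    unfolding En_def emp.Gam_inner integral_uniform_count_measure[OF finite_atLeastAtMost] gram_def by simp
  have hatT: "hat (AA_emp p S1 Xs n \<omega> u) j = En (hat u j)" if "u \<in> H" for u j
  proof -
    have "hat (AA_emp p S1 Xs n \<omega> u) j \<bullet> z = En (hat u j) \<bullet> z" for z
      unfolding AA_emp_hat(2)[of n Xs \<omega>, OF Xk that, simplified] G
      by (simp add: gram_def inner_sum_left inner_commute[of "hat u j"])
    then show ?thesis using vector_eq_rdot by blast
  qed
  have TH: "AA_emp p S1 Xs n \<omega> u \<in> H" if "u \<in> H" for u by (rule AA_emp_hat(1)[of n Xs \<omega>, OF Xk that])
  have dead: "coord (En y) m = 0" if "dead m" for m y
  proof -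
    have "?\<chi> k \<bullet> unit_vec m = 0" if "k \<in> {1..n}" for k
      using kvec_dead[OF chi_K[OF Xk[OF that]] \<open>dead m\<close>] by (simp add: inner_unit_vec chivec_def)
    then show ?thesis
      unfolding En_def emp.coord_Gam integral_uniform_count_measure[OF finite_atLeastAtMost] by simp
  qed
  obtain y \<rho> where y: "onb y" "\<And>i. \<rho> i \<in> {0..\<eta>}"
    and T': "diagonal_operator p ?N hat range_space y \<rho> (AA_emp p S1 Xs n \<omega>)"
    and inv': "\<And>f j v. Bseq (\<lambda>i. f (\<rho> i)) \<Longrightarrow> v \<in> range_space j \<Longrightarrow> diag y (\<lambda>i. f (\<rho> i)) v \<in> range_space j"
    and al': "\<And>j. alive j \<Longrightarrow> (\<forall>v. En v = diag y \<rho> v) \<and> (\<forall>i. En (y i) = \<rho> i *\<^sub>R y i)"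
    using operator_diagonalization[OF TH hatT En dead spec order.trans[OF less_imp_le[OF lam(1)] lam(2)]] by blast
  have Bg: "Bseq (\<lambda>i. g (\<rho> i))" by (rule BseqI'[of _ Gb]) (use g(1) y(2) in simp)
  have AY: "AY_emp Xs Ys n \<omega> \<in> H" by (rule AY_emp_hat(1)[of n Xs \<omega> Ys, OF Xk Yk])
  \<comment> \<open>By \<open>zn\<close> below this is the sample mean of residual times
    observation, so the expansion of the data term around the target leaves only noise.\<close>
  define z where "z j = hat (AY_emp Xs Ys n \<omega>) j - En (hat \<beta> j)" for j
  have zn: "z j \<bullet> a = noise n \<omega> j a" for j a
  proof -
    have "z j \<bullet> a = (\<Sum>k=1..n. L2_inner (leb S2) (Ys k \<omega>) (e j) * (?\<chi> k \<bullet> a)) / real n - gram n \<omega> (hat \<beta> j) a"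
      unfolding z_def inner_diff_left G AY_emp_hat(2)[of n Xs \<omega> Ys, OF Xk Yk, simplified]
      by (simp add: inner_sum_left)
    also have "\<dots> = noise n \<omega> j a"
      by (simp add: gram_def noise_def resid_def diff_divide_distrib[symmetric] sum_subtractf[symmetric]
          inner_commute[of "hat \<beta> j"] algebra_simps)
    finally show ?thesis .
  qed
  interpret DT': diagonal_operator p ?N hat range_space y \<rho> "AA_emp p S1 Xs n \<omega>" by (rule T')
  interpret DT: diagonal_operator p ?N hat range_space x \<tau> "AA_op M p S1 S2 X" by (rule T)
  have rhs: "0 \<le> ?rhs" using T2 by simp
  show ?thesis
  proof (cases "\<exists>j. alive j")
    \<comment> \<open>All elements have norm 0; it remains to check that the error is an element of
      the space at all.\<close>
    case False
    have Bs: "Bseq (\<lambda>i. rpow s (\<tau> i))"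
    proof (rule BseqI'[of _ "(\<eta> + lam) powr s"])
      fix i
      have "rpow s (\<tau> i) \<le> (\<tau> i + lam) powr s" using rpow_le[of "\<tau> i" lam s] x(2)[of i] lam s by simp
      also have "\<dots> \<le> (\<eta> + lam) powr s" using x(2)[of i] lam s by (intro powr_mono2) auto
      finally show "norm (rpow s (\<tau> i)) \<le> (\<eta> + lam) powr s" using rpow_le[of "\<tau> i" lam s] x(2)[of i] lam s by simp
    qed
    define h where "h = rpow s"
    have Bh: "Bseq (\<lambda>i. h (\<tau> i))" using Bs by (simp add: h_def)
    have "fcalc p ?N g (AA_emp p S1 Xs n \<omega>) (AY_emp Xs Ys n \<omega>) \<in> H"
      by (rule DT'.fcalc_diag[OF Bg inv'[OF Bg] AY])
    then have "fcalc p ?N h (AA_op M p S1 S2 X) (ddiff (fcalc p ?N g (AA_emp p S1 Xs n \<omega>) (AY_emp Xs Ys n \<omega>)) \<beta>) \<in> H"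
      by (intro DT.fcalc_diag(1)[OF Bh inv[OF Bh]] ddiff_dsum \<beta>)
    then have "fcalc p ?N (rpow s) (AA_op M p S1 S2 X) (ddiff (fcalc p ?N g (AA_emp p S1 Xs n \<omega>) (AY_emp Xs Ys n \<omega>)) \<beta>) \<in> H"
      unfolding h_def .
    from dnorm_null[OF _ this] False show ?thesis using rhs by simp
  next
    case True
    then obtain j0 where j0: "alive j0" by blast
    note Gx = al[OF j0] and Gy = al'[OF j0]
    have \<tau>: "0 \<le> \<tau> i" "Bseq \<tau>" for i
      using x(2)[of i] DT.\<tau> by auto
    have "perturbation x y \<tau> \<rho> \<eta> lam \<epsilon>"
    proof (intro perturbation.intro perturbation_axioms.intro)
      fix a
      have "norm ((\<lambda>v. Gam v - En v) a) \<le> sqrt T1 * norm (diag x (\<lambda>i. (\<tau> i + lam) powr (1/2)) a)"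
      proof (rule weighted_operator_bound[OF x(1) \<tau> lam(1)])
        show "(Gam u - En u) \<bullet> v = u \<bullet> (Gam v - En v)" for u v
          by (simp add: inner_simps sym En_sym)
        show "(\<Sum>i. \<Sum>j. ennreal (1 / (\<tau> i + lam)) * ennreal (((Gam (x i) - En (x i)) \<bullet> x j)\<^sup>2)) \<le> ennreal T1"
          using dev[OF j0] unfolding gram_dev_def by (simp add: inner_diff_left G power2_commute)
      qed (rule T1)
      also have "sqrt T1 = \<epsilon> * sqrt lam"
        using lam T1 by (simp add: \<epsilon>_def flip: real_sqrt_mult)
      finally show "norm (diag x \<tau> a - diag y \<rho> a) \<le> \<epsilon> * sqrt lam * norm (diag x (\<lambda>i. (\<tau> i + lam) powr (1/2)) a)"
        using Gx Gy by simp
    qed (use x y lam T1 in \<open>auto simp: \<epsilon>_def\<close>)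
    note pert = this
    then interpret pt: perturbation x y \<tau> \<rho> \<eta> lam \<epsilon> .
    define w where "w j = (\<Sum>i. ennreal (1 / (\<tau> i + lam)) * ennreal ((z j \<bullet> x i)\<^sup>2))" for j
    have wT: "(\<Sum>j. w j) \<le> ennreal T2"
      using dev[OF j0] unfolding noise_dev_def w_def zn by (subst ennreal_suminf_swap) (rule conjunct2)
    have wf: "w j \<noteq> \<top>" for j
    proof -
      have "w j = (\<Sum>k\<in>{j}. w k)" by simp
      also have "\<dots> \<le> (\<Sum>j. w j)" by (rule sum_le_suminf) auto
      finally show ?thesis using wT by (auto simp: top_unique)
    qed
    define \<zeta> where "\<zeta> j = sqrt (enn2real (w j))" for j
    have \<zeta>2: "ennreal ((\<zeta> j)\<^sup>2) = w j" for j using wf[of j] by (simp add: \<zeta>_def less_top)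
    have zb: "z j \<bullet> a \<le> \<zeta> j * norm (diag x (\<lambda>i. (\<tau> i + lam) powr (1/2)) a)" for j a
    proof -
      have "ennreal ((z j \<bullet> a)\<^sup>2) \<le> ennreal ((norm (diag x (\<lambda>i. (\<tau> i + lam) powr (1/2)) a))\<^sup>2) * ennreal ((\<zeta> j)\<^sup>2)"
        unfolding \<zeta>2 w_def by (rule weighted_functional_bound[OF x(1) \<tau> lam(1) wf[unfolded w_def]])
      also have "\<dots> = ennreal ((\<zeta> j * norm (diag x (\<lambda>i. (\<tau> i + lam) powr (1/2)) a))\<^sup>2)"
        by (simp add: power_mult_distrib mult.commute flip: ennreal_mult)
      finally have "(z j \<bullet> a)\<^sup>2 \<le> (\<zeta> j * norm (diag x (\<lambda>i. (\<tau> i + lam) powr (1/2)) a))\<^sup>2"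
        by (subst (asm) ennreal_le_iff) auto
      then show ?thesis by (rule power2_le_imp_le) (simp add: \<zeta>_def)
    qed
    \<comment> \<open>On the kernel of the empirical operator the mean of the squares of
      \<open>?\<chi> k \<bullet> y i\<close> is 0, so every observation is orthogonal to
      \<open>y i\<close>, and the noise is a combination of observations.\<close>
    have ker: "z j \<bullet> y i = 0" if "\<rho> i = 0" for i j
    proof -
      have "En (y i) = 0" using conjunct2[OF Gy, THEN HOL.spec, of i] that by simp
      then have "En (y i) \<bullet> y i = 0" by simp
      then have "(\<Sum>k=1..n. (?\<chi> k \<bullet> y i) * (?\<chi> k \<bullet> y i)) = 0" using n by (simp add: G gram_def)
      then have "?\<chi> k \<bullet> y i = 0" if "k \<in> {1..n}" for k
        using that by (subst (asm) sum_nonneg_eq_0_iff) auto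
      then show ?thesis by (simp add: zn noise_def)
    qed
    have AYz: "hat (AY_emp Xs Ys n \<omega>) j = diag y \<rho> (hat \<beta> j) + z j" for j using Gy by (simp add: z_def)
    have Z: "(\<Sum>j. ennreal ((\<zeta> j)\<^sup>2)) \<le> ennreal T2" unfolding \<zeta>2 by (rule wT)
    show ?thesis
      using error_bound(2)[OF T T' inv inv' pert v \<beta> \<beta>_v AY AYz zb _ ker Z T2 r Bg g(2) \<phi> s \<nu> nn]
      by (simp add: \<zeta>_def pt.C1_def)
  qed
qed

end

section \<open>The convergence rate\<close>

text \<open>For \<open>x \<le> lam\<close> the shift is harmless and the residual is at most
  \<open>1 + A\<close>. For \<open>x > lam\<close> the bound at the full qualification is lowered to
  the exponent \<open>a\<close>, since \<open>x powr (a - \<nu>) \<le> lam powr (a - \<nu>)\<close>.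
  Powers of 2 come from replacing \<open>x + lam\<close> by twice the larger of the two.\<close>

lemma residual_bound:
  assumes reg: "regularization \<eta> A B g"
    and w: "0 < w" "\<And>x. x \<in> {0<..\<eta>} \<Longrightarrow> \<bar>1 - x * g lam x\<bar> * x powr \<nu> \<le> w * lam powr \<nu>"
    and lam: "0 < lam" "lam \<le> \<eta>" and x: "x \<in> {0..\<eta>}" and a: "0 \<le> a" "a \<le> \<nu>"
  shows "\<bar>1 - x * g lam x\<bar> * (x + lam) powr a \<le> 2 powr \<nu> * (1 + A + w) * lam powr a"
proof -
  have A: "0 < A" using reg by (simp add: regularization_def)
  have small: "\<bar>1 - x * g lam x\<bar> * (x + lam) powr a \<le> 2 powr \<nu> * (1 + A) * lam powr a" if "x \<le> lam"
  proof -
    have "\<bar>1 - x * g lam x\<bar> \<le> 1 + A"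
    proof (cases "x = 0")
      case False
      then have "\<bar>x * g lam x\<bar> \<le> A" using reg lam x by (auto simp: regularization_def)
      then show ?thesis by linarith
    qed (use A in simp)
    moreover have "(x + lam) powr a \<le> 2 powr \<nu> * lam powr a"
    proof -
      have "(x + lam) powr a \<le> (2 * lam) powr a" using that x lam a by (intro powr_mono2) auto
      also have "\<dots> = 2 powr a * lam powr a" using lam by (simp add: powr_mult)
      also have "\<dots> \<le> 2 powr \<nu> * lam powr a" using a by (intro mult_right_mono powr_mono) auto
      finally show ?thesis .
    qed
    ultimately have "\<bar>1 - x * g lam x\<bar> * (x + lam) powr a \<le> (1 + A) * (2 powr \<nu> * lam powr a)"
      using A by (intro mult_mono) auto
    then show ?thesis by (simp only: mult_ac)
  qed
  have large: "\<bar>1 - x * g lam x\<bar> * (x + lam) powr a \<le> 2 powr \<nu> * w * lam powr a" if xl: "lam < x"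
  proof -
    have "(x + lam) powr a \<le> (2 * x) powr a" using xl lam a by (intro powr_mono2) auto
    also have "\<dots> = 2 powr a * x powr a" using xl lam by (simp add: powr_mult)
    also have "\<dots> \<le> 2 powr \<nu> * x powr a" using a by (intro mult_right_mono powr_mono) auto
    also have "x powr a = x powr \<nu> * x powr (a - \<nu>)" by (simp flip: powr_add)
    also have "2 powr \<nu> * (x powr \<nu> * x powr (a - \<nu>)) \<le> 2 powr \<nu> * (x powr \<nu> * lam powr (a - \<nu>))"
      using xl lam a by (intro mult_left_mono powr_mono2') auto
    finally have "\<bar>1 - x * g lam x\<bar> * (x + lam) powr a \<le> \<bar>1 - x * g lam x\<bar> * (2 powr \<nu> * (x powr \<nu> * lam powr (a - \<nu>)))"
      by (rule mult_left_mono) simp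
    also have "\<dots> = (\<bar>1 - x * g lam x\<bar> * x powr \<nu>) * (2 powr \<nu> * lam powr (a - \<nu>))" by (simp only: mult_ac)
    also have "\<dots> \<le> (w * lam powr \<nu>) * (2 powr \<nu> * lam powr (a - \<nu>))"
      using w(2)[of x] xl x lam by (intro mult_right_mono) auto
    also have "\<dots> = 2 powr \<nu> * w * (lam powr \<nu> * lam powr (a - \<nu>))" by (simp only: mult_ac)
    also have "lam powr \<nu> * lam powr (a - \<nu>) = lam powr a" by (simp flip: powr_add)
    finally show ?thesis .
  qed
  have "2 powr \<nu> * c * lam powr a \<le> 2 powr \<nu> * (1 + A + w) * lam powr a" if "c = 1 + A \<or> c = w" for c
    using that A w(1) by (intro mult_right_mono mult_left_mono) auto
  note le = this
  show ?thesis
  proof (cases "x \<le> lam")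
    case True
    from order.trans[OF small[OF True] le] show ?thesis by simp
  next
    case False
    from order.trans[OF large[OF False[unfolded not_le]] le] show ?thesis by simp
  qed
qed

lemma filter_bound:
  assumes reg: "regularization \<eta> A B g" and lam: "0 < lam" "lam \<le> \<eta>" and x: "0 < x" "x \<le> \<eta>"
  shows "\<bar>g lam x\<bar> * (x + lam) \<le> A + B"
proof -
  have g: "\<bar>x * g lam x\<bar> \<le> A" "\<bar>g lam x\<bar> \<le> B / lam" using reg lam x by (auto simp: regularization_def)
  have "\<bar>g lam x\<bar> * lam \<le> B" using g(2) lam by (simp add: field_simps)
  moreover have "\<bar>g lam x\<bar> * x \<le> A" using g(1) x by (simp add: abs_mult mult.commute)
  ultimately show ?thesis by (simp add: distrib_left)
qed

text \<open>Below \<open>lam\<close> monotonicity of \<phi> is enough; above, the covering condition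
  says that \<phi> divided by the q-th power is almost decreasing.\<close>

lemma index_bound:
  assumes index: "index_function \<eta> \<phi>" and pos: "\<And>x. x \<in> {0<..\<eta>} \<Longrightarrow> 0 < \<phi> x"
    and c: "0 < c" "c * (lam powr q / \<phi> lam) \<le> (INF x\<in>{lam..\<eta>}. x powr q / \<phi> x)"
    and q: "0 < q" and lam: "0 < lam" "lam \<le> \<eta>" and x: "x \<in> {0..\<eta>}"
  shows "\<bar>\<phi> x\<bar> * (x + lam) powr (- q) \<le> (1 + 1 / c) * \<phi> lam * lam powr (- q)"
proof -
  have mono: "\<phi> s \<le> \<phi> t" if "0 \<le> s" "s \<le> t" "t \<le> \<eta>" for s t
    using index that by (auto simp: index_function_def mono_on_def)
  have nn: "0 \<le> \<phi> x" using mono[of 0 x] x index by (simp add: index_function_def)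
  have pl: "0 < \<phi> lam" using pos lam by simp
  have small: "\<phi> x * (x + lam) powr (- q) \<le> \<phi> lam * lam powr (- q)" if "x \<le> lam"
    using that x lam q pl by (intro mult_mono mono powr_mono2') auto
  have large: "\<phi> x * (x + lam) powr (- q) \<le> 1 / c * \<phi> lam * lam powr (- q)" if xl: "lam < x"
  proof -
    have px: "0 < \<phi> x" using pos x xl lam by simp
    have "bdd_below ((\<lambda>x. x powr q / \<phi> x) ` {lam..\<eta>})"
      by (rule bdd_belowI2[of _ 0]) (use pos lam in \<open>auto intro!: divide_nonneg_pos\<close>)
    then have "(INF x\<in>{lam..\<eta>}. x powr q / \<phi> x) \<le> x powr q / \<phi> x"
      by (rule cINF_lower) (use xl x in auto)
    then have "c * (lam powr q / \<phi> lam) \<le> x powr q / \<phi> x" using c(2) by simp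
    then have "\<phi> x * (c * lam powr q) \<le> \<phi> lam * x powr q"
      using px pl by (simp add: field_simps)
    then have "\<phi> x * (c * lam powr q) * (lam powr (- q) / c * (x + lam) powr (- q)) \<le>
        \<phi> lam * x powr q * (lam powr (- q) / c * (x + lam) powr (- q))"
      using c(1) by (intro mult_right_mono) auto
    also have "\<phi> x * (c * lam powr q) * (lam powr (- q) / c * (x + lam) powr (- q)) = \<phi> x * (x + lam) powr (- q)"
    proof -
      have "lam powr q * lam powr (- q) = 1" using lam by (simp flip: powr_add)
      then show ?thesis using c(1) by (simp add: field_simps)
    qed
    also have "\<phi> lam * x powr q * (lam powr (- q) / c * (x + lam) powr (- q)) \<le>
        \<phi> lam * x powr q * (lam powr (- q) / c * x powr (- q))"
      using xl lam q c(1) pl by (intro mult_left_mono powr_mono2') auto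
    also have "\<dots> = 1 / c * \<phi> lam * lam powr (- q)"
    proof -
      have "x powr q * x powr (- q) = 1" using lam xl by (simp flip: powr_add)
      then show ?thesis by (simp add: field_simps)
    qed
    finally show ?thesis .
  qed
  have "\<phi> x * (x + lam) powr (- q) \<le> (1 + 1 / c) * \<phi> lam * lam powr (- q)"
  proof (cases "x \<le> lam")
    case True
    have "\<phi> lam * lam powr (- q) \<le> (1 + 1 / c) * (\<phi> lam * lam powr (- q))"
      using mult_right_mono[of 1 "1 + 1 / c" "\<phi> lam * lam powr (- q)"] c(1) pl by simp
    then show ?thesis using small[OF True] by (simp only: mult.assoc)
  next
    case False
    have "1 / c * (\<phi> lam * lam powr (- q)) \<le> (1 + 1 / c) * (\<phi> lam * lam powr (- q))"
      using pl by (intro mult_right_mono) auto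
    then show ?thesis using large[OF False[unfolded not_le]] unfolding mult.assoc by (rule order.trans[rotated])
  qed
  then show ?thesis using nn by simp
qed

text \<open>The regularization parameter balances the two error terms: with \<open>\<psi> lam = n\<^sup>-\<^sup>1\<^sup>/\<^sup>2\<close> the
  effective dimension \<open>lam\<^sup>-\<^sup>1\<^sup>/\<^sup>b\<close> divided by \<open>n\<close> is \<open>(\<phi> lam)\<^sup>2 lam\<close>.\<close>

lemma parameter_choice:
  fixes b :: real
  assumes lam: "0 < lam" and n: "1 \<le> n" and eq: "\<phi> lam * lam powr (1/2 + 1/(2*b)) = real n powr (-1/2)"
  shows "lam powr (- 1 / b) / real n = (\<phi> lam)\<^sup>2 * lam"
proof -
  have "1 / real n = (real n powr (-1/2))\<^sup>2"
    using n by (simp add: power2_eq_square powr_minus_divide flip: powr_add)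
  also have "\<dots> = (\<phi> lam)\<^sup>2 * lam powr (1 + 1 / b)"
    unfolding eq[symmetric] by (simp add: power_mult_distrib power2_eq_square flip: powr_add)
  finally have "lam powr (- 1 / b) / real n = (\<phi> lam)\<^sup>2 * (lam powr (1 + 1 / b) * lam powr (- 1 / b))"
    using n by (simp add: field_simps)
  also have "lam powr (1 + 1 / b) * lam powr (- 1 / b) = lam" using lam by (simp flip: powr_add)
  finally show ?thesis .
qed

text \<open>Both error terms are multiples of \<open>f * l powr s\<close>: the noise because
  \<open>l powr (s - 1/2)\<close> squared times \<open>l\<close> is \<open>l powr s\<close> squared.
  The added 1 makes the constant strictly positive.\<close>

lemma rate_arithmetic:
  fixes \<epsilon> :: real
  assumes \<epsilon>: "0 \<le> \<epsilon>" "\<epsilon> \<le> E" and D: "D\<^sup>2 \<le> 2 * ((2 + \<epsilon>\<^sup>2) * (2 + \<epsilon>\<^sup>2) * Cr * (f * L) * l powr s)\<^sup>2 * r\<^sup>2 +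
      2 * (l powr (s - 1/2) * ((2 + \<epsilon>\<^sup>2) * (2 + \<epsilon>\<^sup>2) * Cg))\<^sup>2 * (c * (f\<^sup>2 * l))"
    and r: "0 \<le> r" "r \<le> R" and l: "0 < l" and nn: "0 \<le> f" "0 \<le> L" "0 \<le> Cr" "0 \<le> Cg" "0 \<le> c"
  shows "D \<le> (sqrt (2 * ((2 + E\<^sup>2)\<^sup>2 * Cr * L * R)\<^sup>2 + 2 * ((2 + E\<^sup>2)\<^sup>2 * Cg)\<^sup>2 * c) + 1) * f * l powr s"
proof -
  let ?K = "(2 + E\<^sup>2)\<^sup>2" and ?k = "(2 + \<epsilon>\<^sup>2)\<^sup>2"
  have k: "0 \<le> ?k" "?k \<le> ?K" using \<epsilon> by (auto intro!: power_mono)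
  have "?k * Cr * L * r \<le> ?K * Cr * L * R"
    by (rule mult_mono[OF mult_right_mono[OF mult_right_mono[OF k(2) nn(3)] nn(2)] r(2) _ r(1)]) (use nn in simp)
  then have b1: "(?k * Cr * L * r)\<^sup>2 \<le> (?K * Cr * L * R)\<^sup>2"
    by (rule power_mono) (use nn r in simp)
  have b2: "(?k * Cg)\<^sup>2 \<le> (?K * Cg)\<^sup>2"
    by (rule power_mono[OF mult_right_mono[OF k(2) nn(4)]]) (use nn in simp)
  have half: "(l powr (s - 1/2))\<^sup>2 * l = (l powr s)\<^sup>2"
  proof -
    have "(l powr (s - 1/2))\<^sup>2 * l = l powr (s - 1/2) * l powr (s - 1/2) * l powr 1"
      using l by (simp add: power2_eq_square)
    also have "\<dots> = l powr (s - 1/2 + (s - 1/2) + 1)" by (simp only: powr_add)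
    also have "s - 1/2 + (s - 1/2) + 1 = s + s" by simp
    finally show ?thesis by (simp only: powr_add power2_eq_square)
  qed
  have "D\<^sup>2 \<le> (2 * (?k * Cr * L * r)\<^sup>2 + 2 * (?k * Cg)\<^sup>2 * c) * (f * l powr s)\<^sup>2"
  proof -
    have 1: "2 * ((2 + \<epsilon>\<^sup>2) * (2 + \<epsilon>\<^sup>2) * Cr * (f * L) * l powr s)\<^sup>2 * r\<^sup>2 = 2 * (?k * Cr * L * r)\<^sup>2 * (f * l powr s)\<^sup>2"
      by (simp add: power_mult_distrib power2_eq_square[of "2 + \<epsilon>\<^sup>2"] mult_ac)
    have "2 * (l powr (s - 1/2) * ((2 + \<epsilon>\<^sup>2) * (2 + \<epsilon>\<^sup>2) * Cg))\<^sup>2 * (c * (f\<^sup>2 * l)) =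
        2 * (?k * Cg)\<^sup>2 * c * f\<^sup>2 * ((l powr (s - 1/2))\<^sup>2 * l)"
      by (simp add: power_mult_distrib power2_eq_square[of "2 + \<epsilon>\<^sup>2"] mult_ac)
    also have "\<dots> = 2 * (?k * Cg)\<^sup>2 * c * (f * l powr s)\<^sup>2" unfolding half by (simp add: power_mult_distrib)
    finally show ?thesis using D unfolding 1 by (simp only: distrib_right)
  qed
  also have "\<dots> \<le> (2 * (?K * Cr * L * R)\<^sup>2 + 2 * (?K * Cg)\<^sup>2 * c) * (f * l powr s)\<^sup>2"
    by (rule mult_right_mono[OF add_mono[OF mult_left_mono[OF b1] mult_right_mono[OF mult_left_mono[OF b2] nn(5)]]]) simp_all
  also have "\<dots> = (sqrt (2 * (?K * Cr * L * R)\<^sup>2 + 2 * (?K * Cg)\<^sup>2 * c) * (f * l powr s))\<^sup>2"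
    using nn by (simp add: power_mult_distrib)
  finally have "D \<le> sqrt (2 * (?K * Cr * L * R)\<^sup>2 + 2 * (?K * Cg)\<^sup>2 * c) * (f * l powr s)"
    by (rule power2_le_imp_le) (use nn in simp)
  also have "\<dots> \<le> (sqrt (2 * (?K * Cr * L * R)\<^sup>2 + 2 * (?K * Cg)\<^sup>2 * c) + 1) * (f * l powr s)"
    using nn by (intro mult_right_mono) auto
  finally show ?thesis by (simp only: mult.assoc)
qed

theorem corollary3p5:
  fixes M :: "'w measure" and p :: nat and S1 S2 :: "real set"
    and X Y eps :: "'w \<Rightarrow> real \<Rightarrow> real" and Xs Ys :: "nat \<Rightarrow> 'w \<Rightarrow> real \<Rightarrow> real"
    and \<beta> :: "nat \<Rightarrow> real \<times> (nat \<Rightarrow> real) \<Rightarrow> real"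
    and g :: "real \<Rightarrow> real \<Rightarrow> real" and \<phi> \<psi> :: "real \<Rightarrow> real" and \<mu> :: "nat \<Rightarrow> real"
    and \<sigma> \<eta> A B R \<kappa> b \<nu> s :: real
  assumes model: "regression_model M p S1 S2 X Y eps \<sigma> \<beta>"
    and data: "iid_copies M S1 S2 X Y Xs Ys"
    and eta: "\<eta> > 0"
    and spectrum: "spectrum_on p (LL_meas S1 S2) (AA_op M p S1 S2 X) \<subseteq> {0..\<eta>}"
    and spectrum_emp:
      "\<And>n. n \<ge> 1 \<Longrightarrow> AE \<omega> in M. spectrum_on p (LL_meas S1 S2) (AA_emp p S1 Xs n \<omega>) \<subseteq> {0..\<eta>}"
    and reg: "regularization \<eta> A B g"
    and index: "index_function \<eta> \<phi>"
    and R: "R > 0"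
    and source: "\<beta> \<in> source_set p (LL_meas S1 S2) \<phi> (AA_op M p S1 S2 X) R"
    and bounded: "\<And>\<omega>. \<omega> \<in> space M \<Longrightarrow> (L2_norm (leb S1) (X \<omega>))\<^sup>2 \<le> \<kappa>"
    and b: "b > 1"
    and eigenvalues: "eigenvalue_list p (S_pow S1) (Gamma_op M p S1 X) \<mu>"
    and decay_lower: "\<exists>C>0. \<forall>i\<ge>1. real i powr (- b) \<le> C * \<mu> i"
    and decay_upper: "\<exists>C>0. \<forall>i\<ge>1. \<mu> i \<le> C * real i powr (- b)"
    and psi: "\<And>x. \<psi> x = \<phi> x * x powr (1/2 + 1/(2*b))"
    and psi_inj: "inj_on \<psi> {0..\<eta>}"
    and nu: "\<nu> \<ge> 1" "qualification \<eta> g \<nu>"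
    and s: "0 \<le> s" "s \<le> 1/2"
    and cov: "covers \<eta> (\<nu> - s) \<phi>"
  shows "\<forall>\<delta>. 0 < \<delta> \<and> \<delta> < 1 \<longrightarrow>
    (\<exists>C>0. \<forall>n\<ge>1. real n powr (-1/2) \<in> \<psi> ` {0..\<eta>} \<longrightarrow>
      (let lam = the_inv_into {0..\<eta>} \<psi> (real n powr (-1/2)) in
       \<exists>E\<in>sets M. measure M E \<ge> 1 - \<delta> \<and>
         (\<forall>\<omega>\<in>E. dnorm p (LL_meas S1 S2)
             (fcalc p (LL_meas S1 S2) (rpow s) (AA_op M p S1 S2 X)
               (ddiff (estimator p S1 S2 g Xs Ys n lam \<omega>) \<beta>))
           \<le> C * \<phi> lam * lam powr s)))"
proof (intro allI impI)
  fix \<delta> :: real assume \<delta>: "0 < \<delta> \<and> \<delta> < 1"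
  let ?N = "LL_meas S1 S2" and ?T = "AA_op M p S1 S2 X"
  interpret mdl: regression p S1 S2 M X \<kappa> Y eps Xs Ys \<sigma> \<beta>
    using model data bounded
    by (intro regression.intro design.intro compact_domain.intro regression_axioms.intro design_axioms.intro)
      (auto simp: regression_model_def)
  have inv_all: "\<exists>x \<tau>. onb x \<and> (\<forall>i. \<tau> i \<in> {0..\<eta>}) \<and>
    diagonal_operator p ?N mdl.hat mdl.range_space x \<tau> ?T \<and>
    (\<forall>f j v. Bseq (\<lambda>i. f (\<tau> i)) \<longrightarrow> v \<in> mdl.range_space j \<longrightarrow> diag x (\<lambda>i. f (\<tau> i)) v \<in> mdl.range_space j) \<and>
    (\<forall>j. L2_inner (leb S2) (leb_basis S2 j) (leb_basis S2 j) \<noteq> 0 \<longrightarrow> (\<forall>v. mdl.Gam v = diag x \<tau> v) \<and> (\<forall>i. mdl.Gam (x i) = \<tau> i *\<^sub>R x i))"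
    by (rule mdl.operator_diagonalization[OF mdl.AA_op_H mdl.AA_op_hat mdl.positive_hs_axioms mdl.Gam_dead spectrum])
      (use eta in auto)
  then obtain x \<tau> where x: "onb x" "\<And>i. \<tau> i \<in> {0..\<eta>}"
    and DT: "diagonal_operator p ?N mdl.hat mdl.range_space x \<tau> ?T"
    and inv: "\<And>f j v. Bseq (\<lambda>i. f (\<tau> i)) \<Longrightarrow> v \<in> mdl.range_space j \<Longrightarrow> diag x (\<lambda>i. f (\<tau> i)) v \<in> mdl.range_space j"
    and al: "\<And>j. L2_inner (leb S2) (leb_basis S2 j) (leb_basis S2 j) \<noteq> 0 \<Longrightarrow>
      (\<forall>v. mdl.Gam v = diag x \<tau> v) \<and> (\<forall>i. mdl.Gam (x i) = \<tau> i *\<^sub>R x i)" by blast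
  interpret DT: diagonal_operator p ?N mdl.hat mdl.range_space x \<tau> ?T by (rule DT)
  \<comment> \<open>If no \<open>e j\<close> is alive, \<open>\<tau>\<close> is not known to
    diagonalize \<open>Gam\<close>. The pair \<open>x2\<close>, \<open>\<tau>2\<close> always does,
    so the deviation event exists in either case; with an alive \<open>e j\<close> it is the pair
    \<open>x\<close>, \<open>\<tau>\<close>.\<close>
  obtain x2 \<tau>2 where x2: "onb x2" "\<And>i. mdl.Gam (x2 i) = \<tau>2 i *\<^sub>R x2 i" "\<And>i. 0 \<le> \<tau>2 i"
    and x2_eq: "\<And>j. L2_inner (leb S2) (leb_basis S2 j) (leb_basis S2 j) \<noteq> 0 \<Longrightarrow> x2 = x \<and> \<tau>2 = \<tau>"
  proof (cases "\<exists>j. L2_inner (leb S2) (leb_basis S2 j) (leb_basis S2 j) \<noteq> 0")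
    case True
    then show ?thesis using that[of x \<tau>] x al by auto
  next
    case False
    then show ?thesis using that mdl.spectral_theorem by metis
  qed
  obtain C0 where C0: "0 < C0" "\<And>i. 1 \<le> i \<Longrightarrow> \<mu> i \<le> C0 * real i powr (- b)" using decay_upper by blast
  obtain N0 where N0: "0 < N0" "\<And>lam. 0 < lam \<Longrightarrow> lam \<le> \<eta> \<Longrightarrow>
      (\<Sum>i. ennreal (\<tau>2 i * (x2 i \<bullet> x2 i) / (\<tau>2 i + lam))) \<le> ennreal (N0 * lam powr (- 1 / b))"
    using mdl.effective_dimension[OF x2 eigenvalues b C0 eta] by blast
  have mono: "\<phi> t \<le> \<phi> t'" if "0 \<le> t" "t \<le> t'" "t' \<le> \<eta>" for t t'
    using index that by (auto simp: index_function_def mono_on_def)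
  have \<phi>0: "\<phi> 0 = 0" using index by (simp add: index_function_def)
  \<comment> \<open>A zero of \<phi> at \<open>t > 0\<close> would give \<psi> the value 0 both at
    \<open>t\<close> and at 0, against injectivity.\<close>
  have \<phi>_pos: "0 < \<phi> t" if t: "t \<in> {0<..\<eta>}" for t
  proof -
    have "\<phi> t \<noteq> 0"
    proof
      assume "\<phi> t = 0"
      then have "\<psi> t = \<psi> 0" by (simp add: psi)
      then show False using inj_onD[OF psi_inj, of t 0] t by auto
    qed
    then show ?thesis using mono[of 0 t] \<phi>0 t by simp
  qed
  have \<phi>_abs: "\<bar>\<phi> t\<bar> \<le> \<phi> \<eta>" if "t \<in> {0..\<eta>}" for t
    using mono[of 0 t] mono[of t \<eta>] that \<phi>0 by auto
  obtain v where v: "v \<in> dsum p ?N" "dnorm p ?N v \<le> R" "dnorm p ?N (ddiff \<beta> (fcalc p ?N \<phi> ?T v)) = 0"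
    using source by (auto simp: source_set_def)
  have B\<phi>: "Bseq (\<lambda>i. \<phi> (\<tau> i))" by (rule BseqI'[of _ "\<phi> \<eta>"]) (use \<phi>_abs x(2) in simp)
  note F\<phi> = DT.fcalc_diag[OF B\<phi> inv[OF B\<phi>] v(1)]
  have \<beta>_v: "mdl.hat \<beta> j = diag x (\<lambda>i. \<phi> (\<tau> i)) (mdl.hat v j)" for j
    using mdl.hat_eq_0[OF mdl.ddiff_dsum[OF mdl.\<beta> F\<phi>(1)] v(3), of j] mdl.hat_ddiff[OF mdl.\<beta> F\<phi>(1), of j] F\<phi>(2)[of j] by simp
  obtain w where w: "0 < w" "\<And>lam t. lam \<in> {0<..\<eta>} \<Longrightarrow> t \<in> {0<..\<eta>} \<Longrightarrow> \<bar>1 - t * g lam t\<bar> * t powr \<nu> \<le> w * lam powr \<nu>"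
    using nu(2) unfolding qualification_def has_qualification_def by blast
  obtain c where c: "0 < c" "\<And>lam. lam \<in> {0<..\<eta>} \<Longrightarrow>
      c * (lam powr (\<nu> - s) / \<phi> lam) \<le> (INF x\<in>{lam..\<eta>}. x powr (\<nu> - s) / \<phi> x)"
    using cov unfolding covers_def by blast
  have AB: "0 < A" "0 < B" using reg by (auto simp: regularization_def)
  \<comment> \<open>The thresholds of \<open>deviation_event\<close> for effective dimension
    \<open>N0 * lam powr (- 1 / b)\<close>, with the common factor
    \<open>(\<phi> lam)\<^sup>2 * lam\<close> split off by \<open>parameter_choice\<close>.\<close>
  define c1 where "c1 = 2 / \<delta> * (mdl.\<kappa>\<^sub>p + 1) * N0"
  define c2 where "c2 = 2 / \<delta> * (mdl.V + 1) * N0"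
  have c12: "0 \<le> c1" "0 \<le> c2"
    using \<delta> N0(1) mdl.\<kappa>_nonneg mdl.V_nonneg by (auto simp: c1_def c2_def)
  define Cr where "Cr = 2 powr \<nu> * (1 + A + w)"
  \<comment> \<open>The bracket of the bias bound after division by \<open>\<phi> lam\<close>: the
    covering term, then the exchange errors with
    \<open>\<epsilon> = sqrt c1 * \<phi> lam\<close>.\<close>
  define L where "L = (1 + 1 / c) + (\<nu> - s) * sqrt c1 * \<phi> \<eta>"
  \<comment> \<open>An upper bound for \<epsilon> that is free of \<open>n\<close>, by monotonicity
    of \<phi>.\<close>
  define E0 where "E0 = sqrt c1 * \<phi> \<eta>"
  define C where "C = sqrt (2 * ((2 + E0\<^sup>2)\<^sup>2 * Cr * L * R)\<^sup>2 + 2 * ((2 + E0\<^sup>2)\<^sup>2 * (A + B))\<^sup>2 * c2) + 1"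
  have \<phi>\<eta>: "0 < \<phi> \<eta>" using \<phi>_pos eta by simp
  have nn: "0 \<le> Cr" "0 \<le> L" "0 \<le> A + B"
    using AB w c(1) c12 \<phi>\<eta> nu(1) s by (auto simp: Cr_def L_def intro!: add_nonneg_nonneg mult_nonneg_nonneg)
  have "0 < C" unfolding C_def using c12 by (intro add_nonneg_pos real_sqrt_ge_zero add_nonneg_nonneg mult_nonneg_nonneg) auto
  moreover have "\<exists>E\<in>sets M. 1 - \<delta> \<le> measure M E \<and> (\<forall>\<omega>\<in>E. dnorm p ?N (fcalc p ?N (rpow s) ?T
      (ddiff (estimator p S1 S2 g Xs Ys n lam \<omega>) \<beta>)) \<le> C * \<phi> lam * lam powr s)"
    if n: "1 \<le> n" and rg: "real n powr (-1/2) \<in> \<psi> ` {0..\<eta>}" and lam_eq: "lam = the_inv_into {0..\<eta>} \<psi> (real n powr (-1/2))" for n lam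
  proof -
    have \<psi>lam: "\<psi> lam = real n powr (-1/2)" unfolding lam_eq by (rule f_the_inv_into_f[OF psi_inj rg])
    have lam_in: "lam \<in> {0..\<eta>}" unfolding lam_eq by (rule the_inv_into_into[OF psi_inj rg order.refl])
    \<comment> \<open>\<psi> vanishes at 0, whereas \<open>real n powr (-1/2)\<close> is
      positive.\<close>
    have "lam \<noteq> 0"
    proof
      assume "lam = 0"
      then have "real n powr (-1/2) = 0" using \<psi>lam by (simp add: psi)
      then show False using n by simp
    qed
    then have lam: "0 < lam" "lam \<le> \<eta>" using lam_in by auto
    have pc: "lam powr (- 1 / b) / real n = (\<phi> lam)\<^sup>2 * lam"
      by (rule parameter_choice[OF lam(1) n]) (use \<psi>lam psi in simp)
    have \<phi>lam: "0 < \<phi> lam" "\<phi> lam \<le> \<phi> \<eta>" using \<phi>_pos[of lam] mono[of lam \<eta>] lam by auto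
    have Tn: "2 / \<delta> * (a + 1) * (N0 * lam powr (- 1 / b)) / real n = 2 / \<delta> * (a + 1) * N0 * ((\<phi> lam)\<^sup>2 * lam)" for a
      unfolding pc[symmetric] by simp
    have NL: "0 < N0 * lam powr (- 1 / b)" using N0(1) lam by simp
    obtain E where E: "E \<in> sets M" "1 - \<delta> \<le> mdl.prob E" "\<And>\<omega>. \<omega> \<in> E \<Longrightarrow> \<omega> \<in> space M \<and>
        spectrum_on p ?N (AA_emp p S1 Xs n \<omega>) \<subseteq> {0..\<eta>} \<and>
        mdl.gram_dev x2 \<tau>2 lam n \<omega> \<le> ennreal (c1 * ((\<phi> lam)\<^sup>2 * lam)) \<and>
        mdl.noise_dev x2 \<tau>2 lam n \<omega> \<le> ennreal (c2 * ((\<phi> lam)\<^sup>2 * lam))"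
      using mdl.deviation_event[OF x2 lam(1) n N0(2)[OF lam] NL conjunct1[OF \<delta>] spectrum_emp[OF n]]
      unfolding Tn c1_def c2_def by blast
    have T12: "0 \<le> c1 * ((\<phi> lam)\<^sup>2 * lam)" "0 \<le> c2 * ((\<phi> lam)\<^sup>2 * lam)" using c12 lam by auto
    have \<epsilon>: "sqrt (c1 * ((\<phi> lam)\<^sup>2 * lam) / lam) = sqrt c1 * \<phi> lam"
      using lam \<phi>lam by (simp add: real_sqrt_mult)
    have F: "(1 + 1 / c) * \<phi> lam + (\<nu> - s) * (sqrt c1 * \<phi> lam) * \<phi> \<eta> = \<phi> lam * L"
      by (simp add: L_def algebra_simps)
    show ?thesis
    proof (intro bexI[OF _ E(1)] conjI E(2) ballI)
      fix \<omega> assume \<omega>: "\<omega> \<in> E"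
      \<comment> \<open>Regularization leaves the value at 0 free, so it is added to the bound. This
        bound depends on \<open>lam\<close> but enters only as boundedness of the filter on the
        spectrum, not in the rate.\<close>
      have gb: "\<bar>g lam t\<bar> \<le> B / lam + \<bar>g lam 0\<bar>" if "t \<in> {0..\<eta>}" for t
      proof (cases "t = 0")
        case False
        then have "\<bar>g lam t\<bar> \<le> B / lam" using reg lam that by (auto simp: regularization_def)
        then show ?thesis by simp
      qed (use AB lam in simp)
      have "(dnorm p ?N (fcalc p ?N (rpow s) ?T (ddiff (fcalc p ?N (g lam) (AA_emp p S1 Xs n \<omega>) (AY_emp Xs Ys n \<omega>)) \<beta>)))\<^sup>2 \<le>
          2 * ((2 + (sqrt c1 * \<phi> lam)\<^sup>2) * (2 + (sqrt c1 * \<phi> lam)\<^sup>2) * Cr *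
            ((1 + 1 / c) * \<phi> lam + (\<nu> - s) * (sqrt c1 * \<phi> lam) * \<phi> \<eta>) * lam powr s)\<^sup>2 * (dnorm p ?N v)\<^sup>2 +
          2 * (lam powr (s - 1/2) * ((2 + (sqrt c1 * \<phi> lam)\<^sup>2) * (2 + (sqrt c1 * \<phi> lam)\<^sup>2) * (A + B)))\<^sup>2 * (c2 * ((\<phi> lam)\<^sup>2 * lam))"
        unfolding \<epsilon>[symmetric]
      proof (rule mdl.sample_error[where \<tau> = \<tau> and x = x and v = v and \<phi> = \<phi> and Gb = "B / lam + \<bar>g lam 0\<bar>" and \<eta> = \<eta>])
        show "mdl.gram_dev x \<tau> lam n \<omega> \<le> ennreal (c1 * ((\<phi> lam)\<^sup>2 * lam)) \<and>
            mdl.noise_dev x \<tau> lam n \<omega> \<le> ennreal (c2 * ((\<phi> lam)\<^sup>2 * lam))"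
          if "L2_inner (leb S2) (leb_basis S2 j) (leb_basis S2 j) \<noteq> 0" for j
          using E(3)[OF \<omega>] x2_eq[OF that] by simp
        show "\<bar>1 - t * g lam t\<bar> * (t + lam) powr a \<le> Cr * lam powr a" if "t \<in> {0..\<eta>}" "0 \<le> a" "a \<le> \<nu>" for t a
          unfolding Cr_def by (rule residual_bound[OF reg w(1) w(2) lam that]) (use lam in auto)
        show "\<bar>g lam t\<bar> * (t + lam) \<le> A + B" if "0 < t" "t \<le> \<eta>" for t
          by (rule filter_bound[OF reg lam that])
        show "\<bar>\<phi> t\<bar> * (t + lam) powr (- (\<nu> - s)) \<le> (1 + 1 / c) * \<phi> lam * lam powr (- (\<nu> - s))" if "t \<in> {0..\<eta>}" for t
          by (rule index_bound[OF index \<phi>_pos c(1) c(2) _ lam that]) (use lam s nu in auto)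
        show "\<omega> \<in> space M" "spectrum_on p ?N (AA_emp p S1 Xs n \<omega>) \<subseteq> {0..\<eta>}" using E(3)[OF \<omega>] by auto
        show "(\<forall>v. mdl.Gam v = diag x \<tau> v) \<and> (\<forall>i. mdl.Gam (x i) = \<tau> i *\<^sub>R x i)"
          if "L2_inner (leb S2) (leb_basis S2 j) (leb_basis S2 j) \<noteq> 0" for j by (rule al[OF that])
        show "diag x (\<lambda>i. f (\<tau> i)) u \<in> mdl.range_space j" if "Bseq (\<lambda>i. f (\<tau> i))" "u \<in> mdl.range_space j" for f j u
          by (rule inv[OF that])
        show "0 \<le> (1 + 1 / c) * \<phi> lam" using c(1) \<phi>lam by simp
      qed (use n x DT T12 lam v \<beta>_v gb \<phi>_abs s nu nn \<phi>\<eta> in auto)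
      then show "dnorm p ?N (fcalc p ?N (rpow s) ?T (ddiff (estimator p S1 S2 g Xs Ys n lam \<omega>) \<beta>)) \<le> C * \<phi> lam * lam powr s"
        unfolding F C_def estimator_def
        by (rule rate_arithmetic[rotated 2])
          (use c12 \<phi>lam v(2) lam nn in \<open>auto simp: E0_def dnorm_def dinner_def intro!: mult_left_mono sum_nonneg L2_inner_ge_0\<close>)
    qed
  qed
  ultimately show "\<exists>C>0. \<forall>n\<ge>1. real n powr (-1/2) \<in> \<psi> ` {0..\<eta>} \<longrightarrow>
      (let lam = the_inv_into {0..\<eta>} \<psi> (real n powr (-1/2)) in
       \<exists>E\<in>sets M. measure M E \<ge> 1 - \<delta> \<and>
         (\<forall>\<omega>\<in>E. dnorm p (LL_meas S1 S2)
             (fcalc p (LL_meas S1 S2) (rpow s) (AA_op M p S1 S2 X)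
               (ddiff (estimator p S1 S2 g Xs Ys n lam \<omega>) \<beta>))
           \<le> C * \<phi> lam * lam powr s))"
    unfolding Let_def by blast
qed

end
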